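(* Let $K$ be a field of characteristic $0$, let $n \geq 3$, and let $g(X) \in K[X]$ be a separable polynomial of degree $n$ whose discriminant is a square in $K$. Then there exists a polynomial $f(t, X) \in K(t)[X]$ whose splitting field over $K(t)$ is a regular Galois extension of $K(t)$ with Galois group $\mathfrak{A}_n$, and such that the splitting fields over $K$ of $g(X)$ and of $f(0, X)$ coincide.
   Context: $t$ is an indeterminate. A Galois extension $E/K(t)$ is regular if $K$ is algebraically closed in $E$. $f(0,X)$ denotes the polynomial obtained from $f(t,X)$ by specializing $t$ to $0$ (the coefficients being defined at $t=0$). $\mathfrak{A}_n$ denotes the alternating group on $n$ letters. *)

theory Defs
  imports
    "HOL-Algebra.Algebraic_Closure_Type"
    "HOL-Algebra.Finite_Extensions"
    "HOL-Algebra.Generated_Fields"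
    "HOL-Algebra.Sym_Groups"
    "HOL-Algebra.Bij"
    "Subresultants.Resultant_Prelim"
begin

definition separable_poly :: "'a::field poly \<Rightarrow> bool" where
  "separable_poly p \<longleftrightarrow> rsquarefree (map_poly to_ac p)"

definition discriminant :: "'a::field poly \<Rightarrow> 'a" where
  "discriminant p =
     (- 1) ^ (Polynomial.degree p * (Polynomial.degree p - 1) div 2) *
     resultant p (pderiv p) / Polynomial.lead_coeff p"

text \<open>Splitting fields are taken inside the fixed algebraic closure of the base field. They are
  only meaningful for nonzero polynomials.\<close>

definition splitting_field :: "'a::field poly \<Rightarrow> 'a alg_closure set" where
  "splitting_field p =
     generate_field ring_of_type_algebra (range to_ac \<union> {x. poly (map_poly to_ac p) x = 0})"

text \<open>The group of field automorphisms of \<open>E\<close> that fix \<open>F\<close> pointwise. As usual for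
  \<^const>\<open>BijGroup\<close>, automorphisms are extensional functions on \<open>E\<close>.\<close>

definition galois_group :: "'a::field set \<Rightarrow> 'a set \<Rightarrow> ('a \<Rightarrow> 'a) monoid" where
  "galois_group E F = (BijGroup E)
     \<lparr>carrier := {\<sigma> \<in> Bij E.
        \<sigma> \<in> Ring.ring_hom (ring_of_type_algebra\<lparr>carrier := E\<rparr>) (ring_of_type_algebra\<lparr>carrier := E\<rparr>) \<and>
        (\<forall>x\<in>F. \<sigma> x = x)}\<rparr>"

definition galois_extension :: "'a::field set \<Rightarrow> 'a set \<Rightarrow> bool" where
  "galois_extension E F \<longleftrightarrow>
     subfield E ring_of_type_algebra \<and> subfield F ring_of_type_algebra \<and> F \<subseteq> E \<and>
     (\<forall>x\<in>E. ring.algebraic ring_of_type_algebra F x) \<and>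
     {x \<in> E. \<forall>\<sigma> \<in> carrier (galois_group E F). \<sigma> x = x} = F"

definition algebraically_closed_in :: "'a::field set \<Rightarrow> 'a set \<Rightarrow> bool" where
  "algebraically_closed_in C E \<longleftrightarrow>
     C \<subseteq> E \<and> (\<forall>x\<in>E. ring.algebraic ring_of_type_algebra C x \<longrightarrow> x \<in> C)"

text \<open>The rational function field \<open>K(t)\<close> is \<open>'k poly fract\<close>, the indeterminate \<open>t\<close> being that of
  \<open>'k poly\<close>.\<close>

definition constants :: "'k::field poly fract alg_closure set" where
  "constants = range (\<lambda>c. to_ac (to_fract [:c:]))"

definition regular_galois_extension :: "'k::field poly fract alg_closure set \<Rightarrow> bool" where
  "regular_galois_extension E \<longleftrightarrow>
     galois_extension E (range to_ac) \<and> algebraically_closed_in constants E"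

definition defined_at_0 :: "'k::field poly fract \<Rightarrow> bool" where
  "defined_at_0 r \<longleftrightarrow> (\<exists>a b. r = Fract a b \<and> poly b 0 \<noteq> 0)"

definition value_at_0 :: "'k::field poly fract \<Rightarrow> 'k" where
  "value_at_0 r = (THE c. \<exists>a b. r = Fract a b \<and> poly b 0 \<noteq> 0 \<and> c = poly a 0 / poly b 0)"

lemma value_at_0_Fract:
  assumes "poly b 0 \<noteq> 0"
  shows "value_at_0 (Fract a b) = poly a 0 / poly b 0"
  unfolding value_at_0_def
proof (rule the_equality)
  show "\<exists>a' b'. Fract a b = Fract a' b' \<and> poly b' 0 \<noteq> 0 \<and> poly a 0 / poly b 0 = poly a' 0 / poly b' 0"
    using assms by blast
next
  fix c
  assume "\<exists>a' b'. Fract a b = Fract a' b' \<and> poly b' 0 \<noteq> 0 \<and> c = poly a' 0 / poly b' 0"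
  then obtain a' b' where *: "Fract a b = Fract a' b'" "poly b' 0 \<noteq> 0" "c = poly a' 0 / poly b' 0"
    by blast
  have "b \<noteq> 0" "b' \<noteq> 0"
    using assms *(2) by auto
  hence "a * b' = a' * b"
    using *(1) by (simp add: eq_fract)
  hence "poly a 0 * poly b' 0 = poly a' 0 * poly b 0"
    by (metis poly_mult)
  thus "c = poly a 0 / poly b 0"
    using assms *(2,3) by (simp add: frac_eq_eq)
qed

definition specialize_at_0 :: "'k::field poly fract poly \<Rightarrow> 'k poly" where
  "specialize_at_0 f = map_poly value_at_0 f"

end

theory Submission
  imports Defs "HOL-Computational_Algebra.Formal_Laurent_Series" "Jordan_Normal_Form.Determinant"
begin

text \<open>
  Mestre's construction. Let \<open>N\<close> be odd and let \<open>P = \<Prod>(X - \<alpha>\<^sub>i)\<close> have degree \<open>N\<close>. The skew-symmetric system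
  \<open>\<Sum>\<^bsub>i\<noteq>j\<^esub> r\<^sub>i / (\<alpha>\<^sub>j - \<alpha>\<^sub>i) = 0\<close> has a nonzero solution, generically unique up to scaling, and
  \<open>Q = \<Sum> r\<^sub>i\<^sup>2 P/(X - \<alpha>\<^sub>i)\<close>, \<open>R = \<Sum> r\<^sub>i P/(X - \<alpha>\<^sub>i)\<close> satisfy \<open>P'Q - PQ' = R\<^sup>2\<close>. Hence every finite branch point of
  \<open>t = P(x)/Q(x)\<close> is generically a 3-cycle, the geometric monodromy group of \<open>P - tQ\<close> is the alternating group, and
  since the discriminant of \<open>P - tQ\<close> is a square times that of \<open>P\<close>, so is the arithmetic one as soon as the
  discriminant of \<open>P\<close> is a square. Taking \<open>\<alpha>\<^sub>i = q(\<gamma>\<^sub>i)\<close> for a generic polynomial \<open>q\<close> over \<open>K\<close> and the roots \<open>\<gamma>\<^sub>i\<close>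
  of \<open>g\<close> keeps the splitting field and makes \<open>P\<close>, \<open>Q\<close>, \<open>R\<close> rational. For even \<open>n\<close> one adds a rational root to
  \<open>g\<close> and divides \<open>P(X)Q(a+t) - P(a+t)Q(X)\<close> by \<open>X - (a+t)\<close>, which passes to a point stabiliser.
\<close>

text \<open>Passing from three-cycles to the whole alternating group usually rests on the fact that
  a cover of the projective line is generated by its inertia groups. Here an elementary count
  replaces it: the roots linked to \<open>x\<close> by three-cycles cut out a factor of the fibre
  polynomial over the field of rational functions in \<open>x\<close>. Its cofactor, evaluated at
  \<open>x\<close>, has no finite zero, while its pole at infinity has order equal to its degree, so
  the cofactor is trivial. Only local computations with Laurent series are needed. "Generic" means
  that certain determinants do not vanish. They depend rationally on the roots, so one good
  configuration suffices: the roots of X^N + e X with e = N/(N - 2), where the oddness of N keeps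
  the solution of the system unique up to scaling. For regularity two algebraic closures are
  compared through an embedding \<Psi>: that of K(t), where the discriminant bounds the Galois group
  from above, and that of the rational functions over the algebraic closure of K, where the cover
  bounds it from below. Both bounds are the alternating group, so no new constants can
  appear.\<close>

hide_const (open) UnivPoly.up_ring.coeff UnivPoly.up_ring.monom Polynomials.degree
  Polynomials.lead_coeff Coset.order Module.module.smult

section \<open>Subfields, partial homomorphisms and extension of embeddings\<close>

definition is_subfield :: "'a::field set \<Rightarrow> bool" where
  "is_subfield M \<longleftrightarrow> 0 \<in> M \<and> 1 \<in> M \<and> (\<forall>x\<in>M. \<forall>y\<in>M. x + y \<in> M \<and> x * y \<in> M) \<and>
     (\<forall>x\<in>M. - x \<in> M \<and> inverse x \<in> M)"

text \<open>Values outside \<open>M\<close> are unconstrained, so a map obtained by choice or by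
  inverting an embedding on part of a type can serve directly as a homomorphism.\<close>

definition hom_on :: "'a::field set \<Rightarrow> ('a \<Rightarrow> 'b::field) \<Rightarrow> bool" where
  "hom_on M \<phi> \<longleftrightarrow> \<phi> 1 = 1 \<and> (\<forall>x\<in>M. \<forall>y\<in>M. \<phi> (x + y) = \<phi> x + \<phi> y \<and> \<phi> (x * y) = \<phi> x * \<phi> y)"

definition polys_over :: "'a::field set \<Rightarrow> 'a poly set" where
  "polys_over M = {p. \<forall>i. coeff p i \<in> M}"

definition algebraic_over :: "'a::field set \<Rightarrow> 'a \<Rightarrow> bool" where
  "algebraic_over M x \<longleftrightarrow> (\<exists>p\<in>polys_over M. p \<noteq> 0 \<and> poly p x = 0)"

definition is_minpoly :: "'a::field set \<Rightarrow> 'a \<Rightarrow> 'a poly \<Rightarrow> bool" where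
  "is_minpoly M x m \<longleftrightarrow> m \<in> polys_over M \<and> m \<noteq> 0 \<and> poly m x = 0 \<and>
     (\<forall>q\<in>polys_over M. q \<noteq> 0 \<longrightarrow> poly q x = 0 \<longrightarrow> degree m \<le> degree q)"

lemma is_subfieldD:
  assumes "is_subfield M"
  shows "0 \<in> M" "1 \<in> M" "x \<in> M \<Longrightarrow> y \<in> M \<Longrightarrow> x + y \<in> M" "x \<in> M \<Longrightarrow> y \<in> M \<Longrightarrow> x * y \<in> M"
    "x \<in> M \<Longrightarrow> - x \<in> M" "x \<in> M \<Longrightarrow> inverse x \<in> M"
    "x \<in> M \<Longrightarrow> y \<in> M \<Longrightarrow> x - y \<in> M" "x \<in> M \<Longrightarrow> y \<in> M \<Longrightarrow> x / y \<in> M"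
proof -
  show *: "0 \<in> M" "1 \<in> M" "\<And>x y. x \<in> M \<Longrightarrow> y \<in> M \<Longrightarrow> x + y \<in> M"
    "\<And>x y. x \<in> M \<Longrightarrow> y \<in> M \<Longrightarrow> x * y \<in> M"
    "\<And>x. x \<in> M \<Longrightarrow> - x \<in> M" "\<And>x. x \<in> M \<Longrightarrow> inverse x \<in> M"
    using assms by (auto simp: is_subfield_def)
  show "x \<in> M \<Longrightarrow> y \<in> M \<Longrightarrow> x - y \<in> M"
    using *(3)[of x "- y"] *(5) by simp
  show "x \<in> M \<Longrightarrow> y \<in> M \<Longrightarrow> x / y \<in> M"
    using *(4)[of x "inverse y"] *(6) by (simp add: divide_inverse)
qed

lemma is_subfield_sum:
  assumes "is_subfield M" "\<And>i. i \<in> A \<Longrightarrow> f i \<in> M"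
  shows "sum f A \<in> M"
  using assms(2) by (induction A rule: infinite_finite_induct) (auto simp: is_subfieldD[OF assms(1)])

lemma is_subfield_prod:
  assumes "is_subfield M" "\<And>i. i \<in> A \<Longrightarrow> f i \<in> M"
  shows "prod f A \<in> M"
  using assms(2) by (induction A rule: infinite_finite_induct) (auto simp: is_subfieldD[OF assms(1)])

lemma is_subfield_power:
  assumes "is_subfield M" "x \<in> M"
  shows "x ^ n \<in> M"
  using assms by (induction n) (auto simp: is_subfieldD[OF assms(1)])

lemma is_subfield_UNIV: "is_subfield UNIV"
  by (simp add: is_subfield_def)

lemma hom_onD:
  assumes "hom_on M \<phi>"
  shows "\<phi> 1 = 1" "x \<in> M \<Longrightarrow> y \<in> M \<Longrightarrow> \<phi> (x + y) = \<phi> x + \<phi> y"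
    "x \<in> M \<Longrightarrow> y \<in> M \<Longrightarrow> \<phi> (x * y) = \<phi> x * \<phi> y"
  using assms by (auto simp: hom_on_def)

lemma hom_on_0:
  assumes "is_subfield M" "hom_on M \<phi>"
  shows "\<phi> 0 = 0"
proof -
  have "\<phi> 0 + \<phi> 0 = \<phi> 0 + 0"
    using hom_onD(2)[OF assms(2), of 0 0] is_subfieldD(1)[OF assms(1)] by simp
  thus ?thesis by (simp only: add_left_cancel)
qed

lemma hom_on_uminus:
  assumes "is_subfield M" "hom_on M \<phi>" "x \<in> M"
  shows "\<phi> (- x) = - \<phi> x"
  using hom_onD(2)[OF assms(2), of x "- x"] is_subfieldD(5)[OF assms(1,3)] assms(3)
    hom_on_0[OF assms(1,2)] by (simp add: eq_neg_iff_add_eq_0 add.commute)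

lemma hom_on_inverse:
  assumes "is_subfield M" "hom_on M \<phi>" "x \<in> M"
  shows "\<phi> (inverse x) = inverse (\<phi> x)"
proof (cases "x = 0")
  case True thus ?thesis using hom_on_0[OF assms(1,2)] by simp
next
  case False
  have "\<phi> x * \<phi> (inverse x) = 1"
    using hom_onD(3)[OF assms(2,3), of "inverse x"] is_subfieldD(6)[OF assms(1,3)] False
      hom_onD(1)[OF assms(2)] by simp
  thus ?thesis by (metis inverse_unique)
qed

lemma hom_on_eq_0:
  assumes "is_subfield M" "hom_on M \<phi>" "x \<in> M" "\<phi> x = 0"
  shows "x = 0"
proof (rule ccontr)
  assume "x \<noteq> 0"
  hence "\<phi> x * \<phi> (inverse x) = 1"
    using hom_onD(3)[OF assms(2,3), of "inverse x"] is_subfieldD(6)[OF assms(1,3)]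
      hom_onD(1)[OF assms(2)] by simp
  thus False using assms(4) by simp
qed

lemma hom_on_UNIV_iff: "hom_on UNIV \<phi> \<longleftrightarrow> field_hom \<phi>"
proof
  assume h: "hom_on UNIV \<phi>"
  show "field_hom \<phi>"
    by unfold_locales (auto simp: hom_onD[OF h] hom_on_0[OF is_subfield_UNIV h]
        hom_on_uminus[OF is_subfield_UNIV h] hom_on_inverse[OF is_subfield_UNIV h])
next
  assume "field_hom \<phi>"
  then interpret field_hom \<phi> .
  show "hom_on UNIV \<phi>" by (simp add: hom_on_def hom_distribs)
qed

context
  fixes M :: "'a::field set"
  assumes M: "is_subfield M"
begin

lemma polys_over_closed:
  "0 \<in> polys_over M" "1 \<in> polys_over M"
  "p \<in> polys_over M \<Longrightarrow> q \<in> polys_over M \<Longrightarrow> p + q \<in> polys_over M"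
  "p \<in> polys_over M \<Longrightarrow> q \<in> polys_over M \<Longrightarrow> p * q \<in> polys_over M"
  "p \<in> polys_over M \<Longrightarrow> - p \<in> polys_over M"
  "p \<in> polys_over M \<Longrightarrow> q \<in> polys_over M \<Longrightarrow> p - q \<in> polys_over M"
  "a \<in> M \<Longrightarrow> p \<in> polys_over M \<Longrightarrow> smult a p \<in> polys_over M"
  "a \<in> M \<Longrightarrow> p \<in> polys_over M \<Longrightarrow> pCons a p \<in> polys_over M"
  "a \<in> M \<Longrightarrow> monom a n \<in> polys_over M"
  by (auto simp: polys_over_def is_subfieldD[OF M] coeff_mult coeff_pCons is_subfield_sum[OF M]
      split: nat.split)

lemma poly_in_subfield: "p \<in> polys_over M \<Longrightarrow> x \<in> M \<Longrightarrow> poly p x \<in> M"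
  unfolding poly_altdef polys_over_def
  by (intro is_subfield_sum[OF M]) (auto simp: is_subfieldD[OF M] is_subfield_power[OF M])

lemma polys_over_pderiv: "p \<in> polys_over M \<Longrightarrow> pderiv p \<in> polys_over M"
proof -
  have "of_nat n \<in> M" for n by (induction n) (auto simp: is_subfieldD[OF M])
  hence "1 + of_nat n \<in> M" for n by (metis of_nat_Suc)
  thus "p \<in> polys_over M \<Longrightarrow> pderiv p \<in> polys_over M"
    by (auto simp: polys_over_def coeff_pderiv is_subfieldD[OF M])
qed

lemma polys_over_division:
  assumes "p \<in> polys_over M" "m \<in> polys_over M" "m \<noteq> 0"
  shows "\<exists>q\<in>polys_over M. \<exists>r\<in>polys_over M. p = q * m + r \<and> (r = 0 \<or> degree r < degree m)"
  using assms(1)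
proof (induction "degree p" arbitrary: p rule: less_induct)
  case less
  show ?case
  proof (cases "p = 0 \<or> degree p < degree m")
    case True
    thus ?thesis using less.prems polys_over_closed(1)
      by (intro bexI[of _ 0] bexI[of _ p]) auto
  next
    case False
    define c where "c = lead_coeff p / lead_coeff m"
    define s where "s = monom c (degree p - degree m)"
    have cM: "c \<in> M" using less.prems assms(2) unfolding c_def polys_over_def
      by (auto intro!: is_subfieldD(8)[OF M])
    hence s: "s \<in> polys_over M" unfolding s_def by (rule polys_over_closed)
    have c0: "c \<noteq> 0" using False assms(3) by (simp add: c_def)
    define p' where "p' = p - s * m"
    have p': "p' \<in> polys_over M" unfolding p'_def using less.prems s assms(2)
      by (intro polys_over_closed)
    have dsm: "degree (s * m) = degree p"
      using c0 assms(3) False by (simp add: s_def degree_mult_eq monom_eq_0_iff degree_monom_eq)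
    have "coeff (s * m) (degree p) = lead_coeff p"
    proof -
      have "coeff (s * m) (degree p) = lead_coeff (s * m)" by (simp add: dsm)
      also have "\<dots> = lead_coeff p" using assms(3) c0
        by (simp add: lead_coeff_mult s_def degree_monom_eq) (simp add: c_def)
      finally show ?thesis .
    qed
    hence "p' = 0 \<or> degree p' < degree p"
    proof (cases "degree p = 0")
      case True
      hence "degree p' = 0" unfolding p'_def using dsm
        by (metis degree_diff_le_max max.idem le_0_eq)
      moreover have "coeff p' 0 = 0" unfolding p'_def
        using \<open>coeff (s * m) (degree p) = lead_coeff p\<close> True by simp
      ultimately show ?thesis by (metis degree_eq_zeroE coeff_pCons_0 pCons_0_0)
    next
      case False
      have "degree p' \<le> degree p" unfolding p'_def using dsm
        by (metis degree_diff_le_max max.idem)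
      moreover have "coeff p' (degree p) = 0" unfolding p'_def
        using \<open>coeff (s * m) (degree p) = lead_coeff p\<close> by simp
      ultimately show ?thesis
        by (metis le_neq_implies_less leading_coeff_0_iff)
    qed
    then obtain q r where qr: "q \<in> polys_over M" "r \<in> polys_over M" "p' = q * m + r"
      "r = 0 \<or> degree r < degree m"
      using less.hyps[OF _ p'] polys_over_closed(1) by (metis add.right_neutral mult_zero_left)
    have "p = (q + s) * m + r" using qr(3) by (simp add: p'_def algebra_simps)
    thus ?thesis using qr s by (blast intro: polys_over_closed)
  qed
qed

lemma minpoly_exists:
  assumes "algebraic_over M x"
  obtains m where "is_minpoly M x m"
proof -
  let ?P = "\<lambda>p. p \<in> polys_over M \<and> p \<noteq> 0 \<and> poly p x = 0"
  obtain p where "?P p" using assms by (auto simp: algebraic_over_def)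
  hence "?P (arg_min degree ?P) \<and> (\<forall>q. ?P q \<longrightarrow> degree (arg_min degree ?P) \<le> degree q)"
    using arg_min_nat_lemma[of ?P p degree] by blast
  thus ?thesis using that unfolding is_minpoly_def by blast
qed

lemma minpoly_dvd:
  assumes "is_minpoly M x m" "p \<in> polys_over M" "poly p x = 0"
  obtains q where "q \<in> polys_over M" "p = q * m"
proof -
  obtain q r where qr: "q \<in> polys_over M" "r \<in> polys_over M" "p = q * m + r"
      "r = 0 \<or> degree r < degree m"
    using polys_over_division[OF assms(2), of m] assms(1) unfolding is_minpoly_def by blast
  have "poly r x = 0" using qr(3) assms by (auto simp: is_minpoly_def)
  hence "r = 0" using qr(2,4) assms(1) unfolding is_minpoly_def by fastforce
  thus ?thesis using that qr by simp
qed

text \<open>Euclidean descent: writing m = q p + r gives r(x) = - q(x) p(x), so an inverse of r(x)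
  produces one of p(x). Minimality of \<open>m\<close> keeps r(x) nonzero until \<open>p\<close> is
  constant.\<close>

lemma adjoin_inverse:
  assumes "is_minpoly M x m" "p \<in> polys_over M" "poly p x \<noteq> 0"
  shows "\<exists>s\<in>polys_over M. poly s x * poly p x = 1"
proof -
  have m: "m \<in> polys_over M" "m \<noteq> 0" "poly m x = 0" using assms(1) by (auto simp: is_minpoly_def)
  have main: "\<exists>s\<in>polys_over M. poly s x * poly p x = 1"
    if "p \<in> polys_over M" "poly p x \<noteq> 0" "degree p < degree m" for p
    using that
  proof (induction "degree p" arbitrary: p rule: less_induct)
    case less
    have p0: "p \<noteq> 0" using less.prems by auto
    obtain q r where qr: "q \<in> polys_over M" "r \<in> polys_over M" "m = q * p + r"
      "r = 0 \<or> degree r < degree p"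
      using polys_over_division[OF m(1) less.prems(1) p0] by blast
    have rx: "poly r x = - poly q x * poly p x" using m(3) qr(3) by (auto simp: eq_neg_iff_add_eq_0 add.commute)
    show ?case
    proof (cases "degree p = 0")
      case True
      then obtain a where a: "p = [:a:]" by (auto elim: degree_eq_zeroE)
      hence "a \<in> M" "a \<noteq> 0" using less.prems by (auto simp: polys_over_def dest: spec[of _ 0])
      thus ?thesis using a by (intro bexI[of _ "[:inverse a:]"])
         (auto intro!: polys_over_closed is_subfieldD[OF M])
    next
      case False
      have r0: "r \<noteq> 0"
      proof
        assume "r = 0"
        hence q0: "poly q x = 0" using rx less.prems by auto
        have "q \<noteq> 0" using qr(3) m(2) \<open>r = 0\<close> by auto
        hence "degree m \<le> degree q" using assms(1) qr(1) q0 by (auto simp: is_minpoly_def)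
        moreover have "degree m = degree q + degree p" using qr(3) \<open>r = 0\<close> \<open>q \<noteq> 0\<close> p0
          by (simp add: degree_mult_eq)
        ultimately show False using False by simp
      qed
      hence dr: "degree r < degree p" using qr(4) by simp
      have "poly r x \<noteq> 0"
      proof
        assume "poly r x = 0"
        hence "degree m \<le> degree r" using assms(1) qr(2) r0 by (auto simp: is_minpoly_def)
        thus False using dr less.prems(3) by simp
      qed
      then obtain s where s: "s \<in> polys_over M" "poly s x * poly r x = 1"
        using less.hyps[OF dr qr(2)] dr less.prems(3) by auto
      have "poly (- (s * q)) x * poly p x = 1" using s(2) rx by (simp add: algebra_simps)
      thus ?thesis using s(1) qr(1) polys_over_closed by blast
    qed
  qed
  obtain q r where qr: "q \<in> polys_over M" "r \<in> polys_over M" "p = q * m + r"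
      "r = 0 \<or> degree r < degree m"
    using polys_over_division[OF assms(2) m(1,2)] by blast
  have "poly r x = poly p x" using qr(3) m(3) by simp
  thus ?thesis using main[OF qr(2)] qr(4) assms(3) by auto
qed

lemma is_subfield_adjoin:
  assumes "algebraic_over M x"
  shows "is_subfield {poly p x |p. p \<in> polys_over M}"
proof -
  obtain m where m: "is_minpoly M x m" using minpoly_exists[OF assms] .
  have inv: "\<exists>q. inverse (poly p x) = poly q x \<and> q \<in> polys_over M" if "p \<in> polys_over M" for p
  proof (cases "poly p x = 0")
    case True thus ?thesis using polys_over_closed(1) by (intro exI[of _ 0]) simp
  next
    case False
    thus ?thesis using adjoin_inverse[OF m that False] by (metis inverse_unique mult.commute)
  qed
  show ?thesis unfolding is_subfield_def
    by (auto simp: inv; metis polys_over_closed poly_add poly_mult poly_minus poly_0 poly_1)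
qed

lemma map_poly_hom_on:
  fixes \<phi> :: "'a \<Rightarrow> 'b::field"
  assumes "hom_on M \<phi>" "p \<in> polys_over M" "q \<in> polys_over M"
  shows "map_poly \<phi> (p + q) = map_poly \<phi> p + map_poly \<phi> q"
    "map_poly \<phi> (p * q) = map_poly \<phi> p * map_poly \<phi> q"
    "map_poly \<phi> (- p) = - map_poly \<phi> p"
proof -
  have 0: "\<phi> 0 = 0" by (rule hom_on_0[OF M assms(1)])
  have s: "\<phi> (sum f A) = sum (\<lambda>i. \<phi> (f i)) A" if "\<And>i. i \<in> A \<Longrightarrow> f i \<in> M" for f and A :: "nat set"
    using that
  proof (induction A rule: infinite_finite_induct)
    case (insert x A)
    have "sum f A \<in> M" by (rule is_subfield_sum[OF M]) (use insert.prems in auto)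
    thus ?case using insert by (simp add: hom_onD(2)[OF assms(1)])
  qed (auto simp: 0)
  have c: "coeff p i \<in> M" "coeff q i \<in> M" for i using assms by (auto simp: polys_over_def)
  show "map_poly \<phi> (p + q) = map_poly \<phi> p + map_poly \<phi> q"
    by (rule poly_eqI) (simp add: coeff_map_poly 0 hom_onD(2)[OF assms(1)] c)
  show "map_poly \<phi> (p * q) = map_poly \<phi> p * map_poly \<phi> q"
    by (rule poly_eqI) (simp add: coeff_map_poly 0 coeff_mult s hom_onD(3)[OF assms(1)] c is_subfieldD[OF M])
  show "map_poly \<phi> (- p) = - map_poly \<phi> p"
    by (rule poly_eqI) (simp add: coeff_map_poly 0 hom_on_uminus[OF M assms(1)] c)
qed

text \<open>The value at \<open>y\<close> of the transported polynomial depends only on p(x): if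
  p(x) = q(x), then p - q is a multiple of \<open>m\<close>, whose transport vanishes at
  \<open>y\<close>.\<close>

lemma extend_hom_adjoin:
  fixes \<phi> :: "'a \<Rightarrow> 'b::field"
  assumes h: "hom_on M \<phi>" and m: "is_minpoly M x m" and y: "poly (map_poly \<phi> m) y = 0"
  shows "\<exists>\<psi>. hom_on {poly p x |p. p \<in> polys_over M} \<psi> \<and> (\<forall>a\<in>M. \<psi> a = \<phi> a) \<and> \<psi> x = y"
proof -
  have 0: "\<phi> 0 = 0" by (rule hom_on_0[OF M h])
  have pc: "map_poly \<phi> (pCons c p) = pCons (\<phi> c) (map_poly \<phi> p)" for c p
    by (rule poly_eqI) (simp add: coeff_map_poly 0 coeff_pCons split: nat.split)
  have wd: "poly (map_poly \<phi> p) y = poly (map_poly \<phi> q) y"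
    if pq: "p \<in> polys_over M" "q \<in> polys_over M" "poly p x = poly q x" for p q
  proof -
    have "poly (p - q) x = 0" using that(3) by simp
    then obtain s where s: "s \<in> polys_over M" "p - q = s * m"
      using minpoly_dvd[OF m polys_over_closed(6)[OF pq(1,2)]] by blast
    have mM: "m \<in> polys_over M" using m by (simp add: is_minpoly_def)
    have "p = q + s * m" using s(2) by (simp add: algebra_simps)
    hence "map_poly \<phi> p = map_poly \<phi> q + map_poly \<phi> s * map_poly \<phi> m"
      using map_poly_hom_on[OF h] that(2) s(1) mM polys_over_closed by simp
    thus ?thesis using y by simp
  qed
  define \<psi> where "\<psi> z = poly (map_poly \<phi> (SOME p. p \<in> polys_over M \<and> poly p x = z)) y" for z
  have psi: "\<psi> (poly p x) = poly (map_poly \<phi> p) y" if "p \<in> polys_over M" for p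
  proof -
    have "(SOME q. q \<in> polys_over M \<and> poly q x = poly p x) \<in> polys_over M \<and>
      poly (SOME q. q \<in> polys_over M \<and> poly q x = poly p x) x = poly p x"
      by (rule someI[of _ p]) (simp add: that)
    thus ?thesis unfolding \<psi>_def using wd that by blast
  qed
  have a: "\<psi> a = \<phi> a" if "a \<in> M" for a
    using psi[of "[:a:]"] that pc[of a 0] by (simp add: polys_over_closed)
  have x: "\<psi> x = y"
    using psi[of "[:0,1:]"] hom_onD(1)[OF h] pc[of 0 "[:1:]"] pc[of 1 0]
    by (simp add: polys_over_closed 0 is_subfieldD[OF M])
  have "hom_on {poly p x |p. p \<in> polys_over M} \<psi>"
    unfolding hom_on_def
  proof (intro conjI ballI)
    show "\<psi> 1 = 1" using a[of 1] is_subfieldD[OF M] hom_onD(1)[OF h] by simp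
    fix u v assume "u \<in> {poly p x |p. p \<in> polys_over M}" "v \<in> {poly p x |p. p \<in> polys_over M}"
    then obtain p q where pq: "u = poly p x" "v = poly q x" "p \<in> polys_over M" "q \<in> polys_over M"
      by blast
    show "\<psi> (u + v) = \<psi> u + \<psi> v"
      using psi[of "p + q"] pq by (simp add: psi polys_over_closed map_poly_hom_on[OF h])
    show "\<psi> (u * v) = \<psi> u * \<psi> v"
      using psi[of "p * q"] pq by (simp add: psi polys_over_closed map_poly_hom_on[OF h])
  qed
  thus ?thesis using a x by blast
qed

end


text \<open>Zorn's lemma, applied to graphs of partial homomorphisms that are closed under the field
  operations, so that unions of chains are again such graphs. A maximal graph is total: an algebraic
  element outside its domain could be adjoined by sending it to a root of its transported minimal
  polynomial.\<close>

lemma extend_hom: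
  fixes \<phi> :: "'a::field \<Rightarrow> 'b::alg_closed_field"
  assumes F: "is_subfield F" and alg: "\<And>x. algebraic_over F x" and h: "hom_on F \<phi>"
  obtains \<psi> where "field_hom \<psi>" "\<And>x. x \<in> F \<Longrightarrow> \<psi> x = \<phi> x"
proof -
  define good where "good \<Gamma> \<longleftrightarrow> (\<forall>x\<in>F. (x, \<phi> x) \<in> \<Gamma>) \<and>
    (\<forall>a b c. (a, b) \<in> \<Gamma> \<longrightarrow> (a, c) \<in> \<Gamma> \<longrightarrow> b = c) \<and>
    (\<forall>a b c d. (a, b) \<in> \<Gamma> \<longrightarrow> (c, d) \<in> \<Gamma> \<longrightarrow> (a + c, b + d) \<in> \<Gamma> \<and> (a * c, b * d) \<in> \<Gamma>) \<and>
    (\<forall>a b. (a, b) \<in> \<Gamma> \<longrightarrow> (- a, - b) \<in> \<Gamma> \<and> (inverse a, inverse b) \<in> \<Gamma>)" for \<Gamma> :: "('a \<times> 'b) set"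
  have graph: "good {(x, \<psi> x) |x. x \<in> M}"
    if "is_subfield M" "F \<subseteq> M" "hom_on M \<psi>" "\<And>x. x \<in> F \<Longrightarrow> \<psi> x = \<phi> x" for M \<psi>
    using that hom_on_uminus[OF that(1,3)] hom_on_inverse[OF that(1,3)]
    by (auto simp: good_def is_subfieldD[OF that(1)] hom_onD[OF that(3)])
  define \<C> where "\<C> = Collect good"
  have "\<exists>G\<in>\<C>. \<forall>Y\<in>\<C>. G \<subseteq> Y \<longrightarrow> Y = G"
  proof (rule subset_Zorn_nonempty)
    show "\<C> \<noteq> {}" using graph[OF F _ h] by (auto simp: \<C>_def)
  next
    fix C assume C: "C \<noteq> {}" "subset.chain \<C> C"
    have g: "good Z" if "Z \<in> C" for Z using C(2) that by (auto simp: subset.chain_def \<C>_def)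
    have tot: "Z \<subseteq> Y \<or> Y \<subseteq> Z" if "Z \<in> C" "Y \<in> C" for Z Y
      using C(2) that unfolding subset.chain_def by blast
    have two: "\<exists>Z\<in>C. u \<in> Z \<and> v \<in> Z" if "u \<in> \<Union>C" "v \<in> \<Union>C" for u v
      using that tot by blast
    have "good (\<Union>C)" unfolding good_def
    proof (intro conjI allI impI ballI)
      fix x assume "x \<in> F" thus "(x, \<phi> x) \<in> \<Union>C" using C(1) g unfolding good_def by blast
    next
      fix a b c assume "(a, b) \<in> \<Union>C" "(a, c) \<in> \<Union>C"
      then obtain Z where "Z \<in> C" "(a, b) \<in> Z" "(a, c) \<in> Z" using two by blast
      thus "b = c" using g[of Z] unfolding good_def by blast
    next
      fix a b c d assume "(a, b) \<in> \<Union>C" "(c, d) \<in> \<Union>C"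
      then obtain Z where "Z \<in> C" "(a, b) \<in> Z" "(c, d) \<in> Z" using two by blast
      thus "(a + c, b + d) \<in> \<Union>C" "(a * c, b * d) \<in> \<Union>C" using g[of Z] unfolding good_def by blast+
    next
      fix a b assume "(a, b) \<in> \<Union>C"
      then obtain Z where "Z \<in> C" "(a, b) \<in> Z" by blast
      thus "(- a, - b) \<in> \<Union>C" "(inverse a, inverse b) \<in> \<Union>C" using g[of Z] unfolding good_def by blast+
    qed
    thus "\<Union>C \<in> \<C>" by (simp add: \<C>_def)
  qed
  then obtain \<Gamma> where \<Gamma>: "good \<Gamma>" "\<And>Z. good Z \<Longrightarrow> \<Gamma> \<subseteq> Z \<Longrightarrow> Z = \<Gamma>" by (auto simp: \<C>_def)
  define M where "M = fst ` \<Gamma>"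
  define \<psi> where "\<psi> x = (THE y. (x, y) \<in> \<Gamma>)" for x
  have psi: "(x, y) \<in> \<Gamma> \<Longrightarrow> \<psi> x = y" for x y
    unfolding \<psi>_def using \<Gamma>(1) by (intro the_equality) (auto simp: good_def)
  have psiM: "x \<in> M \<Longrightarrow> (x, \<psi> x) \<in> \<Gamma>" for x using psi unfolding M_def by force
  have MI: "(x, y) \<in> \<Gamma> \<Longrightarrow> x \<in> M" for x y unfolding M_def by force
  have FM: "F \<subseteq> M" using \<Gamma>(1) MI unfolding good_def by blast
  have eq: "\<psi> x = \<phi> x" if "x \<in> F" for x using \<Gamma>(1) psi that unfolding good_def by blast
  have cl: "(x + y, \<psi> x + \<psi> y) \<in> \<Gamma>" "(x * y, \<psi> x * \<psi> y) \<in> \<Gamma>" if "x \<in> M" "y \<in> M" for x y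
    using \<Gamma>(1) psiM[OF that(1)] psiM[OF that(2)] unfolding good_def by blast+
  have cl': "(- x, - \<psi> x) \<in> \<Gamma>" "(inverse x, inverse (\<psi> x)) \<in> \<Gamma>" if "x \<in> M" for x
    using \<Gamma>(1) psiM[OF that(1)] unfolding good_def by blast+
  have M: "is_subfield M" unfolding is_subfield_def
    using FM is_subfieldD(1,2)[OF F] MI[OF cl(1)] MI[OF cl(2)] MI[OF cl'(1)] MI[OF cl'(2)] by auto
  have hom: "hom_on M \<psi>" unfolding hom_on_def
    using eq[of 1] is_subfieldD(2)[OF F] hom_onD(1)[OF h] psi[OF cl(1)] psi[OF cl(2)] by auto
  have \<Gamma>_eq: "\<Gamma> = {(x, \<psi> x) |x. x \<in> M}" using psiM psi MI by (auto simp: M_def)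
  have "M = UNIV"
  proof (rule ccontr)
    assume "M \<noteq> UNIV"
    then obtain x where x: "x \<notin> M" by blast
    have alg': "algebraic_over M x" using alg[of x] FM unfolding algebraic_over_def polys_over_def by blast
    obtain m where m: "is_minpoly M x m" using minpoly_exists[OF M alg'] .
    have inj: "\<psi> a \<noteq> 0" if "a \<in> M" "a \<noteq> 0" for a using hom_on_eq_0[OF M hom] that by blast
    have m': "m \<noteq> 0" "poly m x = 0" "m \<in> polys_over M" using m by (auto simp: is_minpoly_def)
    have "degree (map_poly \<psi> m) = degree m"
      using m' inj by (intro map_poly_degree_eq) (auto simp: polys_over_def)
    moreover have "degree m > 0" using m' by (metis degree_eq_zeroE gr0I pCons_0_0 poly_const_conv)
    ultimately obtain y where y: "poly (map_poly \<psi> m) y = 0"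
      using alg_closed_imp_poly_has_root[of "map_poly \<psi> m"] by auto
    obtain \<theta> where \<theta>: "hom_on {poly p x |p. p \<in> polys_over M} \<theta>" "\<And>a. a \<in> M \<Longrightarrow> \<theta> a = \<psi> a"
      using extend_hom_adjoin[OF M hom m y] by blast
    let ?N = "{poly p x |p. p \<in> polys_over M}"
    have MN: "M \<subseteq> ?N"
    proof
      fix a assume "a \<in> M"
      thus "a \<in> ?N" by (auto intro!: exI[of _ "[:a:]"] polys_over_closed[OF M])
    qed
    have xN: "x \<in> ?N" by (auto intro!: exI[of _ "[:0,1:]"] polys_over_closed[OF M] is_subfieldD[OF M])
    have "good {(z, \<theta> z) |z. z \<in> ?N}"
      by (rule graph[OF is_subfield_adjoin[OF M alg'] _ \<theta>(1)]) (use FM MN \<theta>(2) eq in auto)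
    moreover have "\<Gamma> \<subseteq> {(z, \<theta> z) |z. z \<in> ?N}" using MN \<theta>(2) unfolding \<Gamma>_eq by force
    ultimately have "{(z, \<theta> z) |z. z \<in> ?N} = \<Gamma>" by (rule \<Gamma>(2))
    hence "x \<in> M" using xN MI[of x "\<theta> x"] by blast
    thus False using x by simp
  qed
  thus ?thesis using that hom eq by (simp add: hom_on_UNIV_iff)
qed

lemma field_hom_inj:
  assumes "field_hom (\<sigma> :: 'a::field \<Rightarrow> 'b::field)"
  shows "inj \<sigma>"
proof -
  interpret field_hom \<sigma> by fact
  show ?thesis by (rule injI) simp
qed

lemma poly_field_hom:
  assumes "field_hom \<sigma>"
  shows "\<sigma> (poly p x) = poly (map_poly \<sigma> p) (\<sigma> x)"
proof -
  interpret field_hom \<sigma> by fact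
  show ?thesis by simp
qed

lemma map_poly_fixed:
  assumes "p \<in> polys_over F" "\<And>x. x \<in> F \<Longrightarrow> \<sigma> x = x" "0 \<in> F"
  shows "map_poly \<sigma> p = p"
  using assms by (intro poly_eqI) (auto simp: coeff_map_poly polys_over_def)

lemma field_endo_surj:
  fixes \<sigma> :: "'a::field \<Rightarrow> 'a"
  assumes F: "is_subfield F" and alg: "\<And>x. algebraic_over F x"
    and \<sigma>: "field_hom \<sigma>" "\<And>x. x \<in> F \<Longrightarrow> \<sigma> x = x"
  shows "bij \<sigma>"
proof -
  interpret field_hom \<sigma> by fact
  have "y \<in> range \<sigma>" for y
  proof -
    obtain p where p: "p \<in> polys_over F" "p \<noteq> 0" "poly p y = 0"
      using alg[of y] by (auto simp: algebraic_over_def)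
    let ?A = "{x. poly p x = 0}"
    have "map_poly \<sigma> p = p" by (rule map_poly_fixed[OF p(1) \<sigma>(2) is_subfieldD(1)[OF F]])
    hence "\<sigma> (poly p x) = poly p (\<sigma> x)" for x using poly_field_hom[OF \<sigma>(1), of p x] by simp
    hence "\<sigma> ` ?A \<subseteq> ?A" by (metis (mono_tags, lifting) hom_zero image_subsetI mem_Collect_eq)
    moreover have "finite ?A" by (rule poly_roots_finite[OF p(2)])
    ultimately have "\<sigma> ` ?A = ?A"
      using endo_inj_surj[of ?A \<sigma>] inj_on_subset[OF field_hom_inj[OF \<sigma>(1)]] by auto
    thus ?thesis using p(3) by blast
  qed
  thus ?thesis using field_hom_inj[OF \<sigma>(1)] by (auto simp: bij_def)
qed

text \<open>In characteristic 0 the minimal polynomial of \<open>x\<close> is separable and of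
  degree above 1, so it has a second root; sending \<open>x\<close> there and extending to the whole
  field gives the endomorphism.\<close>

lemma exists_endo_moving:
  fixes x :: "'a::{alg_closed_field,field_char_0}"
  assumes F: "is_subfield F" and alg: "\<And>y::'a. algebraic_over F y" and x: "x \<notin> F"
  obtains \<sigma> where "field_hom \<sigma>" "\<And>y. y \<in> F \<Longrightarrow> \<sigma> y = y" "\<sigma> x \<noteq> x"
proof -
  obtain m where m: "is_minpoly F x m" using minpoly_exists[OF F alg] .
  have m': "m \<noteq> 0" "poly m x = 0" "m \<in> polys_over F" using m by (auto simp: is_minpoly_def)
  have id: "hom_on F (\<lambda>z. z)" by (simp add: hom_on_def)
  have d1: "degree m > 1"
  proof (rule ccontr)
    assume "\<not> degree m > 1"
    moreover have "degree m \<noteq> 0" using m' by (metis degree_eq_zeroE pCons_0_0 poly_const_conv)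
    ultimately have d: "degree m = 1" by simp
    then obtain a b where ab: "m = [:a, b:]" "b \<noteq> 0"
      by (metis degree_eq_zeroE degree_pCons_eq_if nat.inject One_nat_def pCons_cases zero_neq_one pCons_eq_0_iff)
    hence "a \<in> F" "b \<in> F" using m'(3) by (auto simp: polys_over_def coeff_pCons dest: spec[of _ 0] spec[of _ 1])
    moreover have "x = - a / b" using m'(2) ab by (simp add: field_simps eq_neg_iff_add_eq_0)
    ultimately show False using x is_subfieldD(8)[OF F is_subfieldD(5)[OF F], of a b] by simp
  qed
  have "\<exists>y. poly m y = 0 \<and> y \<noteq> x"
  \<comment> \<open>Were \<open>x\<close> the only root, it would be a multiple one, and the
    derivative would be a nonzero polynomial of smaller degree vanishing at
    \<open>x\<close>.\<close>
  proof (rule ccontr)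
    assume no: "\<not> ?thesis"
    obtain q where q: "m = [:-x, 1:] * q" using m'(2) by (metis dvdE poly_eq_0_iff_dvd)
    have "q \<noteq> 0" using q m'(1) by auto
    hence "degree m = degree q + 1" unfolding q by (subst degree_mult_eq) auto
    hence "degree q > 0" using d1 by simp
    then obtain y where "poly q y = 0" using alg_closed_imp_poly_has_root by blast
    hence "poly q x = 0" using no q by (metis mult_zero_right poly_mult)
    hence "poly (pderiv m) x = 0" unfolding q by (simp only: pderiv_mult) (simp add: pderiv_pCons)
    moreover have "pderiv m \<noteq> 0" using d1 by (simp add: pderiv_eq_0_iff)
    ultimately have "degree m \<le> degree (pderiv m)"
      using m polys_over_pderiv[OF F m'(3)] unfolding is_minpoly_def by blast
    thus False using d1 by (simp add: degree_pderiv)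
  qed
  then obtain y where y: "poly m y = 0" "y \<noteq> x" by blast
  have mid: "map_poly (\<lambda>z. z) m = m" by (simp add: map_poly_idI)
  have "poly (map_poly (\<lambda>z. z) m) y = 0" using y(1) mid by simp
  from extend_hom_adjoin[OF F id m this] obtain \<psi> where
    \<psi>: "hom_on {poly p x |p. p \<in> polys_over F} \<psi>" "\<forall>a\<in>F. \<psi> a = a" "\<psi> x = y"
    by (elim exE conjE)
  let ?N = "{poly p x |p. p \<in> polys_over F}"
  have FN: "F \<subseteq> ?N"
  proof
    fix a assume "a \<in> F"
    thus "a \<in> ?N" by (auto intro!: exI[of _ "[:a:]"] polys_over_closed[OF F])
  qed
  have xN: "x \<in> ?N" by (auto intro!: exI[of _ "[:0,1:]"] polys_over_closed[OF F] is_subfieldD[OF F])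
  have algN: "algebraic_over ?N z" for z using alg[of z] FN unfolding algebraic_over_def polys_over_def by blast
  show ?thesis
  proof (rule extend_hom[OF is_subfield_adjoin[OF F alg] algN \<psi>(1)])
    fix \<sigma> :: "'a \<Rightarrow> 'a" assume \<sigma>: "field_hom \<sigma>" "\<And>z. z \<in> ?N \<Longrightarrow> \<sigma> z = \<psi> z"
    show thesis
    proof (rule that[OF \<sigma>(1)])
      show "\<sigma> y = y" if "y \<in> F" for y using \<sigma>(2)[of y] FN that \<psi>(2) by auto
      show "\<sigma> x \<noteq> x" using \<sigma>(2)[OF xN] \<psi>(3) y(2) by simp
    qed
  qed
qed

declare One_nat_def [simp del]

section \<open>Mestre's linear system and the Wronskian identity\<close>

definition root_prod :: "nat \<Rightarrow> (nat \<Rightarrow> 'a::field) \<Rightarrow> 'a poly" where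
  "root_prod N \<alpha> = (\<Prod>i\<in>{1..N}. [:- \<alpha> i, 1:])"

definition root_prod_del :: "nat \<Rightarrow> (nat \<Rightarrow> 'a::field) \<Rightarrow> nat \<Rightarrow> 'a poly" where
  "root_prod_del N \<alpha> i = (\<Prod>j\<in>{1..N} - {i}. [:- \<alpha> j, 1:])"

definition part_frac :: "nat \<Rightarrow> (nat \<Rightarrow> 'a::field) \<Rightarrow> (nat \<Rightarrow> 'a) \<Rightarrow> 'a poly" where
  "part_frac N \<alpha> r = (\<Sum>i\<in>{1..N}. smult (r i) (root_prod_del N \<alpha> i))"

definition mestre_system :: "nat \<Rightarrow> (nat \<Rightarrow> 'a::field) \<Rightarrow> (nat \<Rightarrow> 'a) \<Rightarrow> bool" where
  "mestre_system N \<alpha> r \<longleftrightarrow> (\<forall>j\<in>{1..N}. (\<Sum>i\<in>{1..N} - {j}. r i / (\<alpha> j - \<alpha> i)) = 0)"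

lemma root_prod_eq_del:
  assumes "i \<in> {1..N}"
  shows "root_prod N \<alpha> = [:- \<alpha> i, 1:] * root_prod_del N \<alpha> i"
  unfolding root_prod_def root_prod_del_def using assms by (intro prod.remove) auto

lemma poly_root_prod: "poly (root_prod N \<alpha>) x = (\<Prod>i\<in>{1..N}. x - \<alpha> i)"
  by (simp add: root_prod_def poly_prod)

lemma poly_root_prod_del: "poly (root_prod_del N \<alpha> i) x = (\<Prod>j\<in>{1..N} - {i}. x - \<alpha> j)"
  by (simp add: root_prod_del_def poly_prod)

lemma root_prod_nonzero: "root_prod N \<alpha> \<noteq> 0"
  by (simp add: root_prod_def)

lemma degree_prod_linear: "finite A \<Longrightarrow> degree (\<Prod>i\<in>A. [:- \<alpha> i, 1:] :: 'a::field poly) = card A"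
  by (subst degree_prod_eq_sum_degree) auto

lemma degree_root_prod: "degree (root_prod N \<alpha>) = N"
  by (simp add: root_prod_def degree_prod_linear)

lemma degree_root_prod_del: "i \<in> {1..N} \<Longrightarrow> degree (root_prod_del N \<alpha> i) = N - 1"
  by (simp add: root_prod_del_def degree_prod_linear)

lemma monic_root_prod: "lead_coeff (root_prod N \<alpha>) = 1"
  by (simp add: root_prod_def lead_coeff_prod)

lemma monic_root_prod_del: "lead_coeff (root_prod_del N \<alpha> i) = 1"
  by (simp add: root_prod_del_def lead_coeff_prod)

lemma degree_part_frac: "degree (part_frac N \<alpha> r) \<le> N - 1"
  unfolding part_frac_def
  by (rule degree_sum_le) (auto intro: order.trans[OF degree_smult_le] simp: degree_root_prod_del)

lemma coeff_part_frac_top: "coeff (part_frac N \<alpha> r) (N - 1) = sum r {1..N}"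
proof -
  have "coeff (root_prod_del N \<alpha> i) (N - 1) = 1" if "i \<in> {1..N}" for i
    using monic_root_prod_del[of N \<alpha> i] degree_root_prod_del[OF that, of \<alpha>] by metis
  thus ?thesis by (simp add: part_frac_def coeff_sum)
qed

lemma poly_pderiv_root_prod:
  assumes "i \<in> {1..N}"
  shows "poly (pderiv (root_prod N \<alpha>)) (\<alpha> i) = poly (root_prod_del N \<alpha> i) (\<alpha> i)"
  unfolding root_prod_eq_del[OF assms] by (simp only: pderiv_mult) (simp add: pderiv_pCons)

lemma root_prod_del_at_root:
  assumes "i \<in> {1..N}" "j \<in> {1..N}" "i \<noteq> j"
  shows "poly (root_prod_del N \<alpha> i) (\<alpha> j) = 0"
  unfolding poly_root_prod_del using assms by (intro prod_zero) auto

lemma root_prod_del_nonzero: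
  assumes "i \<in> {1..N}" "inj_on \<alpha> {1..N}"
  shows "poly (root_prod_del N \<alpha> i) (\<alpha> i) \<noteq> 0"
  unfolding poly_root_prod_del using assms by (auto dest: inj_onD)

lemma poly_part_frac_root:
  assumes "i \<in> {1..N}"
  shows "poly (part_frac N \<alpha> r) (\<alpha> i) = r i * poly (root_prod_del N \<alpha> i) (\<alpha> i)"
proof -
  have "poly (part_frac N \<alpha> r) (\<alpha> i) = (\<Sum>k\<in>{1..N}. if k = i then r i * poly (root_prod_del N \<alpha> i) (\<alpha> i) else 0)"
    unfolding part_frac_def poly_sum using assms
    by (intro sum.cong) (auto simp: root_prod_del_at_root)
  thus ?thesis using assms by simp
qed

text \<open>With D_i = P/(X - \<alpha>_i), the derivative of P/D_i = X - \<alpha>_i gives P' D_i - P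
  D_i' = D_i^2, so the left side is the diagonal part of the square on the right. Off the diagonal,
  partial fractions turn D_i D_j into P (D_i - D_j)/(\<alpha>_i - \<alpha>_j), and collecting the
  terms P D_i leaves exactly the equations of the system as coefficients.\<close>

lemma mestre_identity:
  fixes \<alpha> :: "nat \<Rightarrow> 'a::field"
  assumes inj: "inj_on \<alpha> {1..N}" and sys: "mestre_system N \<alpha> r"
  defines "P \<equiv> root_prod N \<alpha>"
  defines "Q \<equiv> part_frac N \<alpha> (\<lambda>i. r i ^ 2)"
  shows "pderiv P * Q - P * pderiv Q = part_frac N \<alpha> r ^ 2"
proof -
  let ?D = "root_prod_del N \<alpha>"
  let ?I = "{1..N}"
  have w: "pderiv P * ?D i - P * pderiv (?D i) = ?D i ^ 2" if "i \<in> ?I" for i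
  proof -
    have "pderiv P = ?D i + [:- \<alpha> i, 1:] * pderiv (?D i)"
      unfolding P_def root_prod_eq_del[OF that] by (simp only: pderiv_mult) (simp add: pderiv_pCons)
    thus ?thesis unfolding P_def root_prod_eq_del[OF that]
      by (simp only: P_def root_prod_eq_del[OF that]) (simp add: algebra_simps power2_eq_square)
  qed
  have "pderiv P * Q - P * pderiv Q = (\<Sum>i\<in>?I. smult (r i ^ 2) (pderiv P * ?D i - P * pderiv (?D i)))"
    by (simp add: Q_def part_frac_def sum_distrib_left pderiv_sum pderiv_smult sum_subtractf smult_diff_right)
  also have "\<dots> = (\<Sum>i\<in>?I. smult (r i ^ 2) (?D i ^ 2))"
    by (intro sum.cong) (auto simp: w)
  finally have lhs: "pderiv P * Q - P * pderiv Q = (\<Sum>i\<in>?I. smult (r i ^ 2) (?D i ^ 2))" .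
  have c: "?D i * ?D j = smult (1 / (\<alpha> i - \<alpha> j)) (P * ?D i) - smult (1 / (\<alpha> i - \<alpha> j)) (P * ?D j)"
    if "i \<in> ?I" "j \<in> ?I" "i \<noteq> j" for i j
  proof -
    have ne: "\<alpha> i - \<alpha> j \<noteq> 0" using inj that by (auto dest: inj_onD)
    have "P * ?D i - P * ?D j = ([:- \<alpha> j, 1:] - [:- \<alpha> i, 1:]) * (?D i * ?D j)"
      unfolding left_diff_distrib P_def
      by (subst (1) root_prod_eq_del[OF that(2)], subst root_prod_eq_del[OF that(1)]) (simp add: algebra_simps)
    also have "\<dots> = smult (\<alpha> i - \<alpha> j) (?D i * ?D j)" by simp
    finally have "smult (1 / (\<alpha> i - \<alpha> j)) (P * ?D i - P * ?D j) = ?D i * ?D j"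
      using ne by simp
    thus ?thesis by (simp add: smult_diff_right)
  qed
  have row: "(\<Sum>j\<in>?I - {i}. r i * r j / (\<alpha> i - \<alpha> j)) = 0" if "i \<in> ?I" for i
  proof -
    have "(\<Sum>j\<in>?I - {i}. r i * r j / (\<alpha> i - \<alpha> j)) = r i * (\<Sum>j\<in>?I - {i}. r j / (\<alpha> i - \<alpha> j))"
      by (simp add: sum_distrib_left)
    thus ?thesis using sys that by (simp add: mestre_system_def)
  qed
  \<comment> \<open>Setting the diagonal to 0 extends the coefficients to the full square of
    indices, where the two double sums can be exchanged and \<open>skew\<close> applies.\<close>
  define c' where "c' i j = (if i = j then 0 else r i * r j / (\<alpha> i - \<alpha> j))" for i j
  have row': "(\<Sum>j\<in>?I. c' i j) = 0" if "i \<in> ?I" for i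
  proof -
    have "(\<Sum>j\<in>?I. c' i j) = c' i i + (\<Sum>j\<in>?I - {i}. c' i j)" using that by (intro sum.remove) auto
    also have "(\<Sum>j\<in>?I - {i}. c' i j) = (\<Sum>j\<in>?I - {i}. r i * r j / (\<alpha> i - \<alpha> j))"
      by (intro sum.cong) (auto simp: c'_def)
    finally show ?thesis using row[OF that] by (simp add: c'_def)
  qed
  have skew: "c' j i = - c' i j" for i j
  proof (cases "i = j")
    case False
    have "\<alpha> j - \<alpha> i = - (\<alpha> i - \<alpha> j)" by simp
    thus ?thesis using False by (simp only: c'_def mult.commute[of "r j"] if_False if_not_P divide_minus_right)
  qed (simp add: c'_def)
  have "part_frac N \<alpha> r ^ 2 = (\<Sum>i\<in>?I. \<Sum>j\<in>?I. smult (r i * r j) (?D i * ?D j))"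
    by (simp add: part_frac_def power2_eq_square sum_product mult.commute)
  also have "\<dots> = (\<Sum>i\<in>?I. \<Sum>j\<in>?I. (if i = j then smult (r i ^ 2) (?D i ^ 2) else 0) +
      (smult (c' i j) (P * ?D i) + smult (c' j i) (P * ?D j)))"
  proof (intro sum.cong refl)
    fix i j assume ij: "i \<in> ?I" "j \<in> ?I"
    show "smult (r i * r j) (?D i * ?D j) = (if i = j then smult (r i ^ 2) (?D i ^ 2) else 0) +
      (smult (c' i j) (P * ?D i) + smult (c' j i) (P * ?D j))"
    proof (cases "i = j")
      case False
      show ?thesis unfolding c[OF ij False] skew[of j i] using False
        by (simp add: c'_def smult_diff_right)
    qed (simp add: c'_def power2_eq_square)
  qed
  also have "\<dots> = (\<Sum>i\<in>?I. smult (r i ^ 2) (?D i ^ 2)) +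
     ((\<Sum>i\<in>?I. \<Sum>j\<in>?I. smult (c' i j) (P * ?D i)) + (\<Sum>i\<in>?I. \<Sum>j\<in>?I. smult (c' j i) (P * ?D j)))"
    by (simp add: sum.distrib)
  also have "(\<Sum>i\<in>?I. \<Sum>j\<in>?I. smult (c' j i) (P * ?D j)) = (\<Sum>i\<in>?I. \<Sum>j\<in>?I. smult (c' i j) (P * ?D i))"
    by (rule sum.swap)
  also have "(\<Sum>i\<in>?I. \<Sum>j\<in>?I. smult (c' i j) (P * ?D i)) = (\<Sum>i\<in>?I. smult (\<Sum>j\<in>?I. c' i j) (P * ?D i))"
    by (simp add: smult_sum)
  also have "\<dots> = 0" by (simp add: row')
  finally show ?thesis using lhs by simp
qed

text \<open>The skew matrix of the system, bordered by a row and a column of ones with corner 0. The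
  extra row normalises the sum of the unknowns to 1, which makes
  \<open>part_frac N \<alpha> r\<close> monic of degree N - 1; the extra column makes the matrix
  square, so that uniqueness of the normalised solution becomes invertibility.\<close>

definition mestre_matrix :: "nat \<Rightarrow> (nat \<Rightarrow> 'a::field) \<Rightarrow> 'a mat" where
  "mestre_matrix N \<alpha> = mat (Suc N) (Suc N) (\<lambda>(i, j).
     if i < N \<and> j < N then (if i = j then 0 else 1 / (\<alpha> (Suc i) - \<alpha> (Suc j)))
     else if i = N \<and> j = N then 0 else 1)"

text \<open>Cramer's rule for the bordered system with right-hand side the last unit vector. A
  cofactor divided by the determinant depends rationally on the points, which is what the genericity
  argument needs.\<close>

definition mestre_solution :: "nat \<Rightarrow> (nat \<Rightarrow> 'a::field) \<Rightarrow> nat \<Rightarrow> 'a" where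
  "mestre_solution N \<alpha> i = adj_mat (mestre_matrix N \<alpha>) $$ (i - 1, N) / det (mestre_matrix N \<alpha>)"

lemma sum_1_to_Suc: "(\<Sum>i\<in>{1..N}. f i) = (\<Sum>i\<in>{0..<N}. f (Suc i))"
  by (rule sum.reindex_bij_witness[of _ Suc "\<lambda>i. i - 1"]) auto

lemma mestre_system_alt:
  "mestre_system N \<alpha> r \<longleftrightarrow>
     (\<forall>i<N. (\<Sum>j\<in>{0..<N}. (if i = j then 0 else 1 / (\<alpha> (Suc i) - \<alpha> (Suc j))) * r (Suc j)) = 0)"
proof -
  have "(\<Sum>i\<in>{1..N} - {j}. r i / (\<alpha> j - \<alpha> i)) =
    (\<Sum>i\<in>{0..<N}. (if j = Suc i then 0 else 1 / (\<alpha> j - \<alpha> (Suc i))) * r (Suc i))" if "j \<in> {1..N}" for j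
  proof -
    have "(\<Sum>i\<in>{1..N} - {j}. r i / (\<alpha> j - \<alpha> i)) = (\<Sum>i\<in>{1..N}. (if j = i then 0 else 1 / (\<alpha> j - \<alpha> i)) * r i)"
      using that by (intro sum.mono_neutral_cong_left) auto
    thus ?thesis by (simp only: sum_1_to_Suc)
  qed
  hence "mestre_system N \<alpha> r \<longleftrightarrow> (\<forall>j\<in>{1..N}.
    (\<Sum>i\<in>{0..<N}. (if j = Suc i then 0 else 1 / (\<alpha> j - \<alpha> (Suc i))) * r (Suc i)) = 0)"
    by (simp add: mestre_system_def)
  also have "\<dots> \<longleftrightarrow> (\<forall>i<N. (\<Sum>j\<in>{0..<N}. (if i = j then 0 else 1 / (\<alpha> (Suc i) - \<alpha> (Suc j))) * r (Suc j)) = 0)"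
    (is "?L \<longleftrightarrow> ?R")
  proof
    assume L: ?L
    show ?R
    proof (intro allI impI)
      fix i assume "i < N"
      hence "Suc i \<in> {1..N}" by auto
      from bspec[OF L this] show "(\<Sum>j\<in>{0..<N}. (if i = j then 0 else 1 / (\<alpha> (Suc i) - \<alpha> (Suc j))) * r (Suc j)) = 0"
        by simp
    qed
  next
    assume R: ?R
    show ?L
    proof
      fix j assume "j \<in> {1..N}"
      thus "(\<Sum>i\<in>{0..<N}. (if j = Suc i then 0 else 1 / (\<alpha> j - \<alpha> (Suc i))) * r (Suc i)) = 0"
        using R by (cases j) auto
    qed
  qed
  finally show ?thesis .
qed

lemma mestre_matrix_carrier [simp]: "mestre_matrix N \<alpha> \<in> carrier_mat (Suc N) (Suc N)"
  by (simp add: mestre_matrix_def)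

lemma mestre_matrix_vec:
  assumes "i < N" "v \<in> carrier_vec (Suc N)"
  shows "(mestre_matrix N \<alpha> *\<^sub>v v) $ i = (\<Sum>j\<in>{0..<N}. (if i = j then 0 else 1 / (\<alpha> (Suc i) - \<alpha> (Suc j))) * v $ j) + v $ N"
  using assms by (auto simp: mestre_matrix_def scalar_prod_def intro!: arg_cong2[where f="(+)"] sum.cong)

lemma mestre_matrix_vec_last:
  assumes "v \<in> carrier_vec (Suc N)"
  shows "(mestre_matrix N \<alpha> *\<^sub>v v) $ N = (\<Sum>j\<in>{0..<N}. v $ j)"
  using assms by (auto simp: mestre_matrix_def scalar_prod_def intro!: sum.cong)

text \<open>The last unknown of the bordered system vanishes because the system is skew-symmetric.\<close>

lemma mestre_solution:
  fixes \<alpha> :: "nat \<Rightarrow> 'a::field_char_0"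
  assumes det: "det (mestre_matrix N \<alpha>) \<noteq> 0"
  shows "mestre_system N \<alpha> (mestre_solution N \<alpha>)" "sum (mestre_solution N \<alpha>) {1..N} = 1"
proof -
  let ?A = "mestre_matrix N \<alpha>"
  define v where "v = vec (Suc N) (\<lambda>j. adj_mat ?A $$ (j, N) / det ?A)"
  have v: "v \<in> carrier_vec (Suc N)" by (simp add: v_def)
  have adj: "adj_mat ?A \<in> carrier_mat (Suc N) (Suc N)" "?A * adj_mat ?A = det ?A \<cdot>\<^sub>m 1\<^sub>m (Suc N)"
    using adj_mat[OF mestre_matrix_carrier] by auto
  have Av: "(?A *\<^sub>v v) $ i = (if i = N then 1 else 0)" if "i \<le> N" for i
  proof -
    have "(?A *\<^sub>v v) $ i = (\<Sum>j\<in>{0..<Suc N}. ?A $$ (i, j) * (adj_mat ?A $$ (j, N) / det ?A))"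
      using that by (simp add: scalar_prod_def v_def mestre_matrix_def)
    also have "\<dots> = (\<Sum>j\<in>{0..<Suc N}. ?A $$ (i, j) * adj_mat ?A $$ (j, N)) / det ?A"
      by (simp only: sum_divide_distrib times_divide_eq_right)
    also have "(\<Sum>j\<in>{0..<Suc N}. ?A $$ (i, j) * adj_mat ?A $$ (j, N)) = (?A * adj_mat ?A) $$ (i, N)"
      using that adj(1) by (simp add: scalar_prod_def mestre_matrix_def)
    also have "\<dots> = (if i = N then det ?A else 0)" unfolding adj(2) using that by simp
    finally show ?thesis using det by simp
  qed
  let ?r = "\<lambda>j. v $ j"
  let ?S = "\<lambda>i j. (if i = j then 0 else 1 / (\<alpha> (Suc i) - \<alpha> (Suc j)))"
  have r: "mestre_solution N \<alpha> (Suc j) = v $ j" if "j < N" for j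
    using that by (simp add: mestre_solution_def v_def)
  have sum1: "(\<Sum>j\<in>{0..<N}. v $ j) = 1" using Av[of N] mestre_matrix_vec_last[OF v] by simp
  thus "sum (mestre_solution N \<alpha>) {1..N} = 1" by (simp add: sum_1_to_Suc r)
  have rows: "(\<Sum>j\<in>{0..<N}. ?S i j * v $ j) = - (v $ N)" if "i < N" for i
    using Av[of i] mestre_matrix_vec[OF that v, of \<alpha>] that by (simp add: eq_neg_iff_add_eq_0)
  have skew: "?S j i = - ?S i j" for i j
    by (cases "i = j") (auto simp: minus_divide_right)
  let ?T = "\<Sum>i\<in>{0..<N}. \<Sum>j\<in>{0..<N}. v $ i * (?S i j * v $ j)"
  have "?T = (\<Sum>j\<in>{0..<N}. \<Sum>i\<in>{0..<N}. v $ i * (?S i j * v $ j))" by (rule sum.swap)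
  also have "\<dots> = (\<Sum>j\<in>{0..<N}. \<Sum>i\<in>{0..<N}. - (v $ j * (?S j i * v $ i)))"
    by (intro sum.cong refl) (subst skew, simp)
  also have "\<dots> = - ?T" by (simp only: sum_negf)
  finally have T0: "?T = 0" by simp
  have "?T = (\<Sum>i\<in>{0..<N}. v $ i * - (v $ N))"
    by (intro sum.cong refl) (simp only: rows atLeastLessThan_iff sum_distrib_left[symmetric])
  also have "\<dots> = - (v $ N)" using sum1 by (simp only: sum_distrib_right[symmetric]) simp
  finally have "v $ N = 0" using T0 by simp
  thus "mestre_system N \<alpha> (mestre_solution N \<alpha>)"
    unfolding mestre_system_alt using rows by (simp add: r)
qed

text \<open>The difference of two normalised solutions, completed by 0, lies in the kernel of the
  bordered matrix.\<close>

lemma mestre_solution_unique: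
  fixes \<alpha> :: "nat \<Rightarrow> 'a::field_char_0"
  assumes det: "det (mestre_matrix N \<alpha>) \<noteq> 0"
    and r: "mestre_system N \<alpha> r" "sum r {1..N} = 1" and i: "i \<in> {1..N}"
  shows "r i = mestre_solution N \<alpha> i"
proof -
  let ?s = "mestre_solution N \<alpha>"
  define v where "v = vec (Suc N) (\<lambda>j. if j < N then r (Suc j) - ?s (Suc j) else 0)"
  have v: "v \<in> carrier_vec (Suc N)" by (simp add: v_def)
  have "(mestre_matrix N \<alpha> *\<^sub>v v) $ i = 0" if "i < Suc N" for i
  proof (cases "i = N")
    case True
    thus ?thesis using mestre_matrix_vec_last[OF v, of \<alpha>] r(2) mestre_solution(2)[OF det]
      by (simp add: v_def sum_subtractf sum_1_to_Suc)
  next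
    case False
    hence "i < N" using that by simp
    thus ?thesis using mestre_matrix_vec[OF _ v, of i \<alpha>] r(1) mestre_solution(1)[OF det]
      unfolding mestre_system_alt by (simp add: v_def right_diff_distrib sum_subtractf)
  qed
  hence "mestre_matrix N \<alpha> *\<^sub>v v = 0\<^sub>v (Suc N)"
    by (intro eq_vecI) (auto simp: mestre_matrix_def)
  hence v0: "v = 0\<^sub>v (Suc N)"
    using det_0_iff_vec_prod_zero_field[OF mestre_matrix_carrier] det v by blast
  obtain k where k: "i = Suc k" "k < N" using i by (cases i) auto
  have "v $ k = 0" using v0 k by simp
  thus ?thesis using k by (simp add: v_def)
qed

section \<open>Rational dependence on a parameter\<close>

text \<open>A rational function regular at \<open>u0\<close>, stated for a total function: agreement
  is required only where the chosen denominator is nonzero, so the conventional values of divisions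
  by zero do no harm.\<close>

definition germ :: "'a::field \<Rightarrow> ('a \<Rightarrow> 'a) \<Rightarrow> bool" where
  "germ u0 f \<longleftrightarrow> (\<exists>a b. poly b u0 \<noteq> 0 \<and> (\<forall>u. poly b u \<noteq> 0 \<longrightarrow> f u = poly a u / poly b u))"

lemma germ_const: "germ u0 (\<lambda>u. c)"
  unfolding germ_def by (rule exI[of _ "[:c:]"], rule exI[of _ 1]) simp

lemma germ_id: "germ u0 (\<lambda>u. u)"
  unfolding germ_def by (rule exI[of _ "[:0,1:]"], rule exI[of _ 1]) simp

lemma germ_add:
  assumes "germ u0 f" "germ u0 g"
  shows "germ u0 (\<lambda>u. f u + g u)"
proof -
  obtain a b c d where "poly b u0 \<noteq> 0" "\<And>u. poly b u \<noteq> 0 \<Longrightarrow> f u = poly a u / poly b u"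
    "poly d u0 \<noteq> 0" "\<And>u. poly d u \<noteq> 0 \<Longrightarrow> g u = poly c u / poly d u"
    using assms by (auto simp: germ_def)
  thus ?thesis unfolding germ_def
    by (intro exI[of _ "a * d + c * b"] exI[of _ "b * d"]) (auto simp: field_simps)
qed

lemma germ_mult:
  assumes "germ u0 f" "germ u0 g"
  shows "germ u0 (\<lambda>u. f u * g u)"
proof -
  obtain a b c d where "poly b u0 \<noteq> 0" "\<And>u. poly b u \<noteq> 0 \<Longrightarrow> f u = poly a u / poly b u"
    "poly d u0 \<noteq> 0" "\<And>u. poly d u \<noteq> 0 \<Longrightarrow> g u = poly c u / poly d u"
    using assms by (auto simp: germ_def)
  thus ?thesis unfolding germ_def
    by (intro exI[of _ "a * c"] exI[of _ "b * d"]) auto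
qed

lemma germ_inverse:
  assumes "germ u0 f" "f u0 \<noteq> 0"
  shows "germ u0 (\<lambda>u. inverse (f u))"
proof -
  obtain a b where ab: "poly b u0 \<noteq> 0" "\<And>u. poly b u \<noteq> 0 \<Longrightarrow> f u = poly a u / poly b u"
    using assms by (auto simp: germ_def)
  have "poly a u0 \<noteq> 0" using ab assms(2) by auto
  moreover have "inverse (f u) = poly (b * b) u / poly (a * b) u" if "poly (a * b) u \<noteq> 0" for u
    using that ab(2)[of u] by simp
  \<comment> \<open>The fraction b/a is expanded to (b b)/(a b), so that a nonzero denominator also
    guarantees that the representation of \<open>f\<close> itself is valid at that point.\<close>
  ultimately show ?thesis using ab(1) unfolding germ_def
    by (intro exI[of _ "b * b"] exI[of _ "a * b"]) simp
qed

lemma germ_divide: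
  assumes "germ u0 f" "germ u0 g" "g u0 \<noteq> 0"
  shows "germ u0 (\<lambda>u. f u / g u)"
  unfolding divide_inverse by (intro germ_mult germ_inverse assms)

lemma germ_diff:
  assumes "germ u0 f" "germ u0 g"
  shows "germ u0 (\<lambda>u. f u - g u)"
  using germ_add[OF assms(1) germ_mult[OF germ_const[of u0 "- 1"] assms(2)]] by simp

lemma germ_sum: "(\<And>i. i \<in> A \<Longrightarrow> germ u0 (f i)) \<Longrightarrow> germ u0 (\<lambda>u. \<Sum>i\<in>A. f i u)"
  by (induction A rule: infinite_finite_induct) (auto intro: germ_const germ_add)

lemma germ_prod: "(\<And>i. i \<in> A \<Longrightarrow> germ u0 (f i)) \<Longrightarrow> germ u0 (\<lambda>u. \<Prod>i\<in>A. f i u)"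
  by (induction A rule: infinite_finite_induct) (auto intro: germ_const germ_mult)

lemma germ_det:
  assumes "\<And>i j. i < n \<Longrightarrow> j < n \<Longrightarrow> germ u0 (\<lambda>u. A u i j)"
  shows "germ u0 (\<lambda>u. det (mat n n (\<lambda>(i, j). A u i j)))"
proof -
  have pl: "p i < n" if "p permutes {0..<n}" "i < n" for p i
    using permutes_in_image[OF that(1), of i] that(2) by simp
  have "det (mat n n (\<lambda>(i, j). A u i j)) =
    (\<Sum>p | p permutes {0..<n}. signof p * (\<Prod>i = 0..<n. A u i (p i)))" for u
    by (subst det_def'[of _ n]) (auto intro!: sum.cong prod.cong simp: pl)
  thus ?thesis using assms pl
    by (auto intro!: germ_sum germ_mult germ_prod germ_const)
qed

lemma germ_cofactor_det:
  assumes "\<And>i j. i < n \<Longrightarrow> j < n \<Longrightarrow> germ u0 (\<lambda>u. A u i j)" "i < n" "j < n"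
  shows "germ u0 (\<lambda>u. adj_mat (mat n n (\<lambda>(i, j). A u i j)) $$ (i, j))"
proof -
  have "adj_mat (mat n n (\<lambda>(i, j). A u i j)) $$ (i, j) = (- 1) ^ (j + i) *
     det (mat (n - 1) (n - 1) (\<lambda>(i', j'). A u (if i' < j then i' else Suc i') (if j' < i then j' else Suc j')))" for u
  proof -
    have "mat_delete (mat n n (\<lambda>(i, j). A u i j)) j i =
      mat (n - 1) (n - 1) (\<lambda>(i', j'). A u (if i' < j then i' else Suc i') (if j' < i then j' else Suc j'))"
      unfolding mat_delete_def using assms(2,3) by (intro eq_matI) auto
    thus ?thesis using assms(2,3) by (simp add: adj_mat_def cofactor_def)
  qed
  thus ?thesis using assms by (auto intro!: germ_mult germ_const germ_det)
qed

text \<open>A zero of \<open>f\<close> must be a zero of the numerator or of the denominator, and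
  both are nonzero polynomials.\<close>

lemma germ_nonzero_cofinite:
  fixes f :: "'a::field_char_0 \<Rightarrow> 'a"
  assumes "germ u0 f" "f u0 \<noteq> 0"
  shows "finite {u. f u = 0}"
proof -
  obtain a b where ab: "poly b u0 \<noteq> 0" "\<And>u. poly b u \<noteq> 0 \<Longrightarrow> f u = poly a u / poly b u"
    using assms by (auto simp: germ_def)
  have "a \<noteq> 0" "b \<noteq> 0" using ab assms(2) by auto
  hence "finite ({u. poly a u = 0} \<union> {u. poly b u = 0})" by (simp add: poly_roots_finite)
  moreover have "{u. f u = 0} \<subseteq> {u. poly a u = 0} \<union> {u. poly b u = 0}" using ab(2) by force
  ultimately show ?thesis by (rule finite_subset[rotated])
qed

definition poly_germ :: "'a::field \<Rightarrow> ('a \<Rightarrow> 'a poly) \<Rightarrow> bool" where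
  "poly_germ u0 F \<longleftrightarrow> (\<forall>n. germ u0 (\<lambda>u. coeff (F u) n))"

lemma poly_germ_const: "poly_germ u0 (\<lambda>u. p)"
  by (simp add: poly_germ_def germ_const)

lemma poly_germ_mult: "poly_germ u0 F \<Longrightarrow> poly_germ u0 G \<Longrightarrow> poly_germ u0 (\<lambda>u. F u * G u)"
  by (auto simp: poly_germ_def coeff_mult intro!: germ_sum germ_mult)

lemma poly_germ_sum: "(\<And>i. i \<in> A \<Longrightarrow> poly_germ u0 (F i)) \<Longrightarrow> poly_germ u0 (\<lambda>u. \<Sum>i\<in>A. F i u)"
  by (auto simp: poly_germ_def coeff_sum intro!: germ_sum)

lemma poly_germ_prod: "(\<And>i. i \<in> A \<Longrightarrow> poly_germ u0 (F i)) \<Longrightarrow> poly_germ u0 (\<lambda>u. \<Prod>i\<in>A. F i u)"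
  by (induction A rule: infinite_finite_induct) (auto intro: poly_germ_const poly_germ_mult)

lemma poly_germ_power: "poly_germ u0 F \<Longrightarrow> poly_germ u0 (\<lambda>u. F u ^ n)"
  by (induction n) (auto intro: poly_germ_const poly_germ_mult)

lemma poly_germ_smult: "germ u0 f \<Longrightarrow> poly_germ u0 F \<Longrightarrow> poly_germ u0 (\<lambda>u. smult (f u) (F u))"
  by (auto simp: poly_germ_def intro!: germ_mult)

lemma poly_germ_linear: "germ u0 f \<Longrightarrow> poly_germ u0 (\<lambda>u. [:- f u, 1:])"
proof -
  assume "germ u0 f"
  hence "germ u0 (\<lambda>u. - f u)" using germ_mult[OF germ_const[of u0 "-1"], of f] by simp
  thus ?thesis unfolding poly_germ_def
  proof (intro allI)
    fix n show "germ u0 (\<lambda>u. coeff [:- f u, 1:] n)" if "germ u0 (\<lambda>u. - f u)"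
    proof (cases n)
      case (Suc m) thus ?thesis by (cases m) (simp_all add: germ_const)
    qed (use that in simp)
  qed
qed

section \<open>The genericity determinant\<close>

text \<open>Nonvanishing of this determinant says that the polynomials \<open>P ^ i * Q ^ (d - i)\<close> for
  \<open>i < d\<close> form a basis modulo \<open>R\<close>. If \<open>P' * Q - P * Q' = R\<^sup>2\<close>, this forces \<open>R\<close> to be separable and
  \<open>P / Q\<close> to be finite and injective on the roots of \<open>R\<close>.\<close>

definition crit_matrix :: "nat \<Rightarrow> 'a::field poly \<Rightarrow> 'a poly \<Rightarrow> 'a poly \<Rightarrow> 'a mat" where
  "crit_matrix d P Q R = mat (d * d + d) (d * d + d) (\<lambda>(i, l).
     coeff (if i < d then P ^ i * Q ^ (d - i) else monom 1 (i - d) * R) l)"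

text \<open>This explains the size: the degree of P^i Q^(d-i) is at most i (d+1) + (d-i) d = d^2 +
  i, and the d^2 shifts of \<open>R\<close> also stay below d^2 + d, so d + d^2 rows fit into the
  space of polynomials of degree below d^2 + d.\<close>

lemma crit_matrix_degree:
  assumes "degree P \<le> Suc d" "degree Q \<le> d" "degree R \<le> d" "i < d * d + d"
  shows "degree (if i < d then P ^ i * Q ^ (d - i) else monom 1 (i - d) * (R :: 'a::field poly)) < d * d + d"
proof (cases "i < d")
  case True
  have "degree (P ^ i * Q ^ (d - i)) \<le> i * Suc d + (d - i) * d"
    using assms(1,2) by (intro order.trans[OF degree_mult_le] add_mono order.trans[OF degree_power_le])
      (metis mult.commute mult_le_mono2)+
  also have "\<dots> = i + (i + (d - i)) * d" by (simp add: algebra_simps)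
  also have "\<dots> = i + d * d" using True by simp
  finally show ?thesis using True by simp
next
  case False
  have "degree (monom (1::'a) (i - d) * R) \<le> (i - d) + d"
    using assms by (intro order.trans[OF degree_mult_le] add_mono) (auto simp: degree_monom_eq)
  thus ?thesis using False assms(4) by simp
qed

text \<open>\<open>v\<close> is read as the linear functional sending X^l to \<open>v l\<close>. It
  is nonzero because of its value at 1 or at X, and it kills every row, so its coordinate vector
  lies in the kernel.\<close>

lemma crit_matrix_functional:
  assumes deg: "degree P \<le> Suc d" "degree Q \<le> d" "degree R \<le> d" and d: "d \<ge> 1"
    and v: "v 0 \<noteq> 0 \<or> v 1 \<noteq> 0"
    and PQ: "\<And>i. i < d \<Longrightarrow> (\<Sum>l<d*d+d. coeff (P ^ i * Q ^ (d - i)) l * v l) = 0"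
    and R: "\<And>k. k < d * d \<Longrightarrow> (\<Sum>l<d*d+d. coeff (monom 1 k * R) l * v l) = 0"
  shows "det (crit_matrix d P Q R) = (0 :: 'a::field)"
proof -
  let ?L = "d * d + d"
  let ?v = "vec ?L v"
  have c: "crit_matrix d P Q R \<in> carrier_mat ?L ?L" by (simp add: crit_matrix_def)
  have L: "?L \<ge> 2" using d by (cases d) auto
  have "?v $ 0 = v 0" "?v $ 1 = v 1" using L by (auto intro!: index_vec)
  moreover have "0\<^sub>v ?L $ 0 = (0::'a)" "0\<^sub>v ?L $ 1 = (0::'a)" using L by (auto intro!: index_zero_vec)
  ultimately have "?v \<noteq> 0\<^sub>v ?L" using v by metis
  moreover have "crit_matrix d P Q R *\<^sub>v ?v = 0\<^sub>v ?L"
  proof (intro eq_vecI)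
    fix i assume "i < dim_vec (0\<^sub>v ?L :: 'a vec)"
    hence i: "i < ?L" by simp
    hence "(crit_matrix d P Q R *\<^sub>v ?v) $ i =
      (\<Sum>l<?L. coeff (if i < d then P ^ i * Q ^ (d - i) else monom 1 (i - d) * R) l * v l)"
      by (simp add: crit_matrix_def scalar_prod_def atLeast0LessThan)
    also have "\<dots> = 0" using PQ[of i] R[of "i - d"] i by (cases "i < d") auto
    finally show "(crit_matrix d P Q R *\<^sub>v ?v) $ i = 0\<^sub>v ?L $ i" using i by simp
  qed (simp add: crit_matrix_def)
  moreover have "?v \<in> carrier_vec ?L" by simp
  ultimately show ?thesis using det_0_iff_vec_prod_zero_field[OF c] by blast
qed

lemma sum_coeff_eval:
  assumes "degree F < L"
  shows "(\<Sum>l<L. coeff F l * (x::'a::field) ^ l) = poly F x"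
  unfolding poly_altdef using assms
  by (intro sum.mono_neutral_right) (auto simp: coeff_eq_0)

lemma sum_coeff_eval_pderiv:
  assumes "degree F < L"
  shows "(\<Sum>l<L. coeff F l * (of_nat l * (x::'a::field_char_0) ^ (l - 1))) = poly (pderiv F) x"
proof -
  have F: "F = (\<Sum>l<L. monom (coeff F l) l)"
    using assms by (intro poly_eqI) (auto simp: coeff_sum coeff_eq_0)
  have "poly (pderiv F) x = (\<Sum>l<L. poly (pderiv (monom (coeff F l) l)) x)"
    by (subst F) (simp add: pderiv_sum poly_sum)
  thus ?thesis by (simp add: pderiv_monom poly_monom mult_ac)
qed

text \<open>Each way of being degenerate yields a nonzero functional killing the multiples of
  \<open>R\<close> and all P^i Q^(d-i) with i < d: evaluation at a common zero of \<open>R\<close>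
  and \<open>Q\<close>; a twisted derivative at a multiple zero of \<open>R\<close>; a weighted
  difference of evaluations at two zeros of \<open>R\<close> with the same value of P/Q. The last
  two work because the products are homogeneous of degree d in \<open>P\<close> and
  \<open>Q\<close>.\<close>

lemma crit_matrix_imp_generic:
  fixes P Q R :: "'a::field_char_0 poly"
  assumes deg: "degree P \<le> Suc d" "degree Q \<le> d" "degree R \<le> d" and d: "d \<ge> 1"
    and W: "pderiv P * Q - P * pderiv Q = R ^ 2"
    and det: "det (crit_matrix d P Q R) \<noteq> 0"
  shows "\<And>\<rho>. poly R \<rho> = 0 \<Longrightarrow> poly Q \<rho> \<noteq> 0"
    "\<And>\<rho>. poly R \<rho> = 0 \<Longrightarrow> poly (pderiv R) \<rho> \<noteq> 0"
    "\<And>\<rho> \<rho>'. poly R \<rho> = 0 \<Longrightarrow> poly R \<rho>' = 0 \<Longrightarrow> poly P \<rho> * poly Q \<rho>' = poly P \<rho>' * poly Q \<rho> \<Longrightarrow> \<rho> = \<rho>'"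
proof -
  let ?L = "d * d + d"
  have dPQ: "degree (P ^ i * Q ^ (d - i)) < ?L" if "i < d" for i
    using crit_matrix_degree[OF deg, of i] that by simp
  have dR: "degree (monom 1 k * R) < ?L" if "k < d * d" for k
    using crit_matrix_degree[OF deg, of "k + d"] that by simp
  show Q: "poly Q \<rho> \<noteq> 0" if \<rho>: "poly R \<rho> = 0" for \<rho>
  proof
    assume Q0: "poly Q \<rho> = 0"
    have "det (crit_matrix d P Q R) = 0"
      by (rule crit_matrix_functional[OF deg d, of "\<lambda>l. \<rho> ^ l"])
         (auto simp: sum_coeff_eval dPQ dR \<rho> Q0)
    thus False using det by simp
  qed
  show "poly (pderiv R) \<rho> \<noteq> 0" if \<rho>: "poly R \<rho> = 0" for \<rho>
  proof
    assume R': "poly (pderiv R) \<rho> = 0"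
    \<comment> \<open>The common logarithmic derivative of \<open>P\<close> and \<open>Q\<close> at
      a zero of \<open>R\<close>; a form of degree d in \<open>P\<close> and \<open>Q\<close> then
      has logarithmic derivative d \<kappa>, so the functional F'(\<rho>) - d \<kappa> F(\<rho>)
      kills it.\<close>
    define \<kappa> where "\<kappa> = poly (pderiv Q) \<rho> / poly Q \<rho>"
    have Q': "poly (pderiv Q) \<rho> = \<kappa> * poly Q \<rho>" using Q[OF \<rho>] by (simp add: \<kappa>_def)
    have "poly (pderiv P * Q - P * pderiv Q) \<rho> = 0" unfolding W using \<rho> by simp
    hence P': "poly (pderiv P) \<rho> = \<kappa> * poly P \<rho>" using Q[OF \<rho>] Q' by (simp add: field_simps)
    have pw: "poly (pderiv (F ^ i)) \<rho> = of_nat i * \<kappa> * poly F \<rho> ^ i"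
      if "poly (pderiv F) \<rho> = \<kappa> * poly F \<rho>" for F i
      by (induction i) (auto simp: pderiv_mult that algebra_simps pderiv_1)
    have PQ': "poly (pderiv (P ^ i * Q ^ (d - i))) \<rho> = of_nat d * \<kappa> * poly (P ^ i * Q ^ (d - i)) \<rho>"
      if "i < d" for i
    proof -
      have "of_nat d = (of_nat i + of_nat (d - i) :: 'a)" using that by (simp flip: of_nat_add)
      thus ?thesis by (simp add: pderiv_mult pw[OF P'] pw[OF Q'] algebra_simps)
    qed
    have "det (crit_matrix d P Q R) = 0"
    proof (rule crit_matrix_functional[OF deg d, of "\<lambda>l. of_nat l * \<rho> ^ (l - 1) - of_nat d * \<kappa> * \<rho> ^ l"])
      show "of_nat 0 * \<rho> ^ (0 - 1) - of_nat d * \<kappa> * \<rho> ^ 0 \<noteq> 0 \<or>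
        of_nat 1 * \<rho> ^ (1 - 1) - of_nat d * \<kappa> * \<rho> ^ 1 \<noteq> 0" using d by auto
    next
      fix i assume i: "i < d"
      show "(\<Sum>l<?L. coeff (P ^ i * Q ^ (d - i)) l * (of_nat l * \<rho> ^ (l - 1) - of_nat d * \<kappa> * \<rho> ^ l)) = 0"
        using sum_coeff_eval[OF dPQ[OF i], of \<rho>] sum_coeff_eval_pderiv[OF dPQ[OF i], of \<rho>] PQ'[OF i]
        by (simp add: right_diff_distrib sum_subtractf mult.left_commute[of _ "of_nat d * \<kappa>"]
            flip: sum_distrib_left)
    next
      fix k assume k: "k < d * d"
      have "poly (pderiv (monom 1 k * R)) \<rho> = 0" "poly (monom 1 k * R) \<rho> = 0"
        using \<rho> R' by (simp_all add: pderiv_mult)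
      thus "(\<Sum>l<?L. coeff (monom 1 k * R) l * (of_nat l * \<rho> ^ (l - 1) - of_nat d * \<kappa> * \<rho> ^ l)) = 0"
        using sum_coeff_eval[OF dR[OF k], of \<rho>] sum_coeff_eval_pderiv[OF dR[OF k], of \<rho>]
        by (simp add: right_diff_distrib sum_subtractf mult.left_commute[of _ "of_nat d * \<kappa>"]
            flip: sum_distrib_left)
    qed
    thus False using det by simp
  qed
  show "\<rho> = \<rho>'" if \<rho>: "poly R \<rho> = 0" "poly R \<rho>' = 0"
    and eq: "poly P \<rho> * poly Q \<rho>' = poly P \<rho>' * poly Q \<rho>" for \<rho> \<rho>'
  proof (rule ccontr)
    assume ne: "\<rho> \<noteq> \<rho>'"
    \<comment> \<open>The weights clear the denominators: a form of degree d in \<open>P\<close> and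
      \<open>Q\<close>, divided by Q^d, is a polynomial in P/Q and so takes the same value at both
      points.\<close>
    let ?a = "poly Q \<rho>' ^ d" and ?b = "poly Q \<rho> ^ d"
    have "det (crit_matrix d P Q R) = 0"
    proof (rule crit_matrix_functional[OF deg d, of "\<lambda>l. ?a * \<rho> ^ l - ?b * \<rho>' ^ l"])
      have "?a \<noteq> 0" "?b \<noteq> 0" using Q \<rho> by simp_all
      thus "?a * \<rho> ^ 0 - ?b * \<rho>' ^ 0 \<noteq> 0 \<or> ?a * \<rho> ^ 1 - ?b * \<rho>' ^ 1 \<noteq> 0" using ne by auto
    next
      fix i assume i: "i < d"
      have "?a * poly (P ^ i * Q ^ (d - i)) \<rho> = (poly P \<rho> * poly Q \<rho>') ^ i * (poly Q \<rho> * poly Q \<rho>') ^ (d - i)"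
        using i by (simp add: power_mult_distrib mult_ac flip: power_add)
      also have "\<dots> = ?b * poly (P ^ i * Q ^ (d - i)) \<rho>'"
        unfolding eq using i by (simp add: power_mult_distrib mult_ac flip: power_add)
      finally show "(\<Sum>l<?L. coeff (P ^ i * Q ^ (d - i)) l * (?a * \<rho> ^ l - ?b * \<rho>' ^ l)) = 0"
        using sum_coeff_eval[OF dPQ[OF i], of \<rho>] sum_coeff_eval[OF dPQ[OF i], of \<rho>']
        by (simp add: right_diff_distrib sum_subtractf mult.left_commute[of _ ?a] mult.left_commute[of _ ?b]
            flip: sum_distrib_left)
    next
      fix k assume k: "k < d * d"
      show "(\<Sum>l<?L. coeff (monom 1 k * R) l * (?a * \<rho> ^ l - ?b * \<rho>' ^ l)) = 0"
        using sum_coeff_eval[OF dR[OF k], of \<rho>] sum_coeff_eval[OF dR[OF k], of \<rho>'] \<rho>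
        by (simp add: right_diff_distrib sum_subtractf mult.left_commute[of _ ?a] mult.left_commute[of _ ?b]
            flip: sum_distrib_left)
    qed
    thus False using det by simp
  qed
qed

text \<open>Nonvanishing of the solution's entries makes \<open>Q\<close> and \<open>R\<close>
  nonzero at the roots of \<open>P\<close>, because their values there are r_i^2 and r_i times the
  value of the deleted product. The last determinant makes the critical points simple, free of zeros
  of \<open>Q\<close> and with distinct critical values.\<close>

definition good_conf :: "nat \<Rightarrow> (nat \<Rightarrow> 'a::field) \<Rightarrow> bool" where
  "good_conf N \<alpha> \<longleftrightarrow> inj_on \<alpha> {1..N} \<and> det (mestre_matrix N \<alpha>) \<noteq> 0 \<and>
     (\<forall>i\<in>{1..N}. mestre_solution N \<alpha> i \<noteq> 0) \<and>
     det (crit_matrix (N - 1) (root_prod N \<alpha>) (part_frac N \<alpha> (\<lambda>i. mestre_solution N \<alpha> i ^ 2))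
       (part_frac N \<alpha> (mestre_solution N \<alpha>))) \<noteq> 0"

text \<open>Along a line through a good configuration every quantity that has to be nonzero is a
  rational function of the parameter, regular and nonzero at 0.\<close>

lemma good_conf_open:
  fixes \<alpha> \<beta> :: "nat \<Rightarrow> 'a::field_char_0"
  assumes "good_conf N \<alpha>"
  shows "finite {u. \<not> good_conf N (\<lambda>i. \<alpha> i + u * \<beta> i)}"
proof -
  define a where "a u i = \<alpha> i + u * \<beta> i" for u i
  have a0: "a 0 = \<alpha>" by (simp add: a_def fun_eq_iff)
  have ga: "germ 0 (\<lambda>u. a u i)" for i
    unfolding a_def by (intro germ_add germ_mult germ_const germ_id)
  have inj: "a 0 i - a 0 j \<noteq> 0" if "i \<in> {1..N}" "j \<in> {1..N}" "i \<noteq> j" for i j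
    using assms that by (auto simp: good_conf_def a0 dest: inj_onD)
  define A where "A u i j = (if i < N \<and> j < N then (if i = j then 0 else 1 / (a u (Suc i) - a u (Suc j)))
     else if i = N \<and> j = N then 0 else 1)" for u i j
  have A: "mestre_matrix N (a u) = mat (Suc N) (Suc N) (\<lambda>(i, j). A u i j)" for u
    by (simp add: mestre_matrix_def A_def)
  have gA: "germ 0 (\<lambda>u. A u i j)" if "i < Suc N" "j < Suc N" for i j
  proof (cases "i < N \<and> j < N \<and> i \<noteq> j")
    case True
    hence "germ 0 (\<lambda>u. 1 / (a u (Suc i) - a u (Suc j)))"
      by (intro germ_divide germ_const germ_diff ga inj) auto
    thus ?thesis using True by (simp add: A_def)
  next
    case False
    hence "(\<lambda>u. A u i j) = (\<lambda>u. A 0 i j)" by (auto simp: A_def)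
    thus ?thesis by (metis germ_const)
  qed
  define s where "s u = mestre_solution N (a u)" for u
  have gdet: "germ 0 (\<lambda>u. det (mestre_matrix N (a u)))"
    unfolding A by (rule germ_det[OF gA])
  have det0: "det (mestre_matrix N (a 0)) \<noteq> 0" using assms by (simp add: a0 good_conf_def)
  have gs: "germ 0 (\<lambda>u. s u i)" if "i \<in> {1..N}" for i
    unfolding s_def mestre_solution_def
  proof (rule germ_divide[OF _ gdet det0])
    show "germ 0 (\<lambda>u. adj_mat (mestre_matrix N (a u)) $$ (i - 1, N))"
      unfolding A using that by (intro germ_cofactor_det gA) auto
  qed
  have gD: "poly_germ 0 (\<lambda>u. root_prod_del N (a u) i)" for i
    unfolding root_prod_del_def by (intro poly_germ_prod poly_germ_linear ga)
  have gP: "poly_germ 0 (\<lambda>u. root_prod N (a u))"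
    unfolding root_prod_def by (intro poly_germ_prod poly_germ_linear ga)
  have gR: "poly_germ 0 (\<lambda>u. part_frac N (a u) (s u))"
    unfolding part_frac_def by (intro poly_germ_sum poly_germ_smult gs gD)
  have gQ: "poly_germ 0 (\<lambda>u. part_frac N (a u) (\<lambda>i. s u i ^ 2))"
    unfolding part_frac_def power2_eq_square by (intro poly_germ_sum poly_germ_smult germ_mult gs gD)
  let ?C = "\<lambda>u. crit_matrix (N - 1) (root_prod N (a u)) (part_frac N (a u) (\<lambda>i. s u i ^ 2)) (part_frac N (a u) (s u))"
  have gC: "germ 0 (\<lambda>u. det (?C u))"
    unfolding crit_matrix_def
  proof (rule germ_det)
    fix i l
    show "germ 0 (\<lambda>u. coeff (if i < N - 1 then root_prod N (a u) ^ i * part_frac N (a u) (\<lambda>i. s u i ^ 2) ^ (N - 1 - i)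
      else monom 1 (i - (N - 1)) * part_frac N (a u) (s u)) l)"
      using poly_germ_mult[OF poly_germ_power[OF gP, of i] poly_germ_power[OF gQ, of "N - 1 - i"]]
        poly_germ_mult[OF poly_germ_const[of 0 "monom 1 (i - (N - 1))"] gR]
      by (cases "i < N - 1") (auto simp: poly_germ_def)
  qed
  let ?B = "(\<Union>i\<in>{1..N}. \<Union>j\<in>{1..N} - {i}. {u. a u i - a u j = 0}) \<union> {u. det (mestre_matrix N (a u)) = 0} \<union>
    (\<Union>i\<in>{1..N}. {u. s u i = 0}) \<union> {u. det (?C u) = 0}"
  have f1: "finite {u. a u i - a u j = 0}" if "i \<in> {1..N}" "j \<in> {1..N} - {i}" for i j
    using that by (intro germ_nonzero_cofinite[of 0] germ_diff ga inj) auto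
  have f2: "finite {u. det (mestre_matrix N (a u)) = 0}" by (rule germ_nonzero_cofinite[OF gdet det0])
  have f3: "finite {u. s u i = 0}" if "i \<in> {1..N}" for i
    using that assms by (intro germ_nonzero_cofinite[OF gs]) (auto simp: good_conf_def s_def a0)
  have f4: "finite {u. det (?C u) = 0}"
    using assms by (intro germ_nonzero_cofinite[OF gC]) (auto simp: good_conf_def s_def a0)
  have "finite ?B" using f1 f2 f3 f4 by auto
  moreover have "{u. \<not> good_conf N (a u)} \<subseteq> ?B"
    by (auto simp: good_conf_def inj_on_def s_def)
  ultimately show ?thesis unfolding a_def by (rule finite_subset[rotated])
qed

lemma monic_splits:
  fixes p :: "'a::alg_closed_field poly"
  assumes "lead_coeff p = 1" "degree p = N"
  obtains \<alpha> where "p = root_prod N \<alpha>"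
proof -
  have "\<exists>\<alpha>. p = root_prod N \<alpha>" using assms
  proof (induction N arbitrary: p)
    case 0
    then obtain c where "p = [:c:]" by (auto elim: degree_eq_zeroE)
    thus ?case using 0 by (auto simp: root_prod_def one_pCons)
  next
    case (Suc N)
    then obtain x where x: "poly p x = 0" using alg_closed_imp_poly_has_root[of p] by auto
    then obtain q where q: "p = [:- x, 1:] * q" by (metis dvdE poly_eq_0_iff_dvd)
    have q0: "q \<noteq> 0" using q Suc.prems by auto
    have "degree p = Suc (degree q)" unfolding q using q0 by (subst degree_mult_eq) auto
    moreover have "lead_coeff p = lead_coeff q" unfolding q by (simp only: lead_coeff_mult) simp
    ultimately have "lead_coeff q = 1" "degree q = N" using Suc.prems by simp_all
    from Suc.IH[OF this] obtain \<alpha> where \<alpha>: "q = root_prod N \<alpha>" by blast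
    have "{1..Suc N} = insert (Suc N) {1..N}" by auto
    hence "root_prod (Suc N) (\<alpha>(Suc N := x)) = [:- x, 1:] * root_prod N \<alpha>"
      by (simp only: root_prod_def) (subst prod.insert, auto intro!: arg_cong2[where f="(*)"] prod.cong)
    thus ?case using q \<alpha> by metis
  qed
  thus ?thesis using that by blast
qed

lemma root_prod_inj:
  assumes "\<And>x. poly (root_prod N \<alpha>) x = 0 \<Longrightarrow> poly (pderiv (root_prod N \<alpha>)) x \<noteq> (0::'a::field)"
  shows "inj_on \<alpha> {1..N}"
proof (rule inj_onI, rule ccontr)
  fix i j assume ij: "i \<in> {1..N}" "j \<in> {1..N}" "\<alpha> i = \<alpha> j" "i \<noteq> j"
  have "poly (pderiv (root_prod N \<alpha>)) (\<alpha> i) = 0"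
    unfolding poly_pderiv_root_prod[OF ij(1)] using root_prod_del_at_root[OF ij(1,2,4), of \<alpha>] ij(3) by simp
  moreover have "poly (root_prod N \<alpha>) (\<alpha> i) = 0" by (simp add: root_prod_eq_del[OF ij(1)])
  ultimately show False using assms by blast
qed

lemma root_prod_root_iff: "poly (root_prod N \<alpha>) x = 0 \<longleftrightarrow> (\<exists>i\<in>{1..N}. x = \<alpha> i)"
  by (simp add: poly_root_prod prod_zero_iff)

lemma poly_eq_on_roots:
  fixes p q :: "'a::field poly"
  assumes "inj_on \<alpha> {1..N}" "degree p < N" "degree q < N" "\<And>i. i \<in> {1..N} \<Longrightarrow> poly p (\<alpha> i) = poly q (\<alpha> i)"
  shows "p = q"
proof (rule ccontr)
  assume "p \<noteq> q"
  hence "p - q \<noteq> 0" by simp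
  hence "card {x. poly (p - q) x = 0} \<le> degree (p - q)" by (rule card_poly_roots_bound)
  moreover have "\<alpha> ` {1..N} \<subseteq> {x. poly (p - q) x = 0}" using assms(4) by auto
  hence "card (\<alpha> ` {1..N}) \<le> card {x. poly (p - q) x = 0}"
    using \<open>p - q \<noteq> 0\<close> by (intro card_mono poly_roots_finite)
  moreover have "card (\<alpha> ` {1..N}) = N" using assms(1) by (simp add: card_image)
  moreover have "degree (p - q) < N" using assms(2,3) by (meson degree_diff_less)
  ultimately show False by simp
qed

text \<open>At \<alpha>_j one has P'' = 2 D_j', P' = D_j, R = r_j D_j and R' = r_j D_j' + D_j S,
  where S is the sum of the j-th equation, so the expression equals -2 D_j^2 S. The system thus
  becomes a congruence modulo \<open>P\<close>, which can be checked without knowing the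
  roots.\<close>

lemma mestre_system_iff_poly:
  fixes \<alpha> r :: "nat \<Rightarrow> 'a::field_char_0"
  assumes inj: "inj_on \<alpha> {1..N}"
  defines "P \<equiv> root_prod N \<alpha>"
  defines "R \<equiv> part_frac N \<alpha> r"
  shows "mestre_system N \<alpha> r \<longleftrightarrow>
    (\<forall>j\<in>{1..N}. poly (pderiv (pderiv P) * R - smult 2 (pderiv P * pderiv R)) (\<alpha> j) = 0)"
proof -
  have "poly (pderiv (pderiv P) * R - smult 2 (pderiv P * pderiv R)) (\<alpha> j) =
    - 2 * poly (root_prod_del N \<alpha> j) (\<alpha> j) ^ 2 * (\<Sum>i\<in>{1..N} - {j}. r i / (\<alpha> j - \<alpha> i))"
    if j: "j \<in> {1..N}" for j
  proof -
    let ?D = "root_prod_del N \<alpha>"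
    have "poly (pderiv (pderiv P)) (\<alpha> j) = 2 * poly (pderiv (?D j)) (\<alpha> j)"
    proof -
      have "pderiv P = ?D j + [:- \<alpha> j, 1:] * pderiv (?D j)"
        unfolding P_def root_prod_eq_del[OF j] by (simp only: pderiv_mult) (simp add: pderiv_pCons)
      hence "pderiv (pderiv P) = pderiv (?D j) + (pderiv (?D j) + [:- \<alpha> j, 1:] * pderiv (pderiv (?D j)))"
        by (simp only: pderiv_add pderiv_mult) (simp add: pderiv_pCons)
      thus ?thesis by simp
    qed
    moreover have "poly R (\<alpha> j) = r j * poly (?D j) (\<alpha> j)" unfolding R_def by (rule poly_part_frac_root[OF j])
    moreover have "poly (pderiv P) (\<alpha> j) = poly (?D j) (\<alpha> j)" unfolding P_def by (rule poly_pderiv_root_prod[OF j])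
    moreover have "poly (pderiv R) (\<alpha> j) = r j * poly (pderiv (?D j)) (\<alpha> j) +
      poly (?D j) (\<alpha> j) * (\<Sum>i\<in>{1..N} - {j}. r i / (\<alpha> j - \<alpha> i))"
    proof -
      have d: "poly (pderiv (?D i)) (\<alpha> j) = poly (?D j) (\<alpha> j) / (\<alpha> j - \<alpha> i)"
        if i: "i \<in> {1..N} - {j}" for i
      proof -
        let ?E = "\<Prod>k\<in>{1..N} - {i} - {j}. [:- \<alpha> k, 1:]"
        have Di: "?D i = [:- \<alpha> j, 1:] * ?E"
          unfolding root_prod_del_def using i j by (intro prod.remove) auto
        have "?D j = [:- \<alpha> i, 1:] * (\<Prod>k\<in>{1..N} - {j} - {i}. [:- \<alpha> k, 1:])"
          unfolding root_prod_del_def using i j by (intro prod.remove) auto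
        also have "{1..N} - {j} - {i} = {1..N} - {i} - {j}" by auto
        finally have Dj: "?D j = [:- \<alpha> i, 1:] * ?E" .
        have "\<alpha> j - \<alpha> i \<noteq> 0" using inj i j by (auto dest: inj_onD)
        moreover have "poly (pderiv (?D i)) (\<alpha> j) = poly ?E (\<alpha> j)"
          unfolding Di by (simp only: pderiv_mult) (simp add: pderiv_pCons)
        moreover have "poly (?D j) (\<alpha> j) = (\<alpha> j - \<alpha> i) * poly ?E (\<alpha> j)"
          unfolding Dj by (simp only: poly_mult) simp
        ultimately show ?thesis by simp
      qed
      have "poly (pderiv R) (\<alpha> j) = (\<Sum>i\<in>{1..N}. r i * poly (pderiv (?D i)) (\<alpha> j))"
        by (simp add: R_def part_frac_def pderiv_sum pderiv_smult poly_sum)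
      also have "\<dots> = r j * poly (pderiv (?D j)) (\<alpha> j) + (\<Sum>i\<in>{1..N} - {j}. r i * poly (pderiv (?D i)) (\<alpha> j))"
        using j by (intro sum.remove) auto
      also have "(\<Sum>i\<in>{1..N} - {j}. r i * poly (pderiv (?D i)) (\<alpha> j)) =
        (\<Sum>i\<in>{1..N} - {j}. poly (?D j) (\<alpha> j) * (r i / (\<alpha> j - \<alpha> i)))"
        by (intro sum.cong) (simp_all only: d, simp)
      finally show ?thesis by (simp add: sum_distrib_left)
    qed
    ultimately show ?thesis by (simp add: algebra_simps power2_eq_square)
  qed
  moreover have "poly (root_prod_del N \<alpha> j) (\<alpha> j) \<noteq> 0" if "j \<in> {1..N}" for j
    by (rule root_prod_del_nonzero[OF that inj])
  ultimately show ?thesis unfolding mestre_system_def by simp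
qed


section \<open>An explicit good configuration\<close>

text \<open>With P = X^(d+1) + e X, Q = X^d + 1/e and y = X^d, the Wronskian is y^2 + ((d+1)/e - e
  (d-1)) y + 1. The chosen \<open>e\<close> makes the middle coefficient (d-1) - (d+1) = -2, so this
  is the square of R = X^d - 1.\<close>

locale model_conf =
  fixes d :: nat and e :: "'a::{alg_closed_field,field_char_0}"
  assumes d: "even d" "d \<ge> 2" and e_eq: "e = (of_nat d + 1) / (of_nat d - 1)"
begin

definition "P = monom 1 (Suc d) + monom e 1"
definition "Q = monom 1 d + [:inverse e:]"
definition "R = monom 1 d - (1 :: 'a poly)"

lemma nonzero: "of_nat d \<noteq> (0::'a)" "of_nat d - 1 \<noteq> (0::'a)" "of_nat d + 1 \<noteq> (0::'a)" "d \<noteq> 0"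
proof -
  show "of_nat d \<noteq> (0::'a)" "d \<noteq> 0" using d by auto
  have "of_nat (d - 1) = of_nat d - (1::'a)" using d by (simp add: of_nat_diff)
  thus "of_nat d - 1 \<noteq> (0::'a)" using d by (metis One_nat_def Suc_1 diff_is_0_eq not_less_eq_eq of_nat_eq_0_iff)
  have "of_nat (Suc d) \<noteq> (0::'a)" by (simp only: of_nat_eq_0_iff)
  thus "of_nat d + 1 \<noteq> (0::'a)" by (simp add: add.commute)
qed

lemma e_rel: "e * (of_nat d - 1) = of_nat d + 1" "inverse e * (of_nat d + 1) = of_nat d - 1"
  using nonzero by (simp_all add: e_eq)

lemma e_nonzero: "e \<noteq> 0" "e + 1 \<noteq> 0" "inverse e + 1 \<noteq> 0"
proof -
  show e: "e \<noteq> 0" using nonzero by (simp add: e_eq)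
  have "(e + 1) * (of_nat d - 1) = 2 * of_nat d" using e_rel(1) by (simp add: algebra_simps)
  thus e1: "e + 1 \<noteq> 0" using nonzero by auto
  have "inverse e + 1 = (e + 1) / e" using e by (simp add: field_simps)
  thus "inverse e + 1 \<noteq> 0" using e e1 by simp
qed

lemma degree_P: "degree P = Suc d" and monic_P: "lead_coeff P = 1"
proof -
  have "degree (monom e 1) < degree (monom (1::'a) (Suc d))"
    using d by (simp add: degree_monom_eq e_nonzero)
  hence "degree P = degree (monom (1::'a) (Suc d))" unfolding P_def by (rule degree_add_eq_left)
  thus dd: "degree P = Suc d" by (simp add: degree_monom_eq)
  show "lead_coeff P = 1" unfolding dd using nonzero by (simp add: P_def One_nat_def)
qed

lemma poly_P: "poly P x = x * (x ^ d + e)"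
  by (simp add: P_def poly_monom algebra_simps)

lemma poly_P': "poly (pderiv P) x = (of_nat d + 1) * x ^ d + e"
  by (simp add: P_def pderiv_add pderiv_monom poly_monom add.commute)

lemma poly_P'': "poly (pderiv (pderiv P)) x = (of_nat d + 1) * of_nat d * x ^ (d - 1)"
  by (simp add: P_def pderiv_add pderiv_monom poly_monom add.commute)

lemma root_cases: "poly P x = 0 \<Longrightarrow> x = 0 \<or> x ^ d = - e"
  by (auto simp: poly_P eq_neg_iff_add_eq_0)

lemma P'_root: "poly P x = 0 \<Longrightarrow> poly (pderiv P) x \<noteq> 0"
proof -
  assume "poly P x = 0"
  hence "x = 0 \<or> x ^ d = - e" by (rule root_cases)
  moreover have "(of_nat d + 1) * - e + e = - (of_nat d * e)" by (simp add: algebra_simps)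
  ultimately show ?thesis using nonzero e_nonzero by (auto simp: poly_P' zero_power)
qed

lemma R_root: "poly P x = 0 \<Longrightarrow> poly R x \<noteq> 0"
proof -
  assume "poly P x = 0"
  hence "x = 0 \<or> x ^ d = - e" by (rule root_cases)
  moreover have "- e - 1 = - (e + 1)" by simp
  hence "- e - 1 \<noteq> 0" using e_nonzero by (simp only: neg_equal_0_iff_equal) simp
  moreover have "poly R x = x ^ d - 1" by (simp add: R_def poly_monom)
  ultimately show ?thesis using nonzero by (auto simp: zero_power)
qed

lemma W: "pderiv P * Q - P * pderiv Q = R ^ 2"
proof -
  have "poly (pderiv P * Q - P * pderiv Q) x = poly (R ^ 2) x" for x
  proof -
    have Q': "poly (pderiv Q) x * x = of_nat d * x ^ d"
    proof -
      have "x ^ (d - 1) * x = x ^ d" using nonzero by (metis power_minus_mult not_gr_zero)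
      thus ?thesis by (simp add: Q_def pderiv_add pderiv_monom poly_monom pderiv_pCons mult.assoc)
    qed
    define y where "y = x ^ d"
    define i where "i = inverse e"
    have ie: "e * i = 1" using e_nonzero by (simp add: i_def)
    have "poly (pderiv P * Q - P * pderiv Q) x =
      ((of_nat d + 1) * y + e) * (y + i) - (y + e) * (poly (pderiv Q) x * x)"
      by (simp add: poly_P poly_P' algebra_simps y_def) (simp add: Q_def poly_monom algebra_simps i_def)
    also have "\<dots> = y * y + (i * (of_nat d + 1)) * y - (e * (of_nat d - 1)) * y + e * i"
      unfolding Q' by (simp add: algebra_simps y_def)
    also have "\<dots> = (y - 1) ^ 2"
      unfolding ie e_rel(1) e_rel(2)[folded i_def] by (simp add: algebra_simps power2_eq_square)
    also have "\<dots> = poly (R ^ 2) x" by (simp add: R_def poly_monom y_def)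
    finally show ?thesis .
  qed
  thus ?thesis by (intro poly_ext) simp
qed

text \<open>Modulo \<open>P\<close> one has X^(d+1) = - e X, so the map S to P'' S - 2 P' S' sends
  monomials to polynomials with disjoint supports: exponent d - 1 from the constant, exponents 0 and
  d from X, exponent j - 1 from X^j for 2 <= j < d. The coefficients can therefore be read off one
  at a time.\<close>

lemma kernel_trivial:
  assumes inj: "inj_on \<alpha> {1..Suc d}" and rp: "root_prod (Suc d) \<alpha> = P"
    and S: "degree S < d"
    and van: "\<And>j. j \<in> {1..Suc d} \<Longrightarrow> poly (pderiv (pderiv P) * S - smult 2 (pderiv P * pderiv S)) (\<alpha> j) = 0"
  shows "S = 0"
proof -
  let ?c = "coeff S"
  \<comment> \<open>\<open>g j\<close> is the image of X^j, reduced modulo \<open>P\<close> to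
    degree at most d.\<close>
  define g where "g j = (if j = 0 then monom ((of_nat d + 1) * of_nat d) (d - 1)
    else if j = 1 then monom ((of_nat d + 1) * (of_nat d - 2)) d - [:2 * e:]
    else monom (- e * of_nat d * ((of_nat d + 1) - 2 * of_nat j)) (j - 1))" for j :: nat
  have gval: "(of_nat d + 1) * of_nat d * x ^ (d - 1) * x ^ j - 2 * (((of_nat d + 1) * x ^ d + e) * (of_nat j * x ^ (j - 1))) = poly (g j) x"
    if x: "poly P x = 0" for x and j :: nat
  proof -
    have xN: "x * x ^ d = - e * x" using x by (simp add: poly_P algebra_simps eq_neg_iff_add_eq_0)
    have xd: "x ^ d = x * x ^ (d - 1)" using nonzero by (metis power_minus_mult not_gr_zero mult.commute)
    consider "j = 0" | "j = 1" | k where "j = Suc (Suc k)" by (metis One_nat_def not0_implies_Suc)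
    thus ?thesis
    proof cases
      case 2
      thus ?thesis by (simp add: g_def poly_monom xd algebra_simps)
    next
      case 3
      have 1: "x ^ (d - 1) * x ^ j = - e * (x * x ^ k)"
      proof -
        have "x ^ (d - 1) * x ^ j = (x * x ^ (d - 1)) * x * x ^ k" by (simp add: 3 algebra_simps)
        also have "\<dots> = x * x ^ d * x ^ k" by (simp add: xd)
        finally show ?thesis by (simp add: xN)
      qed
      have 2: "x ^ d * x ^ (j - 1) = - e * (x * x ^ k)"
      proof -
        have "x ^ d * x ^ (j - 1) = x * x ^ d * x ^ k" by (simp add: 3)
        thus ?thesis by (simp add: xN)
      qed
      have "(of_nat d + 1) * of_nat d * x ^ (d - 1) * x ^ j - 2 * (((of_nat d + 1) * x ^ d + e) * (of_nat j * x ^ (j - 1)))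
        = (of_nat d + 1) * of_nat d * (x ^ (d - 1) * x ^ j) - 2 * (of_nat d + 1) * of_nat j * (x ^ d * x ^ (j - 1)) - 2 * e * of_nat j * x ^ (j - 1)"
        by (simp add: algebra_simps)
      also have "\<dots> = (- e * of_nat d * ((of_nat d + 1) - 2 * of_nat j)) * x ^ (j - 1)"
        unfolding 1 2 by (simp add: 3 algebra_simps)
      finally show ?thesis by (simp add: g_def 3 poly_monom One_nat_def)
    qed (simp add: g_def poly_monom)
  qed
  define G where "G = (\<Sum>j<d. smult (?c j) (g j))"
  have "poly (pderiv (pderiv P) * S - smult 2 (pderiv P * pderiv S)) x = poly G x" if x: "poly P x = 0" for x
  proof -
    have "poly (pderiv (pderiv P) * S - smult 2 (pderiv P * pderiv S)) x =
      (of_nat d + 1) * of_nat d * x ^ (d - 1) * (\<Sum>j<d. ?c j * x ^ j) -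
      2 * (((of_nat d + 1) * x ^ d + e) * (\<Sum>j<d. ?c j * (of_nat j * x ^ (j - 1))))"
      by (simp add: poly_P' poly_P'' sum_coeff_eval[OF S] sum_coeff_eval_pderiv[OF S])
    also have "\<dots> = (\<Sum>j<d. ?c j * ((of_nat d + 1) * of_nat d * x ^ (d - 1) * x ^ j - 2 * (((of_nat d + 1) * x ^ d + e) * (of_nat j * x ^ (j - 1)))))"
      by (simp add: sum_distrib_left sum_subtractf right_diff_distrib mult_ac)
    also have "\<dots> = poly G x" by (simp only: gval[OF x]) (simp add: G_def poly_sum)
    finally show ?thesis .
  qed
  hence "poly G (\<alpha> j) = poly 0 (\<alpha> j)" if "j \<in> {1..Suc d}" for j
    using van[OF that] that by (metis poly_0 root_prod_root_iff rp)
  moreover have "degree G < Suc d"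
  proof -
    have "degree (g j) \<le> d" if "j < d" for j
    proof -
      have "degree (monom ((of_nat d + 1) * (of_nat d - 2)) d - [:2 * e:] :: 'a poly) \<le> d"
        by (rule degree_diff_le) (auto simp: degree_monom_le)
      thus ?thesis using that nonzero
        by (auto simp: g_def intro: order.trans[OF degree_monom_le])
    qed
    hence "degree G \<le> d" unfolding G_def
      by (intro degree_sum_le) (auto intro: order.trans[OF degree_smult_le])
    thus ?thesis using nonzero by simp
  qed
  ultimately have "G = 0" using poly_eq_on_roots[OF inj, of G 0] by simp
  hence Gc: "(\<Sum>j<d. ?c j * coeff (g j) m) = 0" for m
    by (metis (no_types, lifting) G_def coeff_0 coeff_smult coeff_sum sum.cong)
  have c1: "?c 1 = 0"
  proof (cases "1 < d")
    case True
    have "(\<Sum>j<d. ?c j * coeff (g j) 0) = (\<Sum>j<d. if j = 1 then - 2 * e * ?c 1 else 0)"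
      using d by (intro sum.cong) (auto simp: g_def One_nat_def)
    thus ?thesis using Gc[of 0] True e_nonzero by simp
  qed (use S nonzero in \<open>simp add: coeff_eq_0\<close>)
  have cj: "?c j = 0" if "2 \<le> j" for j
  proof (cases "j < d")
    case True
    have "coeff (g i) (j - 1) = 0 \<or> ?c i = 0" if "i \<noteq> j" "i < d" for i
    proof -
      consider "i = 0" | "i = 1" | "i \<ge> 2" by linarith
      thus ?thesis
      proof cases
        case 1
        thus ?thesis using True nonzero by (auto simp: g_def)
      next
        case 3
        thus ?thesis using that \<open>2 \<le> j\<close> by (auto simp: g_def)
      qed (simp add: c1)
    qed
    hence "(\<Sum>i<d. ?c i * coeff (g i) (j - 1)) = (\<Sum>i<d. if i = j then ?c j * coeff (g j) (j - 1) else 0)"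
      by (intro sum.cong) auto
    hence "?c j * coeff (g j) (j - 1) = 0" using Gc[of "j - 1"] True by simp
    moreover have "coeff (g j) (j - 1) = - e * of_nat d * ((of_nat d + 1) - 2 * of_nat j)"
      using that by (auto simp: g_def)
    \<comment> \<open>The evenness of \<open>d\<close> enters here: d + 1 is odd and cannot equal 2
      j.\<close>
    moreover have "(of_nat d + 1) - 2 * of_nat j \<noteq> (0::'a)"
    proof
      assume "(of_nat d + 1) - 2 * of_nat j = (0::'a)"
      hence "of_nat (Suc d) = (of_nat (2 * j) :: 'a)" by (simp add: add.commute)
      hence "Suc d = 2 * j" by (simp only: of_nat_eq_iff)
      thus False using d by presburger
    qed
    ultimately show ?thesis using e_nonzero True by auto
  qed (use S in \<open>simp add: coeff_eq_0\<close>)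
  have "?c 0 = 0"
  proof -
    have "(\<Sum>i<d. ?c i * coeff (g i) (d - 1)) = (\<Sum>i<d. if i = 0 then ?c 0 * ((of_nat d + 1) * of_nat d) else 0)"
    proof (intro sum.cong refl)
      fix i assume "i \<in> {..<d}"
      consider "i = 0" | "i = 1" | "i \<ge> 2" by linarith
      thus "?c i * coeff (g i) (d - 1) = (if i = 0 then ?c 0 * ((of_nat d + 1) * of_nat d) else 0)"
        by cases (auto simp: g_def c1 cj)
    qed
    thus ?thesis using Gc[of "d - 1"] nonzero by simp
  qed
  thus ?thesis using c1 cj by (intro poly_eqI) (metis coeff_0 less_2_cases linorder_not_less One_nat_def)
qed


lemma good_model:
  obtains \<alpha> :: "nat \<Rightarrow> 'a" where "good_conf (Suc d) \<alpha>"
proof -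
  let ?N = "Suc d"
  obtain \<alpha> where rp: "P = root_prod ?N \<alpha>" using monic_splits[OF monic_P degree_P] .
  have inj: "inj_on \<alpha> {1..?N}" by (rule root_prod_inj) (simp only: rp[symmetric] P'_root not_False_eq_True)
  have root: "poly P (\<alpha> i) = 0" if "i \<in> {1..?N}" for i using that rp root_prod_root_iff by metis
  \<comment> \<open>Lagrange interpolation: these are the coefficients for which
    \<open>part_frac\<close> returns the given \<open>R\<close>.\<close>
  define r where "r i = poly R (\<alpha> i) / poly (pderiv P) (\<alpha> i)" for i
  have D: "poly (root_prod_del ?N \<alpha> i) (\<alpha> i) = poly (pderiv P) (\<alpha> i)" if "i \<in> {1..?N}" for i
    using poly_pderiv_root_prod[OF that, of \<alpha>] rp by simp
  have dR: "degree R = d"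
  proof -
    have "degree (- 1::'a poly) < degree (monom (1::'a) d)" using d by (simp add: degree_monom_eq)
    hence "degree (monom (1::'a) d + (- 1)) = degree (monom (1::'a) d)" by (rule degree_add_eq_left)
    hence "degree R = degree (monom (1::'a) d)" by (simp add: R_def)
    thus ?thesis by (simp add: degree_monom_eq)
  qed
  have dQ: "degree Q \<le> d" unfolding Q_def by (rule degree_add_le) (auto simp: degree_monom_le)
  have R: "part_frac ?N \<alpha> r = R"
  proof (rule poly_eq_on_roots[OF inj])
    show "degree (part_frac ?N \<alpha> r) < ?N" using degree_part_frac[of ?N \<alpha> r] by simp
    show "poly (part_frac ?N \<alpha> r) (\<alpha> i) = poly R (\<alpha> i)" if "i \<in> {1..?N}" for i
      using P'_root[OF root[OF that]] by (simp add: poly_part_frac_root[OF that] D[OF that] r_def)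
  qed (simp add: dR)
  have Qr: "part_frac ?N \<alpha> (\<lambda>i. r i ^ 2) = Q"
  proof (rule poly_eq_on_roots[OF inj])
    show "degree (part_frac ?N \<alpha> (\<lambda>i. r i ^ 2)) < ?N" using degree_part_frac[of ?N \<alpha>] by (simp add: le_imp_less_Suc)
    show "poly (part_frac ?N \<alpha> (\<lambda>i. r i ^ 2)) (\<alpha> i) = poly Q (\<alpha> i)" if "i \<in> {1..?N}" for i
    proof -
      have "poly (pderiv P * Q - P * pderiv Q) (\<alpha> i) = poly (R ^ 2) (\<alpha> i)" by (simp only: W)
      hence "poly (pderiv P) (\<alpha> i) * poly Q (\<alpha> i) = poly R (\<alpha> i) ^ 2" using root[OF that] by simp
      thus ?thesis using P'_root[OF root[OF that]]
        by (simp add: poly_part_frac_root[OF that] D[OF that] r_def power2_eq_square field_simps)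
    qed
  qed (use dQ in simp)
  \<comment> \<open>At a root of \<open>P\<close> the Wronskian identity gives P' Q = R^2 and its
    derivative gives P'' Q = 2 R R'; eliminating \<open>Q\<close> and cancelling \<open>R\<close>
    yields the polynomial form of the system.\<close>
  have sys: "mestre_system ?N \<alpha> r"
    unfolding mestre_system_iff_poly[OF inj] R rp[symmetric]
  proof
    fix j assume j: "j \<in> {1..?N}"
    let ?x = "\<alpha> j"
    have P0: "poly P ?x = 0" by (rule root[OF j])
    have "poly (pderiv (pderiv P * Q - P * pderiv Q)) ?x = poly (pderiv (R * R)) ?x"
      by (simp only: W power2_eq_square)
    hence 1: "poly (pderiv (pderiv P)) ?x * poly Q ?x = 2 * (poly R ?x * poly (pderiv R) ?x)"
      using P0 by (simp add: pderiv_diff pderiv_mult algebra_simps)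
    from arg_cong[OF W, of "\<lambda>p. poly p ?x"]
    have 2: "poly (pderiv P) ?x * poly Q ?x = poly R ?x ^ 2" using P0 by simp
    have "poly R ?x * (poly (pderiv (pderiv P)) ?x * poly R ?x - 2 * (poly (pderiv P) ?x * poly (pderiv R) ?x)) =
      poly (pderiv (pderiv P)) ?x * poly R ?x ^ 2 - poly (pderiv P) ?x * (2 * (poly R ?x * poly (pderiv R) ?x))"
      by (simp add: algebra_simps power2_eq_square)
    also have "\<dots> = 0" unfolding 1[symmetric] 2[symmetric] by simp
    finally show "poly (pderiv (pderiv P) * R - smult 2 (pderiv P * pderiv R)) ?x = 0"
      using R_root[OF P0] by simp
  qed
  have sum1: "sum r {1..?N} = 1"
    using coeff_part_frac_top[of ?N \<alpha> r] R dR nonzero by (simp add: R_def)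
  have det: "det (mestre_matrix ?N \<alpha>) \<noteq> 0"
  proof
    assume "det (mestre_matrix ?N \<alpha>) = 0"
    then obtain v where v: "v \<in> carrier_vec (Suc ?N)" "v \<noteq> 0\<^sub>v (Suc ?N)" "mestre_matrix ?N \<alpha> *\<^sub>v v = 0\<^sub>v (Suc ?N)"
      using det_0_iff_vec_prod_zero_field[OF mestre_matrix_carrier] by blast
    let ?S = "\<lambda>i j. (if i = j then 0 else 1 / (\<alpha> (Suc i) - \<alpha> (Suc j)))"
    have rows: "(\<Sum>j\<in>{0..<?N}. ?S i j * v $ j) = - (v $ ?N)" if "i < ?N" for i
    proof -
      have "(mestre_matrix ?N \<alpha> *\<^sub>v v) $ i = 0" unfolding v(3) using that by simp
      thus ?thesis unfolding mestre_matrix_vec[OF that v(1)] by (simp add: eq_neg_iff_add_eq_0)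
    qed
    have "(mestre_matrix ?N \<alpha> *\<^sub>v v) $ ?N = 0" unfolding v(3) by simp
    hence last: "(\<Sum>j\<in>{0..<?N}. v $ j) = 0" unfolding mestre_matrix_vec_last[OF v(1)] .
    have skew: "?S j i = - ?S i j" for i j by (cases "i = j") (auto simp: minus_divide_right)
    \<comment> \<open>Pairing a kernel vector with the known solution \<open>r\<close>, whose
      entries sum to 1, isolates the last coordinate, and skew symmetry moves the matrix onto
      \<open>r\<close>, where it gives 0. What is left is a solution of the system with sum 0,
      excluded by \<open>kernel_trivial\<close>.\<close>
    have "- (v $ ?N) = (\<Sum>i\<in>{0..<?N}. r (Suc i) * - (v $ ?N))"
      using sum1 unfolding sum_1_to_Suc by (simp only: sum_distrib_right[symmetric]) simp
    also have "\<dots> = (\<Sum>i\<in>{0..<?N}. r (Suc i) * (\<Sum>j\<in>{0..<?N}. ?S i j * v $ j))"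
      by (intro sum.cong refl) (simp only: rows atLeastLessThan_iff)
    also have "\<dots> = (\<Sum>i\<in>{0..<?N}. \<Sum>j\<in>{0..<?N}. r (Suc i) * (?S i j * v $ j))"
      by (simp only: sum_distrib_left)
    also have "\<dots> = (\<Sum>j\<in>{0..<?N}. \<Sum>i\<in>{0..<?N}. r (Suc i) * (?S i j * v $ j))" by (rule sum.swap)
    also have "\<dots> = (\<Sum>j\<in>{0..<?N}. - (v $ j) * (\<Sum>i\<in>{0..<?N}. ?S j i * r (Suc i)))"
      unfolding sum_distrib_left by (intro sum.cong refl) (subst skew, simp)
    also have "\<dots> = 0" using sys unfolding mestre_system_alt by (intro sum.neutral) auto
    finally have vN: "v $ ?N = 0" by simp
    define s where "s i = v $ (i - 1)" for i
    have sys': "mestre_system ?N \<alpha> s" unfolding mestre_system_alt using rows vN by (simp add: s_def)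
    have sum0: "sum s {1..?N} = 0" using last by (simp add: sum_1_to_Suc s_def)
    have "degree (part_frac ?N \<alpha> s) < d"
    proof -
      have "coeff (part_frac ?N \<alpha> s) d = 0" using coeff_part_frac_top[of ?N \<alpha> s] sum0 by simp
      moreover have "degree (part_frac ?N \<alpha> s) \<le> d" using degree_part_frac[of ?N \<alpha> s] by simp
      ultimately show ?thesis using nonzero
        by (metis degree_0 le_neq_implies_less leading_coeff_0_iff not_gr_zero)
    qed
    hence pf0: "part_frac ?N \<alpha> s = 0"
      using sys' unfolding mestre_system_iff_poly[OF inj] rp[symmetric]
      by (intro kernel_trivial[OF inj rp[symmetric]]) auto
    have s0: "s i = 0" if "i \<in> {1..?N}" for i
      using poly_part_frac_root[OF that, of \<alpha> s] root_prod_del_nonzero[OF that inj] pf0 by simp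
    have "v $ j = 0" if "j < ?N" for j using that s0[of "Suc j"] by (simp add: s_def)
    hence "v = 0\<^sub>v (Suc ?N)" using v(1) vN by (intro eq_vecI) (auto simp: less_Suc_eq)
    thus False using v(2) by simp
  qed
  have sol: "mestre_solution ?N \<alpha> i = r i" if "i \<in> {1..?N}" for i
    using mestre_solution_unique[OF det sys sum1 that] by simp
  have solR: "part_frac ?N \<alpha> (mestre_solution ?N \<alpha>) = R" "part_frac ?N \<alpha> (\<lambda>i. mestre_solution ?N \<alpha> i ^ 2) = Q"
    unfolding R[symmetric] Qr[symmetric] by (auto simp: part_frac_def sol intro!: sum.cong)
  have "det (crit_matrix d P Q R) \<noteq> 0"
  proof
    let ?L = "d * d + d"
    let ?A = "crit_matrix d P Q R"
    have c: "?A \<in> carrier_mat ?L ?L" by (simp add: crit_matrix_def)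
    assume "det ?A = 0"
    hence "det (transpose_mat ?A) = 0" using det_transpose[OF c] by simp
    then obtain w where w: "w \<in> carrier_vec ?L" "w \<noteq> 0\<^sub>v ?L" "transpose_mat ?A *\<^sub>v w = 0\<^sub>v ?L"
      using det_0_iff_vec_prod_zero_field[of "transpose_mat ?A" ?L] c by auto
    define row where "row i = (if i < d then P ^ i * Q ^ (d - i) else monom 1 (i - d) * R)" for i
    have drow: "degree (row i) < ?L" if "i < ?L" for i
      unfolding row_def using degree_P dQ dR that by (intro crit_matrix_degree) auto
    have rel: "(\<Sum>i<?L. smult (w $ i) (row i)) = 0"
    proof (rule poly_eqI)
      fix l
      show "coeff (\<Sum>i<?L. smult (w $ i) (row i)) l = coeff 0 l"
      proof (cases "l < ?L")
        case True
        have "(transpose_mat ?A *\<^sub>v w) $ l = (\<Sum>i<?L. coeff (row i) l * w $ i)"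
          using True w(1) by (simp add: crit_matrix_def scalar_prod_def atLeast0LessThan row_def)
        thus ?thesis using w(3) True by (simp add: coeff_sum mult.commute)
      next
        case False
        have "coeff (row i) l = 0" if "i < ?L" for i
          using drow[OF that] False by (intro coeff_eq_0) simp
        thus ?thesis by (simp add: coeff_sum)
      qed
    qed
    \<comment> \<open>Modulo R = X^d - 1 the polynomial \<open>P\<close> becomes a X and
      \<open>Q\<close> becomes the constant b, so P^i Q^(d-i) becomes a nonzero multiple of X^i. For
      i < d these are independent modulo \<open>R\<close>, and a linear relation between the rows
      must be trivial.\<close>
    define a where "a = 1 + e"
    define b where "b = 1 + inverse e"
    have ab: "a \<noteq> 0" "b \<noteq> 0" using e_nonzero by (auto simp: a_def b_def add.commute)
    have Pm: "P = monom a 1 + R * monom 1 1"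
      by (simp add: P_def R_def a_def algebra_simps mult_monom add_monom[symmetric] One_nat_def)
    have Qm: "Q = [:b:] + R" by (simp add: Q_def R_def b_def algebra_simps one_pCons)
    have row_mod: "R dvd row i - monom (a ^ i * b ^ (d - i)) i" if "i < d" for i
    proof -
      have p: "R dvd (u + R * t) ^ k - u ^ k" for u t :: "'a poly" and k
      proof (induction k)
        case (Suc k)
        have "(u + R * t) ^ Suc k - u ^ Suc k = (u + R * t) * ((u + R * t) ^ k - u ^ k) + R * (t * u ^ k)"
          by (simp add: algebra_simps)
        thus ?case using Suc by (metis dvd_add dvd_mult dvd_triv_left)
      qed simp
      have 1: "R dvd P ^ i - monom a 1 ^ i" unfolding Pm by (rule p)
      have 2: "R dvd Q ^ (d - i) - [:b:] ^ (d - i)" unfolding Qm using p[of "[:b:]" 1] by simp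
      have "P ^ i * Q ^ (d - i) - monom a 1 ^ i * [:b:] ^ (d - i) =
        (P ^ i - monom a 1 ^ i) * Q ^ (d - i) + monom a 1 ^ i * (Q ^ (d - i) - [:b:] ^ (d - i))"
        by (simp add: algebra_simps)
      also have "R dvd \<dots>" using 1 2 by (intro dvd_add dvd_mult dvd_mult2)
      also have "monom a 1 ^ i * [:b:] ^ (d - i) = monom (a ^ i * b ^ (d - i)) i"
        by (simp add: monom_power poly_const_pow mult.commute smult_monom)
      finally show ?thesis using that by (simp add: row_def)
    qed
    define Tp where "Tp = (\<Sum>i<d. monom (w $ i * (a ^ i * b ^ (d - i))) i)"
    have split: "(\<Sum>i<?L. smult (w $ i) (row i)) = (\<Sum>i<d. smult (w $ i) (row i)) + R * (\<Sum>k<d*d. monom (w $ (d + k)) k)"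
    proof -
      have "(\<Sum>i<?L. smult (w $ i) (row i)) = (\<Sum>i<d. smult (w $ i) (row i)) + (\<Sum>i\<in>{d..<?L}. smult (w $ i) (row i))"
        by (subst sum.union_disjoint[symmetric]) (auto intro!: sum.cong)
      also have "(\<Sum>i\<in>{d..<?L}. smult (w $ i) (row i)) = (\<Sum>k<d*d. smult (w $ (d + k)) (row (d + k)))"
        by (rule sum.reindex_bij_witness[of _ "\<lambda>k. d + k" "\<lambda>i. i - d"]) auto
      also have "\<dots> = R * (\<Sum>k<d*d. monom (w $ (d + k)) k)"
        unfolding sum_distrib_left
      proof (intro sum.cong refl)
        fix k
        have "smult (w $ (d + k)) (row (d + k)) = smult (w $ (d + k)) (monom 1 k) * R" by (simp add: row_def)
        thus "smult (w $ (d + k)) (row (d + k)) = R * monom (w $ (d + k)) k"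
          by (simp only: smult_monom mult.right_neutral) (simp only: mult.commute)
      qed
      finally show ?thesis .
    qed
    have "Tp = (\<Sum>i<d. smult (w $ i) (monom (a ^ i * b ^ (d - i)) i))" by (simp add: Tp_def smult_monom)
    also have "\<dots> = (\<Sum>i<d. smult (w $ i) (row i)) - (\<Sum>i<d. smult (w $ i) (row i - monom (a ^ i * b ^ (d - i)) i))"
      by (simp add: smult_diff_right sum_subtractf)
    also have "(\<Sum>i<d. smult (w $ i) (row i)) = - R * (\<Sum>k<d*d. monom (w $ (d + k)) k)"
      using rel split by (simp add: eq_neg_iff_add_eq_0)
    also have "R dvd - R * (\<Sum>k<d*d. monom (w $ (d + k)) k) -
       (\<Sum>i<d. smult (w $ i) (row i - monom (a ^ i * b ^ (d - i)) i))"
      by (intro dvd_diff dvd_sum dvd_smult row_mod) auto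
    finally have "R dvd Tp" .
    moreover have "degree Tp < degree R"
    proof -
      have "degree Tp \<le> d - 1" unfolding Tp_def
        by (rule degree_sum_le) (auto intro!: order.trans[OF degree_monom_le])
      thus ?thesis using dR nonzero by simp
    qed
    ultimately have T0: "Tp = 0" using dvd_imp_degree_le[of R Tp] by fastforce
    have w1: "w $ i = 0" if "i < d" for i
    proof -
      have "coeff Tp i = w $ i * (a ^ i * b ^ (d - i))" using that by (simp add: Tp_def coeff_sum)
      thus ?thesis using T0 ab by simp
    qed
    have "R * (\<Sum>k<d*d. monom (w $ (d + k)) k) = 0" using rel split w1 by simp
    moreover have "R \<noteq> 0" using dR nonzero by auto
    ultimately have "(\<Sum>k<d*d. monom (w $ (d + k)) k) = 0" by simp
    hence w2: "w $ (d + k) = 0" if "k < d * d" for k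
    proof -
      assume "(\<Sum>k<d*d. monom (w $ (d + k)) k) = 0"
      hence "coeff (\<Sum>k<d*d. monom (w $ (d + k)) k) k = 0" by simp
      thus ?thesis using that by (simp add: coeff_sum)
    qed
    have "w $ i = 0" if "i < ?L" for i
      using w1[of i] w2[of "i - d"] that by (cases "i < d") auto
    hence "w = 0\<^sub>v ?L" using w(1) by (intro eq_vecI) auto
    thus False using w(2) by simp
  qed
  moreover have "r i \<noteq> 0" if "i \<in> {1..?N}" for i
    using R_root[OF root[OF that]] P'_root[OF root[OF that]] by (simp add: r_def)
  ultimately have "good_conf ?N \<alpha>"
    unfolding good_conf_def solR rp[symmetric] using inj det sol by simp
  thus ?thesis using that by blast
qed

end

lemma good_conf_exists:
  assumes "odd N" "N \<ge> 3"
  obtains \<alpha> :: "nat \<Rightarrow> 'a::{alg_closed_field,field_char_0}" where "good_conf N \<alpha>"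
proof -
  obtain d where N: "N = Suc d" "even d" "d \<ge> 2" using assms by (cases N) auto
  interpret model_conf d "(of_nat d + 1) / (of_nat d - 1) :: 'a"
    by unfold_locales (use N in auto)
  obtain \<alpha> :: "nat \<Rightarrow> 'a" where "good_conf (Suc d) \<alpha>" using good_model .
  thus ?thesis using that[of \<alpha>] N(1) by simp
qed

section \<open>Gauss's lemma and Hensel's lemma over formal power series\<close>

interpretation fps_to_fls_hom: inj_comm_ring_hom "fps_to_fls :: 'a::comm_ring_1 fps \<Rightarrow> 'a fls"
  by unfold_locales (auto simp: fls_times_fps_to_fls)

interpretation fps_nth_0_hom: comm_ring_hom "\<lambda>f. fps_nth f 0 :: 'a::comm_ring_1"
  by unfold_locales auto

interpretation fps_to_fls_poly_hom: map_poly_inj_comm_ring_hom "fps_to_fls :: 'a::comm_ring_1 fps \<Rightarrow> 'a fls" ..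

interpretation fps_nth_0_poly_hom: map_poly_comm_ring_hom "\<lambda>f. fps_nth f 0 :: 'a::comm_ring_1" ..

interpretation fps_const_hom: inj_comm_ring_hom "fps_const :: 'a::comm_ring_1 \<Rightarrow> 'a fps"
  by unfold_locales auto

interpretation fls_const_hom: field_hom "fls_const :: 'a::field \<Rightarrow> 'a fls"
  by unfold_locales (auto simp: fls_const_mult_const fls_plus_const)

abbreviation fls_of_poly :: "'a::comm_ring_1 fps poly \<Rightarrow> 'a fls poly" where
  "fls_of_poly \<equiv> map_poly fps_to_fls"

abbreviation residue_poly :: "'a::comm_ring_1 fps poly \<Rightarrow> 'a poly" where
  "residue_poly \<equiv> map_poly (\<lambda>f. fps_nth f 0)"

text \<open>The exponent is minus the least order among the coefficients, so one coefficient becomes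
  a unit.\<close>

lemma primitive_scaling:
  fixes C :: "'a::field fls poly"
  assumes "C \<noteq> 0"
  obtains m C' where "smult (fls_X_intpow m) C = fls_of_poly C'" "residue_poly C' \<noteq> 0"
proof -
  let ?S = "{i. coeff C i \<noteq> 0}"
  have fin: "finite ?S" using MOST_coeff_eq_0[of C] by (simp add: eventually_cofinite)
  have ne: "?S \<noteq> {}" using assms by (auto simp: poly_eq_iff)
  define k where "k = Min ((\<lambda>i. fls_subdegree (coeff C i)) ` ?S)"
  have kle: "k \<le> fls_subdegree (coeff C i)" if "i \<in> ?S" for i
    unfolding k_def using that fin by (intro Min_le) auto
  have "k \<in> (\<lambda>i. fls_subdegree (coeff C i)) ` ?S" unfolding k_def using fin ne by (intro Min_in) auto
  then obtain i0 where i0: "coeff C i0 \<noteq> 0" "fls_subdegree (coeff C i0) = k" by auto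
  let ?z = "fls_X_intpow (- k) :: 'a fls"
  define C' where "C' = map_poly (\<lambda>c. fls_regpart (?z * c)) C"
  have co: "fps_to_fls (coeff C' i) = ?z * coeff C i" for i
  proof (cases "i \<in> ?S")
    case True
    hence "fls_subdegree (?z * coeff C i) \<ge> 0" using kle[OF True] by (subst fls_subdegree_mult) (auto simp: fls_shift_eq0_iff)
    thus ?thesis by (simp add: C'_def coeff_map_poly)
  qed (simp add: C'_def coeff_map_poly)
  have "smult ?z C = fls_of_poly C'" by (rule poly_eqI) (simp add: co)
  moreover have "coeff (residue_poly C') i0 \<noteq> 0"
  proof -
    have "coeff (residue_poly C') i0 = fls_nth (?z * coeff C i0) 0" by (simp add: C'_def coeff_map_poly)
    also have "\<dots> = fls_nth (coeff C i0) (fls_subdegree (coeff C i0))" by (simp add: fls_shifted_times_simps i0(2))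
    finally show ?thesis using i0(1) by simp
  qed
  hence "residue_poly C' \<noteq> 0" by (metis coeff_0)
  ultimately show ?thesis using that by blast
qed

text \<open>If \<open>A\<close> were not integral, a positive power of the parameter would make it
  primitive. The product with \<open>C'\<close> would then be a positive power times
  \<open>F\<close>, with zero residue, although residues of primitive polynomials multiply in a
  domain.\<close>

lemma gauss_primitive:
  fixes A :: "'a::field fls poly"
  assumes "A * fls_of_poly C' = fls_of_poly F" "residue_poly C' \<noteq> 0"
  obtains A' where "A = fls_of_poly A'"
proof (cases "A = 0")
  case True thus ?thesis using that[of 0] by simp
next
  case False
  obtain m A1 where A1: "smult (fls_X_intpow m) A = fls_of_poly A1" "residue_poly A1 \<noteq> 0"
    using primitive_scaling[OF False] .
  show ?thesis
  proof (cases "m \<le> 0")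
    case True
    have "fls_X_intpow (- m) * fls_X_intpow m = (1 :: 'a fls)" by (simp add: fls_shifted_times_simps)
    hence "A = smult (fls_X_intpow (- m)) (smult (fls_X_intpow m) A)" by simp
    also have "\<dots> = smult (fps_to_fls (fps_X ^ nat (- m))) (fls_of_poly A1)"
      unfolding A1(1) using True by (simp add: fls_X_power_conv_shift_1 fps_to_fls_power)
    also have "\<dots> = fls_of_poly (smult (fps_X ^ nat (- m)) A1)" by (simp add: hom_distribs)
    finally show ?thesis using that by blast
  next
    case False
    have "fls_of_poly (A1 * C') = smult (fls_X_intpow m) (A * fls_of_poly C')"
      by (simp add: hom_distribs A1(1)[symmetric])
    also have "\<dots> = smult (fps_to_fls (fps_X ^ nat m)) (fls_of_poly F)"
      unfolding assms(1) using False by (simp add: fls_X_power_conv_shift_1 fps_to_fls_power)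
    also have "\<dots> = fls_of_poly (smult (fps_X ^ nat m) F)" by (simp add: hom_distribs)
    finally have "A1 * C' = smult (fps_X ^ nat m) F" by simp
    hence "residue_poly A1 * residue_poly C' = residue_poly (smult (fps_X ^ nat m) F)"
      by (simp flip: fps_nth_0_poly_hom.hom_mult)
    also have "\<dots> = 0" using False by (intro poly_eqI) (simp add: coeff_map_poly)
    finally show ?thesis using A1(2) assms(2) by simp
  qed
qed

text \<open>The common scalar is the leading coefficient of the primitive scaling of the monic
  factor, hence itself a power series. It moves the denominators of \<open>C\<close> into
  \<open>A\<close>, where they are absorbed.\<close>

lemma gauss_monic_factor:
  fixes A C :: "'a::field fls poly"
  assumes "A * C = fls_of_poly F" "lead_coeff C = 1"
  obtains z A' C' where "smult (fps_to_fls z) C = fls_of_poly C'" "A = smult (fps_to_fls z) (fls_of_poly A')"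
    "F = A' * C'"
proof -
  have C0: "C \<noteq> 0" using assms(2) by auto
  obtain m C' where C': "smult (fls_X_intpow m) C = fls_of_poly C'" "residue_poly C' \<noteq> 0"
    using primitive_scaling[OF C0] .
  let ?z = "fls_X_intpow m :: 'a fls"
  have z: "?z = fps_to_fls (coeff C' (degree C))"
    using arg_cong[OF C'(1), of "\<lambda>p. coeff p (degree C)"] assms(2) by simp
  have z0: "?z \<noteq> 0" by simp
  have eq: "smult (inverse ?z) A * fls_of_poly C' = fls_of_poly F"
    using assms(1) z0 by (simp flip: C'(1))
  obtain A' where A': "smult (inverse ?z) A = fls_of_poly A'" using gauss_primitive[OF eq C'(2)] .
  have A: "A = smult ?z (fls_of_poly A')" using z0 by (simp flip: A')
  have "fls_of_poly (A' * C') = fls_of_poly F" using eq unfolding A' by (simp add: hom_distribs)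
  hence "A' * C' = F" by simp
  thus ?thesis using that[of "coeff C' (degree C)" C' A'] C'(1) A z by simp
qed

lemma gauss_monic:
  fixes A C :: "'a::field fls poly"
  assumes "A * C = fls_of_poly F" "lead_coeff A = 1" "lead_coeff C = 1"
  obtains C' where "C = fls_of_poly C'"
proof -
  obtain z A' C' where z: "smult (fps_to_fls z) C = fls_of_poly C'" "A = smult (fps_to_fls z) (fls_of_poly A')"
    using gauss_monic_factor[OF assms(1,3)] .
  have "1 = fps_to_fls (z * coeff A' (degree A))"
    using arg_cong[OF z(2), of "\<lambda>p. coeff p (degree A)"] assms(2) by (simp add: fls_times_fps_to_fls)
  hence 1: "fps_to_fls (coeff A' (degree A)) * fps_to_fls z = 1" by (simp add: fls_times_fps_to_fls mult.commute)
  have "C = smult (fps_to_fls (coeff A' (degree A))) (smult (fps_to_fls z) C)" by (simp add: 1)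
  also have "\<dots> = fls_of_poly (smult (coeff A' (degree A)) C')" unfolding z(1) by (simp add: hom_distribs)
  finally show ?thesis using that by blast
qed

lemma poly_taylor2:
  fixes p :: "'a::idom poly"
  shows "\<exists>g. poly p (y + h) = poly p y + h * poly (pderiv p) y + h * h * g"
proof (induction p)
  case (pCons a p)
  then obtain g where g: "poly p (y + h) = poly p y + h * poly (pderiv p) y + h * h * g" by blast
  show ?case
    by (rule exI[of _ "poly (pderiv p) y + y * g + h * g"])
       (simp only: poly_pCons g pderiv_pCons poly_add, simp add: algebra_simps)
qed auto

text \<open>Newton's iteration with the derivative frozen at its residue: stage n corrects the
  coefficient n + 1 only, and by the second-order Taylor formula the quadratic error lies beyond it.
  The root collects the stabilised coefficients.\<close>

lemma hensel_fps:
  fixes F :: "'a::field fps poly"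
  assumes "poly (residue_poly F) y0 = 0" "poly (pderiv (residue_poly F)) y0 \<noteq> 0"
  obtains y where "poly F y = 0" "fps_nth y 0 = y0"
proof -
  define a where "a = poly (pderiv (residue_poly F)) y0"
  define s where "s = rec_nat (fps_const y0)
    (\<lambda>n y. y + fps_const (- fps_nth (poly F y) (Suc n) / a) * fps_X ^ Suc n)"
  have s0: "s 0 = fps_const y0" by (simp add: s_def)
  have sS: "s (Suc n) = s n + fps_const (- fps_nth (poly F (s n)) (Suc n) / a) * fps_X ^ Suc n" for n
    by (simp add: s_def)
  have c0: "fps_nth (s n) 0 = y0" for n
    by (induction n) (simp_all add: s0 sS)
  have res: "fps_nth (poly G y) 0 = poly (residue_poly G) (fps_nth y 0)" for G and y :: "'a fps"
    using fps_nth_0_hom.poly_map_poly[of G y] by simp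
  have pd: "residue_poly (pderiv F) = pderiv (residue_poly F)"
    by (rule poly_eqI) (simp add: coeff_pderiv coeff_map_poly fps_of_nat[symmetric] del: fps_of_nat of_nat_Suc)
  have van: "fps_nth (poly F (s n)) k = 0" if "k \<le> n" for n k
    using that
  proof (induction n arbitrary: k)
    case 0 thus ?case using res[of F "s 0"] assms(1) by (simp add: s0)
  next
    case (Suc n)
    let ?c = "- fps_nth (poly F (s n)) (Suc n) / a"
    let ?h = "fps_const ?c * fps_X ^ Suc n"
    obtain g where g: "poly F (s n + ?h) = poly F (s n) + ?h * poly (pderiv F) (s n) + ?h * ?h * g"
      using poly_taylor2 by blast
    have h2: "?h * ?h * g = fps_X ^ (Suc n + Suc n) * (fps_const (?c * ?c) * g)"
      by (simp only: power_add fps_const_mult[symmetric] mult_ac)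
    have "fps_nth (poly F (s (Suc n))) k = fps_nth (poly F (s n)) k +
      ?c * (if k < Suc n then 0 else fps_nth (poly (pderiv F) (s n)) (k - Suc n))"
      using Suc.prems unfolding sS g
      by (simp only: fps_add_nth h2 fps_X_power_mult_nth mult.assoc fps_mult_left_const_nth) auto
    also have "\<dots> = 0"
    proof (cases "k = Suc n")
      case True
      have "fps_nth (poly (pderiv F) (s n)) 0 = a" by (simp add: res c0 pd a_def)
      thus ?thesis using True assms(2) by (simp add: a_def)
    qed (use Suc in auto)
    finally show ?case .
  qed
  define y where "y = Abs_fps (\<lambda>k. fps_nth (s k) k)"
  have stab: "fps_nth (s n) k = fps_nth (s k) k" if "k \<le> n" for n k
    using that
  proof (induction n)
    case (Suc n)
    show ?case
    proof (cases "k = Suc n")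
      case False
      hence "fps_nth (s (Suc n)) k = fps_nth (s n) k"
        using Suc.prems unfolding sS by (simp only: fps_add_nth fps_mult_left_const_nth fps_X_power_nth) auto
      thus ?thesis using Suc False by simp
    qed simp
  qed simp
  have "fps_nth (poly F y) n = 0" for n
  proof -
    let ?h = "y - s n"
    obtain g where g: "poly F (s n + ?h) = poly F (s n) + ?h * poly (pderiv F) (s n) + ?h * ?h * g"
      using poly_taylor2 by blast
    have "fps_nth ?h k = 0" if "k \<le> n" for k using stab[OF that] by (simp add: y_def)
    hence hz: "fps_nth (?h * u) n = 0" for u
      unfolding fps_mult_nth by (intro sum.neutral) simp
    have "poly F y = poly F (s n) + ?h * (poly (pderiv F) (s n) + ?h * g)"
      using g by (simp add: algebra_simps)
    thus ?thesis using hz van[of n n] by simp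
  qed
  hence "poly F y = 0" by (intro fps_ext) simp
  moreover have "fps_nth y 0 = y0" by (simp add: y_def c0)
  ultimately show ?thesis using that by blast
qed

section \<open>Rational functions and descent to the base field\<close>

interpretation to_fract_hom: inj_idom_hom "to_fract :: 'a::idom \<Rightarrow> 'a fract"
  by unfold_locales auto

interpretation to_ac_hom: field_hom "to_ac :: 'a::field \<Rightarrow> 'a alg_closure"
  by unfold_locales auto

instance fract :: ("{idom,ring_char_0}") field_char_0
proof
  show "inj (of_nat :: nat \<Rightarrow> 'a fract)"
  proof (rule injI)
    fix m n :: nat assume "(of_nat m :: 'a fract) = of_nat n"
    hence "to_fract (of_nat m :: 'a) = to_fract (of_nat n)" by (simp add: to_fract_hom.hom_of_nat)
    thus "m = n" by simp
  qed
qed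

lemma fract_rep:
  obtains a b :: "'a::idom" where "q = to_fract a / to_fract b" "b \<noteq> 0"
  by (cases q) (auto simp: Fract_conv_to_fract)

text \<open>Substitution of \<xi> for the indeterminate. The value is independent of the
  representing fraction once \<xi> is transcendental over the image of \<kappa>, which is the
  standing condition whenever it is used.\<close>

definition fract_eval :: "('c::field \<Rightarrow> 'b::field) \<Rightarrow> 'b \<Rightarrow> 'c poly fract \<Rightarrow> 'b" where
  "fract_eval \<kappa> \<xi> q = (THE y. \<exists>a b. b \<noteq> 0 \<and> q = to_fract a / to_fract b \<and>
     y = poly (map_poly \<kappa> a) \<xi> / poly (map_poly \<kappa> b) \<xi>)"

lemma fract_eval:
  fixes \<kappa> :: "'c::field \<Rightarrow> 'b::field"
  assumes "field_hom \<kappa>" and tr: "\<And>p. poly (map_poly \<kappa> p) \<xi> = 0 \<Longrightarrow> p = 0"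
  shows "field_hom (fract_eval \<kappa> \<xi>)" "fract_eval \<kappa> \<xi> (to_fract a) = poly (map_poly \<kappa> a) \<xi>"
proof -
  interpret field_hom \<kappa> by fact
  interpret mp: map_poly_idom_hom \<kappa> ..
  let ?e = "\<lambda>a. poly (map_poly \<kappa> a) \<xi>"
  have e: "?e (a + b) = ?e a + ?e b" "?e (a * b) = ?e a * ?e b" "?e 1 = 1" "?e 0 = 0" for a b
    by (simp_all add: hom_distribs)
  have val: "fract_eval \<kappa> \<xi> (to_fract a / to_fract b) = ?e a / ?e b" if "b \<noteq> 0" for a b
    unfolding fract_eval_def
  proof (rule the_equality)
    show "\<exists>a' b'. b' \<noteq> 0 \<and> to_fract a / to_fract b = to_fract a' / to_fract b' \<and> ?e a / ?e b = ?e a' / ?e b'"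
      using that by blast
  next
    fix y assume "\<exists>a' b'. b' \<noteq> 0 \<and> to_fract a / to_fract b = to_fract a' / to_fract b' \<and> y = ?e a' / ?e b'"
    then obtain a' b' where ab: "b' \<noteq> 0" "to_fract a / to_fract b = to_fract a' / to_fract b'" "y = ?e a' / ?e b'" by blast
    have "to_fract (a * b') = to_fract (a' * b)" using ab that by (simp add: frac_eq_eq)
    hence "a * b' = a' * b" by (simp only: to_fract_eq_iff)
    hence "?e a * ?e b' = ?e a' * ?e b" using e(2) by metis
    moreover have "?e b \<noteq> 0" "?e b' \<noteq> 0" using tr that ab(1) by blast+
    ultimately show "y = ?e a / ?e b" using ab(3) by (simp add: frac_eq_eq)
  qed
  have ne: "?e b \<noteq> 0" if "b \<noteq> 0" for b using tr that by blast
  have "hom_on UNIV (fract_eval \<kappa> \<xi>)"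
    unfolding hom_on_def
  proof (intro conjI ballI)
    show "fract_eval \<kappa> \<xi> 1 = 1" using val[of 1 1] e(3) by simp
    fix p q :: "'c poly fract"
    obtain a b where p: "p = to_fract a / to_fract b" "b \<noteq> 0" by (rule fract_rep)
    obtain c d where q: "q = to_fract c / to_fract d" "d \<noteq> 0" by (rule fract_rep)
    have bd: "b * d \<noteq> 0" using p q by simp
    have "p + q = to_fract (a * d + c * b) / to_fract (b * d)" using p q by (simp add: add_frac_eq)
    thus "fract_eval \<kappa> \<xi> (p + q) = fract_eval \<kappa> \<xi> p + fract_eval \<kappa> \<xi> q"
      using val[OF bd, of "a * d + c * b"] val[OF p(2), of a] val[OF q(2), of c] p q ne[OF p(2)] ne[OF q(2)]
      by (simp only: e) (simp add: add_frac_eq)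
    have "p * q = to_fract (a * c) / to_fract (b * d)" using p q by simp
    thus "fract_eval \<kappa> \<xi> (p * q) = fract_eval \<kappa> \<xi> p * fract_eval \<kappa> \<xi> q"
      using val[OF bd, of "a * c"] val[OF p(2), of a] val[OF q(2), of c] p q by (simp only: e) simp
  qed
  thus "field_hom (fract_eval \<kappa> \<xi>)" by (simp add: hom_on_UNIV_iff)
  show "fract_eval \<kappa> \<xi> (to_fract a) = ?e a" using val[of 1 a] e(3) by simp
qed

text \<open>Common linear factors are cancelled until none is left. Absence of a common zero in the
  field is all that the later search for zeros requires.\<close>

lemma fract_coprime_rep:
  fixes q :: "'c::field poly fract"
  obtains u v where "q = to_fract u / to_fract v" "v \<noteq> 0" "\<And>x. poly u x = 0 \<Longrightarrow> poly v x \<noteq> 0"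
proof -
  have "\<exists>u v. q = to_fract u / to_fract v \<and> v \<noteq> 0 \<and> (\<forall>x. poly u x = 0 \<longrightarrow> poly v x \<noteq> 0)"
    if "q = to_fract a / to_fract b" "b \<noteq> 0" for a b
    using that
  proof (induction "degree b" arbitrary: a b rule: less_induct)
    case less
    show ?case
    proof (cases "\<exists>x. poly a x = 0 \<and> poly b x = 0")
      case False thus ?thesis using less.prems by blast
    next
      case True
      then obtain x a' b' where x: "a = [:-x, 1:] * a'" "b = [:-x, 1:] * b'"
        by (metis dvdE poly_eq_0_iff_dvd)
      have b': "b' \<noteq> 0" using x(2) less.prems(2) by auto
      have "degree b = Suc (degree b')" unfolding x(2) using b' by (subst degree_mult_eq) auto
      moreover have "q = to_fract a' / to_fract b'"
      proof -
        have "to_fract [:-x, 1:] \<noteq> 0" by simp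
        thus ?thesis unfolding less.prems(1) x by (simp only: to_fract_mult) simp
      qed
      ultimately show ?thesis using less.hyps[of b' a'] b' by simp
    qed
  qed
  moreover obtain a b where "q = to_fract a / to_fract b" "b \<noteq> 0" by (rule fract_rep)
  ultimately show ?thesis using that by blast
qed

lemma is_subfield_range_to_ac: "is_subfield (range (to_ac :: 'a::field \<Rightarrow> 'a alg_closure))"
  unfolding is_subfield_def
  by (auto simp flip: to_ac_add to_ac_mult to_ac_minus to_ac_inverse to_ac_0 to_ac_1)

lemma polys_over_range_to_ac:
  "p \<in> polys_over (range to_ac) \<longleftrightarrow> (\<exists>q. p = map_poly (to_ac :: 'a::field \<Rightarrow> _) q)"
proof
  assume p: "p \<in> polys_over (range to_ac)"
  have "p = map_poly to_ac (map_poly of_ac p)"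
    using p by (intro poly_eqI) (auto simp: coeff_map_poly polys_over_def to_ac_of_ac)
  thus "\<exists>q. p = map_poly (to_ac :: 'a::field \<Rightarrow> _) q" by blast
qed (auto simp: polys_over_def coeff_map_poly)

lemma algebraic_over_range_to_ac: "algebraic_over (range (to_ac :: 'a::field \<Rightarrow> _)) x"
proof -
  obtain p :: "'a poly" where "p \<noteq> 0" "poly (map_poly to_ac p) x = 0" by (rule alg_closure_algebraic)
  thus ?thesis unfolding algebraic_over_def
    by (intro bexI[of _ "map_poly to_ac p"]) (auto simp: polys_over_range_to_ac)
qed

lemma fixed_in_range_to_ac:
  fixes y :: "'a::field_char_0 alg_closure"
  assumes "\<And>\<sigma>. field_hom \<sigma> \<Longrightarrow> (\<And>a::'a. \<sigma> (to_ac a) = to_ac a) \<Longrightarrow> \<sigma> y = y"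
  shows "y \<in> range to_ac"
proof (rule ccontr)
  assume y: "y \<notin> range to_ac"
  obtain \<sigma> where "field_hom \<sigma>" "\<And>z. z \<in> range (to_ac :: 'a \<Rightarrow> _) \<Longrightarrow> \<sigma> z = z" "\<sigma> y \<noteq> y"
    using exists_endo_moving[OF is_subfield_range_to_ac algebraic_over_range_to_ac y] by blast
  thus False using assms[of \<sigma>] by auto
qed

lemma fixed_poly_in_range_to_ac:
  fixes p :: "'a::field_char_0 alg_closure poly"
  assumes "\<And>\<sigma>. field_hom \<sigma> \<Longrightarrow> (\<And>a::'a. \<sigma> (to_ac a) = to_ac a) \<Longrightarrow> map_poly \<sigma> p = p"
  obtains q :: "'a poly" where "p = map_poly to_ac q"
proof -
  have "coeff p i \<in> range to_ac" for i
  proof (rule fixed_in_range_to_ac)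
    fix \<sigma> :: "'a alg_closure \<Rightarrow> 'a alg_closure" assume s: "field_hom \<sigma>" "\<And>a::'a. \<sigma> (to_ac a) = to_ac a"
    interpret field_hom \<sigma> by fact
    have "coeff (map_poly \<sigma> p) i = coeff p i" using assms[OF s] by simp
    thus "\<sigma> (coeff p i) = coeff p i" by simp
  qed
  thus ?thesis using that polys_over_range_to_ac[of p] by (auto simp: polys_over_def)
qed

section \<open>Permutation groups containing three-cycles\<close>

abbreviation cyc3 :: "nat \<Rightarrow> nat \<Rightarrow> nat \<Rightarrow> nat \<Rightarrow> nat" where
  "cyc3 a b c \<equiv> cycle_of_list [a, b, c]"

lemma cyc3_apply:
  assumes "distinct [a, b, c]"
  shows "cyc3 a b c x = (if x = a then b else if x = b then c else if x = c then a else x)"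
  using assms by (auto simp: transpose_def)

lemma cyc3_rotate: "distinct [a, b, c] \<Longrightarrow> cyc3 a b c = cyc3 b c a"
  by (rule ext, subst (1 2) cyc3_apply) auto

lemma cyc3_inverse: "distinct [a, b, c] \<Longrightarrow> inv_into UNIV (cyc3 a b c) = cyc3 c b a"
proof (rule inv_unique_comp)
  assume d: "distinct [a, b, c]"
  show "cyc3 a b c \<circ> cyc3 c b a = id" "cyc3 c b a \<circ> cyc3 a b c = id"
    using d by (auto simp: fun_eq_iff cyc3_apply simp del: cycle_of_list.simps)
qed

locale perm_subgroup =
  fixes n :: nat and G :: "(nat \<Rightarrow> nat) set"
  assumes perm: "\<And>p. p \<in> G \<Longrightarrow> p permutes {1..n}"
    and id_in: "id \<in> G"
    and comp_in: "\<And>p q. p \<in> G \<Longrightarrow> q \<in> G \<Longrightarrow> p \<circ> q \<in> G"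
begin

text \<open>A permutation of a finite set has finite order, so its inverse is one of its
  powers.\<close>

lemma inv_in: "p \<in> G \<Longrightarrow> inv_into UNIV p \<in> G"
proof -
  assume p: "p \<in> G"
  have "permutation p" using perm[OF p] by (auto simp: permutation_permutes)
  then obtain k where k: "p ^^ k = id" "k > 0" by (rule permutation_is_nilpotent)
  have pw: "p ^^ m \<in> G" for m by (induction m) (simp_all only: funpow.simps id_in comp_in p)
  have "inv_into UNIV p = p ^^ (k - 1)"
  proof (rule inv_unique_comp)
    show "p \<circ> p ^^ (k - 1) = id" using k by (metis Suc_pred' funpow.simps(2))
    show "p ^^ (k - 1) \<circ> p = id" using k by (metis Suc_pred' funpow_Suc_right)
  qed
  thus ?thesis using pw by simp
qed

lemma conj_in:
  assumes "g \<in> G" "cyc3 a b c \<in> G" "distinct [a, b, c]"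
  shows "cyc3 (g a) (g b) (g c) \<in> G"
proof -
  have "bij g" using perm[OF assms(1)] by (rule permutes_bij)
  hence "g \<circ> cyc3 a b c \<circ> inv_into UNIV g = cycle_of_list (map g [a, b, c])"
    by (rule conjugation_of_cycle[OF assms(3)])
  moreover have "g \<circ> cyc3 a b c \<circ> inv_into UNIV g \<in> G"
    using assms inv_in comp_in by blast
  ultimately show ?thesis by (simp del: cycle_of_list.simps)
qed

lemma rotate_in: "distinct [a, b, c] \<Longrightarrow> cyc3 a b c \<in> G \<Longrightarrow> cyc3 b c a \<in> G"
  by (simp only: cyc3_rotate[of a b c])

lemma inverse_in: "distinct [a, b, c] \<Longrightarrow> cyc3 a b c \<in> G \<Longrightarrow> cyc3 c b a \<in> G"
  using inv_in[of "cyc3 a b c"] by (simp only: cyc3_inverse)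

text \<open>Two points are linked when some three-cycle of \<open>G\<close> maps one to the other.
  This is an equivalence relation, and conjugation makes it invariant under \<open>G\<close>; if a
  single class covers everything, \<open>G\<close> contains the alternating group.\<close>

definition linked :: "nat \<Rightarrow> nat \<Rightarrow> bool" where
  "linked i j \<longleftrightarrow> i = j \<or> (\<exists>k. distinct [i, j, k] \<and> {i, j, k} \<subseteq> {1..n} \<and> cyc3 i j k \<in> G)"

lemma linked_sym: "linked i j \<Longrightarrow> linked j i"
proof -
  assume "linked i j"
  then consider "i = j" | k where "distinct [i, j, k]" "{i, j, k} \<subseteq> {1..n}" "cyc3 i j k \<in> G"
    by (auto simp: linked_def simp del: cycle_of_list.simps)
  thus ?thesis
  proof cases
    case 2
    have d: "distinct [k, j, i]" using 2 by auto
    have "cyc3 j i k \<in> G" using rotate_in[OF d inverse_in[OF 2(1,3)]] .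
    thus ?thesis unfolding linked_def using 2 by (intro disjI2 exI[of _ k]) auto
  qed (simp add: linked_def)
qed

text \<open>Conjugating (i j a) by (j k b) gives a three-cycle sending i to k, provided the second
  cycle fixes i; if instead b = i, the inverse of the second cycle already sends i to k.\<close>

lemma linked_trans:
  assumes "linked i j" "linked j k"
  shows "linked i k"
proof (cases "i = j \<or> j = k \<or> i = k")
  case True thus ?thesis using assms by (auto simp: linked_def)
next
  case False
  obtain a where a: "distinct [i, j, a]" "{i, j, a} \<subseteq> {1..n}" "cyc3 i j a \<in> G"
    using assms(1) False by (auto simp: linked_def simp del: cycle_of_list.simps)
  obtain b where b: "distinct [j, k, b]" "{j, k, b} \<subseteq> {1..n}" "cyc3 j k b \<in> G"
    using assms(2) False by (auto simp: linked_def simp del: cycle_of_list.simps)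
  show ?thesis
  proof (cases "i = b")
    case True
    have d: "distinct [b, k, j]" using b by auto
    have "cyc3 i k j \<in> G" using inverse_in[OF b(1,3)] True by simp
    thus ?thesis unfolding linked_def using b True d by (intro disjI2 exI[of _ j]) auto
  next
    case ib: False
    let ?g = "cyc3 j k b"
    have gi: "?g i = i" "?g j = k" unfolding cyc3_apply[OF b(1)] using False ib b(1) by auto
    have c: "cyc3 i k (?g a) \<in> G" using conj_in[OF b(3) a(3,1)] unfolding gi .
    have inj: "inj ?g" using perm[OF b(3)] by (rule permutes_inj)
    have "?g a \<noteq> i" "?g a \<noteq> k" using gi inj a(1) by (metis distinct_length_2_or_more injD)+
    moreover have "?g a \<in> {1..n}" using permutes_in_image[OF perm[OF b(3)], of a] a(2) by blast
    ultimately show ?thesis unfolding linked_def using c a(2) b(2) False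
      by (intro disjI2 exI[of _ "?g a"]) auto
  qed
qed

lemma linked_invariant: "g \<in> G \<Longrightarrow> linked i j \<Longrightarrow> linked (g i) (g j)"
proof -
  assume g: "g \<in> G" and "linked i j"
  then consider "i = j" | k where "distinct [i, j, k]" "{i, j, k} \<subseteq> {1..n}" "cyc3 i j k \<in> G"
    by (auto simp: linked_def simp del: cycle_of_list.simps)
  thus ?thesis
  proof cases
    case 2
    have "inj g" using perm[OF g] by (rule permutes_inj)
    hence "distinct [g i, g j, g k]" using 2(1) by (auto dest: injD)
    moreover have "{g i, g j, g k} \<subseteq> {1..n}" using permutes_in_image[OF perm[OF g]] 2(2) by auto
    ultimately show ?thesis unfolding linked_def using conj_in[OF g 2(3,1)] by blast
  qed (simp add: linked_def)
qed

text \<open>Start from (a b d) in \<open>G\<close> with d possibly wrong, and take (d c e) linking d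
  to c. If e is neither a nor b, conjugation by the second cycle replaces d by c. Otherwise
  conjugating the second cycle by the first, or by its inverse, yields (a b c) up to rotation and
  inversion.\<close>

lemma all_cyc3:
  assumes link: "\<And>i j. i \<in> {1..n} \<Longrightarrow> j \<in> {1..n} \<Longrightarrow> linked i j"
    and abc: "distinct [a, b, c]" "{a, b, c} \<subseteq> {1..n}"
  shows "cyc3 a b c \<in> G"
proof -
  obtain d where d: "distinct [a, b, d]" "{a, b, d} \<subseteq> {1..n}" "cyc3 a b d \<in> G"
    using link[of a b] abc by (auto simp: linked_def simp del: cycle_of_list.simps)
  show ?thesis
  proof (cases "d = c")
    case True thus ?thesis using d by simp
  next
    case False
    obtain e where e: "distinct [d, c, e]" "{d, c, e} \<subseteq> {1..n}" "cyc3 d c e \<in> G"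
      using link[of d c] abc d False by (auto simp: linked_def simp del: cycle_of_list.simps)
    consider "e = a" | "e = b" | "e \<noteq> a" "e \<noteq> b" by blast
    thus ?thesis
    proof cases
      case 1
      have "cyc3 a b d d = a" "cyc3 a b d c = c" "cyc3 a b d e = b"
        unfolding cyc3_apply[OF d(1)] using 1 abc d False by auto
      hence "cyc3 a c b \<in> G" using conj_in[OF d(3) e(3,1)] by (simp only:)
      hence "cyc3 b c a \<in> G" using inverse_in[of a c b] abc by auto
      thus ?thesis using cyc3_rotate[OF abc(1)] by (simp only:)
    next
      case 2
      have dd: "distinct [d, b, a]" using d by auto
      have "cyc3 d b a d = b" "cyc3 d b a c = c" "cyc3 d b a e = a"
        unfolding cyc3_apply[OF dd] using 2 abc d False by auto
      hence "cyc3 b c a \<in> G" using conj_in[OF inverse_in[OF d(1,3)] e(3,1)] by (simp only:)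
      thus ?thesis using cyc3_rotate[OF abc(1)] by (simp only:)
    next
      case 3
      have "cyc3 d c e a = a" "cyc3 d c e b = b" "cyc3 d c e d = c"
        unfolding cyc3_apply[OF e(1)] using 3 abc d by auto
      thus ?thesis using conj_in[OF e(3) d(3,1)] by (simp only:)
    qed
  qed
qed

lemma contains_alternating:
  assumes link: "\<And>i. i \<in> {1..n} \<Longrightarrow> linked m i" and p: "p permutes {1..n}" "evenperm p"
  shows "p \<in> G"
proof -
  have link': "linked i j" if "i \<in> {1..n}" "j \<in> {1..n}" for i j
    using link that linked_sym linked_trans by blast
  have "p \<in> generate (alt_group n) (three_cycles n)"
    using p by (simp only: alt_group_carrier_as_three_cycles[symmetric] alt_group_carrier)
  thus ?thesis
  proof induction
    case one thus ?case by (simp only: alt_group_one id_in)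
  next
    case (incl h)
    then obtain cs where cs: "h = cycle_of_list cs" "distinct cs" "length cs = 3" "set cs \<subseteq> {1..n}" by auto
    then obtain a b c where "cs = [a, b, c]" by (metis stupid_lemma)
    thus ?case using cs all_cyc3[OF link', of a b c] by (auto simp del: cycle_of_list.simps)
  next
    case (inv h)
    have h: "h \<in> carrier (alt_group n)" using inv three_cycles_incl by blast
    from inv obtain cs where cs: "h = cycle_of_list cs" "distinct cs" "length cs = 3" "set cs \<subseteq> {1..n}" by auto
    then obtain a b c where "cs = [a, b, c]" by (metis stupid_lemma)
    hence "h \<in> G" using cs all_cyc3[OF link', of a b c] by (auto simp del: cycle_of_list.simps)
    thus ?case using alt_group_inv_equality[OF h] inv_in by simp
  next
    case (eng h1 h2) thus ?case by (simp only: alt_group_mult comp_in)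
  qed
qed

end

lemma hom_permutes_roots:
  fixes xs :: "nat \<Rightarrow> 'a"
  assumes "inj_on xs {1..N}" "inj \<sigma>" "\<And>i. i \<in> {1..N} \<Longrightarrow> \<sigma> (xs i) \<in> xs ` {1..N}"
  obtains p where "p permutes {1..N}" "\<And>i. i \<in> {1..N} \<Longrightarrow> \<sigma> (xs i) = xs (p i)"
proof -
  define p where "p i = (if i \<in> {1..N} then inv_into {1..N} xs (\<sigma> (xs i)) else i)" for i
  have p1: "p i \<in> {1..N}" "xs (p i) = \<sigma> (xs i)" if "i \<in> {1..N}" for i
    using assms(3)[OF that] that by (auto simp: p_def inv_into_into f_inv_into_f simp del: atLeastAtMost_iff)
  have inj: "inj_on p {1..N}"
  proof (rule inj_onI)
    fix i j assume ij: "i \<in> {1..N}" "j \<in> {1..N}" "p i = p j"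
    hence "\<sigma> (xs i) = \<sigma> (xs j)" using p1(2) by metis
    hence "xs i = xs j" by (rule injD[OF assms(2)])
    thus "i = j" using ij(1,2) by (rule inj_onD[OF assms(1)])
  qed
  moreover have "p ` {1..N} = {1..N}" using p1(1) by (intro endo_inj_surj inj) auto
  ultimately have "bij_betw p {1..N} {1..N}" by (simp only: bij_betw_def simp_thms)
  hence "p permutes {1..N}" by (rule bij_imp_permutes) (simp only: p_def if_False simp_thms)
  thus ?thesis using that p1(2) by metis
qed

text \<open>The polynomial already splits into linear factors over its own closed field, so larger
  fields contribute no further roots.\<close>

lemma root_of_map_poly:
  fixes p :: "'c::alg_closed_field poly" and \<kappa> :: "'c \<Rightarrow> 'b::field"
  assumes "field_hom \<kappa>" "p \<noteq> 0" "poly (map_poly \<kappa> p) y = 0"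
  obtains a where "y = \<kappa> a" "poly p a = 0"
proof -
  interpret field_hom \<kappa> by fact
  interpret mp: map_poly_idom_hom \<kappa> ..
  have "\<exists>a. y = \<kappa> a \<and> poly p a = 0" using assms(2,3)
  proof (induction "degree p" arbitrary: p)
    case 0
    then obtain c where "p = [:c:]" by (metis degree_eq_zeroE)
    thus ?case using 0 by (auto simp: hom_distribs)
  next
    case (Suc n)
    then obtain x where "poly p x = 0" using alg_closed_imp_poly_has_root[of p] by auto
    then obtain q where q: "p = [:- x, 1:] * q" by (metis dvdE poly_eq_0_iff_dvd)
    have q0: "q \<noteq> 0" using q Suc.prems by auto
    have "degree p = Suc (degree q)" unfolding q using q0 by (subst degree_mult_eq) auto
    hence dq: "n = degree q" using Suc.hyps(2) by simp
    have "map_poly \<kappa> p = [:- \<kappa> x, 1:] * map_poly \<kappa> q" unfolding q by (simp only: mp.hom_mult) (simp add: hom_distribs)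
    hence "(y - \<kappa> x) * poly (map_poly \<kappa> q) y = 0" using Suc.prems(2) by (simp only: poly_mult) simp
    hence "y = \<kappa> x \<or> poly (map_poly \<kappa> q) y = 0" by simp
    thus ?case
    proof
      assume "poly (map_poly \<kappa> q) y = 0"
      from Suc.hyps(1)[OF dq q0 this] show ?thesis unfolding q by auto
    qed (use \<open>poly p x = 0\<close> in blast)
  qed
  thus ?thesis using that by blast
qed

text \<open>Split off the power of X - \<rho>, with \<rho> the constant term of \<xi>: that power
  stays nonzero at \<xi> because \<xi> is not constant, and the remaining factor has a nonzero
  constant term there.\<close>

lemma transcendental_fps:
  fixes p :: "'c::field poly" and \<xi> :: "'c fps"
  assumes "\<xi> \<noteq> fps_const (fps_nth \<xi> 0)" "poly (map_poly fls_const p) (fps_to_fls \<xi>) = 0"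
  shows "p = 0"
proof (rule ccontr)
  assume p0: "p \<noteq> 0"
  let ?\<rho> = "fps_nth \<xi> 0"
  interpret fc: map_poly_inj_comm_ring_hom "fps_const :: 'c \<Rightarrow> 'c fps" ..
  obtain q m where q: "p = [:- ?\<rho>, 1:] ^ m * q" "\<not> [:- ?\<rho>, 1:] dvd q"
    using order_decomp[OF p0, of ?\<rho>] by blast
  have e: "poly (map_poly fls_const r) (fps_to_fls \<xi>) = fps_to_fls (poly (map_poly fps_const r) \<xi>)" for r :: "'c poly"
  proof -
    have "map_poly fls_const r = fls_of_poly (map_poly fps_const r)"
      by (rule poly_eqI) (simp add: coeff_map_poly)
    thus ?thesis by simp
  qed
  have "poly (map_poly fps_const p) \<xi> = (\<xi> - fps_const ?\<rho>) ^ m * poly (map_poly fps_const q) \<xi>"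
  proof -
    have "\<xi> - fps_const ?\<rho> = fps_const (- ?\<rho>) + \<xi>"
      by (simp add: diff_conv_add_uminus add.commute del: add_uminus_conv_diff)
    thus ?thesis unfolding q(1) by (simp only: fc.hom_mult fc.hom_power poly_mult poly_power)
      (simp add: fps_const_hom.map_poly_pCons_hom)
  qed
  moreover have "poly (map_poly fps_const p) \<xi> = 0" using assms(2) unfolding e by simp
  ultimately have "poly (map_poly fps_const q) \<xi> = 0" using assms(1) by simp
  hence "fps_nth (poly (map_poly fps_const q) \<xi>) 0 = 0" by simp
  moreover have "fps_nth (poly (map_poly fps_const q) \<xi>) 0 = poly (residue_poly (map_poly fps_const q)) ?\<rho>"
    using fps_nth_0_hom.poly_map_poly[of "map_poly fps_const q" \<xi>] by simp
  moreover have "residue_poly (map_poly fps_const q) = q" by (rule poly_eqI) (simp add: coeff_map_poly)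
  ultimately show False using q(2) by (simp add: poly_eq_0_iff_dvd)
qed

lemma poly_fls_const_fps:
  "poly (map_poly fls_const r) (fps_to_fls \<xi>) = fps_to_fls (poly (map_poly fps_const r) \<xi>)"
  for r :: "'c::field poly"
proof -
  have "map_poly fls_const r = fls_of_poly (map_poly fps_const r)"
    by (rule poly_eqI) (simp add: coeff_map_poly)
  thus ?thesis by simp
qed

lemma poly_fps_const_nth_0: "fps_nth (poly (map_poly fps_const r) \<xi>) 0 = poly r (fps_nth \<xi> 0)"
  for r :: "'c::field poly"
proof -
  have "residue_poly (map_poly fps_const r) = r" by (rule poly_eqI) (simp add: coeff_map_poly)
  thus ?thesis using fps_nth_0_hom.poly_map_poly[of "map_poly fps_const r" \<xi>] by simp
qed

section \<open>The cover t = P(x)/Q(x) over closed constants and its inertia\<close>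

text \<open>The ambient field is the algebraic closure of the rational functions in
  \<open>x\<close>, not in \<open>t\<close>. Since \<open>t\<close> is defined as P(x)/Q(x), the
  element \<open>x\<close> is by construction one root of the fibre polynomial \<open>f\<close>, and
  expanding around points of the \<open>x\<close>-line needs no uniformisation.\<close>

locale mestre_cover =
  fixes N :: nat and P Q R :: "'c::{alg_closed_field,field_char_0} poly"
  assumes N: "N \<ge> 1"
    and degree_P: "degree P = N" and monic_P: "lead_coeff P = 1"
    and degree_Q: "degree Q < N"
    and W: "pderiv P * Q - P * pderiv Q = R ^ 2"
    and coprime_PQ: "\<And>y. poly P y = 0 \<Longrightarrow> poly Q y \<noteq> 0"
    and crit_Q: "\<And>\<rho>. poly R \<rho> = 0 \<Longrightarrow> poly Q \<rho> \<noteq> 0"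
    and crit_R: "\<And>\<rho>. poly R \<rho> = 0 \<Longrightarrow> poly (pderiv R) \<rho> \<noteq> 0"
    and crit_inj: "\<And>\<rho> \<rho>'. poly R \<rho> = 0 \<Longrightarrow> poly R \<rho>' = 0 \<Longrightarrow>
      poly P \<rho> * poly Q \<rho>' = poly P \<rho>' * poly Q \<rho> \<Longrightarrow> \<rho> = \<rho>'"
begin

definition \<kappa> :: "'c \<Rightarrow> 'c poly fract alg_closure" where "\<kappa> c = to_ac (to_fract [:c:])"
definition x :: "'c poly fract alg_closure" where "x = to_ac (to_fract [:0, 1:])"
definition t :: "'c poly fract alg_closure" where "t = poly (map_poly \<kappa> P) x / poly (map_poly \<kappa> Q) x"
definition f :: "'c poly fract alg_closure poly" where "f = map_poly \<kappa> P - smult t (map_poly \<kappa> Q)"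

lemma field_hom_\<kappa>: "field_hom \<kappa>"
proof -
  have "[:a + b:] = [:a:] + [:b:]" "[:a * b:] = [:a:] * [:b:]" for a b :: 'c by simp_all
  hence "hom_on UNIV \<kappa>" unfolding hom_on_def \<kappa>_def
    by (simp only: to_fract_add to_fract_mult to_ac_add to_ac_mult) (simp flip: one_pCons)
  thus ?thesis by (simp add: hom_on_UNIV_iff)
qed

sublocale \<kappa>: field_hom \<kappa> by (rule field_hom_\<kappa>)
sublocale \<kappa>p: map_poly_inj_idom_hom \<kappa> ..

lemma eval_x: "to_ac (to_fract p) = poly (map_poly \<kappa> p) x"
proof (induction p)
  case (pCons a p)
  have "pCons a p = [:a:] + [:0, 1:] * p" by simp
  hence "to_ac (to_fract (pCons a p)) = \<kappa> a + x * to_ac (to_fract p)"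
    by (simp only: to_fract_add to_fract_mult to_ac_add to_ac_mult \<kappa>_def x_def)
  thus ?case by (simp add: pCons.IH hom_distribs)
qed simp

lemma x_transcendental: "poly (map_poly \<kappa> p) x = 0 \<Longrightarrow> p = 0"
  by (simp flip: eval_x)

lemma Q_nonzero: "Q \<noteq> 0"
proof
  assume "Q = 0"
  obtain y where "poly P y = 0" using alg_closed_imp_poly_has_root[of P] degree_P N by auto
  thus False using coprime_PQ[of y] \<open>Q = 0\<close> by simp
qed

lemma Qx_nonzero: "poly (map_poly \<kappa> Q) x \<noteq> 0"
  using x_transcendental Q_nonzero by blast

lemma degree_f: "degree f = N" and monic_f: "lead_coeff f = 1"
proof -
  have d: "degree (smult t (map_poly \<kappa> Q)) < degree (map_poly \<kappa> P)"
    using degree_Q degree_P by (intro le_less_trans[OF degree_smult_le]) simp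
  have "degree (map_poly \<kappa> P + - smult t (map_poly \<kappa> Q)) = degree (map_poly \<kappa> P)"
    by (rule degree_add_eq_left) (use d in simp)
  thus df: "degree f = N" by (simp add: f_def degree_P)
  show "lead_coeff f = 1"
    unfolding df using d degree_P monic_P
    by (simp add: f_def coeff_eq_0[of "smult t (map_poly \<kappa> Q)" N] del: coeff_smult)
qed

lemma coprime_\<Omega>: "poly (map_poly \<kappa> P) y = 0 \<Longrightarrow> poly (map_poly \<kappa> Q) y \<noteq> 0"
proof -
  assume y: "poly (map_poly \<kappa> P) y = 0"
  have "P \<noteq> 0" using monic_P by auto
  then obtain a where "y = \<kappa> a" "poly P a = 0" using root_of_map_poly[OF field_hom_\<kappa> _ y] by blast
  thus ?thesis using coprime_PQ by simp
qed

lemma f_root_Q: "poly f y = 0 \<Longrightarrow> poly (map_poly \<kappa> Q) y \<noteq> 0"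
  using coprime_\<Omega>[of y] by (auto simp: f_def)

lemma f_pderiv: "poly f y = 0 \<Longrightarrow> poly (pderiv f) y * poly (map_poly \<kappa> Q) y = poly (map_poly \<kappa> R) y ^ 2"
proof -
  assume y: "poly f y = 0"
  have "map_poly \<kappa> (pderiv P * Q - P * pderiv Q) = map_poly \<kappa> (R ^ 2)" by (simp only: W)
  hence "pderiv (map_poly \<kappa> P) * map_poly \<kappa> Q - map_poly \<kappa> P * pderiv (map_poly \<kappa> Q) = map_poly \<kappa> R ^ 2"
    by (simp add: hom_distribs)
  from arg_cong[OF this, of "\<lambda>p. poly p y"] y show ?thesis
    by (simp add: f_def pderiv_diff pderiv_smult algebra_simps)
qed

lemma t_not_const: "t \<noteq> \<kappa> c"
proof
  assume "t = \<kappa> c"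
  hence "poly (map_poly \<kappa> (P - smult c Q)) x = 0" using Qx_nonzero by (simp add: t_def hom_distribs field_simps)
  hence "P = smult c Q" using x_transcendental by (metis eq_iff_diff_eq_0)
  hence "degree P \<le> degree Q" by (metis degree_smult_le)
  thus False using degree_P degree_Q by simp
qed

lemma W_nonzero: "R \<noteq> 0"
proof
  assume "R = 0"
  obtain y where y: "poly P y = 0" using alg_closed_imp_poly_has_root[of P] degree_P N by auto
  thus False using crit_R[of 0] \<open>R = 0\<close> by simp
qed

text \<open>A multiple root of \<open>f\<close> is a zero of \<open>R\<close> by
  \<open>f_pderiv\<close>, hence a constant; then t = P(y)/Q(y) would be constant as well.\<close>

lemma f_separable: "poly f y = 0 \<Longrightarrow> poly (pderiv f) y \<noteq> 0"
proof
  assume y: "poly f y = 0" "poly (pderiv f) y = 0"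
  hence "poly (map_poly \<kappa> R) y = 0" using f_pderiv[OF y(1)] by simp
  then obtain \<rho> where \<rho>: "y = \<kappa> \<rho>" "poly R \<rho> = 0" using root_of_map_poly[OF field_hom_\<kappa> W_nonzero] by blast
  have "t = \<kappa> (poly P \<rho> / poly Q \<rho>)" using y(1) crit_Q[OF \<rho>(2)]
    by (simp add: f_def \<rho>(1) hom_distribs field_simps)
  thus False using t_not_const by blast
qed

text \<open>The Wronskian of the fibre polynomial with \<open>Q\<close> is still R^2, which vanishes
  to order exactly 2 at \<rho>, so \<rho> has multiplicity 3. Any other multiple root would also be
  a zero of \<open>R\<close> with the same critical value, and \<open>crit_inj\<close> excludes
  that.\<close>

lemma critical_fibre:
  assumes \<rho>: "poly R \<rho> = 0"
  defines "f0 \<equiv> P - smult (poly P \<rho> / poly Q \<rho>) Q"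
  obtains \<eta> where "f0 = [:- \<rho>, 1:] ^ 3 * \<eta>" "poly \<eta> \<rho> \<noteq> 0"
    "\<And>y. poly \<eta> y = 0 \<Longrightarrow> poly (pderiv \<eta>) y \<noteq> 0" "lead_coeff \<eta> = 1" "N = 3 + degree \<eta>"
proof -
  let ?t = "poly P \<rho> / poly Q \<rho>"
  have W0: "pderiv f0 * Q - f0 * pderiv Q = R ^ 2"
    unfolding W[symmetric] f0_def by (simp add: pderiv_diff pderiv_smult algebra_simps)
  have df: "degree f0 = N" "lead_coeff f0 = 1"
  proof -
    have d: "degree (smult ?t Q) < degree P" using degree_Q degree_P by (intro le_less_trans[OF degree_smult_le]) simp
    have "degree (P + - smult ?t Q) = degree P"
      by (rule degree_add_eq_left) (use d in simp)
    thus 1: "degree f0 = N" by (simp add: f0_def degree_P)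
    show "lead_coeff f0 = 1" unfolding 1 using d degree_P monic_P
      by (simp add: f0_def coeff_eq_0[of "smult ?t Q" N] del: coeff_smult)
  qed
  have f00: "f0 \<noteq> 0" using df by auto
  have f0\<rho>: "poly f0 \<rho> = 0" using crit_Q[OF \<rho>] by (simp add: f0_def)
  define m where "m = order \<rho> f0"
  obtain \<eta> where \<eta>: "f0 = [:- \<rho>, 1:] ^ m * \<eta>" "\<not> [:- \<rho>, 1:] dvd \<eta>"
    using order_decomp[OF f00, of \<rho>] by (auto simp: m_def)
  have \<eta>\<rho>: "poly \<eta> \<rho> \<noteq> 0" using \<eta>(2) by (simp add: poly_eq_0_iff_dvd)
  obtain k where k: "m = Suc k" using f0\<rho> f00 \<eta>(1) \<eta>\<rho> by (cases m) auto
  define L where "L = [:- \<rho>, 1:]"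
  obtain R1 where R1: "R = L * R1" using \<rho> by (metis L_def dvdE poly_eq_0_iff_dvd)
  have R1\<rho>: "poly R1 \<rho> \<noteq> 0"
  proof -
    have "poly (pderiv R) \<rho> = poly R1 \<rho>" unfolding R1 L_def by (simp only: pderiv_mult) (simp add: pderiv_pCons)
    thus ?thesis using crit_R[OF \<rho>] by simp
  qed
  have dL: "pderiv (L ^ Suc k) = smult (of_nat (Suc k)) (L ^ k)"
    by (simp only: pderiv_power_Suc L_def) (simp add: pderiv_pCons)
  have "L ^ k * (smult (of_nat (Suc k)) (\<eta> * Q) + L * (pderiv \<eta> * Q - \<eta> * pderiv Q)) = L ^ 2 * (R1 ^ 2)"
    (is "L ^ k * ?U = _")
  proof -
    have "pderiv f0 * Q - f0 * pderiv Q = L ^ k * ?U"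
      unfolding \<eta>(1) k L_def[symmetric] pderiv_mult dL by (simp add: algebra_simps)
    thus ?thesis using W0 R1 by (simp add: power_mult_distrib)
  qed
  moreover have "poly ?U \<rho> \<noteq> 0" using \<eta>\<rho> crit_Q[OF \<rho>] by (simp add: L_def del: of_nat_Suc)
  moreover have "poly (R1 ^ 2) \<rho> \<noteq> 0" using R1\<rho> by simp
  ultimately have "k = 2"
  proof -
    assume eq: "L ^ k * ?U = L ^ 2 * (R1 ^ 2)" and U: "poly ?U \<rho> \<noteq> 0" and r: "poly (R1 ^ 2) \<rho> \<noteq> 0"
    have o: "order \<rho> (L ^ j * V) = j" if "poly V \<rho> \<noteq> 0" for j V
    proof -
      have "V \<noteq> 0" using that by auto
      thus ?thesis using that unfolding L_def
        by (subst order_mult) (auto simp: order_power_n_n order_0I)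
    qed
    show ?thesis using o[OF U, of k] o[OF r, of 2] eq by simp
  qed
  hence m3: "m = 3" using k by simp
  have \<eta>0: "\<eta> \<noteq> 0" using \<eta>\<rho> by auto
  have sep: "poly (pderiv \<eta>) y \<noteq> 0" if y: "poly \<eta> y = 0" for y
  proof
    assume y': "poly (pderiv \<eta>) y = 0"
    have fy: "poly f0 y = 0" "poly (pderiv f0) y = 0" unfolding \<eta>(1) using y y' by (auto simp: pderiv_mult)
    hence "poly (R ^ 2) y = 0" unfolding W0[symmetric] by simp
    hence Ry: "poly R y = 0" by simp
    have "poly P y * poly Q \<rho> = poly P \<rho> * poly Q y" using fy(1) crit_Q[OF \<rho>] by (simp add: f0_def field_simps)
    hence "y = \<rho>" using crit_inj[OF Ry \<rho>] by simp
    thus False using y \<eta>\<rho> by simp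
  qed
  have "N = 3 + degree \<eta>"
    using arg_cong[OF \<eta>(1), of degree] \<eta>0 df(1) m3 by (simp add: degree_mult_eq degree_power_eq)
  moreover have "lead_coeff \<eta> = 1"
    using arg_cong[OF \<eta>(1), of lead_coeff] df(2) by (simp add: lead_coeff_mult lead_coeff_power)
  ultimately show ?thesis using that[of \<eta>] \<eta>(1) \<eta>\<rho> sep m3 by blast
qed

text \<open>Near a critical point, \<open>t - t\<^sub>0\<close> is the cube of a local parameter.\<close>

lemma critical_parameter:
  assumes \<rho>: "poly R \<rho> = 0"
  obtains v where "fps_nth v 0 = \<rho>" "fps_nth v 1 \<noteq> 0"
    "poly (map_poly fps_const P) v = (fps_const (poly P \<rho> / poly Q \<rho>) + fps_X ^ 3) * poly (map_poly fps_const Q) v"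
proof -
  interpret fc: map_poly_inj_comm_ring_hom "fps_const :: 'c \<Rightarrow> 'c fps" ..
  let ?t = "poly P \<rho> / poly Q \<rho>"
  obtain \<eta> where \<eta>: "P - smult ?t Q = [:- \<rho>, 1:] ^ 3 * \<eta>" "poly \<eta> \<rho> \<noteq> 0"
    using critical_fibre[OF \<rho>] by metis
  \<comment> \<open>With v = \<rho> + X Y the equation P(v) = (t0 + X^3) Q(v) becomes, after
    cancelling X^3, the equation Y^3 \<eta>(v) = Q(v) for Y. Its residue is a binomial cubic with
    simple roots, so Hensel's lemma applies.\<close>
  let ?s = "[:fps_const \<rho>, fps_X:]"
  let ?F = "monom 1 3 * (map_poly fps_const \<eta> \<circ>\<^sub>p ?s) - (map_poly fps_const Q \<circ>\<^sub>p ?s)"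
  have rs: "residue_poly (map_poly fps_const p \<circ>\<^sub>p ?s) = [:poly p \<rho>:]" for p
  proof -
    have "residue_poly (map_poly fps_const p \<circ>\<^sub>p ?s) = residue_poly (map_poly fps_const p) \<circ>\<^sub>p residue_poly ?s"
      by (simp only: fps_nth_0_hom.map_poly_pcompose)
    also have "residue_poly (map_poly fps_const p) = p" by (rule poly_eqI) (simp add: coeff_map_poly)
    also have "residue_poly ?s = [:\<rho>:]" by (simp add: fps_nth_0_hom.map_poly_pCons_hom)
    also have "p \<circ>\<^sub>p [:\<rho>:] = [:poly p \<rho>:]" by (induction p) (simp_all add: pcompose_pCons)
    finally show ?thesis .
  qed
  have res: "residue_poly ?F = smult (poly \<eta> \<rho>) (monom 1 3) - [:poly Q \<rho>:]"
    by (simp only: fps_nth_0_poly_hom.hom_minus fps_nth_0_poly_hom.hom_mult rs fps_nth_0_hom.map_poly_hom_monom)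
       simp
  obtain y0 where y0: "y0 ^ 3 = poly Q \<rho> / poly \<eta> \<rho>" using nth_root_exists[of 3 "poly Q \<rho> / poly \<eta> \<rho>"] by auto
  have y00: "y0 \<noteq> 0" using y0 crit_Q[OF \<rho>] \<eta>(2) by auto
  have "poly (residue_poly ?F) y0 = 0" unfolding res using \<eta>(2) by (simp add: poly_monom y0)
  moreover have "poly (pderiv (residue_poly ?F)) y0 \<noteq> 0"
    unfolding res using \<eta>(2) y00 by (simp add: pderiv_diff pderiv_smult pderiv_monom poly_monom pderiv_pCons)
  ultimately obtain Y where Y: "poly ?F Y = 0" "fps_nth Y 0 = y0" by (rule hensel_fps)
  define v where "v = fps_const \<rho> + fps_X * Y"
  have sv: "poly ?s Y = v" by (simp add: v_def mult.commute)
  have eq: "Y ^ 3 * poly (map_poly fps_const \<eta>) v = poly (map_poly fps_const Q) v"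
    using Y(1) by (simp only: poly_diff poly_mult poly_pcompose sv poly_monom) simp
  have "poly (map_poly fps_const P) v - fps_const ?t * poly (map_poly fps_const Q) v =
    poly (map_poly fps_const (P - smult ?t Q)) v" by (simp add: fc.hom_minus fps_const_hom.map_poly_hom_smult)
  also have "\<dots> = (v - fps_const \<rho>) ^ 3 * poly (map_poly fps_const \<eta>) v"
  proof -
    have "v - fps_const \<rho> = fps_const (- \<rho>) + v"
      by (simp add: diff_conv_add_uminus add.commute del: add_uminus_conv_diff)
    thus ?thesis unfolding \<eta>(1) by (simp only: fc.hom_mult fc.hom_power poly_mult poly_power)
      (simp add: fps_const_hom.map_poly_pCons_hom)
  qed
  also have "\<dots> = fps_X ^ 3 * poly (map_poly fps_const Q) v"
  proof -
    have "v - fps_const \<rho> = fps_X * Y" by (simp add: v_def)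
    thus ?thesis by (simp only: power_mult_distrib mult.assoc eq)
  qed
  finally have "poly (map_poly fps_const P) v = (fps_const ?t + fps_X ^ 3) * poly (map_poly fps_const Q) v"
    by (simp add: algebra_simps)
  moreover have "fps_nth v 0 = \<rho>" "fps_nth v 1 \<noteq> 0" using y00 Y(2) by (simp_all add: v_def One_nat_def)
  ultimately show ?thesis using that by blast
qed

end

lemma field_homD:
  assumes "field_hom \<sigma>"
  shows "\<sigma> 0 = 0" "\<sigma> 1 = 1" "\<sigma> (a + b) = \<sigma> a + \<sigma> b" "\<sigma> (a * b) = \<sigma> a * \<sigma> b" "\<sigma> (- a) = - \<sigma> a"
    "\<sigma> (inverse a) = inverse (\<sigma> a)"
proof -
  interpret field_hom \<sigma> by fact
  show "\<sigma> 0 = 0" "\<sigma> 1 = 1" "\<sigma> (a + b) = \<sigma> a + \<sigma> b" "\<sigma> (a * b) = \<sigma> a * \<sigma> b" "\<sigma> (- a) = - \<sigma> a"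
    "\<sigma> (inverse a) = inverse (\<sigma> a)"
    by (simp_all add: hom_distribs)
qed

lemma field_hom_comp: "field_hom \<sigma> \<Longrightarrow> field_hom \<tau> \<Longrightarrow> field_hom (\<lambda>z. \<sigma> (\<tau> z))"
  unfolding hom_on_UNIV_iff[symmetric] hom_on_def by simp

lemma field_hom_ident: "field_hom (\<lambda>z. z)"
  unfolding hom_on_UNIV_iff[symmetric] hom_on_def by simp

lemma extend_to_alg_closure:
  fixes \<psi> :: "'q::field \<Rightarrow> 'b::alg_closed_field"
  assumes "field_hom \<psi>"
  obtains \<epsilon> where "field_hom \<epsilon>" "\<And>q. \<epsilon> (to_ac q) = \<psi> q"
proof -
  have h: "hom_on (range to_ac) (\<lambda>y. \<psi> (of_ac y))"
    unfolding hom_on_def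
  proof (intro conjI ballI)
    show "\<psi> (of_ac 1) = 1" using of_ac_eqI[OF to_ac_1] field_homD(2)[OF assms] by simp
    fix a b :: "'q alg_closure" assume "a \<in> range to_ac" "b \<in> range to_ac"
    then obtain q q' where q: "a = to_ac q" "b = to_ac q'" by blast
    have "of_ac (a + b) = q + q'" "of_ac (a * b) = q * q'" by (auto intro!: of_ac_eqI simp: q)
    thus "\<psi> (of_ac (a + b)) = \<psi> (of_ac a) + \<psi> (of_ac b)" "\<psi> (of_ac (a * b)) = \<psi> (of_ac a) * \<psi> (of_ac b)"
      by (simp_all add: q field_homD(3,4)[OF assms])
  qed
  obtain \<epsilon> where "field_hom \<epsilon>" "\<And>y. y \<in> range to_ac \<Longrightarrow> \<epsilon> y = \<psi> (of_ac y)"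
    using extend_hom[OF is_subfield_range_to_ac algebraic_over_range_to_ac h] by blast
  thus ?thesis using that[of \<epsilon>] by simp
qed

lemma field_hom_fls_compose:
  fixes \<omega> :: "'c::field"
  assumes "\<omega> \<noteq> 0"
  shows "field_hom (\<lambda>g. fls_compose_fps g (fps_const \<omega> * fps_X))"
proof -
  have H: "fps_const \<omega> * fps_X \<noteq> 0" "fps_nth (fps_const \<omega> * fps_X) 0 = 0" using assms by simp_all
  have "hom_on UNIV (\<lambda>g. fls_compose_fps g (fps_const \<omega> * fps_X))"
    unfolding hom_on_def by (simp add: fls_compose_fps_add[OF H] fls_compose_fps_mult[OF H] H)
  thus ?thesis by (simp only: hom_on_UNIV_iff)
qed

lemma map_root_prod:
  assumes "field_hom \<sigma>"
  shows "map_poly \<sigma> (\<Prod>i\<in>A. [:- xs i, 1:]) = (\<Prod>i\<in>A. [:- \<sigma> (xs i), 1:])"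
proof -
  interpret field_hom \<sigma> by fact
  interpret mp: map_poly_idom_hom \<sigma> ..
  show ?thesis by (simp only: mp.hom_prod) (simp add: hom_distribs)
qed

lemma card_separable_roots:
  fixes p :: "'a::alg_closed_field poly"
  assumes "lead_coeff p = 1" "\<And>y. poly p y = 0 \<Longrightarrow> poly (pderiv p) y \<noteq> 0"
  shows "card {y. poly p y = 0} = degree p"
proof -
  obtain \<alpha> where \<alpha>: "p = root_prod (degree p) \<alpha>" using monic_splits[OF assms(1) refl] .
  define N where "N = degree p"
  have p: "p = root_prod N \<alpha>" using \<alpha> by (simp add: N_def)
  have "inj_on \<alpha> {1..N}" by (rule root_prod_inj) (use assms(2) p in blast)
  moreover have "{y. poly p y = 0} = \<alpha> ` {1..N}" unfolding p root_prod_root_iff by blast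
  ultimately show ?thesis by (simp add: card_image N_def)
qed

text \<open>The roots are numbered so that the last one is the generic point \<open>x\<close>
  itself; the index \<open>N\<close> therefore stands for \<open>x\<close> from here on.\<close>

locale mestre_roots = mestre_cover +
  fixes xs :: "nat \<Rightarrow> 'a poly fract alg_closure"
  assumes f_eq: "f = root_prod N xs" and xs_N: "xs N = x"
begin

lemma inj_xs: "inj_on xs {1..N}"
  by (rule root_prod_inj) (simp only: f_eq[symmetric] f_separable not_False_eq_True)

lemma root_iff: "poly f y = 0 \<longleftrightarrow> (\<exists>i\<in>{1..N}. y = xs i)"
  unfolding f_eq by (rule root_prod_root_iff)

definition stab :: "('a poly fract alg_closure \<Rightarrow> 'a poly fract alg_closure) \<Rightarrow> bool" where
  "stab \<sigma> \<longleftrightarrow> field_hom \<sigma> \<and> (\<forall>c. \<sigma> (\<kappa> c) = \<kappa> c) \<and> \<sigma> t = t"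

lemma stab_f: "stab \<sigma> \<Longrightarrow> map_poly \<sigma> f = f"
proof -
  assume s: "stab \<sigma>"
  then interpret s: field_hom \<sigma> by (simp add: stab_def)
  show ?thesis using s by (intro poly_eqI) (simp add: f_def stab_def hom_distribs)
qed

lemma stab_perm:
  assumes "stab \<sigma>"
  obtains p where "p permutes {1..N}" "\<And>i. i \<in> {1..N} \<Longrightarrow> \<sigma> (xs i) = xs (p i)"
proof (rule hom_permutes_roots[OF inj_xs])
  have s: "field_hom \<sigma>" using assms by (simp add: stab_def)
  show "inj \<sigma>" by (rule field_hom_inj[OF s])
  fix i assume "i \<in> {1..N}"
  hence "poly f (xs i) = 0" using root_iff by blast
  hence "poly f (\<sigma> (xs i)) = 0"
    using poly_field_hom[OF s, of f "xs i"] stab_f[OF assms] field_homD(1)[OF s] by simp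
  thus "\<sigma> (xs i) \<in> xs ` {1..N}" using root_iff by blast
qed (use that in blast)

text \<open>The geometric monodromy group as permutations of root indices. It is described through
  endomorphisms of the whole algebraic closure over the constants and \<open>t\<close>, so no group
  of automorphisms has to be set up.\<close>

definition G :: "(nat \<Rightarrow> nat) set" where
  "G = {p. p permutes {1..N} \<and> (\<exists>\<sigma>. stab \<sigma> \<and> (\<forall>i\<in>{1..N}. \<sigma> (xs i) = xs (p i)))}"

sublocale perm_subgroup N G
proof
  show "p permutes {1..N}" if "p \<in> G" for p using that by (simp add: G_def)
  have "stab (\<lambda>z. z)" by (simp add: stab_def field_hom_ident)
  thus "id \<in> G" by (auto simp: G_def permutes_id)
  fix p q assume pq: "p \<in> G" "q \<in> G"
  then obtain \<sigma> \<tau> where s: "stab \<sigma>" "\<forall>i\<in>{1..N}. \<sigma> (xs i) = xs (p i)" and t: "stab \<tau>" "\<forall>i\<in>{1..N}. \<tau> (xs i) = xs (q i)"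
    by (auto simp: G_def)
  have "stab (\<lambda>z. \<sigma> (\<tau> z))" using s t field_hom_comp by (auto simp: stab_def)
  moreover have "\<forall>i\<in>{1..N}. \<sigma> (\<tau> (xs i)) = xs ((p \<circ> q) i)"
    using s t permutes_in_image[of q "{1..N}"] pq by (auto simp: G_def)
  moreover have "p \<circ> q permutes {1..N}" using pq by (auto simp: G_def intro: permutes_compose)
  ultimately show "p \<circ> q \<in> G" unfolding G_def by blast
qed

text \<open>The inertia group at a critical point: the substitution \<open>s \<mapsto> \<omega> s\<close>, with \<open>\<omega>\<close> a primitive cube
  root of unity and \<open>s ^ 3 = t - t\<^sub>0\<close>, permutes the roots by a three-cycle through \<open>x\<close>.\<close>

lemma critical_inertia:
  assumes \<rho>: "poly R \<rho> = 0"
  obtains v v2 v3 :: "'a fps" and i1 i2 and \<epsilon> :: "'a poly fract alg_closure \<Rightarrow> 'a fls alg_closure"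
  where "fps_nth v 0 = \<rho>" "v \<noteq> fps_const (fps_nth v 0)" "fps_nth v2 0 = \<rho>" "fps_nth v3 0 = \<rho>"
    "v2 \<noteq> v" "v3 \<noteq> v" "v2 \<noteq> v3"
    "poly (map_poly fps_const P) v = (fps_const (poly P \<rho> / poly Q \<rho>) + fps_X ^ 3) * poly (map_poly fps_const Q) v"
    "field_hom \<epsilon>" "\<And>q. \<epsilon> (to_ac q) = to_ac (fract_eval fls_const (fps_to_fls v) q)"
    "i1 \<in> {1..N}" "i2 \<in> {1..N}" "linked N i1" "linked N i2"
    "\<epsilon> (xs i1) = to_ac (fps_to_fls v2)" "\<epsilon> (xs i2) = to_ac (fps_to_fls v3)"
proof -
  interpret fc: map_poly_inj_comm_ring_hom "fps_const :: 'a \<Rightarrow> 'a fps" ..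
  let ?t = "poly P \<rho> / poly Q \<rho>"
  obtain v where v: "fps_nth v 0 = \<rho>" "fps_nth v 1 \<noteq> 0"
    "poly (map_poly fps_const P) v = (fps_const ?t + fps_X ^ 3) * poly (map_poly fps_const Q) v"
    using critical_parameter[OF \<rho>] .
  have vnc: "v \<noteq> fps_const (fps_nth v 0)" using v(2) by (metis fps_nth_fps_const One_nat_def nat.distinct(1))
  \<comment> \<open>A root of X^2 + X + 1 is a primitive cube root of unity.\<close>
  obtain \<omega> :: 'a where \<omega>: "\<omega> ^ 2 + \<omega> + 1 = 0"
    using alg_closed_imp_poly_has_root[of "[:1, 1, 1::'a:]"] by (auto simp: power2_eq_square algebra_simps)
  have \<omega>3: "\<omega> ^ 3 = 1"
  proof -
    have "\<omega> ^ 3 - 1 = (\<omega> - 1) * (\<omega> ^ 2 + \<omega> + 1)" by (simp add: algebra_simps power2_eq_square power3_eq_cube)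
    thus ?thesis using \<omega> by simp
  qed
  have \<omega>1: "\<omega> \<noteq> 1" using \<omega> by auto
  have \<omega>0: "\<omega> \<noteq> 0" using \<omega>3 by auto
  define H where "H = fps_const \<omega> * fps_X"
  have H: "H \<noteq> 0" "fps_nth H 0 = 0" using \<omega>0 by (auto simp: H_def)
  define S where "S = (\<lambda>g. fls_compose_fps g H)"
  have S_hom: "field_hom S" unfolding S_def H_def by (rule field_hom_fls_compose[OF \<omega>0])
  interpret S: field_hom S by (rule S_hom)
  have S_fps: "S (fps_to_fls g) = fps_to_fls (fps_compose g H)" for g unfolding S_def using H by simp
  have comp_nth: "fps_nth (fps_compose g H) n = \<omega> ^ n * fps_nth g n" for g n
    by (simp add: H_def fps_compose_linear)
  define v2 where "v2 = fps_compose v H"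
  define v3 where "v3 = fps_compose v2 H"
  have v31: "fps_compose v3 H = v"
  proof (rule fps_ext)
    fix n
    have "fps_nth (fps_compose v3 H) n = (\<omega> ^ 3) ^ n * fps_nth v n"
      by (simp add: v3_def v2_def comp_nth power3_eq_cube power_mult_distrib mult_ac)
    thus "fps_nth (fps_compose v3 H) n = fps_nth v n" by (simp add: \<omega>3)
  qed
  have c0: "fps_nth v2 0 = \<rho>" "fps_nth v3 0 = \<rho>" by (simp_all add: v2_def v3_def comp_nth v(1))
  have c1: "fps_nth v2 1 = \<omega> * fps_nth v 1" "fps_nth v3 1 = \<omega> * (\<omega> * fps_nth v 1)"
    by (simp_all add: v2_def v3_def comp_nth)
  have ne: "v2 \<noteq> v" "v2 \<noteq> v3" "v3 \<noteq> v"
  proof -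
    show "v2 \<noteq> v" using c1 v(2) \<omega>1 by auto
    show "v2 \<noteq> v3" using c1 v(2) \<omega>1 \<omega>0 by auto
    show "v3 \<noteq> v"
    proof
      assume "v3 = v"
      hence "v = fps_compose v H" using v31 by simp
      thus False using \<open>v2 \<noteq> v\<close> by (simp add: v2_def)
    qed
  qed
  text \<open>The other roots of the fibre polynomial lift by Hensel's lemma.\<close>
  define F where "F = map_poly fps_const P - smult (fps_const ?t + fps_X ^ 3) (map_poly fps_const Q)"
  have resF: "residue_poly F = P - smult ?t Q" unfolding F_def by (rule poly_eqI) (simp add: coeff_map_poly)
  obtain \<eta> where \<eta>: "P - smult ?t Q = [:- \<rho>, 1:] ^ 3 * \<eta>" "poly \<eta> \<rho> \<noteq> 0"
    "\<And>y. poly \<eta> y = 0 \<Longrightarrow> poly (pderiv \<eta>) y \<noteq> 0" "lead_coeff \<eta> = 1" "N = 3 + degree \<eta>"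
    using critical_fibre[OF \<rho>] by metis
  define Z where "Z = {y. poly \<eta> y = 0}"
  have cardZ: "card Z = N - 3" "finite Z"
  proof -
    show "card Z = N - 3" using card_separable_roots[OF \<eta>(4) \<eta>(3)] \<eta>(5) by (simp add: Z_def)
    have "\<eta> \<noteq> 0" using \<eta>(2) by auto
    thus "finite Z" unfolding Z_def by (rule poly_roots_finite)
  qed
  have "\<exists>w. poly F w = 0 \<and> fps_nth w 0 = \<beta>" if "\<beta> \<in> Z" for \<beta>
  proof -
    have \<beta>: "poly \<eta> \<beta> = 0" "\<beta> \<noteq> \<rho>" using that \<eta>(2) by (auto simp: Z_def)
    have 1: "poly (residue_poly F) \<beta> = 0" unfolding resF \<eta>(1) using \<beta> by simp
    have "poly (pderiv (residue_poly F)) \<beta> = (\<beta> - \<rho>) ^ 3 * poly (pderiv \<eta>) \<beta>"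
      unfolding resF \<eta>(1) using \<beta>(1) by (simp only: pderiv_mult poly_add poly_mult poly_power) simp
    hence 2: "poly (pderiv (residue_poly F)) \<beta> \<noteq> 0" using \<beta> \<eta>(3) by simp
    show ?thesis using hensel_fps[OF 1 2] by metis
  qed
  then obtain w where w: "\<And>\<beta>. \<beta> \<in> Z \<Longrightarrow> poly F (w \<beta>) = 0" "\<And>\<beta>. \<beta> \<in> Z \<Longrightarrow> fps_nth (w \<beta>) 0 = \<beta>" by metis
  \<comment> \<open>Three expansions with constant term \<rho> and one for each of the N - 3 simple
    roots of the special fibre: N distinct roots, hence all of them.\<close>
  define Y where "Y = fps_to_fls ` ({v, v2, v3} \<union> w ` Z)"
  have cardY: "card Y = N" "finite Y"
  proof -
    have injw: "inj_on w Z" by (rule inj_onI) (metis w(2))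
    have "w ` Z \<inter> {v, v2, v3} = {}" using w(2) v(1) c0 \<eta>(2) by (auto simp: Z_def)
    hence "card ({v, v2, v3} \<union> w ` Z) = card {v, v2, v3} + card (w ` Z)"
      using cardZ by (intro card_Un_disjoint) auto
    also have "\<dots> = N" using ne \<eta>(5) cardZ by (simp add: card_image[OF injw])
    finally show "card Y = N" unfolding Y_def by (subst card_image) (auto simp: inj_on_def)
    show "finite Y" using cardZ by (simp add: Y_def)
  qed
  define f2 where "f2 = fls_of_poly F"
  have f2_fixed: "map_poly S f2 = f2"
  proof -
    have "fps_compose (fps_const ?t + fps_X ^ 3) H = fps_const ?t + fps_X ^ 3"
      using \<omega>3 by (intro fps_ext) (auto simp: comp_nth)
    moreover have "fps_compose (fps_const c) H = fps_const c" for c by simp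
    ultimately have "fps_compose (coeff F n) H = coeff F n" for n
      by (simp add: F_def coeff_map_poly fps_compose_sub_distrib fps_compose_mult_distrib[OF H(2)])
    thus ?thesis unfolding f2_def by (intro poly_eqI) (simp add: S_fps)
  qed
  have S_root: "poly f2 (S y) = 0" if "poly f2 y = 0" for y
    using poly_field_hom[OF S_hom, of f2 y] f2_fixed that by simp
  have Fv: "poly F v = 0" unfolding F_def using v(3) by simp
  have Y_root: "poly f2 y = 0" if "y \<in> Y" for y
  proof -
    have v1: "poly f2 (fps_to_fls v) = 0" using Fv by (simp add: f2_def)
    have v2: "poly f2 (fps_to_fls v2) = 0" using S_root[OF v1] by (simp add: S_fps v2_def)
    have v3: "poly f2 (fps_to_fls v3) = 0" using S_root[OF v2] by (simp add: S_fps v3_def)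
    show ?thesis using that v1 v2 v3 w(1) by (auto simp: Y_def f2_def)
  qed
  text \<open>Embed the algebraic closure of the function field.\<close>
  let ?\<xi> = "fps_to_fls v"
  let ?\<theta> = "fract_eval fls_const ?\<xi>"
  have tr: "p = 0" if "poly (map_poly fls_const p) ?\<xi> = 0" for p
    by (rule transcendental_fps[OF vnc that])
  have \<theta>: "field_hom ?\<theta>" "?\<theta> (to_fract a) = poly (map_poly fls_const a) ?\<xi>" for a
    using fract_eval[OF fls_const_hom.field_hom_axioms, of ?\<xi>] tr by blast+
  obtain \<epsilon> where \<epsilon>: "field_hom \<epsilon>" and \<epsilon>_ac: "\<And>q. \<epsilon> (to_ac q) = to_ac (?\<theta> q)"
    using extend_to_alg_closure[OF field_hom_comp[OF to_ac_hom.field_hom_axioms \<theta>(1)]] by blast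
  interpret e: field_hom \<epsilon> by (rule \<epsilon>)
  have \<epsilon>_inj: "inj \<epsilon>" by (rule field_hom_inj[OF \<epsilon>])
  have \<epsilon>_\<kappa>: "\<epsilon> (\<kappa> c) = to_ac (fls_const c)" for c by (simp add: \<kappa>_def \<epsilon>_ac \<theta>(2) hom_distribs)
  have \<epsilon>_x: "\<epsilon> x = to_ac ?\<xi>" by (simp add: x_def \<epsilon>_ac \<theta>(2) hom_distribs)
  have Qv: "poly (map_poly fps_const Q) v \<noteq> 0"
    using poly_fps_const_nth_0[of Q v] crit_Q[OF \<rho>] v(1) by auto
  have \<epsilon>_t: "\<epsilon> t = to_ac (fps_to_fls (fps_const ?t + fps_X ^ 3))"
  proof -
    have m: "map_poly \<epsilon> (map_poly \<kappa> p) = map_poly to_ac (map_poly fls_const p)" for p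
      by (rule poly_eqI) (simp add: \<epsilon>_\<kappa>)
    have ev: "\<epsilon> (poly (map_poly \<kappa> p) x) = to_ac (fps_to_fls (poly (map_poly fps_const p) v))" for p
      using poly_field_hom[OF \<epsilon>, of "map_poly \<kappa> p" x] by (simp add: m \<epsilon>_x poly_fls_const_fps)
    show ?thesis unfolding t_def using Qv by (simp add: divide_inverse field_homD[OF \<epsilon>] ev v(3) fls_times_fps_to_fls)
  qed
  have g2: "map_poly \<epsilon> f = map_poly to_ac f2"
    by (rule poly_eqI) (simp add: f_def f2_def F_def \<epsilon>_\<kappa> \<epsilon>_t hom_distribs fls_times_fps_to_fls)
  have roots: "(\<lambda>i. \<epsilon> (xs i)) ` {1..N} = to_ac ` Y"
  proof -
    have "map_poly \<epsilon> f = root_prod N (\<lambda>i. \<epsilon> (xs i))"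
      unfolding f_eq root_prod_def by (rule map_root_prod[OF \<epsilon>])
    hence r: "{y. poly (map_poly to_ac f2) y = 0} = (\<lambda>i. \<epsilon> (xs i)) ` {1..N}"
      unfolding g2[symmetric] by (auto simp only: root_prod_root_iff)
    have "to_ac ` Y \<subseteq> (\<lambda>i. \<epsilon> (xs i)) ` {1..N}" unfolding r[symmetric] using Y_root by auto
    moreover have "card (to_ac ` Y) = N" using cardY by (subst card_image) (auto simp: inj_on_def)
    moreover have "card ((\<lambda>i. \<epsilon> (xs i)) ` {1..N}) \<le> N" using card_image_le[of "{1..N}"] by simp
    ultimately show ?thesis using card_seteq[of "(\<lambda>i. \<epsilon> (xs i)) ` {1..N}" "to_ac ` Y"] by simp
  qed
  have S_in_Y: "S y \<in> Y" if "y \<in> Y" for y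
  proof -
    have "poly (map_poly to_ac f2) (to_ac (S y)) = 0" using S_root[OF Y_root[OF that]] by simp
    hence "poly (map_poly \<epsilon> f) (to_ac (S y)) = 0" by (simp only: g2)
    moreover have "map_poly \<epsilon> f = root_prod N (\<lambda>i. \<epsilon> (xs i))"
      unfolding f_eq root_prod_def by (rule map_root_prod[OF \<epsilon>])
    ultimately have "to_ac (S y) \<in> (\<lambda>i. \<epsilon> (xs i)) ` {1..N}" by (auto simp only: root_prod_root_iff)
    thus ?thesis unfolding roots by auto
  qed
  \<comment> \<open>The substitution preserves constant terms, and a root whose constant term is a
    simple root of the special fibre is determined by it.\<close>
  have S_w: "S (fps_to_fls (w \<beta>)) = fps_to_fls (w \<beta>)" if "\<beta> \<in> Z" for \<beta>
  proof -
    have "S (fps_to_fls (w \<beta>)) \<in> Y" using that by (intro S_in_Y) (auto simp: Y_def)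
    hence "fps_compose (w \<beta>) H \<in> {v, v2, v3} \<union> w ` Z" unfolding S_fps Y_def by auto
    moreover have n0: "fps_nth (fps_compose (w \<beta>) H) 0 = \<beta>" by (simp add: comp_nth w(2)[OF that])
    moreover have "\<beta> \<noteq> \<rho>" using that \<eta>(2) by (auto simp: Z_def)
    ultimately obtain \<beta>' where "\<beta>' \<in> Z" "fps_compose (w \<beta>) H = w \<beta>'" using v(1) c0 by auto
    hence "fps_compose (w \<beta>) H = w \<beta>" using n0 w(2) by metis
    thus ?thesis by (simp add: S_fps)
  qed
  have ex: "\<exists>i\<in>{1..N}. \<epsilon> (xs i) = to_ac y" if "y \<in> Y" for y
    using roots that by (metis (no_types, lifting) imageE imageI)
  obtain i1 where i1: "i1 \<in> {1..N}" "\<epsilon> (xs i1) = to_ac (fps_to_fls v2)" using ex[of "fps_to_fls v2"] by (auto simp: Y_def)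
  obtain i2 where i2: "i2 \<in> {1..N}" "\<epsilon> (xs i2) = to_ac (fps_to_fls v3)" using ex[of "fps_to_fls v3"] by (auto simp: Y_def)
  have NN: "N \<in> {1..N}" using N by simp
  have iN: "\<epsilon> (xs N) = to_ac (fps_to_fls v)" by (simp add: xs_N \<epsilon>_x)
  have dist: "distinct [N, i1, i2]"
    using i1 i2 iN ne by auto
  text \<open>Pull the substitution back along the embedding.\<close>
  define M where "M = {y. \<epsilon> y \<in> range to_ac \<and> to_ac (S (of_ac (\<epsilon> y))) \<in> range \<epsilon>}"
  define \<phi> where "\<phi> y = inv_into UNIV \<epsilon> (to_ac (S (of_ac (\<epsilon> y))))" for y
  have MI: "y \<in> M" if "\<epsilon> y = to_ac q" "to_ac (S q) = \<epsilon> z" for y q z using that by (auto simp: M_def)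
  have ME: "\<exists>q z. \<epsilon> y = to_ac q \<and> to_ac (S q) = \<epsilon> z" if "y \<in> M" for y
    using that unfolding M_def by (force simp: to_ac_of_ac)
  have \<phi>I: "\<phi> y = z" if "\<epsilon> y = to_ac q" "to_ac (S q) = \<epsilon> z" for y q z
    using that by (simp add: \<phi>_def inv_into_f_f[OF \<epsilon>_inj])
  have M: "is_subfield M" unfolding is_subfield_def
  proof (intro conjI ballI)
    show "0 \<in> M" by (rule MI[of 0 0 0]) auto
    show "1 \<in> M" by (rule MI[of 1 1 1]) auto
    fix a assume "a \<in> M"
    then obtain q z where a: "\<epsilon> a = to_ac q" "to_ac (S q) = \<epsilon> z" using ME by blast
    show "- a \<in> M" by (rule MI[of _ "- q" "- z"]) (simp_all add: a hom_distribs)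
    show "inverse a \<in> M" by (rule MI[of _ "inverse q" "inverse z"]) (simp_all add: a hom_distribs)
    fix b assume "b \<in> M"
    then obtain q' z' where b: "\<epsilon> b = to_ac q'" "to_ac (S q') = \<epsilon> z'" using ME by blast
    show "a + b \<in> M" by (rule MI[of _ "q + q'" "z + z'"]) (simp_all add: a b hom_distribs)
    show "a * b \<in> M" by (rule MI[of _ "q * q'" "z * z'"]) (simp_all add: a b hom_distribs)
  qed
  have hom: "hom_on M \<phi>" unfolding hom_on_def
  proof (intro conjI ballI)
    show "\<phi> 1 = 1" by (rule \<phi>I[of _ 1]) auto
    fix a b assume "a \<in> M" "b \<in> M"
    then obtain q z q' z' where a: "\<epsilon> a = to_ac q" "to_ac (S q) = \<epsilon> z" and b: "\<epsilon> b = to_ac q'" "to_ac (S q') = \<epsilon> z'"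
      using ME by meson
    have "\<phi> a = z" "\<phi> b = z'" using \<phi>I a b by blast+
    moreover have "\<phi> (a + b) = z + z'" by (rule \<phi>I[of _ "q + q'"]) (simp_all add: a b hom_distribs)
    moreover have "\<phi> (a * b) = z * z'" by (rule \<phi>I[of _ "q * q'"]) (simp_all add: a b hom_distribs)
    ultimately show "\<phi> (a + b) = \<phi> a + \<phi> b" "\<phi> (a * b) = \<phi> a * \<phi> b" by simp_all
  qed
  have S_const: "S (fls_const c) = fls_const c" for c by (simp add: S_def)
  have \<kappa>M: "\<kappa> c \<in> M" "\<phi> (\<kappa> c) = \<kappa> c" for c
    using MI[OF \<epsilon>_\<kappa>, of c "\<kappa> c"] \<phi>I[OF \<epsilon>_\<kappa>, of c "\<kappa> c"] by (simp_all add: S_const \<epsilon>_\<kappa>)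
  have S_t: "S (fps_to_fls (fps_const ?t + fps_X ^ 3)) = fps_to_fls (fps_const ?t + fps_X ^ 3)"
    unfolding S_fps using \<omega>3 by (intro arg_cong[of _ _ fps_to_fls] fps_ext) (auto simp: comp_nth)
  have tM: "t \<in> M" "\<phi> t = t"
    using MI[OF \<epsilon>_t, of t] \<phi>I[OF \<epsilon>_t, of t] by (simp_all only: S_t \<epsilon>_t)
  have xM: "xs N \<in> M" "\<phi> (xs N) = xs i1"
    using MI[OF iN, of "xs i1"] \<phi>I[OF iN, of "xs i1"] by (simp_all add: S_fps v2_def[symmetric] i1(2))
  have x1M: "xs i1 \<in> M" "\<phi> (xs i1) = xs i2"
    using MI[OF i1(2), of "xs i2"] \<phi>I[OF i1(2), of "xs i2"] by (simp_all add: S_fps v3_def[symmetric] i2(2))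
  have x2M: "xs i2 \<in> M" "\<phi> (xs i2) = xs N"
    using MI[OF i2(2), of "xs N"] \<phi>I[OF i2(2), of "xs N"] by (simp_all add: S_fps v31 iN)
  have x3M: "xs i \<in> M" "\<phi> (xs i) = xs i" if i: "i \<in> {1..N}" "i \<notin> {N, i1, i2}" for i
  proof -
    have "\<epsilon> (xs i) \<in> to_ac ` Y" unfolding roots[symmetric] using i by blast
    then obtain y where y: "y \<in> Y" "\<epsilon> (xs i) = to_ac y" by blast
    have inj': "\<epsilon> (xs i) \<noteq> \<epsilon> (xs j)" if "j \<in> {1..N}" "i \<noteq> j" for j
      using \<epsilon>_inj inj_xs that i(1) by (metis injD inj_onD)
    have "y \<noteq> fps_to_fls v" "y \<noteq> fps_to_fls v2" "y \<noteq> fps_to_fls v3"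
      using inj'[OF NN] inj'[OF i1(1)] inj'[OF i2(1)] i(2) y(2) iN i1(2) i2(2) by auto
    then obtain \<beta> where "\<beta> \<in> Z" "y = fps_to_fls (w \<beta>)" using y(1) by (auto simp: Y_def)
    hence "S y = y" using S_w by simp
    thus "xs i \<in> M" "\<phi> (xs i) = xs i" using MI[OF y(2), of "xs i"] \<phi>I[OF y(2), of "xs i"] y(2) by simp_all
  qed
  \<comment> \<open>The domain \<open>M\<close> of the pulled-back substitution contains all
    rational functions of \<open>x\<close>, so the closure is algebraic over \<open>M\<close> and
    the map extends to an endomorphism.\<close>
  have "range to_ac \<subseteq> M"
  proof
    fix y :: "'a poly fract alg_closure" assume "y \<in> range to_ac"
    then obtain q where q: "y = to_ac q" by blast
    obtain a b where ab: "q = to_fract a / to_fract b" by (rule fract_rep)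
    have pM: "poly (map_poly \<kappa> p) x \<in> M" for p
      using xM(1) \<kappa>M(1) unfolding xs_N by (intro poly_in_subfield[OF M]) (auto simp: polys_over_def)
    have "y = poly (map_poly \<kappa> a) x / poly (map_poly \<kappa> b) x" unfolding q ab by (simp add: eval_x)
    thus "y \<in> M" using is_subfieldD(8)[OF M pM pM] by simp
  qed
  hence algM: "algebraic_over M y" for y
    using algebraic_over_range_to_ac[of y] unfolding algebraic_over_def polys_over_def by blast
  obtain \<sigma> where \<sigma>: "field_hom \<sigma>" "\<And>y. y \<in> M \<Longrightarrow> \<sigma> y = \<phi> y"
    using extend_hom[OF M algM hom] by blast
  have "stab \<sigma>" unfolding stab_def using \<sigma> \<kappa>M tM by auto
  moreover have "\<sigma> (xs i) = xs (cyc3 N i1 i2 i)" if "i \<in> {1..N}" for i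
    unfolding cyc3_apply[OF dist] using \<sigma>(2) xM x1M x2M x3M[OF that] by auto
  moreover have "cyc3 N i1 i2 permutes {1..N}"
    by (rule permutes_subset[OF cycle_permutes[of "[N, i1, i2]"]]) (use NN i1(1) i2(1) in auto)
  ultimately have inG: "cyc3 N i1 i2 \<in> G" unfolding G_def by blast
  have l1: "linked N i1" unfolding linked_def using inG dist NN i1(1) i2(1) by blast
  have l2: "linked i1 i2" unfolding linked_def using rotate_in[OF dist inG] dist NN i1(1) i2(1)
    by (intro disjI2 exI[of _ N]) auto
  show ?thesis
    using that[OF v(1) vnc c0 ne(1) ne(3) ne(2) v(3) \<epsilon> \<epsilon>_ac i1(1) i2(1) l1 linked_trans[OF l1 l2] i1(2) i2(2)] .
qed

end

section \<open>The cofactor of the roots linked to x\<close>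

context mestre_roots
begin

text \<open>\<open>\<kappa>0\<close>, \<open>x0\<close> and \<open>t0\<close> are the elements
  \<kappa>, \<open>x\<close> and \<open>t\<close> before the passage to the algebraic closure; at
  this level rational functions can be expanded at chosen points.\<close>

definition \<kappa>0 :: "'a \<Rightarrow> 'a poly fract" where "\<kappa>0 c = to_fract [:c:]"
definition x0 :: "'a poly fract" where "x0 = to_fract [:0, 1:]"
definition t0 :: "'a poly fract" where "t0 = to_fract P / to_fract Q"

definition J :: "nat set" where "J = {j \<in> {1..N}. linked N j}"
definition B where "B = (\<Prod>j\<in>J. [:- xs j, 1:])"
definition C where "C = (\<Prod>j\<in>{1..N} - J. [:- xs j, 1:])"

lemma N_in_J: "N \<in> J"
  using N by (simp add: J_def linked_def)

lemma f_BC: "f = B * C"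
proof -
  have "{1..N} = J \<union> ({1..N} - J)" by (auto simp: J_def)
  thus ?thesis unfolding f_eq root_prod_def B_def C_def
    by (subst prod.union_disjoint[symmetric]) (auto simp: J_def)
qed

text \<open>Such an endomorphism fixes \<open>x\<close>, so its permutation fixes the index
  \<open>N\<close>; as linking is invariant under \<open>G\<close>, the class \<open>J\<close> of
  \<open>N\<close> is mapped to itself.\<close>

lemma BC_fixed:
  assumes \<sigma>: "field_hom \<sigma>" "\<And>q. \<sigma> (to_ac q) = to_ac q"
  shows "map_poly \<sigma> B = B" "map_poly \<sigma> C = C"
proof -
  have sx: "\<sigma> x = x" by (simp add: x_def \<sigma>(2))
  have st: "stab \<sigma>"
  proof -
    have "t = to_ac (to_fract P / to_fract Q)" by (simp add: t_def eval_x)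
    hence "\<sigma> t = t" by (simp only: \<sigma>(2))
    thus ?thesis by (simp add: stab_def \<sigma> \<kappa>_def)
  qed
  obtain p where p: "p permutes {1..N}" "\<And>i. i \<in> {1..N} \<Longrightarrow> \<sigma> (xs i) = xs (p i)" using stab_perm[OF st] by blast
  have pG: "p \<in> G" using p st by (auto simp: G_def)
  have NN: "N \<in> {1..N}" using N by simp
  have "xs (p N) = xs N" using p(2)[OF NN] sx by (simp add: xs_N)
  hence pN: "p N = N" using inj_xs NN permutes_in_image[OF p(1), of N] by (metis inj_onD)
  have pin: "i \<in> {1..N} \<Longrightarrow> p i \<in> {1..N}" for i using permutes_in_image[OF p(1)] by blast
  have JJ: "p i \<in> J" if "i \<in> J" for i
    using linked_invariant[OF pG, of N i] that pin unfolding J_def pN by blast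
  have injp: "inj p" by (rule permutes_inj[OF p(1)])
  have finJ: "finite J" by (simp add: J_def)
  have imJ: "p ` J = J" using JJ by (intro endo_inj_surj finJ inj_on_subset[OF injp]) auto
  have imJc: "p ` ({1..N} - J) = {1..N} - J"
    using permutes_image[OF p(1)] imJ injp by (simp add: image_set_diff)
  have gen: "map_poly \<sigma> (\<Prod>j\<in>A. [:- xs j, 1:]) = (\<Prod>j\<in>A. [:- xs j, 1:])" if A: "A \<subseteq> {1..N}" "p ` A = A" for A
  proof -
    have "map_poly \<sigma> (\<Prod>j\<in>A. [:- xs j, 1:]) = (\<Prod>j\<in>A. [:- xs (p j), 1:])"
      unfolding map_root_prod[OF \<sigma>(1)] using A(1) p(2) by (intro prod.cong) auto
    also have "\<dots> = (\<Prod>j\<in>p ` A. [:- xs j, 1:])"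
      by (subst prod.reindex) (auto intro: inj_on_subset[OF injp])
    finally show ?thesis using A(2) by simp
  qed
  show "map_poly \<sigma> B = B" unfolding B_def by (rule gen[OF _ imJ]) (auto simp: J_def)
  show "map_poly \<sigma> C = C" unfolding C_def by (rule gen[OF _ imJc]) auto
qed

lemma BC_rational:
  obtains B0 C0 where "B = map_poly to_ac B0" "C = map_poly to_ac C0"
    "B0 * C0 = map_poly \<kappa>0 P - smult t0 (map_poly \<kappa>0 Q)" "lead_coeff B0 = 1" "lead_coeff C0 = 1"
    "poly B0 x0 = 0" "degree C0 = N - card J"
proof -
  obtain B0 where B0: "B = map_poly to_ac B0" using fixed_poly_in_range_to_ac[OF BC_fixed(1)] by blast
  obtain C0 where C0: "C = map_poly to_ac C0" using fixed_poly_in_range_to_ac[OF BC_fixed(2)] by blast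
  have ta: "to_ac t0 = t" by (simp add: t_def t0_def eval_x)
  interpret tp: map_poly_inj_idom_hom "to_ac :: 'a poly fract \<Rightarrow> _" ..
  have "map_poly to_ac (B0 * C0) = map_poly to_ac (map_poly \<kappa>0 P - smult t0 (map_poly \<kappa>0 Q))"
  proof -
    have "map_poly to_ac (B0 * C0) = f" by (simp add: f_BC B0 C0 hom_distribs)
    also have "\<dots> = map_poly to_ac (map_poly \<kappa>0 P - smult t0 (map_poly \<kappa>0 Q))"
      unfolding f_def by (intro poly_eqI) (simp add: ta[symmetric] \<kappa>_def \<kappa>0_def coeff_map_poly)
    finally show ?thesis .
  qed
  hence eq: "B0 * C0 = map_poly \<kappa>0 P - smult t0 (map_poly \<kappa>0 Q)" by simp
  have "lead_coeff B = 1" "lead_coeff C = 1" by (simp_all add: B_def C_def lead_coeff_prod)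
  hence "to_ac (lead_coeff B0) = 1" "to_ac (lead_coeff C0) = 1" by (simp_all add: B0 C0)
  hence lc: "lead_coeff B0 = 1" "lead_coeff C0 = 1" by (metis to_ac_1 to_ac_eq_iff)+
  have "poly B x = 0" unfolding B_def poly_prod
    using N_in_J by (intro prod_zero) (auto simp: J_def xs_N[symmetric])
  hence "to_ac (poly B0 x0) = 0" by (simp add: B0 x_def x0_def)
  hence b: "poly B0 x0 = 0" by simp
  have "degree C0 = degree C" by (simp add: C0)
  also have "\<dots> = card ({1..N} - J)" unfolding C_def by (rule degree_prod_linear) simp
  also have "\<dots> = N - card J" by (subst card_Diff_subset) (auto simp: J_def)
  finally show ?thesis using that[OF B0 C0 eq lc b] by simp
qed

end

lemma fract_eval_data:
  fixes \<xi> :: "'a::field fls"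
  assumes tr: "\<forall>p. poly (map_poly fls_const p) \<xi> = 0 \<longrightarrow> p = 0"
  shows "field_hom (fract_eval fls_const \<xi>)"
    "fract_eval fls_const \<xi> (to_fract a) = poly (map_poly fls_const a) \<xi>"
  using fract_eval[OF fls_const_hom.field_hom_axioms, of \<xi>] tr by blast+

context mestre_roots
begin

text \<open>Expanding \<open>x\<close> as a Laurent series \<xi> carries the factorisation over the
  rational functions into one over Laurent series, where Gauss's lemma can be applied.\<close>

lemma local_factorization:
  fixes \<xi> :: "'a fls"
  assumes tr: "\<forall>p. poly (map_poly fls_const p) \<xi> = 0 \<longrightarrow> p = 0"
    and BC: "B0 * C0 = map_poly \<kappa>0 P - smult t0 (map_poly \<kappa>0 Q)"
  defines "\<theta> \<equiv> fract_eval fls_const \<xi>"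
  shows "map_poly \<theta> B0 * map_poly \<theta> C0 = map_poly fls_const P -
      smult (poly (map_poly fls_const P) \<xi> / poly (map_poly fls_const Q) \<xi>) (map_poly fls_const Q)"
    "\<theta> (poly p x0) = poly (map_poly \<theta> p) \<xi>"
proof -
  note \<theta> = fract_eval_data[OF tr, folded \<theta>_def]
  interpret th: field_hom \<theta> by (rule \<theta>(1))
  interpret tp: map_poly_inj_idom_hom \<theta> ..
  have k: "\<theta> (\<kappa>0 c) = fls_const c" for c by (simp add: \<kappa>0_def \<theta>(2) hom_distribs)
  have tt: "\<theta> t0 = poly (map_poly fls_const P) \<xi> / poly (map_poly fls_const Q) \<xi>"
    by (simp add: t0_def divide_inverse field_homD[OF \<theta>(1)] \<theta>(2))
  have k00: "\<kappa>0 0 = 0" by (simp add: \<kappa>0_def)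
  have "map_poly \<theta> (B0 * C0) = map_poly fls_const P - smult (\<theta> t0) (map_poly fls_const Q)"
    unfolding BC by (rule poly_eqI) (simp add: coeff_map_poly[where f=\<kappa>0, OF k00] k hom_distribs)
  thus "map_poly \<theta> B0 * map_poly \<theta> C0 = map_poly fls_const P -
      smult (poly (map_poly fls_const P) \<xi> / poly (map_poly fls_const Q) \<xi>) (map_poly fls_const Q)"
    by (simp add: tt hom_distribs)
  have "\<theta> x0 = \<xi>" by (simp add: x0_def \<theta>(2) hom_distribs)
  thus "\<theta> (poly p x0) = poly (map_poly \<theta> p) \<xi>" using poly_field_hom[OF \<theta>(1), of p x0] by simp
qed

text \<open>The cofactor of the linked roots, evaluated at \<open>x\<close>, is a rational function of \<open>x\<close> without
  zeros, but with a pole at infinity unless all roots are linked.\<close>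

lemma no_zero_noncritical:
  assumes BC: "B0 * C0 = map_poly \<kappa>0 P - smult t0 (map_poly \<kappa>0 Q)" "lead_coeff C0 = 1" "poly B0 x0 = 0"
    and uv: "poly C0 x0 = to_fract u / to_fract v" "poly u a = 0" "poly v a \<noteq> 0"
  shows "poly R a = 0"
proof -
  interpret fc: map_poly_inj_comm_ring_hom "fps_const :: 'a \<Rightarrow> 'a fps" ..
  \<comment> \<open>The expansion of \<open>x\<close> at the point \<open>a\<close>.\<close>
  define \<xi> where "\<xi> = fps_const a + fps_X"
  have \<xi>a: "fps_nth \<xi> 0 = a" by (simp add: \<xi>_def)
  have nc: "\<xi> \<noteq> fps_const (fps_nth \<xi> 0)"
  proof
    assume "\<xi> = fps_const (fps_nth \<xi> 0)"
    hence "fps_nth \<xi> 1 = 0" by (metis fps_nth_fps_const One_nat_def nat.distinct(1))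
    thus False by (simp add: \<xi>_def One_nat_def)
  qed
  have tr: "\<forall>p. poly (map_poly fls_const p) (fps_to_fls \<xi>) = 0 \<longrightarrow> p = 0"
    using transcendental_fps[OF nc] by blast
  let ?\<theta> = "fract_eval fls_const (fps_to_fls \<xi>)"
  note \<theta> = fract_eval_data[OF tr]
  interpret th: field_hom ?\<theta> by (rule \<theta>(1))
  let ?p = "\<lambda>p. poly (map_poly fps_const p) \<xi>"
  \<comment> \<open>Multiplying by Q(\<xi>) clears the denominator of t = P(\<xi>)/Q(\<xi>), because
    \<open>a\<close> may be a zero of \<open>Q\<close>.\<close>
  define A where "A = smult (fps_to_fls (?p Q)) (map_poly ?\<theta> B0)"
  define Ct where "Ct = map_poly ?\<theta> C0"
  define F where "F = smult (?p Q) (map_poly fps_const P) - smult (?p P) (map_poly fps_const Q)"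
  have Qn: "?p Q \<noteq> 0"
  proof
    assume "?p Q = 0"
    hence "poly (map_poly fls_const Q) (fps_to_fls \<xi>) = 0" by (simp add: poly_fls_const_fps)
    thus False using tr Q_nonzero by blast
  qed
  have AC: "A * Ct = fls_of_poly F"
  proof -
    have "A * Ct = smult (fps_to_fls (?p Q)) (map_poly ?\<theta> B0 * map_poly ?\<theta> C0)" by (simp add: A_def Ct_def)
    also have "map_poly ?\<theta> B0 * map_poly ?\<theta> C0 = map_poly fls_const P - smult (fps_to_fls (?p P) / fps_to_fls (?p Q)) (map_poly fls_const Q)"
      using local_factorization(1)[OF tr BC(1)] by (simp add: poly_fls_const_fps)
    also have "smult (fps_to_fls (?p Q)) \<dots> = fls_of_poly F"
      using Qn by (intro poly_eqI) (simp add: F_def coeff_map_poly fls_times_fps_to_fls right_diff_distrib)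
    finally show ?thesis .
  qed
  have lc: "lead_coeff Ct = 1" using BC(2) by (simp add: Ct_def)
  obtain z A' C' where z: "smult (fps_to_fls z) Ct = fls_of_poly C'" "A = smult (fps_to_fls z) (fls_of_poly A')" "F = A' * C'"
    using gauss_monic_factor[OF AC lc] .
  have z0: "z \<noteq> 0"
  proof
    assume "z = 0"
    hence "A = 0" using z(2) by simp
    hence "F = 0" using AC by simp
    hence "smult (?p Q) (map_poly fps_const P) = smult (?p P) (map_poly fps_const Q)" by (simp add: F_def)
    hence "degree (map_poly fps_const P) \<le> degree (map_poly fps_const Q)"
      using Qn by (metis degree_smult_eq degree_smult_le)
    thus False using degree_P degree_Q by simp
  qed
  have A\<xi>: "poly A' \<xi> = 0"
  proof -
    have "poly (map_poly ?\<theta> B0) (fps_to_fls \<xi>) = ?\<theta> (poly B0 x0)" using local_factorization(2)[OF tr BC(1), of B0] by simp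
    hence "poly A (fps_to_fls \<xi>) = 0" using BC(3) by (simp add: A_def)
    thus ?thesis unfolding z(2) using z0 by simp
  qed
  have "fps_nth (poly C' \<xi>) 0 = 0"
  proof -
    have vn: "fps_nth (?p v) 0 \<noteq> 0" using uv(3) by (simp add: poly_fps_const_nth_0 \<xi>a)
    hence vn0: "?p v \<noteq> 0" by auto
    have "poly Ct (fps_to_fls \<xi>) = ?\<theta> (poly C0 x0)" using local_factorization(2)[OF tr BC(1), of C0] by (simp add: Ct_def)
    also have "\<dots> = fps_to_fls (?p u) / fps_to_fls (?p v)"
      unfolding uv(1) by (simp add: divide_inverse field_homD[OF \<theta>(1)] \<theta>(2) poly_fls_const_fps)
    finally have "fps_to_fls (poly C' \<xi>) = fps_to_fls z * (fps_to_fls (?p u) / fps_to_fls (?p v))"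
      using arg_cong[OF z(1), of "\<lambda>p. poly p (fps_to_fls \<xi>)"] by simp
    hence "fps_to_fls (poly C' \<xi> * ?p v) = fps_to_fls (z * ?p u)" using vn0 by (simp add: fls_times_fps_to_fls)
    hence "poly C' \<xi> * ?p v = z * ?p u" by simp
    hence "fps_nth (poly C' \<xi>) 0 * fps_nth (?p v) 0 = fps_nth z 0 * fps_nth (?p u) 0" by (metis fps_mult_nth_0)
    thus ?thesis using vn uv(2) by (simp add: poly_fps_const_nth_0 \<xi>a)
  qed
  \<comment> \<open>Since \<xi> is a root of the first factor, the derivative of \<open>F\<close>
    there is a multiple of the cofactor's value; but it also equals R(\<xi>)^2. A zero of the
    cofactor at \<open>a\<close> thus forces R(a) = 0.\<close>
  moreover have "poly (pderiv F) \<xi> = poly (pderiv A') \<xi> * poly C' \<xi>" unfolding z(3) by (simp add: pderiv_mult A\<xi>)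
  moreover have "poly (pderiv F) \<xi> = ?p R ^ 2"
  proof -
    have pd: "pderiv (map_poly fps_const p) = map_poly fps_const (pderiv p)" for p :: "'a poly"
      by (rule poly_eqI) (simp add: coeff_pderiv coeff_map_poly fps_of_nat[symmetric] del: fps_of_nat of_nat_Suc)
    have "?p R ^ 2 = ?p (R ^ 2)" by (simp add: fc.hom_power)
    also have "\<dots> = ?p (pderiv P * Q - P * pderiv Q)" by (simp only: W)
    also have "\<dots> = poly (pderiv F) \<xi>" by (simp add: F_def pderiv_diff pderiv_smult pd fc.hom_minus fc.hom_mult algebra_simps)
    finally show ?thesis by simp
  qed
  ultimately have "fps_nth (?p R ^ 2) 0 = 0" by (metis fps_mult_nth_0 mult_zero_right)
  thus "poly R a = 0" by (simp add: fps_power_zeroth poly_fps_const_nth_0 \<xi>a)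
qed

text \<open>All three roots merging at the critical point \<open>a\<close> are linked to
  \<open>x\<close>, so the factor \<open>B0\<close> absorbs the whole triple root. The residue of
  the cofactor then divides \<eta>, which does not vanish at \<open>a\<close>.\<close>

lemma no_zero_critical:
  assumes BC: "B = map_poly to_ac B0" "B0 * C0 = map_poly \<kappa>0 P - smult t0 (map_poly \<kappa>0 Q)"
      "lead_coeff B0 = 1" "lead_coeff C0 = 1" "poly B0 x0 = 0"
    and uv: "poly C0 x0 = to_fract u / to_fract v" "poly u a = 0" "poly v a \<noteq> 0"
    and \<rho>: "poly R a = 0"
  shows False
proof -
  interpret fc: map_poly_inj_comm_ring_hom "fps_const :: 'a \<Rightarrow> 'a fps" ..
  let ?t = "poly P a / poly Q a"
  obtain w w2 w3 i1 i2 \<epsilon> where w: "fps_nth w 0 = a" "w \<noteq> fps_const (fps_nth w 0)" "fps_nth w2 0 = a" "fps_nth w3 0 = a"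
    "w2 \<noteq> w" "w3 \<noteq> w" "w2 \<noteq> w3"
    "poly (map_poly fps_const P) w = (fps_const ?t + fps_X ^ 3) * poly (map_poly fps_const Q) w"
    and \<epsilon>: "field_hom \<epsilon>" "\<And>q. \<epsilon> (to_ac q) = to_ac (fract_eval fls_const (fps_to_fls w) q)"
    and i: "i1 \<in> {1..N}" "i2 \<in> {1..N}" "linked N i1" "linked N i2"
    "\<epsilon> (xs i1) = to_ac (fps_to_fls w2)" "\<epsilon> (xs i2) = to_ac (fps_to_fls w3)"
    using critical_inertia[OF \<rho>] by metis
  have tr: "\<forall>p. poly (map_poly fls_const p) (fps_to_fls w) = 0 \<longrightarrow> p = 0"
    using transcendental_fps[OF w(2)] by blast
  let ?\<theta> = "fract_eval fls_const (fps_to_fls w)"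
  note \<theta> = fract_eval_data[OF tr]
  interpret th: field_hom ?\<theta> by (rule \<theta>(1))
  let ?p = "\<lambda>p. poly (map_poly fps_const p) w"
  define Bt where "Bt = map_poly ?\<theta> B0"
  define Ct where "Ct = map_poly ?\<theta> C0"
  have root: "poly Bt y = 0" if "j \<in> J" "\<epsilon> (xs j) = to_ac y" for j y
  proof -
    have "poly B (xs j) = 0" unfolding B_def poly_prod using that(1) by (intro prod_zero) (auto simp: J_def)
    hence "poly (map_poly \<epsilon> B) (\<epsilon> (xs j)) = 0" using poly_field_hom[OF \<epsilon>(1), of B "xs j"] field_homD(1)[OF \<epsilon>(1)] by simp
    moreover have "map_poly \<epsilon> B = map_poly to_ac Bt"
      unfolding BC(1) Bt_def using field_homD(1)[OF \<epsilon>(1)] by (intro poly_eqI) (simp add: \<epsilon>(2) coeff_map_poly)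
    ultimately show ?thesis by (simp add: that(2))
  qed
  have i12: "i1 \<in> J" "i2 \<in> J" using i by (auto simp: J_def)
  have r1: "poly Bt (fps_to_fls w) = 0"
    using local_factorization(2)[OF tr BC(2), of B0] BC(5) by (simp add: Bt_def)
  have r2: "poly Bt (fps_to_fls w2) = 0" by (rule root[OF i12(1) i(5)])
  have r3: "poly Bt (fps_to_fls w3) = 0" by (rule root[OF i12(2) i(6)])
  define L where "L y = [:- y, 1:]" for y :: "'a fps"
  have fL: "fls_of_poly (L y) = [:- fps_to_fls y, 1:]" for y by (simp add: L_def hom_distribs)
  obtain B1 where B1: "Bt = fls_of_poly (L w) * B1" using r1 unfolding fL by (metis dvdE poly_eq_0_iff_dvd)
  have "poly B1 (fps_to_fls w2) = 0" using r2 w(5) unfolding B1 fL by simp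
  then obtain B2 where B2: "B1 = fls_of_poly (L w2) * B2" unfolding fL by (metis dvdE poly_eq_0_iff_dvd)
  have "poly B2 (fps_to_fls w3) = 0" using r3 w(6,7) unfolding B1 B2 fL by auto
  then obtain B3 where B3: "B2 = fls_of_poly (L w3) * B3" unfolding fL by (metis dvdE poly_eq_0_iff_dvd)
  define F where "F = map_poly fps_const P - smult (fps_const ?t + fps_X ^ 3) (map_poly fps_const Q)"
  have resF: "residue_poly F = P - smult ?t Q" unfolding F_def by (rule poly_eqI) (simp add: coeff_map_poly)
  have Qn: "?p Q \<noteq> 0" using poly_fps_const_nth_0[of Q w] crit_Q[OF \<rho>] w(1) by auto
  have BtCt: "Bt * Ct = fls_of_poly F"
  proof -
    have "fps_to_fls (?p P) / fps_to_fls (?p Q) = fps_to_fls (fps_const ?t + fps_X ^ 3)"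
      using Qn by (simp add: w(8) fls_times_fps_to_fls)
    hence "Bt * Ct = map_poly fls_const P - smult (fps_to_fls (fps_const ?t + fps_X ^ 3)) (map_poly fls_const Q)"
      using local_factorization(1)[OF tr BC(2)] by (simp add: poly_fls_const_fps Bt_def Ct_def)
    also have "\<dots> = fls_of_poly F" by (intro poly_eqI) (simp add: F_def coeff_map_poly fls_times_fps_to_fls)
    finally show ?thesis .
  qed
  define LL where "LL = L w * L w2 * L w3"
  have eq: "(B3 * Ct) * fls_of_poly LL = fls_of_poly F"
    unfolding BtCt[symmetric] B1 B2 B3 LL_def by (simp only: fps_to_fls_poly_hom.hom_mult mult_ac)
  have resLL: "residue_poly LL = [:- a, 1:] ^ 3"
  proof -
    have "residue_poly (L y) = [:- fps_nth y 0, 1:]" for y by (simp add: L_def fps_nth_0_hom.map_poly_pCons_hom)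
    thus ?thesis unfolding LL_def fps_nth_0_poly_hom.hom_mult w(1,3,4) by (simp only: w power3_eq_cube)
  qed
  obtain D where D: "B3 * Ct = fls_of_poly D" using gauss_primitive[OF eq] resLL by auto
  have lC: "lead_coeff Ct = 1" using BC(4) by (simp add: Ct_def)
  have lB: "lead_coeff B3 = 1"
  proof -
    have "lead_coeff Bt = 1" using BC(3) by (simp add: Bt_def)
    moreover have "lead_coeff Bt = lead_coeff B3" unfolding B1 B2 B3 fL by (simp only: lead_coeff_mult) simp
    ultimately show ?thesis by simp
  qed
  \<comment> \<open>Both factors are monic, so neither needs a denominator and their residues
    multiply to \<eta>.\<close>
  obtain C' where C': "Ct = fls_of_poly C'" using gauss_monic[OF D lB lC] .
  have D': "Ct * B3 = fls_of_poly D" using D by (simp add: mult.commute)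
  obtain B' where B': "B3 = fls_of_poly B'" using gauss_monic[OF D' lC lB] .
  have "fls_of_poly (B' * C' * LL) = fls_of_poly F" using eq unfolding B' C' by (simp only: fps_to_fls_poly_hom.hom_mult)
  hence "B' * C' * LL = F" by simp
  hence "residue_poly B' * residue_poly C' * [:- a, 1:] ^ 3 = P - smult ?t Q"
    unfolding resF[symmetric] resLL[symmetric] by (simp only: fps_nth_0_poly_hom.hom_mult[symmetric])
  moreover obtain \<eta> where \<eta>: "P - smult ?t Q = [:- a, 1:] ^ 3 * \<eta>" "poly \<eta> a \<noteq> 0"
    using critical_fibre[OF \<rho>] by metis
  ultimately have "[:- a, 1:] ^ 3 * (residue_poly B' * residue_poly C') = [:- a, 1:] ^ 3 * \<eta>" by (simp only: mult_ac)
  hence "residue_poly B' * residue_poly C' = \<eta>" by (subst (asm) mult_cancel_left) auto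
  hence Ca: "poly (residue_poly C') a \<noteq> 0" using \<eta>(2) by auto
  have "fps_nth (poly C' w) 0 = poly (residue_poly C') a"
    using fps_nth_0_hom.poly_map_poly[of C' w] w(1) by simp
  moreover have "fps_nth (poly C' w) 0 = 0"
  proof -
    have vn: "fps_nth (?p v) 0 \<noteq> 0" using uv(3) by (simp add: poly_fps_const_nth_0 w(1))
    hence vn0: "?p v \<noteq> 0" by auto
    have "poly Ct (fps_to_fls w) = ?\<theta> (poly C0 x0)" using local_factorization(2)[OF tr BC(2), of C0] by (simp add: Ct_def)
    also have "\<dots> = fps_to_fls (?p u) / fps_to_fls (?p v)"
      unfolding uv(1) by (simp add: divide_inverse field_homD[OF \<theta>(1)] \<theta>(2) poly_fls_const_fps)
    finally have "fps_to_fls (poly C' w) = fps_to_fls (?p u) / fps_to_fls (?p v)" by (simp add: C')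
    hence "fps_to_fls (poly C' w * ?p v) = fps_to_fls (?p u)" using vn0 by (simp add: fls_times_fps_to_fls)
    hence "poly C' w * ?p v = ?p u" by simp
    hence "fps_nth (poly C' w) 0 * fps_nth (?p v) 0 = fps_nth (?p u) 0" by (metis fps_mult_nth_0)
    thus ?thesis using vn uv(2) by (simp add: poly_fps_const_nth_0 w(1))
  qed
  ultimately show False using Ca by simp
qed

end

section \<open>Expansion at infinity and the monodromy theorem\<close>

text \<open>Multiplying the value at 1/X by X to the degree reverses the coefficient
  sequence.\<close>

lemma poly_at_infinity:
  fixes K :: "'a::field fps poly"
  assumes "K \<noteq> 0"
  shows "fls_X ^ degree K * poly (fls_of_poly K) (inverse fls_X) = fps_to_fls (poly (reflect_poly K) fps_X)"
    "fps_nth (poly (reflect_poly K) fps_X) 0 = fps_nth (lead_coeff K) 0"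
proof -
  have r: "reflect_poly (fls_of_poly K) = fls_of_poly (reflect_poly K)"
    by (rule poly_eqI) (simp add: coeff_reflect_poly)
  have "poly (reflect_poly (fls_of_poly K)) fls_X = fls_X ^ degree K * poly (fls_of_poly K) (inverse fls_X)"
    by (subst poly_reflect_poly_nz) auto
  moreover have "fls_X = fps_to_fls (fps_X :: 'a fps)" by simp
  ultimately show "fls_X ^ degree K * poly (fls_of_poly K) (inverse fls_X) = fps_to_fls (poly (reflect_poly K) fps_X)"
    unfolding r by (metis fps_to_fls_hom.poly_map_poly)
  have "fps_nth (poly (reflect_poly K) fps_X) 0 = poly (residue_poly (reflect_poly K)) 0"
    using fps_nth_0_hom.poly_map_poly[of "reflect_poly K" fps_X] by simp
  also have "\<dots> = fps_nth (lead_coeff K) 0" by (simp add: poly_0_coeff_0)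
  finally show "fps_nth (poly (reflect_poly K) fps_X) 0 = fps_nth (lead_coeff K) 0" .
qed

lemma poly_const_at_infinity:
  fixes p :: "'a::field poly"
  assumes "p \<noteq> 0"
  obtains g where "fls_X ^ degree p * poly (map_poly fls_const p) (inverse fls_X) = fps_to_fls g"
    "fps_nth g 0 = lead_coeff p"
proof -
  let ?K = "map_poly fps_const p"
  have K0: "?K \<noteq> 0" using assms by (metis coeff_0 fps_const_hom.coeff_map_poly_hom fps_const_eq_0_iff leading_coeff_0_iff)
  have "fls_of_poly ?K = map_poly fls_const p" by (rule poly_eqI) (simp add: coeff_map_poly)
  thus ?thesis using poly_at_infinity[OF K0] that[of "poly (reflect_poly ?K) fps_X"] by simp
qed

context mestre_roots
begin

text \<open>Because deg P = deg Q + 1, \<open>t\<close> has at most a simple pole at x = infinity,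
  and only the root \<open>x\<close> itself tends to infinity there: after division by it, the other
  roots are roots of a monic integral polynomial. The cofactor is monic with integral coefficients,
  so at x = 1/X its leading term dominates and its pole has order equal to its degree.\<close>

lemma pole_at_infinity:
  assumes dQ: "Suc (degree Q) = N"
    and BC: "B0 * C0 = map_poly \<kappa>0 P - smult t0 (map_poly \<kappa>0 Q)"
      "lead_coeff B0 = 1" "lead_coeff C0 = 1" "poly B0 x0 = 0"
    and uv: "poly C0 x0 = to_fract u / to_fract v" "u \<noteq> 0" "v \<noteq> 0"
  shows "degree u = degree C0 + degree v"
proof -
  let ?\<xi> = "inverse fls_X :: 'a fls"
  have X0: "fls_X \<noteq> (0 :: 'a fls)" by simp
  have nz: "poly (map_poly fls_const p) ?\<xi> \<noteq> 0" if p: "p \<noteq> 0" for p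
  proof
    assume a: "poly (map_poly fls_const p) ?\<xi> = 0"
    obtain g where "fls_X ^ degree p * poly (map_poly fls_const p) ?\<xi> = fps_to_fls g" "fps_nth g 0 = lead_coeff p"
      using poly_const_at_infinity[OF p] .
    hence "g = 0" using a by simp
    thus False using \<open>fps_nth g 0 = lead_coeff p\<close> p by simp
  qed
  hence tr: "\<forall>p. poly (map_poly fls_const p) ?\<xi> = 0 \<longrightarrow> p = 0" by blast
  let ?\<theta> = "fract_eval fls_const ?\<xi>"
  note \<theta> = fract_eval_data[OF tr]
  interpret th: field_hom ?\<theta> by (rule \<theta>(1))
  define Bt where "Bt = map_poly ?\<theta> B0"
  define Ct where "Ct = map_poly ?\<theta> C0"
  let ?e = "\<lambda>p. poly (map_poly fls_const p) ?\<xi>"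
  have P0: "P \<noteq> 0" using monic_P by auto
  obtain gP where gP: "fls_X ^ N * ?e P = fps_to_fls gP" using poly_const_at_infinity[OF P0] degree_P by metis
  obtain gQ where gQ: "fls_X ^ degree Q * ?e Q = fps_to_fls gQ" "fps_nth gQ 0 = lead_coeff Q"
    using poly_const_at_infinity[OF Q_nonzero] .
  have gQ0: "fps_nth gQ 0 \<noteq> 0" using gQ(2) Q_nonzero by simp
  \<comment> \<open>X t is a power series, since the degrees of \<open>P\<close> and
    \<open>Q\<close> differ by one.\<close>
  have st: "fls_X * (?e P / ?e Q) = fps_to_fls (gP * inverse gQ)"
  proof -
    have "fls_X * (?e P / ?e Q) = (fls_X ^ N * ?e P) / (fls_X ^ degree Q * ?e Q)"
      using X0 nz[OF Q_nonzero] by (simp add: dQ[symmetric])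
    also have "\<dots> = fps_to_fls gP / fps_to_fls gQ" by (simp only: gP gQ(1))
    also have "\<dots> = fps_to_fls (gP * inverse gQ)"
    proof -
      have "gQ * inverse gQ = 1" using gQ0 by (metis inverse_mult_eq_1 mult.commute)
      hence "fps_to_fls gQ * fps_to_fls (inverse gQ) = 1" by (simp only: fls_times_fps_to_fls[symmetric] fps_to_fls_eq_1_iff)
      moreover have "fps_to_fls gQ \<noteq> 0" using gQ0 by auto
      ultimately show ?thesis by (simp add: fls_times_fps_to_fls divide_eq_eq mult.assoc mult.commute[of "fps_to_fls (inverse gQ)"])
    qed
    finally show ?thesis .
  qed
  have "poly Bt ?\<xi> = 0" using local_factorization(2)[OF tr BC(1), of B0] BC(4) by (simp add: Bt_def)
  then obtain B1 where B1: "Bt = [:- ?\<xi>, 1:] * B1" by (metis dvdE poly_eq_0_iff_dvd)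
  define F where "F = smult fps_X (map_poly fps_const P) - smult (gP * inverse gQ) (map_poly fps_const Q)"
  \<comment> \<open>The linear factor of the root 1/X is scaled to X Y - 1, which is integral and
    has nonzero residue, so it can be divided out by Gauss's lemma.\<close>
  have eq: "(B1 * Ct) * fls_of_poly [:- 1, fps_X:] = fls_of_poly F"
  proof -
    have "fls_of_poly [:- 1, fps_X :: 'a fps:] = smult fls_X [:- ?\<xi>, 1:]" using X0 by (simp add: hom_distribs)
    hence "(B1 * Ct) * fls_of_poly [:- 1, fps_X:] = smult fls_X (Bt * Ct)" unfolding B1 by (simp only: mult_smult_right mult_ac)
    also have "\<dots> = smult fls_X (map_poly fls_const P - smult (?e P / ?e Q) (map_poly fls_const Q))"
      unfolding Bt_def Ct_def by (simp only: local_factorization(1)[OF tr BC(1)])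
    also have "\<dots> = fls_of_poly F"
    proof (rule poly_eqI)
      fix n
      have "coeff (smult fls_X (map_poly fls_const P - smult (?e P / ?e Q) (map_poly fls_const Q))) n =
        fls_X * fls_const (coeff P n) - (fls_X * (?e P / ?e Q)) * fls_const (coeff Q n)"
        by (simp add: right_diff_distrib)
      also have "\<dots> = coeff (fls_of_poly F) n" unfolding st by (simp add: F_def coeff_map_poly fls_times_fps_to_fls)
      finally show "coeff (smult fls_X (map_poly fls_const P - smult (?e P / ?e Q) (map_poly fls_const Q))) n = coeff (fls_of_poly F) n" .
    qed
    finally show ?thesis .
  qed
  have res: "residue_poly [:- 1, fps_X :: 'a fps:] \<noteq> 0" by (simp add: fps_nth_0_hom.map_poly_pCons_hom)
  obtain D where D: "B1 * Ct = fls_of_poly D" using gauss_primitive[OF eq res] .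
  have lC: "lead_coeff Ct = 1" using BC(3) by (simp add: Ct_def)
  have lB: "lead_coeff B1 = 1"
  proof -
    have "lead_coeff Bt = 1" using BC(2) by (simp add: Bt_def)
    moreover have "lead_coeff Bt = lead_coeff B1" unfolding B1 by (simp only: lead_coeff_mult) simp
    ultimately show ?thesis by simp
  qed
  obtain C' where C': "Ct = fls_of_poly C'" using gauss_monic[OF D lB lC] .
  have dC: "degree C' = degree C0"
  proof -
    have "degree Ct = degree C0" by (simp add: Ct_def)
    thus ?thesis by (simp add: C')
  qed
  have "fps_to_fls (lead_coeff C') = 1" using lC by (simp add: C')
  hence lC': "lead_coeff C' = 1" by simp
  hence C'0: "C' \<noteq> 0" by auto
  define g where "g = poly (reflect_poly C') fps_X"
  have g: "fls_X ^ degree C0 * poly Ct ?\<xi> = fps_to_fls g" "fps_nth g 0 = 1"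
    using poly_at_infinity[OF C'0] lC' by (simp_all add: g_def C' dC)
  obtain gu where gu: "fls_X ^ degree u * ?e u = fps_to_fls gu" "fps_nth gu 0 = lead_coeff u"
    using poly_const_at_infinity[OF uv(2)] .
  obtain gv where gv: "fls_X ^ degree v * ?e v = fps_to_fls gv" "fps_nth gv 0 = lead_coeff v"
    using poly_const_at_infinity[OF uv(3)] .
  have "poly Ct ?\<xi> = ?e u / ?e v"
    using local_factorization(2)[OF tr BC(1), of C0] unfolding uv(1) Ct_def
    by (simp add: divide_inverse field_homD[OF \<theta>(1)] \<theta>(2))
  hence prod: "poly Ct ?\<xi> * ?e v = ?e u" using nz[OF uv(3)] by simp
  have "fls_X ^ degree u * (fls_X ^ degree C0 * poly Ct ?\<xi>) * (fls_X ^ degree v * ?e v) =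
    fls_X ^ (degree C0 + degree v) * (fls_X ^ degree u * (poly Ct ?\<xi> * ?e v))" by (simp only: power_add mult_ac)
  hence "fls_X ^ degree u * fps_to_fls g * fps_to_fls gv = fls_X ^ (degree C0 + degree v) * fps_to_fls gu"
    by (simp only: prod g(1) gu(1) gv(1))
  hence "fps_to_fls (fps_X ^ degree u * (g * gv)) = fps_to_fls (fps_X ^ (degree C0 + degree v) * gu)"
    by (simp add: fls_times_fps_to_fls fps_to_fls_power mult.assoc)
  hence e: "fps_X ^ degree u * (g * gv) = fps_X ^ (degree C0 + degree v) * gu" by simp
  have "fps_nth (g * gv) 0 \<noteq> 0" "fps_nth gu 0 \<noteq> 0" using g(2) gv(2) gu(2) uv by simp_all
  moreover from this have "g * gv \<noteq> 0" "gu \<noteq> 0" by auto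
  ultimately have "subdegree (fps_X ^ degree u * (g * gv)) = degree u"
    "subdegree (fps_X ^ (degree C0 + degree v) * gu) = degree C0 + degree v"
    by (subst subdegree_mult; force simp: subdegree_eq_0_iff)+
  thus ?thesis using e by simp
qed

text \<open>If some root were not linked to \<open>x\<close>, the numerator of the cofactor's value
  would have positive degree by the count at infinity, hence a zero, although neither a critical nor
  a noncritical point can be one. So all roots are linked.\<close>

theorem alternating_monodromy:
  assumes dQ: "Suc (degree Q) = N" and p: "p permutes {1..N}" "evenperm p"
  obtains \<sigma> where "field_hom \<sigma>" "\<And>c. \<sigma> (\<kappa> c) = \<kappa> c" "\<sigma> t = t" "\<And>i. i \<in> {1..N} \<Longrightarrow> \<sigma> (xs i) = xs (p i)"
proof -
  obtain B0 C0 where BC: "B = map_poly to_ac B0" "C = map_poly to_ac C0"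
    "B0 * C0 = map_poly \<kappa>0 P - smult t0 (map_poly \<kappa>0 Q)" "lead_coeff B0 = 1" "lead_coeff C0 = 1"
    "poly B0 x0 = 0" "degree C0 = N - card J"
    using BC_rational .
  have JN: "J = {1..N}"
  proof (rule ccontr)
    assume "J \<noteq> {1..N}"
    hence "J \<subset> {1..N}" by (auto simp: J_def)
    hence "card J < N" using psubset_card_mono[of "{1..N}" J] by simp
    hence dC: "degree C0 > 0" using BC(7) by simp
    obtain u v where uv: "poly C0 x0 = to_fract u / to_fract v" "v \<noteq> 0" "\<And>a. poly u a = 0 \<Longrightarrow> poly v a \<noteq> 0"
      using fract_coprime_rep[of "poly C0 x0"] by metis
    have "poly C x \<noteq> 0"
    proof -
      have "x - xs j \<noteq> 0" if "j \<in> {1..N} - J" for j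
      proof
        assume "x - xs j = 0"
        hence "xs N = xs j" by (simp add: xs_N)
        hence "N = j" using inj_onD[OF inj_xs, of N j] that N by auto
        thus False using that N_in_J by simp
      qed
      thus ?thesis by (simp add: C_def poly_prod)
    qed
    moreover have "poly C x = to_ac (poly C0 x0)" by (simp add: BC(2) x_def x0_def)
    ultimately have "u \<noteq> 0" using uv by auto
    hence "degree u = degree C0 + degree v" using pole_at_infinity[OF dQ BC(3-6) uv(1) _ uv(2)] by blast
    then obtain a where a: "poly u a = 0" using alg_closed_imp_poly_has_root[of u] dC by auto
    have "poly R a = 0" by (rule no_zero_noncritical[OF BC(3,5,6) uv(1) a uv(3)[OF a]])
    thus False by (rule no_zero_critical[OF BC(1,3-6) uv(1) a uv(3)[OF a]])
  qed
  have link: "linked N i" if "i \<in> {1..N}" for i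
  proof -
    have "i \<in> J" using that by (simp only: JN)
    thus ?thesis by (simp only: J_def mem_Collect_eq simp_thms)
  qed
  have "p \<in> G" by (rule contains_alternating[OF link p])
  then obtain \<sigma> where \<sigma>: "stab \<sigma>" "\<forall>i\<in>{1..N}. \<sigma> (xs i) = xs (p i)" unfolding G_def by blast
  show ?thesis by (rule that[of \<sigma>]) (use \<sigma> in \<open>simp_all add: stab_def\<close>)
qed

end

section \<open>Resultants and Vandermonde products\<close>

text \<open>The rows of the Sylvester matrix are the coefficients of monomial multiples of
  \<open>p\<close> and \<open>q\<close>. Multiplying by columns of powers of the roots evaluates
  them: multiples of \<open>p\<close> give 0 and multiples of \<open>q\<close> give a Vandermonde
  matrix times the diagonal of values of \<open>q\<close>. The remaining block is triangular with
  the leading coefficient of \<open>p\<close> on its diagonal, and distinct roots allow the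
  Vandermonde determinant to be cancelled.\<close>

lemma resultant_roots:
  fixes p q :: "'a::field poly"
  assumes inj: "inj_on \<gamma> {1..degree p}" and root: "\<And>k. k \<in> {1..degree p} \<Longrightarrow> poly p (\<gamma> k) = 0"
  shows "resultant p q = lead_coeff p ^ degree q * (\<Prod>k\<in>{1..degree p}. poly q (\<gamma> k))"
proof -
  define m where "m = degree p"
  define n where "n = degree q"
  let ?S = "sylvester_mat p q"
  \<comment> \<open>Exponents decrease because the Sylvester matrix lists coefficients from the
    highest down. \<open>V\<close> is the bottom part of the column block, \<open>Vt\<close> its
    continuation to the larger powers.\<close>
  define V where "V = mat m m (\<lambda>(i, k). \<gamma> (Suc k) ^ (m - 1 - i))"
  define Vt where "Vt = mat n m (\<lambda>(i, k). \<gamma> (Suc k) ^ (m + n - 1 - i))"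
  define Wm where "Wm = four_block_mat (1\<^sub>m n) Vt (0\<^sub>m m n) V"
  define Tm where "Tm = mat n n (\<lambda>(i, k). ?S $$ (i, k))"
  define Bm where "Bm = mat m n (\<lambda>(i, k). ?S $$ (n + i, k))"
  define Dm where "Dm = mat m m (\<lambda>(i, k). \<gamma> (Suc k) ^ (m - 1 - i) * poly q (\<gamma> (Suc k)))"
  have Sc: "?S \<in> carrier_mat (n + m) (n + m)" using sylvester_carrier_mat[of p q] by (simp add: m_def n_def add.commute)
  have Wc: "Wm \<in> carrier_mat (n + m) (n + m)" by (auto simp: Wm_def V_def Vt_def)
  have idx: "?S $$ (i, j) = (if i < n then if i \<le> j \<and> j - i \<le> m then coeff p (m + i - j) else 0
     else if i - n \<le> j \<and> j \<le> i then coeff q (i - j) else 0)" if "i < m + n" "j < m + n" for i j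
    using sylvester_index_mat[of i p q j] that by (simp add: m_def n_def)
  have row1: "(\<Sum>j<m+n. ?S $$ (i, j) * g ^ (m + n - 1 - j)) = g ^ (n - 1 - i) * poly p g" if i: "i < n" for i and g :: 'a
  proof -
    have "(\<Sum>j<m+n. ?S $$ (i, j) * g ^ (m + n - 1 - j)) = (\<Sum>j\<in>{i..i+m}. coeff p (m + i - j) * g ^ (m + n - 1 - j))"
      using i by (intro sum.mono_neutral_cong_right) (auto simp: idx)
    also have "\<dots> = (\<Sum>k\<le>m. coeff p k * g ^ (k + (n - 1 - i)))"
      by (rule sum.reindex_bij_witness[of _ "\<lambda>k. m + i - k" "\<lambda>j. m + i - j"])
         (use i in \<open>auto intro!: arg_cong2[where f="(*)"] arg_cong2[where f=power]\<close>)
    also have "\<dots> = g ^ (n - 1 - i) * poly p g"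
      by (simp add: poly_altdef m_def power_add sum_distrib_left mult_ac)
    finally show ?thesis .
  qed
  have row2: "(\<Sum>j<m+n. ?S $$ (n + i, j) * g ^ (m + n - 1 - j)) = g ^ (m - 1 - i) * poly q g" if i: "i < m" for i and g :: 'a
  proof -
    have "(\<Sum>j<m+n. ?S $$ (n + i, j) * g ^ (m + n - 1 - j)) = (\<Sum>j\<in>{i..i+n}. coeff q (n + i - j) * g ^ (m + n - 1 - j))"
      using i by (intro sum.mono_neutral_cong_right) (auto simp: idx)
    also have "\<dots> = (\<Sum>k\<le>n. coeff q k * g ^ (k + (m - 1 - i)))"
      by (rule sum.reindex_bij_witness[of _ "\<lambda>k. n + i - k" "\<lambda>j. n + i - j"])
         (use i in \<open>auto intro!: arg_cong2[where f="(*)"] arg_cong2[where f=power]\<close>)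
    also have "\<dots> = g ^ (m - 1 - i) * poly q g"
      by (simp add: poly_altdef n_def power_add sum_distrib_left mult_ac)
    finally show ?thesis .
  qed
  have prod: "?S * Wm = four_block_mat Tm (0\<^sub>m n m) Bm Dm"
  proof (rule eq_matI)
    fix i k assume "i < dim_row (four_block_mat Tm (0\<^sub>m n m) Bm Dm)" "k < dim_col (four_block_mat Tm (0\<^sub>m n m) Bm Dm)"
    hence ik: "i < n + m" "k < n + m" by (simp_all add: Tm_def Dm_def)
    have "(?S * Wm) $$ (i, k) = (\<Sum>j<m+n. ?S $$ (i, j) * Wm $$ (j, k))"
    proof -
      have dims: "dim_row ?S = m + n" "dim_col ?S = m + n" "dim_row Wm = m + n" "dim_col Wm = m + n"
        using carrier_matD[OF Sc] carrier_matD[OF Wc] by linarith+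
      have "i < m + n" "k < m + n" using ik by simp_all
      thus ?thesis using dims by (simp add: scalar_prod_def atLeast0LessThan)
    qed
    also have "\<dots> = four_block_mat Tm (0\<^sub>m n m) Bm Dm $$ (i, k)"
    proof (cases "k < n")
      case True
      have "(\<Sum>j<m+n. ?S $$ (i, j) * Wm $$ (j, k)) = (\<Sum>j<m+n. if j = k then ?S $$ (i, k) else 0)"
        using True by (intro sum.cong) (auto simp: Wm_def V_def Vt_def)
      also have "\<dots> = ?S $$ (i, k)" using ik by simp
      also have "\<dots> = four_block_mat Tm (0\<^sub>m n m) Bm Dm $$ (i, k)"
        using ik True by (auto simp: Tm_def Bm_def Dm_def)
      finally show ?thesis .
    next
      case False
      let ?g = "\<gamma> (Suc (k - n))"
      have kr: "Suc (k - n) \<in> {1..degree p}" using ik False by (auto simp: m_def)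
      have W: "Wm $$ (j, k) = ?g ^ (m + n - 1 - j)" if "j < m + n" for j
        using that ik False by (auto simp: Wm_def V_def Vt_def intro!: arg_cong2[where f=power])
      have "(\<Sum>j<m+n. ?S $$ (i, j) * Wm $$ (j, k)) = (\<Sum>j<m+n. ?S $$ (i, j) * ?g ^ (m + n - 1 - j))"
        by (intro sum.cong) (auto simp: W)
      also have "\<dots> = four_block_mat Tm (0\<^sub>m n m) Bm Dm $$ (i, k)"
      proof (cases "i < n")
        case True
        thus ?thesis using row1[OF True, of ?g] root[OF kr] ik False by (simp add: Tm_def Dm_def)
      next
        case i: False
        thus ?thesis using row2[of "i - n" ?g] ik False by (simp add: Tm_def Dm_def)
      qed
      finally show ?thesis .
    qed
    finally show "(?S * Wm) $$ (i, k) = four_block_mat Tm (0\<^sub>m n m) Bm Dm $$ (i, k)" .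
  qed (use Sc Wc in \<open>simp_all add: Tm_def Dm_def m_def n_def\<close>)
  have detW: "det Wm = det V"
    unfolding Wm_def by (subst det_four_block_mat_lower_left_zero[of _ n _ m]) (auto simp: V_def Vt_def)
  have detT: "det Tm = lead_coeff p ^ n"
  proof -
    have "upper_triangular Tm" by (auto simp: upper_triangular_def Tm_def idx)
    hence "det Tm = prod_list (diag_mat Tm)" by (rule det_upper_triangular[of _ n]) (simp add: Tm_def)
    also have "\<dots> = (\<Prod>i\<in>{0..<n}. Tm $$ (i, i))" by (simp add: prod_list_diag_prod Tm_def)
    also have "\<dots> = (\<Prod>i\<in>{0..<n}. lead_coeff p)" by (intro prod.cong) (auto simp: Tm_def idx m_def)
    finally show ?thesis by simp
  qed
  have detD: "det Dm = det V * (\<Prod>k\<in>{1..m}. poly q (\<gamma> k))"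
  proof -
    define E where "E = mat m m (\<lambda>(i, k). if i = k then poly q (\<gamma> (Suc k)) else 0)"
    have "Dm = V * E"
    proof (rule eq_matI)
      fix i k assume "i < dim_row (V * E)" "k < dim_col (V * E)"
      hence ik: "i < m" "k < m" by (simp_all add: V_def E_def)
      have "(V * E) $$ (i, k) = (\<Sum>j<m. V $$ (i, j) * E $$ (j, k))"
        using ik by (simp add: scalar_prod_def V_def E_def atLeast0LessThan)
      also have "\<dots> = (\<Sum>j<m. if j = k then V $$ (i, k) * poly q (\<gamma> (Suc k)) else 0)"
        using ik by (intro sum.cong) (auto simp: E_def)
      finally show "Dm $$ (i, k) = (V * E) $$ (i, k)" using ik by (simp add: Dm_def V_def)
    qed (simp_all add: V_def E_def Dm_def)
    hence "det Dm = det V * det E" using det_mult[of V m E] by (simp add: V_def E_def)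
    also have "det E = (\<Prod>i\<in>{0..<m}. E $$ (i, i))"
    proof -
      have "upper_triangular E" by (auto simp: upper_triangular_def E_def)
      hence "det E = prod_list (diag_mat E)" by (rule det_upper_triangular[of _ m]) (simp add: E_def)
      thus ?thesis by (simp add: prod_list_diag_prod E_def)
    qed
    also have "\<dots> = (\<Prod>k\<in>{1..m}. poly q (\<gamma> k))"
      by (rule prod.reindex_bij_witness[of _ "\<lambda>k. k - 1" Suc]) (auto simp: E_def)
    finally show ?thesis .
  qed
  have detV: "det V \<noteq> 0"
  proof
    assume "det V = 0"
    hence "det (transpose_mat V) = 0" by (subst det_transpose[of _ m]) (simp_all add: V_def)
    then obtain v where v: "v \<in> carrier_vec m" "v \<noteq> 0\<^sub>v m" "transpose_mat V *\<^sub>v v = 0\<^sub>v m"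
      using det_0_iff_vec_prod_zero_field[of "transpose_mat V" m] by (auto simp: V_def)
    define h where "h = (\<Sum>i<m. monom (v $ i) (m - 1 - i))"
    have hz: "poly h (\<gamma> k) = 0" if k: "k \<in> {1..m}" for k
    proof -
      obtain l where l: "k = Suc l" "l < m" using k by (cases k) auto
      have "(transpose_mat V *\<^sub>v v) $ l = (\<Sum>i<m. \<gamma> k ^ (m - 1 - i) * v $ i)"
        using l v(1) by (simp add: V_def scalar_prod_def atLeast0LessThan)
      thus ?thesis using v(3) l by (simp add: h_def poly_sum poly_monom mult.commute)
    qed
    have "v $ i = 0" if "i < m" for i
    proof -
      have "h = 0"
      proof (rule poly_eq_on_roots[of \<gamma> m])
        show "inj_on \<gamma> {1..m}" using inj by (simp add: m_def)
        have "degree h \<le> m - 1" unfolding h_def by (rule degree_sum_le) (auto intro: order.trans[OF degree_monom_le])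
        thus "degree h < m" using that by simp
      qed (use that hz in auto)
      moreover have "coeff h (m - 1 - i) = (\<Sum>j<m. if j = i then v $ i else 0)"
        unfolding h_def coeff_sum using that by (intro sum.cong) auto
      ultimately show ?thesis using that by simp
    qed
    hence "v = 0\<^sub>v m" using v(1) by (intro eq_vecI) auto
    thus False using v(2) by simp
  qed
  have "det ?S * det Wm = det (four_block_mat Tm (0\<^sub>m n m) Bm Dm)"
    using det_mult[OF Sc Wc] prod by simp
  also have "\<dots> = det Tm * det Dm"
    by (rule det_four_block_mat_upper_right_zero[of _ n _ m]) (auto simp: Tm_def Bm_def Dm_def)
  finally have "det ?S * det V = lead_coeff p ^ n * (det V * (\<Prod>k\<in>{1..m}. poly q (\<gamma> k)))"
    unfolding detW detT detD .
  hence "det ?S = lead_coeff p ^ n * (\<Prod>k\<in>{1..m}. poly q (\<gamma> k))" using detV by simp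
  thus ?thesis by (simp add: resultant_def m_def n_def)
qed

definition vdm :: "nat \<Rightarrow> (nat \<Rightarrow> 'a::field) \<Rightarrow> 'a" where
  "vdm N \<gamma> = (\<Prod>j\<in>{1..N}. \<Prod>i\<in>{1..<j}. \<gamma> i - \<gamma> j)"

lemma vdm_Suc: "vdm (Suc N) \<gamma> = vdm N \<gamma> * (\<Prod>i\<in>{1..N}. \<gamma> i - \<gamma> (Suc N))"
  by (simp add: vdm_def atLeastLessThanSuc_atLeastAtMost mult.commute)

lemma vdm_cong: "(\<And>i. i \<in> {1..N} \<Longrightarrow> \<gamma> i = \<delta> i) \<Longrightarrow> vdm N \<gamma> = vdm N \<delta>"
  unfolding vdm_def by (intro prod.cong) auto

lemma vdm_nonzero: "inj_on \<gamma> {1..N} \<Longrightarrow> vdm N \<gamma> \<noteq> 0"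
  by (auto simp: vdm_def dest: inj_onD)

text \<open>Induction on \<open>N\<close>: transpositions not touching the last index come from the
  induction hypothesis, the one of the last two indices is computed directly, and any other is a
  conjugate of it.\<close>

lemma vdm_transpose:
  assumes "a \<in> {1..N}" "b \<in> {1..N}" "a \<noteq> b"
  shows "vdm N (\<gamma> \<circ> transpose a b) = - vdm N \<gamma>"
  using assms
proof (induction N arbitrary: a b \<gamma>)
  case (Suc N)
  have inner: "vdm (Suc N) (\<gamma> \<circ> transpose a b) = - vdm (Suc N) \<gamma>" if ab: "a \<in> {1..N}" "b \<in> {1..N}" "a \<noteq> b" for a b and \<gamma> :: "nat \<Rightarrow> 'a"
  proof -
    have p: "transpose a b permutes {1..N}" using ab by (intro permutes_swap_id)
    have "(\<Prod>i\<in>{1..N}. (\<gamma> \<circ> transpose a b) i - (\<gamma> \<circ> transpose a b) (Suc N)) = (\<Prod>i\<in>{1..N}. \<gamma> (transpose a b i) - \<gamma> (Suc N))"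
      using ab by (intro prod.cong) (auto simp: transpose_def)
    also have "\<dots> = (\<Prod>i\<in>{1..N}. \<gamma> i - \<gamma> (Suc N))"
      using prod.permute[OF p, of "\<lambda>i. \<gamma> i - \<gamma> (Suc N)"] by (simp add: o_def)
    finally show ?thesis unfolding vdm_Suc Suc.IH[OF ab] by simp
  qed
  have adj: "vdm (Suc N) (\<gamma> \<circ> transpose N (Suc N)) = - vdm (Suc N) \<gamma>" if N1: "N \<ge> 1" for \<gamma> :: "nat \<Rightarrow> 'a"
  proof -
    obtain L where L: "N = Suc L" using N1 by (cases N) auto
    let ?t = "transpose N (Suc N)"
    have 1: "vdm L (\<gamma> \<circ> ?t) = vdm L \<gamma>" by (rule vdm_cong) (auto simp: L transpose_def)
    have 2: "(\<Prod>i\<in>{1..L}. (\<gamma> \<circ> ?t) i - (\<gamma> \<circ> ?t) N) = (\<Prod>i\<in>{1..L}. \<gamma> i - \<gamma> (Suc N))"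
      "(\<Prod>i\<in>{1..L}. (\<gamma> \<circ> ?t) i - (\<gamma> \<circ> ?t) (Suc N)) = (\<Prod>i\<in>{1..L}. \<gamma> i - \<gamma> N)"
      by (intro prod.cong; auto simp: L transpose_def)+
    have split: "vdm (Suc N) \<delta> = vdm L \<delta> * (\<Prod>i\<in>{1..L}. \<delta> i - \<delta> N) * ((\<Prod>i\<in>{1..L}. \<delta> i - \<delta> (Suc N)) * (\<delta> N - \<delta> (Suc N)))" for \<delta> :: "nat \<Rightarrow> 'a"
      unfolding vdm_Suc L by (simp add: vdm_Suc)
    show ?thesis unfolding split 1 2 by (simp add: algebra_simps)
  qed
  have main: "vdm (Suc N) (\<gamma> \<circ> transpose a b) = - vdm (Suc N) \<gamma>" if ab: "a \<in> {1..Suc N}" "b \<in> {1..Suc N}" "a < b" for a b and \<gamma> :: "nat \<Rightarrow> 'a"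
  proof (cases "b \<le> N")
    case True
    thus ?thesis using ab by (intro inner) auto
  next
    case False
    hence b: "b = Suc N" using ab by simp
    hence a: "a \<le> N" "1 \<le> N" using ab by auto
    show ?thesis
    proof (cases "a = N")
      case True thus ?thesis using adj a b by simp
    next
      case ne: False
      have "transpose a b = transpose a N \<circ> transpose N (Suc N) \<circ> transpose a N"
        using ne a b by (auto simp: fun_eq_iff transpose_def)
      hence "\<gamma> \<circ> transpose a b = ((\<gamma> \<circ> transpose a N) \<circ> transpose N (Suc N)) \<circ> transpose a N"
        by (simp only: o_assoc)
      moreover have aN: "a \<in> {1..N}" "N \<in> {1..N}" "a \<noteq> N" using ne a ab by auto
      ultimately show ?thesis by (simp only: inner[OF aN] adj[OF a(2)] minus_minus)
    qed
  qed
  show ?case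
  proof (cases "a < b")
    case True thus ?thesis using main Suc.prems by blast
  next
    case False
    hence "b < a" using Suc.prems by simp
    thus ?thesis using main[of b a \<gamma>] Suc.prems by (simp only: transpose_commute)
  qed
qed simp

lemma vdm_permute:
  assumes "p permutes {1..N}"
  shows "vdm N (\<gamma> \<circ> p) = of_int (sign p) * vdm N \<gamma>"
  using finite_atLeastAtMost[of 1 N] assms
proof (induction p arbitrary: \<gamma> rule: permutes_rev_induct)
  case id
  show ?case by simp
next
  case (swap a b p)
  show ?case
  proof (cases "a = b")
    case True thus ?thesis using swap by simp
  next
    case False
    have p: "permutation p" using swap by (auto simp: permutation_permutes)
    have "\<gamma> \<circ> (p \<circ> transpose a b) = (\<gamma> \<circ> p) \<circ> transpose a b" by (simp only: o_assoc)
    moreover have "vdm N ((\<gamma> \<circ> p) \<circ> transpose a b) = - vdm N (\<gamma> \<circ> p)"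
      using swap False by (intro vdm_transpose)
    moreover have "sign (p \<circ> transpose a b) = - sign p"
      using False by (subst sign_compose[OF p permutation_swap_id]) (simp add: sign_swap_id)
    ultimately show ?thesis using swap.IH[of \<gamma>] by (simp only: of_int_minus mult_minus_left)
  qed
qed

text \<open>Each difference occurs in the product of derivatives once with each sign, which accounts
  for the factor with exponent N (N - 1)/2. Up to that sign the product of derivatives at the roots
  is the discriminant of a monic polynomial.\<close>

lemma vdm_square:
  "vdm N \<gamma> ^ 2 = (- 1) ^ (N * (N - 1) div 2) * (\<Prod>i\<in>{1..N}. poly (pderiv (root_prod N \<gamma>)) (\<gamma> i))"
proof -
  have "(\<Prod>i\<in>{1..N}. poly (pderiv (root_prod N \<gamma>)) (\<gamma> i)) = (\<Prod>i\<in>{1..N}. \<Prod>j\<in>{1..N} - {i}. \<gamma> i - \<gamma> j)"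
    by (intro prod.cong refl) (simp only: poly_pderiv_root_prod poly_root_prod_del)
  moreover have "vdm N \<gamma> ^ 2 = (- 1) ^ (N * (N - 1) div 2) * (\<Prod>i\<in>{1..N}. \<Prod>j\<in>{1..N} - {i}. \<gamma> i - \<gamma> j)"
  proof (induction N)
    case 0 thus ?case by (simp add: vdm_def)
  next
    case (Suc N)
    let ?s = "\<gamma> (Suc N)"
    have I: "{1..Suc N} = insert (Suc N) {1..N}" by auto
    have 1: "(\<Prod>j\<in>{1..Suc N} - {i}. \<gamma> i - \<gamma> j) = (\<gamma> i - ?s) * (\<Prod>j\<in>{1..N} - {i}. \<gamma> i - \<gamma> j)" if "i \<in> {1..N}" for i
    proof -
      have "{1..Suc N} - {i} = insert (Suc N) ({1..N} - {i})" using that by auto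
      thus ?thesis by simp
    qed
    have 2: "{1..Suc N} - {Suc N} = {1..N}" by auto
    have 3: "(\<Prod>j\<in>{1..N}. ?s - \<gamma> j) = (- 1) ^ N * (\<Prod>j\<in>{1..N}. \<gamma> j - ?s)"
    proof -
      have "(\<Prod>j\<in>{1..N}. ?s - \<gamma> j) = (\<Prod>j\<in>{1..N}. (- 1) * (\<gamma> j - ?s))" by (intro prod.cong) auto
      thus ?thesis by (simp only: prod.distrib) simp
    qed
    have "(\<Prod>i\<in>{1..Suc N}. \<Prod>j\<in>{1..Suc N} - {i}. \<gamma> i - \<gamma> j) =
      (\<Prod>j\<in>{1..N}. ?s - \<gamma> j) * (\<Prod>i\<in>{1..N}. (\<gamma> i - ?s) * (\<Prod>j\<in>{1..N} - {i}. \<gamma> i - \<gamma> j))"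
      by (subst (1) I, subst prod.insert) (auto simp only: finite_atLeastAtMost atLeastAtMost_iff 2 1 intro!: arg_cong2[where f="(*)"] prod.cong)
    also have "\<dots> = (- 1) ^ N * (\<Prod>j\<in>{1..N}. \<gamma> j - ?s) ^ 2 * (\<Prod>i\<in>{1..N}. \<Prod>j\<in>{1..N} - {i}. \<gamma> i - \<gamma> j)"
      unfolding 3 by (simp add: prod.distrib power2_eq_square mult_ac)
    finally have e: "(\<Prod>i\<in>{1..Suc N}. \<Prod>j\<in>{1..Suc N} - {i}. \<gamma> i - \<gamma> j) =
      (- 1) ^ N * (\<Prod>j\<in>{1..N}. \<gamma> j - ?s) ^ 2 * (\<Prod>i\<in>{1..N}. \<Prod>j\<in>{1..N} - {i}. \<gamma> i - \<gamma> j)" .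
    have k: "Suc N * (Suc N - 1) div 2 = N * (N - 1) div 2 + N"
    proof -
      have "Suc N * (Suc N - 1) = N * (N - 1) + 2 * N" by (cases N) (auto simp: algebra_simps)
      thus ?thesis by simp
    qed
    have sg: "(- 1) ^ N * (- 1) ^ N = (1 :: 'a)" by (simp flip: power_mult_distrib)
    have "vdm (Suc N) \<gamma> ^ 2 = vdm N \<gamma> ^ 2 * (\<Prod>j\<in>{1..N}. \<gamma> j - ?s) ^ 2"
      by (simp only: vdm_Suc power_mult_distrib)
    also have "\<dots> = (- 1) ^ (N * (N - 1) div 2) * (\<Prod>i\<in>{1..N}. \<Prod>j\<in>{1..N} - {i}. \<gamma> i - \<gamma> j) * (\<Prod>j\<in>{1..N}. \<gamma> j - ?s) ^ 2 * ((- 1) ^ N * (- 1) ^ N)"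
      unfolding Suc.IH sg by simp
    also have "\<dots> = (- 1) ^ (Suc N * (Suc N - 1) div 2) * (\<Prod>i\<in>{1..Suc N}. \<Prod>j\<in>{1..Suc N} - {i}. \<gamma> i - \<gamma> j)"
      unfolding e k power_add by (simp only: mult_ac)
    finally show ?case .
  qed
  ultimately show ?thesis by simp
qed

lemma map_vdm:
  assumes "field_hom \<sigma>"
  shows "\<sigma> (vdm N \<gamma>) = vdm N (\<lambda>i. \<sigma> (\<gamma> i))"
proof -
  interpret field_hom \<sigma> by fact
  show ?thesis by (simp add: vdm_def hom_distribs)
qed

lemma root_prod_permute:
  assumes "p permutes {1..N}"
  shows "root_prod N (\<lambda>i. \<alpha> (p i)) = root_prod N \<alpha>"
  unfolding root_prod_def using prod.permute[OF assms, of "\<lambda>i. [:- \<alpha> i, 1:]"] by (simp add: o_def)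

lemma part_frac_permute:
  assumes p: "p permutes {1..N}"
  shows "part_frac N (\<lambda>i. \<alpha> (p i)) (\<lambda>i. s (p i)) = part_frac N \<alpha> s"
proof -
  have inj: "inj p" by (rule permutes_inj[OF p])
  have del: "root_prod_del N (\<lambda>i. \<alpha> (p i)) i = root_prod_del N \<alpha> (p i)" for i
  proof -
    have im: "p ` ({1..N} - {i}) = {1..N} - {p i}"
      using permutes_image[OF p] inj by (simp add: image_set_diff)
    have "(\<Prod>j\<in>{1..N} - {p i}. [:- \<alpha> j, 1:]) = (\<Prod>j\<in>{1..N} - {i}. [:- \<alpha> (p j), 1:])"
      unfolding im[symmetric] by (subst prod.reindex) (auto intro: inj_on_subset[OF inj])
    thus ?thesis by (simp add: root_prod_del_def)
  qed
  have "part_frac N (\<lambda>i. \<alpha> (p i)) (\<lambda>i. s (p i)) = (\<Sum>i\<in>{1..N}. smult (s (p i)) (root_prod_del N \<alpha> (p i)))"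
    by (simp add: part_frac_def del)
  also have "\<dots> = part_frac N \<alpha> s" unfolding part_frac_def
    using sum.permute[OF p, of "\<lambda>i. smult (s i) (root_prod_del N \<alpha> i)"] by (simp add: o_def)
  finally show ?thesis .
qed

lemma map_part_frac:
  assumes "field_hom \<sigma>"
  shows "map_poly \<sigma> (part_frac N \<alpha> s) = part_frac N (\<lambda>i. \<sigma> (\<alpha> i)) (\<lambda>i. \<sigma> (s i))"
proof -
  interpret field_hom \<sigma> by fact
  interpret mp: map_poly_idom_hom \<sigma> ..
  show ?thesis unfolding part_frac_def root_prod_del_def
    by (simp only: mp.hom_sum map_poly_hom_smult map_root_prod[OF assms])
qed

lemma part_frac_cong:
  assumes "\<And>i. i \<in> {1..N} \<Longrightarrow> \<alpha> i = \<beta> i" "\<And>i. i \<in> {1..N} \<Longrightarrow> s i = s' i"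
  shows "part_frac N \<alpha> s = part_frac N \<beta> s'"
  unfolding part_frac_def root_prod_del_def using assms
  by (intro sum.cong arg_cong2[where f=smult] prod.cong) auto

lemma root_prod_cong:
  "(\<And>i. i \<in> {1..N} \<Longrightarrow> \<alpha> i = \<beta> i) \<Longrightarrow> root_prod N \<alpha> = root_prod N \<beta>"
  unfolding root_prod_def by (intro prod.cong) auto

section \<open>Genericity over the base field and descent of P, Q, R\<close>

text \<open>Interpolation writes a known good configuration as values of a polynomial at \<gamma>,
  with coefficients in the algebraic closure. These are replaced by elements of the base field one
  at a time: changing the coefficient of X^m moves the configuration along the line with direction
  \<gamma>_i^m, on which only finitely many parameters are bad.\<close>

lemma good_conf_rational:
  fixes \<gamma> :: "nat \<Rightarrow> 'k::field_char_0 alg_closure"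
  assumes N: "odd N" "N \<ge> 3" and inj: "inj_on \<gamma> {1..N}"
  obtains q :: "'k poly" where "good_conf N (\<lambda>i. poly (map_poly to_ac q) (\<gamma> i))"
proof -
  obtain \<alpha> :: "nat \<Rightarrow> 'k alg_closure" where \<alpha>: "good_conf N \<alpha>" using good_conf_exists[OF N] .
  define q0 where "q0 = part_frac N \<gamma> (\<lambda>i. \<alpha> i / poly (root_prod_del N \<gamma> i) (\<gamma> i))"
  have q0: "poly q0 (\<gamma> i) = \<alpha> i" if "i \<in> {1..N}" for i
    unfolding q0_def poly_part_frac_root[OF that] using root_prod_del_nonzero[OF that inj] by simp
  have cong: "good_conf N \<alpha>' = good_conf N \<beta>'" if "\<And>i. i \<in> {1..N} \<Longrightarrow> \<alpha>' i = \<beta>' i" for \<alpha>' \<beta>' :: "nat \<Rightarrow> 'k alg_closure"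
  proof -
    have m: "mestre_matrix N \<alpha>' = mestre_matrix N \<beta>'"
      unfolding mestre_matrix_def using that by (intro eq_matI) auto
    hence s: "mestre_solution N \<alpha>' = mestre_solution N \<beta>'" by (simp add: mestre_solution_def fun_eq_iff)
    have "inj_on \<alpha>' {1..N} = inj_on \<beta>' {1..N}" using that by (rule inj_on_cong)
    moreover have "root_prod N \<alpha>' = root_prod N \<beta>'" by (rule root_prod_cong) (rule that)
    moreover have "part_frac N \<alpha>' w = part_frac N \<beta>' w" for w by (rule part_frac_cong) (simp_all add: that)
    ultimately show ?thesis unfolding good_conf_def m s by simp
  qed
  have main: "\<exists>q. good_conf N (\<lambda>i. poly q (\<gamma> i)) \<and> (\<forall>l<m. coeff q l \<in> range to_ac) \<and> degree q \<le> N"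
    if "m \<le> Suc N" for m
    using that
  proof (induction m)
    case 0
    have "good_conf N (\<lambda>i. poly q0 (\<gamma> i))" using \<alpha> cong[of "\<lambda>i. poly q0 (\<gamma> i)" \<alpha>] q0 by simp
    moreover have "degree q0 \<le> N" using degree_part_frac[of N \<gamma>] unfolding q0_def by (meson diff_le_self order.trans)
    ultimately show ?case by blast
  next
    case (Suc m)
    then obtain q where q: "good_conf N (\<lambda>i. poly q (\<gamma> i))" "\<forall>l<m. coeff q l \<in> range to_ac" "degree q \<le> N"
      by auto
    let ?bad = "{u. \<not> good_conf N (\<lambda>i. poly q (\<gamma> i) + u * \<gamma> i ^ m)}"
    have fin: "finite ?bad" by (rule good_conf_open[OF q(1)])
    have "inj (\<lambda>c::'k. to_ac c - coeff q m)" by (rule injI) simp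
    hence "infinite (range (\<lambda>c::'k. to_ac c - coeff q m))"
      using infinite_UNIV_char_0 by (metis finite_imageD)
    then obtain c :: 'k where c: "to_ac c - coeff q m \<notin> ?bad" using fin
      by (metis (no_types, lifting) finite_subset image_subset_iff)
    define q' where "q' = q + monom (to_ac c - coeff q m) m"
    have "(\<lambda>i. poly q' (\<gamma> i)) = (\<lambda>i. poly q (\<gamma> i) + (to_ac c - coeff q m) * \<gamma> i ^ m)"
      by (simp add: q'_def poly_monom)
    hence "good_conf N (\<lambda>i. poly q' (\<gamma> i))" using c by simp
    moreover have "coeff q' l \<in> range to_ac" if "l < Suc m" for l
      using that q(2) by (cases "l = m") (auto simp: q'_def)
    moreover have "degree q' \<le> N" unfolding q'_def using q(3) Suc.prems
      by (intro degree_add_le) (auto intro: order.trans[OF degree_monom_le])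
    ultimately show ?case by blast
  qed
  obtain q where q: "good_conf N (\<lambda>i. poly q (\<gamma> i))" "\<forall>l<Suc N. coeff q l \<in> range to_ac" "degree q \<le> N"
    using main[of "Suc N"] by auto
  have "coeff q l \<in> range to_ac" for l
  proof (cases "l < Suc N")
    case False
    hence "coeff q l = 0" using q(3) by (intro coeff_eq_0) simp
    thus ?thesis by (metis rangeI to_ac_0)
  qed (use q(2) in blast)
  then obtain q1 where "q = map_poly to_ac q1" using polys_over_range_to_ac[of q] by (auto simp: polys_over_def)
  thus ?thesis using that q(1) by blast
qed

text \<open>The consequence of a square discriminant that the construction needs. In this form it
  carries over at once when a rational root is added, with no new discriminant to compute.\<close>

definition even_galois_action :: "nat \<Rightarrow> (nat \<Rightarrow> 'k::field alg_closure) \<Rightarrow> bool" where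
  "even_galois_action N \<gamma> \<longleftrightarrow> (\<forall>\<sigma>. field_hom \<sigma> \<longrightarrow> (\<forall>a. \<sigma> (to_ac a) = to_ac a) \<longrightarrow>
     (\<exists>p. p permutes {1..N} \<and> evenperm p \<and> (\<forall>i\<in>{1..N}. \<sigma> (\<gamma> i) = \<gamma> (p i))))"

lemma even_galois_actionD:
  "even_galois_action N \<gamma> \<Longrightarrow> field_hom \<sigma> \<Longrightarrow> (\<And>a. \<sigma> (to_ac a) = to_ac a) \<Longrightarrow>
    \<exists>p. p permutes {1..N} \<and> evenperm p \<and> (\<forall>i\<in>{1..N}. \<sigma> (\<gamma> i) = \<gamma> (p i))"
  by (simp add: even_galois_action_def)

text \<open>The normalised solution is unique, so Galois conjugation only permutes it together with
  the roots; \<open>P\<close>, \<open>Q\<close> and \<open>R\<close> are therefore fixed and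
  rational. Evenness of the action makes the Vandermonde product rational too.\<close>

lemma mestre_descent:
  fixes \<gamma> :: "nat \<Rightarrow> 'k::field_char_0 alg_closure"
  assumes N: "odd N" "N \<ge> 3" and inj\<gamma>: "inj_on \<gamma> {1..N}"
    and gal: "even_galois_action N \<gamma>"
  obtains q P Q R :: "'k poly" and \<alpha> \<delta>
  where "\<And>i. \<alpha> i = poly (map_poly to_ac q) (\<gamma> i)" "inj_on \<alpha> {1..N}" "map_poly to_ac P = root_prod N \<alpha>"
    "mestre_cover N (map_poly to_ac P) (map_poly to_ac Q) (map_poly to_ac R)" "Suc (degree Q) = N"
    "vdm N \<alpha> = to_ac \<delta>" "\<And>i. i \<in> {1..N} \<Longrightarrow> poly (map_poly to_ac R) (\<alpha> i) \<noteq> 0"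
proof -
  obtain q :: "'k poly" where q: "good_conf N (\<lambda>i. poly (map_poly to_ac q) (\<gamma> i))"
    using good_conf_rational[OF N inj\<gamma>] .
  define \<alpha> where "\<alpha> i = poly (map_poly to_ac q) (\<gamma> i)" for i
  define r where "r = mestre_solution N \<alpha>"
  have good: "good_conf N \<alpha>" using q unfolding \<alpha>_def .
  have inj: "inj_on \<alpha> {1..N}" and det: "det (mestre_matrix N \<alpha>) \<noteq> 0"
    and r0: "\<And>i. i \<in> {1..N} \<Longrightarrow> r i \<noteq> 0"
    and crit: "det (crit_matrix (N - 1) (root_prod N \<alpha>) (part_frac N \<alpha> (\<lambda>i. r i ^ 2)) (part_frac N \<alpha> r)) \<noteq> 0"
    using good by (auto simp: good_conf_def r_def)
  have sys: "mestre_system N \<alpha> r" "sum r {1..N} = 1" using mestre_solution[OF det] by (simp_all add: r_def)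
  define P where "P = root_prod N \<alpha>"
  define Q where "Q = part_frac N \<alpha> (\<lambda>i. r i ^ 2)"
  define R where "R = part_frac N \<alpha> r"
  have fixed: "map_poly \<sigma> P = P \<and> map_poly \<sigma> Q = Q \<and> map_poly \<sigma> R = R \<and> \<sigma> (vdm N \<alpha>) = vdm N \<alpha>"
    if s: "field_hom \<sigma>" "\<And>a::'k. \<sigma> (to_ac a) = to_ac a" for \<sigma>
  proof -
    interpret s: field_hom \<sigma> by fact
    obtain p where p: "p permutes {1..N}" "evenperm p" "\<forall>i\<in>{1..N}. \<sigma> (\<gamma> i) = \<gamma> (p i)" using even_galois_actionD[OF gal s] by blast
    have mq: "map_poly \<sigma> (map_poly to_ac q) = map_poly to_ac q" by (rule poly_eqI) (simp add: s(2))
    have \<sigma>\<alpha>: "\<sigma> (\<alpha> i) = \<alpha> (p i)" if "i \<in> {1..N}" for i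
      using poly_field_hom[OF s(1), of "map_poly to_ac q" "\<gamma> i"] p(3) that by (simp add: \<alpha>_def mq)
    define p' where "p' = inv_into UNIV p"
    have p': "p' permutes {1..N}" unfolding p'_def by (rule permutes_inv[OF p(1)])
    have pp': "p (p' j) = j" "p' (p j) = j" for j using permutes_inverses[OF p(1)] by (simp_all add: p'_def)
    \<comment> \<open>The conjugate solution, reindexed so that it belongs to the original order of
      the points; uniqueness then gives \<sigma>(r_i) = r_(p i).\<close>
    define r' where "r' j = \<sigma> (r (p' j))" for j
    have "mestre_system N \<alpha> r'" unfolding mestre_system_def
    proof
      fix j assume j: "j \<in> {1..N}"
      have j': "p' j \<in> {1..N}" using permutes_in_image[OF p'] j by blast
      have "(\<Sum>i\<in>{1..N} - {j}. r' i / (\<alpha> j - \<alpha> i)) = (\<Sum>i\<in>{1..N} - {p' j}. \<sigma> (r i) / (\<alpha> j - \<alpha> (p i)))"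
      proof (rule sum.reindex_bij_witness[of _ p p'])
        fix i assume "i \<in> {1..N} - {j}"
        thus "p' i \<in> {1..N} - {p' j}" using permutes_in_image[OF p'] pp' by (metis Diff_iff singletonD singletonI)
        show "p (p' i) = i" by (rule pp')
        show "\<sigma> (r (p' i)) / (\<alpha> j - \<alpha> (p (p' i))) = r' i / (\<alpha> j - \<alpha> i)" by (simp only: pp' r'_def)
      next
        fix i assume "i \<in> {1..N} - {p' j}"
        thus "p i \<in> {1..N} - {j}" using permutes_in_image[OF p(1)] pp' by (metis Diff_iff singletonD singletonI)
        show "p' (p i) = i" by (rule pp')
      qed
      also have "\<dots> = (\<Sum>i\<in>{1..N} - {p' j}. \<sigma> (r i / (\<alpha> (p' j) - \<alpha> i)))"
      proof (intro sum.cong refl)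
        fix i assume "i \<in> {1..N} - {p' j}"
        thus "\<sigma> (r i) / (\<alpha> j - \<alpha> (p i)) = \<sigma> (r i / (\<alpha> (p' j) - \<alpha> i))"
          using \<sigma>\<alpha>[of i] \<sigma>\<alpha>[OF j'] by (simp add: divide_inverse field_homD[OF s(1)] pp' s.hom_minus)
      qed
      also have "\<dots> = \<sigma> (\<Sum>i\<in>{1..N} - {p' j}. r i / (\<alpha> (p' j) - \<alpha> i))" by (simp only: s.hom_sum)
      also have "\<dots> = 0" using sys(1) j' by (simp add: mestre_system_def)
      finally show "(\<Sum>i\<in>{1..N} - {j}. r' i / (\<alpha> j - \<alpha> i)) = 0" .
    qed
    moreover have "sum r' {1..N} = 1"
    proof -
      have "sum r' {1..N} = (\<Sum>i\<in>{1..N}. \<sigma> (r i))"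
        using sum.permute[OF p', of "\<lambda>i. \<sigma> (r i)"] by (simp add: r'_def o_def)
      also have "\<dots> = \<sigma> (sum r {1..N})" by (simp only: s.hom_sum)
      finally show ?thesis by (simp add: sys(2))
    qed
    ultimately have r'r: "r' i = r i" if "i \<in> {1..N}" for i
      using mestre_solution_unique[OF det _ _ that] by (simp add: r_def)
    have \<sigma>r: "\<sigma> (r i) = r (p i)" if "i \<in> {1..N}" for i
      using r'r[of "p i"] permutes_in_image[OF p(1), of i] that by (simp add: r'_def pp')
    have "map_poly \<sigma> P = root_prod N (\<lambda>i. \<sigma> (\<alpha> i))" unfolding P_def root_prod_def by (rule map_root_prod[OF s(1)])
    also have "\<dots> = root_prod N (\<lambda>i. \<alpha> (p i))" by (rule root_prod_cong) (rule \<sigma>\<alpha>)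
    finally have 1: "map_poly \<sigma> P = P" unfolding root_prod_permute[OF p(1)] P_def .
    have 2: "map_poly \<sigma> R = R" unfolding R_def map_part_frac[OF s(1)]
      by (subst part_frac_permute[OF p(1), symmetric]) (rule part_frac_cong; simp only: \<sigma>\<alpha> \<sigma>r)
    have \<sigma>r2: "\<sigma> (r i ^ 2) = r (p i) ^ 2" if "i \<in> {1..N}" for i using \<sigma>r[OF that] by (simp add: hom_distribs)
    have 3: "map_poly \<sigma> Q = Q" unfolding Q_def map_part_frac[OF s(1)]
      using part_frac_permute[OF p(1), of \<alpha> "\<lambda>i. r i ^ 2"]
        part_frac_cong[of N "\<lambda>i. \<sigma> (\<alpha> i)" "\<lambda>i. \<alpha> (p i)" "\<lambda>i. \<sigma> (r i ^ 2)" "\<lambda>i. r (p i) ^ 2"] \<sigma>\<alpha> \<sigma>r2 by simp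
    have "\<sigma> (vdm N \<alpha>) = vdm N (\<alpha> \<circ> p)" unfolding map_vdm[OF s(1)] by (rule vdm_cong) (simp only: \<sigma>\<alpha> o_apply)
    also have "\<dots> = vdm N \<alpha>" unfolding vdm_permute[OF p(1)] using p(2) by (simp add: sign_def)
    finally show ?thesis using 1 2 3 by blast
  qed
  obtain P0 :: "'k poly" where P0: "P = map_poly to_ac P0" using fixed_poly_in_range_to_ac[of P] fixed by blast
  obtain Q0 :: "'k poly" where Q0: "Q = map_poly to_ac Q0" using fixed_poly_in_range_to_ac[of Q] fixed by blast
  obtain R0 :: "'k poly" where R0: "R = map_poly to_ac R0" using fixed_poly_in_range_to_ac[of R] fixed by blast
  obtain \<delta> :: 'k where \<delta>: "vdm N \<alpha> = to_ac \<delta>" using fixed_in_range_to_ac[of "vdm N \<alpha>"] fixed by blast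
  have W: "pderiv P * Q - P * pderiv Q = R ^ 2" unfolding P_def Q_def R_def by (rule mestre_identity[OF inj sys(1)])
  have dR: "degree R = N - 1"
  proof -
    have "coeff R (N - 1) = 1" unfolding R_def coeff_part_frac_top by (rule sys(2))
    moreover have "degree R \<le> N - 1" unfolding R_def by (rule degree_part_frac)
    ultimately show ?thesis by (metis le_antisym le_degree zero_neq_one)
  qed
  have R00: "R \<noteq> 0" using dR N by auto
  have dQ: "degree Q = N - 1"
  proof -
    have "degree Q \<le> N - 1" unfolding Q_def by (rule degree_part_frac)
    \<comment> \<open>The degree of \<open>Q\<close> cannot drop: R^2 has degree 2 (N - 1), and the
      Wronskian has degree at most N - 1 + deg Q.\<close>
    moreover have "2 * (N - 1) \<le> (N - 1) + degree Q"
    proof -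
      have "2 * (N - 1) = degree (R ^ 2)" using R00 dR by (simp add: degree_power_eq)
      also have "\<dots> \<le> (N - 1) + degree Q" unfolding W[symmetric]
      proof (rule degree_diff_le)
        show "degree (pderiv P * Q) \<le> (N - 1) + degree Q"
          by (intro order.trans[OF degree_mult_le] add_mono) (simp_all add: degree_pderiv P_def degree_root_prod)
        show "degree (P * pderiv Q) \<le> (N - 1) + degree Q"
        proof (cases "degree Q = 0")
          case True
          hence "pderiv Q = 0" by (simp add: pderiv_eq_0_iff)
          thus ?thesis by simp
        next
          case False
          have "degree (P * pderiv Q) \<le> N + (degree Q - 1)"
            by (intro order.trans[OF degree_mult_le] add_mono) (simp_all add: degree_pderiv P_def degree_root_prod)
          thus ?thesis using False N by simp
        qed
      qed
      finally show ?thesis .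
    qed
    ultimately show ?thesis by simp
  qed
  have degs: "degree P \<le> Suc (N - 1)" "degree Q \<le> N - 1" "degree R \<le> N - 1" "N - 1 \<ge> 1"
    using N by (simp_all add: P_def degree_root_prod dQ dR)
  note gen = crit_matrix_imp_generic[OF degs W crit[folded P_def Q_def R_def]]
  have cover: "mestre_cover N P Q R"
  proof
    show "1 \<le> N" using N by simp
    show "degree P = N" unfolding P_def by (rule degree_root_prod)
    show "lead_coeff P = 1" unfolding P_def by (rule monic_root_prod)
    show "degree Q < N" using dQ N by simp
    show "pderiv P * Q - P * pderiv Q = R ^ 2" by (rule W)
    fix y
    show "poly Q y \<noteq> 0" if "poly P y = 0"
    proof -
      obtain i where i: "i \<in> {1..N}" "y = \<alpha> i" using \<open>poly P y = 0\<close> unfolding P_def root_prod_root_iff by blast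
      show ?thesis unfolding i(2) Q_def poly_part_frac_root[OF i(1)]
        using r0[OF i(1)] root_prod_del_nonzero[OF i(1) inj] by simp
    qed
    show "poly Q y \<noteq> 0" "poly (pderiv R) y \<noteq> 0" if "poly R y = 0" using gen(1,2)[OF that] by blast+
    fix y' show "y = y'" if "poly R y = 0" "poly R y' = 0" "poly P y * poly Q y' = poly P y' * poly Q y"
      using gen(3)[OF that] .
  qed
  have Rr: "poly R (\<alpha> i) \<noteq> 0" if "i \<in> {1..N}" for i
    unfolding R_def poly_part_frac_root[OF that] using r0[OF that] root_prod_del_nonzero[OF that inj] by simp
  have "Suc (degree Q0) = N" using dQ N by (simp add: Q0)
  thus ?thesis using that[of \<alpha> q P0 Q0 R0 \<delta>] inj cover \<delta> Rr unfolding P0[symmetric] Q0[symmetric] R0[symmetric]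
    by (simp add: \<alpha>_def P_def)
qed

section \<open>Splitting fields: from the algebraic structures of the statement to subfields of a
  type\<close>

abbreviation type_ring :: "'a::field ring" where "type_ring \<equiv> ring_of_type_algebra"

lemma type_ring_simps [simp]:
  "carrier type_ring = UNIV" "x \<otimes>\<^bsub>type_ring\<^esub> y = x * y" "x \<oplus>\<^bsub>type_ring\<^esub> y = x + y"
  "\<one>\<^bsub>type_ring\<^esub> = 1" "\<zero>\<^bsub>type_ring\<^esub> = 0"
  by (simp_all add: ring_of_type_algebra_def)

lemma type_ring_a_inv [simp]: "\<ominus>\<^bsub>type_ring\<^esub> x = - x"
proof -
  interpret field "type_ring :: 'a ring" by rule
  show ?thesis using minus_equality[of "- x" x] by simp
qed

lemma type_ring_m_inv: "x \<noteq> 0 \<Longrightarrow> inv\<^bsub>type_ring\<^esub> x = inverse x"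
proof -
  interpret field "type_ring :: 'a ring" by rule
  assume "x \<noteq> 0"
  thus ?thesis using comm_inv_char[of x "inverse x"] by simp
qed

lemma type_ring_pow [simp]: "x [^]\<^bsub>type_ring\<^esub> (n::nat) = x ^ n"
proof -
  interpret field "type_ring :: 'a ring" by rule
  show ?thesis by (induction n) (simp_all add: mult.commute)
qed

lemma subfield_type_ring:
  assumes "is_subfield (M :: 'a::field set)"
  shows "subfield M type_ring" "subring M type_ring"
proof -
  interpret field "type_ring :: 'a ring" by rule
  show r: "subring M type_ring"
    by (rule subringI) (simp_all add: is_subfieldD[OF assms])
  show "subfield M type_ring"
    by (rule subfieldI'[OF r]) (simp add: type_ring_m_inv is_subfieldD(6)[OF assms])
qed

lemma is_subfield_generate_field: "is_subfield (generate_field type_ring (S :: 'a::field set))"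
proof -
  interpret field "type_ring :: 'a ring" by rule
  let ?G = "generate_field type_ring S"
  have 0: "0 \<in> ?G" using zero_in_generate[of S] by simp
  have "inverse x \<in> ?G" if "x \<in> ?G" for x
    using generate_field.m_inv[OF that] that by (cases "x = 0") (simp_all add: type_ring_m_inv)
  thus ?thesis unfolding is_subfield_def
    using 0 generate_field.one[of type_ring S] generate_field.eng_add[of _ type_ring S]
      generate_field.eng_mult[of _ type_ring S] generate_field.a_inv[of _ type_ring S] by simp
qed

lemma generate_field_subset:
  assumes "is_subfield (M :: 'a::field set)" "S \<subseteq> M"
  shows "generate_field type_ring S \<subseteq> M"
proof -
  interpret field "type_ring :: 'a ring" by rule
  show ?thesis
    by (rule generate_field_min_subfield1[OF _ subfield_type_ring(1)[OF assms(1)] assms(2)]) simp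
qed

text \<open>Univariate polynomials of the ring structure are lists with the leading coefficient
  first, whence the reversal.\<close>

lemma algebraic_type_ring_iff:
  assumes M: "is_subfield (M :: 'a::field set)"
  shows "ring.algebraic type_ring M x \<longleftrightarrow> algebraic_over M x"
proof -
  interpret field "type_ring :: 'a ring" by rule
  have ev: "eval l y = poly (Poly (rev l)) y" for l y
    by (induction l) (simp_all add: Poly_append poly_monom)
  show ?thesis
  proof
    assume "algebraic M x"
    then obtain l where l: "l \<in> carrier (M[X]\<^bsub>type_ring\<^esub>)" "l \<noteq> []" "eval l x = 0"
      using algebraicE[OF subfield_type_ring(2)[OF M], of x] by (auto simp: over_def)
    hence l': "set l \<subseteq> M" "hd l \<noteq> 0" by (simp_all add: univ_poly_carrier[symmetric] polynomial_def)
    have nz: "Poly (rev l) \<noteq> 0"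
    proof
      assume "Poly (rev l) = 0"
      moreover have "Polynomial.coeff (Poly (rev l)) (length l - 1) = hd l"
        using l(2) by (simp add: coeff_Poly_eq nth_default_def rev_nth hd_conv_nth)
      ultimately show False using l'(2) by simp
    qed
    have "Poly (rev l) \<in> polys_over M" unfolding polys_over_def
      using l'(1) is_subfieldD(1)[OF M] by (auto simp: coeff_Poly_eq nth_default_def rev_nth subset_iff)
    thus "algebraic_over M x" unfolding algebraic_over_def using nz l(3) ev by auto
  next
    assume "algebraic_over M x"
    then obtain p where p: "p \<in> polys_over M" "p \<noteq> 0" "poly p x = 0" by (auto simp: algebraic_over_def)
    let ?l = "rev (coeffs p)"
    have "set ?l \<subseteq> M"
      using p(1) by (auto simp: polys_over_def coeffs_def)
    moreover have "hd ?l \<noteq> 0" using p(2) by (simp add: hd_rev last_coeffs_eq_coeff_degree)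
    ultimately have "?l \<in> carrier (M[X]\<^bsub>type_ring\<^esub>)"
      by (simp add: univ_poly_carrier[symmetric] polynomial_def)
    moreover have "?l \<noteq> []" using p(2) by simp
    moreover have "eval ?l x = \<zero>\<^bsub>type_ring\<^esub>" using p(3) by (simp add: ev)
    ultimately show "algebraic M x" using algebraicI[of ?l M x] by (simp add: over_def)
  qed
qed

lemma splitting_field_props:
  fixes f :: "'a::field poly"
  shows "is_subfield (splitting_field f)" "to_ac c \<in> splitting_field f"
    "poly (map_poly to_ac f) y = 0 \<Longrightarrow> y \<in> splitting_field f"
    "is_subfield M \<Longrightarrow> range to_ac \<subseteq> M \<Longrightarrow> (\<And>y. poly (map_poly to_ac f) y = 0 \<Longrightarrow> y \<in> M) \<Longrightarrow> splitting_field f \<subseteq> M"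
proof -
  show "is_subfield (splitting_field f)" unfolding splitting_field_def by (rule is_subfield_generate_field)
  show "to_ac c \<in> splitting_field f" unfolding splitting_field_def by (rule generate_field.incl) simp
  show "y \<in> splitting_field f" if "poly (map_poly to_ac f) y = 0"
    unfolding splitting_field_def by (rule generate_field.incl) (simp add: that)
  show "splitting_field f \<subseteq> M" if "is_subfield M" "range to_ac \<subseteq> M" "\<And>y. poly (map_poly to_ac f) y = 0 \<Longrightarrow> y \<in> M"
    unfolding splitting_field_def by (rule generate_field_subset[OF that(1)]) (use that in auto)
qed

lemma algebraic_over_mono: "algebraic_over F x \<Longrightarrow> F \<subseteq> M \<Longrightarrow> algebraic_over M x"
  unfolding algebraic_over_def polys_over_def by blast

text \<open>One inclusion is clear from \<alpha>_i = q(\<gamma>_i). For the other, an endomorphism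
  fixing the splitting field of \<open>h\<close> sends \<gamma>_i to some \<gamma>_j with \<alpha>_i
  = \<alpha>_j, and injectivity of \<alpha> forces j = i.\<close>

lemma splitting_field_eqI:
  fixes g h q :: "'a::field_char_0 poly"
  assumes inj: "inj_on \<alpha> {1..n}" and \<alpha>: "\<And>i. i \<in> {1..n} \<Longrightarrow> \<alpha> i = poly (map_poly to_ac q) (\<gamma> i)"
    and g: "\<And>y. poly (map_poly to_ac g) y = 0 \<longleftrightarrow> y \<in> \<gamma> ` {1..n}"
    and h: "\<And>y. poly (map_poly to_ac h) y = 0 \<longleftrightarrow> y \<in> \<alpha> ` {1..n}"
  shows "splitting_field g = splitting_field h"
proof
  have q: "map_poly to_ac q \<in> polys_over (range to_ac)" unfolding polys_over_range_to_ac by blast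
  show "splitting_field h \<subseteq> splitting_field g"
  proof (rule splitting_field_props(4)[OF splitting_field_props(1)])
    show "range to_ac \<subseteq> splitting_field g" using splitting_field_props(2) by blast
    hence q': "map_poly to_ac q \<in> polys_over (splitting_field g)" using q by (auto simp: polys_over_def)
    fix y assume "poly (map_poly to_ac h) y = 0"
    then obtain i where i: "i \<in> {1..n}" "y = \<alpha> i" unfolding h by blast
    have "\<gamma> i \<in> splitting_field g" by (rule splitting_field_props(3)) (use i g in blast)
    thus "y \<in> splitting_field g" unfolding i(2) \<alpha>[OF i(1)]
      by (rule poly_in_subfield[OF splitting_field_props(1) q'])
  qed
  show "splitting_field g \<subseteq> splitting_field h"
  proof (rule splitting_field_props(4)[OF splitting_field_props(1)])
    show sub: "range to_ac \<subseteq> splitting_field h" using splitting_field_props(2) by blast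
    fix y assume "poly (map_poly to_ac g) y = 0"
    then obtain i where i: "i \<in> {1..n}" "y = \<gamma> i" unfolding g by blast
    show "y \<in> splitting_field h"
    proof (rule ccontr)
      assume "y \<notin> splitting_field h"
      then obtain \<sigma> where \<sigma>: "field_hom \<sigma>" "\<And>z. z \<in> splitting_field h \<Longrightarrow> \<sigma> z = z" "\<sigma> y \<noteq> y"
        using exists_endo_moving[OF splitting_field_props(1) algebraic_over_mono[OF algebraic_over_range_to_ac sub]]
        by blast
      have \<sigma>k: "map_poly \<sigma> (map_poly to_ac r) = map_poly to_ac r" for r
        by (rule poly_eqI) (simp add: coeff_map_poly \<sigma>(2) splitting_field_props(2) field_homD(1)[OF \<sigma>(1)])
      have "poly (map_poly to_ac g) (\<sigma> y) = \<sigma> (poly (map_poly to_ac g) y)"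
        unfolding poly_field_hom[OF \<sigma>(1)] \<sigma>k ..
      also have "\<dots> = 0" using \<open>poly (map_poly to_ac g) y = 0\<close> field_homD(1)[OF \<sigma>(1)] by simp
      finally obtain j where j: "j \<in> {1..n}" "\<sigma> y = \<gamma> j" unfolding g by blast
      have "\<alpha> i \<in> splitting_field h" by (rule splitting_field_props(3)) (use i h in blast)
      hence "\<alpha> i = \<sigma> (poly (map_poly to_ac q) y)" using \<sigma>(2) \<alpha>[OF i(1)] i(2) by simp
      also have "\<dots> = \<alpha> j" unfolding poly_field_hom[OF \<sigma>(1)] \<sigma>k j(2) \<alpha>[OF j(1)] ..
      finally have "i = j" using inj i j by (simp add: inj_on_def)
      thus False using \<sigma>(3) i j by simp
    qed
  qed
qed

lemma is_subfield_equalizer: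
  assumes "field_hom \<phi>" "field_hom \<psi>"
  shows "is_subfield {z. \<phi> z = \<psi> z}"
  unfolding is_subfield_def by (simp add: field_homD[OF assms(1)] field_homD[OF assms(2)])

lemma is_subfield_image:
  assumes "field_hom \<sigma>" "is_subfield M"
  shows "is_subfield (\<sigma> ` M)"
proof -
  note h = field_homD[OF assms(1), symmetric] and d = is_subfieldD[OF assms(2)]
  have "0 \<in> \<sigma> ` M" "1 \<in> \<sigma> ` M" using d(1,2) h(1,2) by (metis imageI)+
  moreover have "u + v \<in> \<sigma> ` M \<and> u * v \<in> \<sigma> ` M" if "u \<in> \<sigma> ` M" "v \<in> \<sigma> ` M" for u v
    using that d(3,4) by (auto simp: h(3,4))
  moreover have "- u \<in> \<sigma> ` M \<and> inverse u \<in> \<sigma> ` M" if "u \<in> \<sigma> ` M" for u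
    using that d(5,6) by (auto simp: h(5,6))
  ultimately show ?thesis by (simp add: is_subfield_def)
qed

lemma is_subfield_preimage:
  assumes "field_hom \<sigma>" "is_subfield M"
  shows "is_subfield {z. \<sigma> z \<in> M}"
  unfolding is_subfield_def by (simp add: field_homD[OF assms(1)] is_subfieldD[OF assms(2)])

lemma permutes_eqI:
  assumes "p permutes A" "p' permutes A" "\<And>i. i \<in> A \<Longrightarrow> p i = p' i"
  shows "p = p'"
proof
  fix i show "p i = p' i" using assms by (cases "i \<in> A") (simp_all add: permutes_not_in)
qed

section \<open>Galois groups of polynomials on which exactly the even permutations act\<close>

text \<open>\<open>even\<close> is the upper bound, supplied by the discriminant, and
  \<open>alt\<close> the lower bound, supplied by monodromy; together they pin the Galois group down
  to the alternating group.\<close>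

locale alt_splitting =
  fixes n :: nat and f :: "'a::field_char_0 poly" and y :: "nat \<Rightarrow> 'a alg_closure"
  assumes inj_y: "inj_on y {1..n}"
    and roots: "poly (map_poly to_ac f) z = 0 \<longleftrightarrow> z \<in> y ` {1..n}"
    and even: "field_hom \<sigma> \<Longrightarrow> (\<forall>a. \<sigma> (to_ac a) = to_ac a) \<Longrightarrow> p permutes {1..n} \<Longrightarrow>
      (\<forall>i\<in>{1..n}. \<sigma> (y i) = y (p i)) \<Longrightarrow> evenperm p"
    and alt: "p permutes {1..n} \<Longrightarrow> evenperm p \<Longrightarrow>
      \<exists>\<sigma>. field_hom \<sigma> \<and> (\<forall>a. \<sigma> (to_ac a) = to_ac a) \<and> (\<forall>i\<in>{1..n}. \<sigma> (y i) = y (p i))"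
begin

abbreviation E :: "'a alg_closure set" where "E \<equiv> splitting_field f"
abbreviation Gal where "Gal \<equiv> galois_group E (range to_ac)"

lemma y_in_E: "i \<in> {1..n} \<Longrightarrow> y i \<in> E"
  by (rule splitting_field_props(3)) (use roots in blast)

lemma E_minimal: "is_subfield M \<Longrightarrow> range to_ac \<subseteq> M \<Longrightarrow> (\<And>i. i \<in> {1..n} \<Longrightarrow> y i \<in> M) \<Longrightarrow> E \<subseteq> M"
  by (rule splitting_field_props(4)) (auto simp: roots)

lemma hom_eq_on_E:
  assumes "field_hom \<phi>" "field_hom \<psi>" "\<And>a. \<phi> (to_ac a) = \<psi> (to_ac a)" "\<And>i. i \<in> {1..n} \<Longrightarrow> \<phi> (y i) = \<psi> (y i)"
    and z: "z \<in> E"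
  shows "\<phi> z = \<psi> z"
  using E_minimal[OF is_subfield_equalizer[OF assms(1,2)]] assms(3,4) z by blast

lemma galois_perm:
  assumes s: "field_hom \<sigma>" "\<forall>a. \<sigma> (to_ac a) = to_ac a"
  obtains p where "p permutes {1..n}" "evenperm p" "\<And>i. i \<in> {1..n} \<Longrightarrow> \<sigma> (y i) = y (p i)"
proof -
  have \<sigma>f: "map_poly \<sigma> (map_poly to_ac f) = map_poly to_ac f"
    by (rule poly_eqI) (simp add: coeff_map_poly s(2) field_homD(1)[OF s(1)])
  have "\<sigma> (y i) \<in> y ` {1..n}" if "i \<in> {1..n}" for i
  proof -
    have "poly (map_poly to_ac f) (y i) = 0" using that roots by blast
    hence "poly (map_poly to_ac f) (\<sigma> (y i)) = 0"
      using poly_field_hom[OF s(1), of "map_poly to_ac f" "y i"] field_homD(1)[OF s(1)] by (simp add: \<sigma>f)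
    thus ?thesis by (simp only: roots)
  qed
  then obtain p where p: "p permutes {1..n}" "\<And>i. i \<in> {1..n} \<Longrightarrow> \<sigma> (y i) = y (p i)"
    using hom_permutes_roots[OF inj_y field_hom_inj[OF s(1)]] by blast
  show ?thesis using that[OF p(1) even[OF s p(1)]] p(2) by blast
qed

lemma galois_image:
  assumes s: "field_hom \<sigma>" "\<forall>a. \<sigma> (to_ac a) = to_ac a"
  shows "\<sigma> ` E = E"
proof
  obtain p where p: "p permutes {1..n}" "\<And>i. i \<in> {1..n} \<Longrightarrow> \<sigma> (y i) = y (p i)" using galois_perm[OF s] by blast
  have "E \<subseteq> {z. \<sigma> z \<in> E}"
  proof (rule E_minimal[OF is_subfield_preimage[OF s(1) splitting_field_props(1)]])
    show "range to_ac \<subseteq> {z. \<sigma> z \<in> E}" using s(2) splitting_field_props(2) by auto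
    fix i assume i: "i \<in> {1..n}"
    hence "p i \<in> {1..n}" using permutes_in_image[OF p(1)] by blast
    thus "y i \<in> {z. \<sigma> z \<in> E}" using p(2)[OF i] y_in_E by simp
  qed
  thus "\<sigma> ` E \<subseteq> E" by blast
  show "E \<subseteq> \<sigma> ` E"
  proof (rule E_minimal[OF is_subfield_image[OF s(1) splitting_field_props(1)]])
    show "range to_ac \<subseteq> \<sigma> ` E"
    proof (rule image_subsetI)
      fix a show "to_ac a \<in> \<sigma> ` E" using image_eqI[of "to_ac a" \<sigma> "to_ac a" E] s(2) by (simp add: splitting_field_props(2))
    qed
    fix i assume i: "i \<in> {1..n}"
    define j where "j = inv_into UNIV p i"
    have j: "j \<in> {1..n}" using permutes_in_image[OF permutes_inv[OF p(1)]] i by (simp add: j_def)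
    have "p j = i" unfolding j_def by (rule permutes_inverses(1)[OF p(1)])
    hence "y i = \<sigma> (y j)" using p(2)[OF j] by simp
    thus "y i \<in> \<sigma> ` E" using y_in_E[OF j] by blast
  qed
qed

text \<open>Every automorphism of the splitting field extends to the algebraic closure, so the
  extensional functions of the group can be traded for endomorphisms of a type.\<close>

lemma Gal_carrier_iff:
  "\<tau> \<in> carrier Gal \<longleftrightarrow> (\<exists>\<sigma>. field_hom \<sigma> \<and> (\<forall>a. \<sigma> (to_ac a) = to_ac a) \<and> \<tau> = restrict \<sigma> E)"
proof
  assume "\<tau> \<in> carrier Gal"
  hence t: "\<tau> \<in> Bij E" "\<tau> \<in> Ring.ring_hom (type_ring\<lparr>carrier := E\<rparr>) (type_ring\<lparr>carrier := E\<rparr>)"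
    "\<And>a. \<tau> (to_ac a) = to_ac a" by (simp_all add: galois_group_def)
  have "hom_on E \<tau>" using t(2) by (simp add: hom_on_def Ring.ring_hom_def)
  moreover have "algebraic_over E z" for z
    by (rule algebraic_over_mono[OF algebraic_over_range_to_ac]) (use splitting_field_props(2) in blast)
  ultimately obtain \<sigma> where \<sigma>: "field_hom \<sigma>" "\<And>z. z \<in> E \<Longrightarrow> \<sigma> z = \<tau> z"
    using extend_hom[OF splitting_field_props(1), of f \<tau>] by blast
  have "\<tau> = restrict \<sigma> E"
    by (rule extensionalityI[OF Bij_imp_extensional[OF t(1)]]) (simp_all add: \<sigma>(2))
  moreover have "\<sigma> (to_ac a) = to_ac a" for a using \<sigma>(2)[OF splitting_field_props(2)] t(3) by simp
  ultimately show "\<exists>\<sigma>. field_hom \<sigma> \<and> (\<forall>a. \<sigma> (to_ac a) = to_ac a) \<and> \<tau> = restrict \<sigma> E" using \<sigma>(1) by blast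
next
  assume "\<exists>\<sigma>. field_hom \<sigma> \<and> (\<forall>a. \<sigma> (to_ac a) = to_ac a) \<and> \<tau> = restrict \<sigma> E"
  then obtain \<sigma> where s: "field_hom \<sigma>" "\<forall>a. \<sigma> (to_ac a) = to_ac a" and \<tau>: "\<tau> = restrict \<sigma> E" by blast
  have "inj_on \<sigma> E" using field_hom_inj[OF s(1)] by (rule inj_on_subset) simp
  hence "bij_betw \<sigma> E E" unfolding bij_betw_def using galois_image[OF s] by simp
  hence "\<tau> \<in> Bij E" unfolding \<tau> Bij_def by (simp add: bij_betw_def inj_on_restrict_eq)
  moreover have "\<tau> \<in> Ring.ring_hom (type_ring\<lparr>carrier := E\<rparr>) (type_ring\<lparr>carrier := E\<rparr>)"
  proof -
    have "\<sigma> z \<in> E" if "z \<in> E" for z using galois_image[OF s] that by blast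
    thus ?thesis unfolding Ring.ring_hom_def \<tau>
      by (simp add: Pi_iff is_subfieldD[OF splitting_field_props(1)] field_homD[OF s(1)])
  qed
  ultimately show "\<tau> \<in> carrier Gal" using s(2) by (simp add: galois_group_def \<tau> splitting_field_props(2))
qed

theorem galois: "galois_extension E (range to_ac)"
  unfolding galois_extension_def
proof (intro conjI ballI)
  show "subfield E type_ring" by (rule subfield_type_ring[OF splitting_field_props(1)])
  show "subfield (range to_ac) (type_ring :: 'a alg_closure ring)"
    by (rule subfield_type_ring[OF is_subfield_range_to_ac])
  show sub: "range to_ac \<subseteq> E" using splitting_field_props(2) by blast
  show "ring.algebraic type_ring (range to_ac) z" for z :: "'a alg_closure"
    unfolding algebraic_type_ring_iff[OF is_subfield_range_to_ac] by (rule algebraic_over_range_to_ac)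
  show "{z \<in> E. \<forall>\<sigma>\<in>carrier Gal. \<sigma> z = z} = range to_ac"
  proof (intro subset_antisym subsetI)
    fix z assume z: "z \<in> {z \<in> E. \<forall>\<sigma>\<in>carrier Gal. \<sigma> z = z}"
    show "z \<in> range to_ac"
    proof (rule fixed_in_range_to_ac)
      fix \<sigma> :: "'a alg_closure \<Rightarrow> 'a alg_closure"
      assume "field_hom \<sigma>" "\<And>a::'a. \<sigma> (to_ac a) = to_ac a"
      hence "restrict \<sigma> E \<in> carrier Gal" unfolding Gal_carrier_iff by blast
      thus "\<sigma> z = z" using z by fastforce
    qed
  next
    fix z :: "'a alg_closure" assume z: "z \<in> range to_ac"
    thus "z \<in> {z \<in> E. \<forall>\<sigma>\<in>carrier Gal. \<sigma> z = z}" using sub by (auto simp: galois_group_def)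
  qed
qed

definition perm_of :: "('a alg_closure \<Rightarrow> 'a alg_closure) \<Rightarrow> nat \<Rightarrow> nat" where
  "perm_of \<tau> = (THE p. p permutes {1..n} \<and> (\<forall>i\<in>{1..n}. \<tau> (y i) = y (p i)))"

lemma perm_of_eq:
  assumes "p permutes {1..n}" "\<forall>i\<in>{1..n}. \<tau> (y i) = y (p i)"
  shows "perm_of \<tau> = p"
  unfolding perm_of_def
proof (rule the_equality)
  fix p' assume "p' permutes {1..n} \<and> (\<forall>i\<in>{1..n}. \<tau> (y i) = y (p' i))"
  hence p': "p' permutes {1..n}" "\<forall>i\<in>{1..n}. \<tau> (y i) = y (p' i)" by simp_all
  show "p' = p"
  proof (rule permutes_eqI)
    fix i assume i: "i \<in> {1..n}"
    have in': "p i \<in> {1..n}" "p' i \<in> {1..n}" 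
      using permutes_in_image[OF assms(1)] permutes_in_image[OF p'(1)] i by blast+
    have "y (p' i) = y (p i)" using bspec[OF assms(2) i] bspec[OF p'(2) i] by simp
    thus "p' i = p i" by (rule inj_onD[OF inj_y _ in'(2,1)])
  qed (rule p' assms)+
qed (rule conjI[OF assms])

lemma perm_of:
  assumes "\<tau> \<in> carrier Gal"
  shows "perm_of \<tau> permutes {1..n}" "evenperm (perm_of \<tau>)" "\<forall>i\<in>{1..n}. \<tau> (y i) = y (perm_of \<tau> i)"
proof -
  obtain \<sigma> where s: "field_hom \<sigma>" "\<forall>a. \<sigma> (to_ac a) = to_ac a" and \<tau>: "\<tau> = restrict \<sigma> E"
    using assms unfolding Gal_carrier_iff by blast
  obtain p where p: "p permutes {1..n}" "evenperm p" "\<And>i. i \<in> {1..n} \<Longrightarrow> \<sigma> (y i) = y (p i)"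
    using galois_perm[OF s] by blast
  have *: "\<forall>i\<in>{1..n}. \<tau> (y i) = y (p i)" using p(3) y_in_E by (simp add: \<tau>)
  show "perm_of \<tau> permutes {1..n}" "evenperm (perm_of \<tau>)" "\<forall>i\<in>{1..n}. \<tau> (y i) = y (perm_of \<tau> i)"
    unfolding perm_of_eq[OF p(1) *] by (rule p * )+
qed

theorem galois_group_iso: "Gal \<cong> alt_group n"
proof -
  have "perm_of \<in> iso Gal (alt_group n)"
  proof (rule isoI)
    show "perm_of \<in> hom Gal (alt_group n)"
    proof (rule homI)
      fix \<tau> assume "\<tau> \<in> carrier Gal"
      thus "perm_of \<tau> \<in> carrier (alt_group n)" using perm_of by (simp add: alt_group_def)
    next
      fix \<tau> \<tau>' assume t: "\<tau> \<in> carrier Gal" "\<tau>' \<in> carrier Gal"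
      hence b: "\<tau> \<in> Bij E" "\<tau>' \<in> Bij E" by (simp_all add: galois_group_def)
      have m: "\<tau> \<otimes>\<^bsub>Gal\<^esub> \<tau>' = compose E \<tau> \<tau>'" using b by (simp add: galois_group_def BijGroup_def)
      have "perm_of (compose E \<tau> \<tau>') = perm_of \<tau> \<circ> perm_of \<tau>'"
      proof (rule perm_of_eq)
        show "perm_of \<tau> \<circ> perm_of \<tau>' permutes {1..n}"
          by (rule permutes_compose[OF perm_of(1)[OF t(2)] perm_of(1)[OF t(1)]])
        show "\<forall>i\<in>{1..n}. compose E \<tau> \<tau>' (y i) = y ((perm_of \<tau> \<circ> perm_of \<tau>') i)"
        proof
          fix i assume i: "i \<in> {1..n}"
          have "perm_of \<tau>' i \<in> {1..n}" using permutes_in_image[OF perm_of(1)[OF t(2)]] i by blast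
          thus "compose E \<tau> \<tau>' (y i) = y ((perm_of \<tau> \<circ> perm_of \<tau>') i)"
            using perm_of(3)[OF t(1)] perm_of(3)[OF t(2)] i y_in_E by (simp add: compose_eq)
        qed
      qed
      thus "perm_of (\<tau> \<otimes>\<^bsub>Gal\<^esub> \<tau>') = perm_of \<tau> \<otimes>\<^bsub>alt_group n\<^esub> perm_of \<tau>'"
        unfolding m by (simp add: alt_group_def sym_group_def)
    qed
    show "bij_betw perm_of (carrier Gal) (carrier (alt_group n))"
      unfolding bij_betw_def
    proof
      show "inj_on perm_of (carrier Gal)"
      proof (rule inj_onI)
        fix \<tau> \<tau>' assume t: "\<tau> \<in> carrier Gal" "\<tau>' \<in> carrier Gal" "perm_of \<tau> = perm_of \<tau>'"
        obtain \<sigma> where s: "field_hom \<sigma>" "\<forall>a. \<sigma> (to_ac a) = to_ac a" and \<tau>: "\<tau> = restrict \<sigma> E"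
          using t(1) unfolding Gal_carrier_iff by blast
        obtain \<sigma>' where s': "field_hom \<sigma>'" "\<forall>a. \<sigma>' (to_ac a) = to_ac a" and \<tau>': "\<tau>' = restrict \<sigma>' E"
          using t(2) unfolding Gal_carrier_iff by blast
        have "\<sigma> z = \<sigma>' z" if "z \<in> E" for z
        proof (rule hom_eq_on_E[OF s(1) s'(1) _ _ that])
          show "\<sigma> (to_ac a) = \<sigma>' (to_ac a)" for a using s(2) s'(2) by simp
          fix i assume i: "i \<in> {1..n}"
          have "\<sigma> (y i) = \<tau> (y i)" "\<sigma>' (y i) = \<tau>' (y i)" using y_in_E[OF i] by (simp_all add: \<tau> \<tau>')
          thus "\<sigma> (y i) = \<sigma>' (y i)" using perm_of(3)[OF t(1)] perm_of(3)[OF t(2)] t(3) i by simp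
        qed
        thus "\<tau> = \<tau>'" unfolding \<tau> \<tau>' by (rule restrict_ext)
      qed
      show "perm_of ` carrier Gal = carrier (alt_group n)"
      proof (intro subset_antisym subsetI)
        fix p assume "p \<in> perm_of ` carrier Gal"
        thus "p \<in> carrier (alt_group n)" using perm_of by (auto simp: alt_group_def)
      next
        fix p assume "p \<in> carrier (alt_group n)"
        hence p: "p permutes {1..n}" "evenperm p" by (simp_all add: alt_group_def)
        obtain \<sigma> where s: "field_hom \<sigma>" "\<forall>a. \<sigma> (to_ac a) = to_ac a" "\<forall>i\<in>{1..n}. \<sigma> (y i) = y (p i)"
          using alt[OF p] by blast
        have "restrict \<sigma> E \<in> carrier Gal" unfolding Gal_carrier_iff using s by blast
        moreover have "perm_of (restrict \<sigma> E) = p" by (rule perm_of_eq[OF p(1)]) (use s(3) y_in_E in simp)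
        ultimately show "p \<in> perm_of ` carrier Gal" by blast
      qed
    qed
  qed
  thus ?thesis by (auto simp: is_iso_def)
qed

end

section \<open>Comparison of arithmetic and geometric monodromy\<close>

definition const_ac :: "'k::field \<Rightarrow> 'k poly fract alg_closure" where
  "const_ac c = to_ac (to_fract [:c:])"

definition var_ac :: "'k::field poly fract alg_closure" where
  "var_ac = to_ac (to_fract [:0, 1:])"

lemma field_hom_const_ac: "field_hom (const_ac :: 'k::field \<Rightarrow> _)"
proof -
  have "to_fract [:a + b:] = to_fract [:a:] + to_fract [:b:]" "to_fract [:a * b:] = to_fract [:a:] * to_fract [:b:]" for a b :: 'k
    by (simp_all flip: to_fract_add to_fract_mult)
  thus ?thesis unfolding hom_on_UNIV_iff[symmetric] hom_on_def
    by (simp add: const_ac_def flip: one_pCons)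
qed

lemma to_ac_to_fract: "to_ac (to_fract p) = poly (map_poly const_ac p) var_ac"
proof (induction p)
  case (pCons a p)
  interpret c: field_hom const_ac by (rule field_hom_const_ac)
  have "pCons a p = [:a:] + [:0, 1:] * p" by simp
  hence "to_ac (to_fract (pCons a p)) = const_ac a + var_ac * to_ac (to_fract p)"
    by (simp only: to_fract_add to_fract_mult to_ac_add to_ac_mult const_ac_def var_ac_def)
  thus ?case by (simp add: pCons.IH hom_distribs)
qed simp

lemma to_ac_in_subfield:
  assumes M: "is_subfield M" "\<And>c. const_ac c \<in> M" "var_ac \<in> M"
  shows "to_ac q \<in> M"
proof -
  have p: "to_ac (to_fract p) \<in> M" for p
  proof -
    have "map_poly const_ac p \<in> polys_over M" unfolding polys_over_def
      by (simp add: coeff_map_poly field_homD(1)[OF field_hom_const_ac] M(2))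
    from poly_in_subfield[OF M(1) this M(3)] show ?thesis unfolding to_ac_to_fract .
  qed
  obtain a b where "q = to_fract a / to_fract b" by (rule fract_rep)
  thus ?thesis using is_subfieldD(8)[OF M(1) p p] by (simp add: to_ac_divide)
qed

lemma polys_over_range:
  assumes "field_hom \<iota>" "p \<in> polys_over (range \<iota>)"
  obtains q where "p = map_poly \<iota> q"
proof
  have i: "inj \<iota>" by (rule field_hom_inj[OF assms(1)])
  have 0: "\<iota> 0 = 0" by (rule field_homD(1)[OF assms(1)])
  have c: "\<iota> (inv_into UNIV \<iota> (coeff p j)) = coeff p j" for j
    using assms(2) by (intro f_inv_into_f) (simp add: polys_over_def)
  have z0: "inv_into UNIV \<iota> 0 = 0" using inv_into_f_f[OF i, of 0] 0 by simp
  show "p = map_poly \<iota> (map_poly (inv_into UNIV \<iota>) p)"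
    by (rule poly_eqI) (simp add: coeff_map_poly 0 z0 c)
qed

lemma transcendental_of_nonconst:
  fixes \<kappa> :: "'c::alg_closed_field \<Rightarrow> 'b::field"
  assumes "field_hom \<kappa>" "\<forall>c. \<tau> \<noteq> \<kappa> c" "poly (map_poly \<kappa> p) \<tau> = 0"
  shows "p = 0"
  using root_of_map_poly[OF assms(1) _ assms(3)] assms(2) by blast

text \<open>\<Psi> embeds the algebraic closure of k(t) into that of the rational functions in x
  over the algebraic closure of k. The image of \<open>t\<close> is only required to be nonconstant,
  so that the odd case can send it to P(x)/Q(x) and the even case to x - a.\<close>

locale geometric_alt =
  fixes n :: nat and f :: "'k::field_char_0 poly fract poly" and y :: "nat \<Rightarrow> 'k poly fract alg_closure"
    and \<Psi> :: "'k poly fract alg_closure \<Rightarrow> 'k alg_closure poly fract alg_closure"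
  assumes inj_y: "inj_on y {1..n}"
    and roots: "poly (map_poly to_ac f) z = 0 \<longleftrightarrow> z \<in> y ` {1..n}"
    and even: "field_hom \<sigma> \<Longrightarrow> (\<forall>a. \<sigma> (to_ac a) = to_ac a) \<Longrightarrow> p permutes {1..n} \<Longrightarrow>
      (\<forall>i\<in>{1..n}. \<sigma> (y i) = y (p i)) \<Longrightarrow> evenperm p"
    and \<Psi>: "field_hom \<Psi>" "\<Psi> (const_ac c) = const_ac (to_ac c)" "\<Psi> var_ac \<noteq> const_ac b"
    and geometric_alt: "p permutes {1..n} \<Longrightarrow> evenperm p \<Longrightarrow>
      \<exists>\<sigma>. field_hom \<sigma> \<and> (\<forall>c. \<sigma> (const_ac c) = const_ac c) \<and> \<sigma> (\<Psi> var_ac) = \<Psi> var_ac \<and>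
        (\<forall>i\<in>{1..n}. \<sigma> (\<Psi> (y i)) = \<Psi> (y (p i)))"
begin

lemma fixes_rational:
  assumes "field_hom \<sigma>" "\<forall>c. \<sigma> (const_ac c) = const_ac c" "\<sigma> (\<Psi> var_ac) = \<Psi> var_ac"
  shows "\<sigma> (\<Psi> (to_ac q)) = \<Psi> (to_ac q)"
proof -
  have "to_ac q \<in> {z. \<sigma> (\<Psi> z) = \<Psi> z}"
    by (rule to_ac_in_subfield[OF is_subfield_equalizer[OF field_hom_comp[OF assms(1) \<Psi>(1)] \<Psi>(1)]])
      (simp_all add: assms \<Psi>(2))
  thus ?thesis by simp
qed

sublocale alt_splitting n f y
proof
  fix p assume p: "p permutes {1..n}" "evenperm p"
  obtain \<sigma> where \<sigma>: "field_hom \<sigma>" "\<forall>c. \<sigma> (const_ac c) = const_ac c" "\<sigma> (\<Psi> var_ac) = \<Psi> var_ac"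
    "\<forall>i\<in>{1..n}. \<sigma> (\<Psi> (y i)) = \<Psi> (y (p i))" using geometric_alt[OF p] by blast
  note fr = fixes_rational[OF \<sigma>(1-3)]
  let ?E = "splitting_field f"
  \<comment> \<open>An automorphism found on the large side need not preserve the image of \<Psi>,
    but it preserves the image of the splitting field: it fixes the rational functions of
    \<open>t\<close> and permutes the roots. There it can be pulled back and then extended.\<close>
  have sub: "?E \<subseteq> {z. \<sigma> (\<Psi> z) \<in> range \<Psi>}"
  proof (rule splitting_field_props(4))
    show "is_subfield {z. \<sigma> (\<Psi> z) \<in> range \<Psi>}"
      by (rule is_subfield_preimage[OF field_hom_comp[OF \<sigma>(1) \<Psi>(1)] is_subfield_image[OF \<Psi>(1) is_subfield_UNIV]])
    show "range to_ac \<subseteq> {z. \<sigma> (\<Psi> z) \<in> range \<Psi>}" using fr by auto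
    fix z assume "poly (map_poly to_ac f) z = 0"
    then obtain i where i: "i \<in> {1..n}" "z = y i" using roots by blast
    show "z \<in> {z. \<sigma> (\<Psi> z) \<in> range \<Psi>}" using bspec[OF \<sigma>(4) i(1)] by (simp add: i(2))
  qed
  define \<phi> where "\<phi> z = inv_into UNIV \<Psi> (\<sigma> (\<Psi> z))" for z
  have \<phi>: "\<Psi> (\<phi> z) = \<sigma> (\<Psi> z)" if "z \<in> ?E" for z
    unfolding \<phi>_def by (rule f_inv_into_f) (use sub that in blast)
  have inj: "\<Psi> u = \<Psi> v \<Longrightarrow> u = v" for u v using field_hom_inj[OF \<Psi>(1)] by (rule injD)
  have "hom_on ?E \<phi>" unfolding hom_on_def
  proof (intro conjI ballI)
    note E = is_subfieldD[OF splitting_field_props(1)]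
    show "\<phi> 1 = 1" by (rule inj) (simp add: \<phi>[OF E(2)] field_homD[OF \<sigma>(1)] field_homD[OF \<Psi>(1)])
    fix u v assume uv: "u \<in> ?E" "v \<in> ?E"
    show "\<phi> (u + v) = \<phi> u + \<phi> v"
      by (rule inj) (simp add: \<phi>[OF E(3)[OF uv]] \<phi>[OF uv(1)] \<phi>[OF uv(2)] field_homD[OF \<sigma>(1)] field_homD[OF \<Psi>(1)])
    show "\<phi> (u * v) = \<phi> u * \<phi> v"
      by (rule inj) (simp add: \<phi>[OF E(4)[OF uv]] \<phi>[OF uv(1)] \<phi>[OF uv(2)] field_homD[OF \<sigma>(1)] field_homD[OF \<Psi>(1)])
  qed
  moreover have "algebraic_over ?E z" for z
    by (rule algebraic_over_mono[OF algebraic_over_range_to_ac]) (use splitting_field_props(2) in blast)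
  ultimately obtain \<tau> where \<tau>: "field_hom \<tau>" "\<And>z. z \<in> ?E \<Longrightarrow> \<tau> z = \<phi> z"
    using extend_hom[OF splitting_field_props(1), of f \<phi>] by blast
  have "\<tau> (to_ac a) = to_ac a" for a
    by (rule inj) (simp add: \<tau>(2) \<phi> splitting_field_props(2) fr)
  moreover have "\<tau> (y i) = y (p i)" if "i \<in> {1..n}" for i
  proof (rule inj)
    have "y i \<in> ?E" by (rule splitting_field_props(3)) (use roots that in blast)
    thus "\<Psi> (\<tau> (y i)) = \<Psi> (y (p i))" using bspec[OF \<sigma>(4) that] by (simp add: \<tau>(2) \<phi>)
  qed
  ultimately show "\<exists>\<sigma>. field_hom \<sigma> \<and> (\<forall>a. \<sigma> (to_ac a) = to_ac a) \<and> (\<forall>i\<in>{1..n}. \<sigma> (y i) = y (p i))"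
    using \<tau>(1) by blast
qed (fact inj_y roots even)+

text \<open>An element algebraic over the constants becomes a constant under \<Psi>. Every Galois
  element over k(t) acts on the splitting field like a geometric one with the same even permutation,
  and that one fixes constants. So the element lies in k(t), where being constant is checked on
  coefficients.\<close>

theorem regular: "algebraically_closed_in constants E"
  unfolding algebraically_closed_in_def
proof (intro conjI ballI impI)
  have cr: "constants = range (const_ac :: 'k \<Rightarrow> _)" by (simp add: constants_def const_ac_def)
  have sc: "is_subfield (constants :: 'k poly fract alg_closure set)" unfolding cr
    by (rule is_subfield_image[OF field_hom_const_ac is_subfield_UNIV])
  show "constants \<subseteq> E" unfolding cr const_ac_def using splitting_field_props(2) by blast
  fix z assume z: "z \<in> E" "ring.algebraic type_ring constants z"
  then obtain r where r: "r \<in> polys_over constants" "r \<noteq> 0" "poly r z = 0"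
    unfolding algebraic_type_ring_iff[OF sc] algebraic_over_def by blast
  obtain s :: "'k poly" where s: "r = map_poly const_ac s"
    using polys_over_range[OF field_hom_const_ac r(1)[unfolded cr]] .
  interpret \<Psi>: field_hom \<Psi> by (rule \<Psi>(1))
  interpret k: field_hom "const_ac :: 'k \<Rightarrow> _" by (rule field_hom_const_ac)
  interpret kb: field_hom "const_ac :: 'k alg_closure \<Rightarrow> _" by (rule field_hom_const_ac)
  interpret mp: map_poly_idom_hom "const_ac :: 'k alg_closure \<Rightarrow> _" ..
  have \<Psi>map: "map_poly \<Psi> (map_poly const_ac u) = map_poly const_ac (map_poly to_ac u)" for u
    by (rule poly_eqI) (simp add: \<Psi>(2))
  have "poly (map_poly const_ac (map_poly to_ac s)) (\<Psi> z) = 0"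
    using poly_field_hom[OF \<Psi>(1), of r z] r(3) by (simp add: s \<Psi>map)
  moreover have "map_poly to_ac s \<noteq> 0" using r(2) by (auto simp: s)
  ultimately obtain c where c: "\<Psi> z = const_ac c"
    using root_of_map_poly[OF field_hom_const_ac, of "map_poly to_ac s" "\<Psi> z"] by blast
  have "z \<in> range to_ac"
  proof (rule fixed_in_range_to_ac)
    fix \<tau> :: "'k poly fract alg_closure \<Rightarrow> 'k poly fract alg_closure"
    assume \<tau>: "field_hom \<tau>" "\<And>a. \<tau> (to_ac a) = to_ac a"
    obtain p where p: "p permutes {1..n}" "evenperm p" "\<And>i. i \<in> {1..n} \<Longrightarrow> \<tau> (y i) = y (p i)"
      using galois_perm[OF \<tau>(1)] \<tau>(2) by blast
    obtain \<sigma> where \<sigma>: "field_hom \<sigma>" "\<forall>c. \<sigma> (const_ac c) = const_ac c" "\<sigma> (\<Psi> var_ac) = \<Psi> var_ac"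
      "\<forall>i\<in>{1..n}. \<sigma> (\<Psi> (y i)) = \<Psi> (y (p i))" using geometric_alt[OF p(1,2)] by blast
    have "\<Psi> (\<tau> z) = \<sigma> (\<Psi> z)"
    proof (rule hom_eq_on_E[OF field_hom_comp[OF \<Psi>(1) \<tau>(1)] field_hom_comp[OF \<sigma>(1) \<Psi>(1)] _ _ z(1)])
      show "\<Psi> (\<tau> (to_ac a)) = \<sigma> (\<Psi> (to_ac a))" for a using fixes_rational[OF \<sigma>(1-3)] \<tau>(2) by simp
      show "\<Psi> (\<tau> (y i)) = \<sigma> (\<Psi> (y i))" if "i \<in> {1..n}" for i using p(3)[OF that] bspec[OF \<sigma>(4) that] by simp
    qed
    hence "\<Psi> (\<tau> z) = \<Psi> z" using \<sigma>(2) c by simp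
    thus "\<tau> z = z" by (rule injD[OF field_hom_inj[OF \<Psi>(1)]])
  qed
  then obtain q where q: "z = to_ac q" by blast
  obtain u v where uv: "q = to_fract u / to_fract v" "v \<noteq> 0" by (rule fract_rep)
  have \<Psi>f: "\<Psi> (to_ac (to_fract w)) = poly (map_poly const_ac (map_poly to_ac w)) (\<Psi> var_ac)" for w
    unfolding to_ac_to_fract[of w] poly_field_hom[OF \<Psi>(1)] \<Psi>map ..
  have "z * to_ac (to_fract v) = to_ac (to_fract u)"
    using uv by (simp add: q to_ac_divide)
  hence "const_ac c * \<Psi> (to_ac (to_fract v)) = \<Psi> (to_ac (to_fract u))"
    using field_homD(4)[OF \<Psi>(1)] c by metis
  hence "poly (map_poly const_ac (smult c (map_poly to_ac v) - map_poly to_ac u)) (\<Psi> var_ac) = 0"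
    by (simp add: \<Psi>f mp.hom_minus kb.map_poly_hom_smult)
  hence "smult c (map_poly to_ac v) - map_poly to_ac u = 0"
    by (rule transcendental_of_nonconst[OF field_hom_const_ac, rotated]) (use \<Psi>(3) in blast)
  hence e: "smult c (map_poly to_ac v) = map_poly to_ac u" by simp
  from arg_cong[OF this, of "\<lambda>p. coeff p (degree v)"] have "c * to_ac (lead_coeff v) = to_ac (coeff u (degree v))" by simp
  \<comment> \<open>A proportionality factor between two polynomials over k is a quotient of their
    coefficients, hence lies in k.\<close>
  hence c': "c = to_ac (coeff u (degree v) / lead_coeff v)" (is "c = to_ac ?c") using uv(2) by (simp add: to_ac_divide field_simps)
  have "u = smult ?c v"
  proof (rule poly_eqI)
    fix j
    from arg_cong[OF e, of "\<lambda>p. coeff p j"] have "to_ac (?c * coeff v j) = to_ac (coeff u j)"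
      unfolding c' to_ac_mult by simp
    thus "coeff u j = coeff (smult ?c v) j" by (simp only: to_ac_hom.eq_iff coeff_smult)
  qed
  hence "u = [:?c:] * v" by simp
  hence "to_fract u = to_fract [:?c:] * to_fract v" unfolding to_fract_mult[symmetric] by (rule arg_cong)
  moreover have "to_fract v \<noteq> 0" using uv(2) by simp
  ultimately have "q = to_fract [:?c:]" unfolding uv(1) by simp
  thus "z \<in> constants" unfolding cr q const_ac_def by blast
qed

theorem regular_galois: "regular_galois_extension (splitting_field f)"
  unfolding regular_galois_extension_def using galois regular by blast

end

text \<open>This is the invariance of the resultant of \<open>p\<close> and \<open>q\<close> under adding multiples of \<open>q\<close> to \<open>p\<close>.\<close>

lemma prod_poly_roots_shift:
  fixes q :: "'a::alg_closed_field poly"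
  assumes "root_prod N y' = root_prod N y + smult T q"
  shows "(\<Prod>i\<in>{1..N}. poly q (y' i)) = (\<Prod>i\<in>{1..N}. poly q (y i))"
proof (cases "q = 0")
  case False
  define l where "l = lead_coeff q"
  have l: "l \<noteq> 0" using False by (simp add: l_def)
  have "lead_coeff (smult (inverse l) q) = 1" using l by (simp add: l_def)
  moreover have "degree (smult (inverse l) q) = degree q" using l by simp
  ultimately obtain b where b: "smult (inverse l) q = root_prod (degree q) b" by (rule monic_splits)
  hence q: "q = smult l (root_prod (degree q) b)" using l by (metis smult_smult right_inverse smult_1_left)
  have *: "(\<Prod>i\<in>{1..N}. poly q (w i)) = l ^ N * (\<Prod>j\<in>{1..degree q}. (- 1) ^ N * poly (root_prod N w) (b j))" for w
  proof -
    have "(\<Prod>i\<in>{1..N}. poly q (w i)) = (\<Prod>i\<in>{1..N}. l * (\<Prod>j\<in>{1..degree q}. w i - b j))"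
      by (subst q) (simp only: poly_smult poly_root_prod)
    also have "\<dots> = l ^ N * (\<Prod>j\<in>{1..degree q}. \<Prod>i\<in>{1..N}. w i - b j)"
      unfolding prod.distrib by (subst prod.swap) simp
    also have "(\<Prod>j\<in>{1..degree q}. \<Prod>i\<in>{1..N}. w i - b j) = (\<Prod>j\<in>{1..degree q}. (- 1) ^ N * poly (root_prod N w) (b j))"
    proof (rule prod.cong[OF refl])
      fix j
      have "(\<Prod>i\<in>{1..N}. w i - b j) = (\<Prod>i\<in>{1..N}. (- 1) * (b j - w i))" by simp
      also have "\<dots> = (- 1) ^ N * poly (root_prod N w) (b j)" unfolding prod.distrib poly_root_prod by simp
      finally show "(\<Prod>i\<in>{1..N}. w i - b j) = (- 1) ^ N * poly (root_prod N w) (b j)" .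
    qed
    finally show ?thesis .
  qed
  have "poly q (b j) = 0" if "j \<in> {1..degree q}" for j
    by (subst q) (use that root_prod_root_iff[of "degree q" b "b j"] in auto)
  hence "poly (root_prod N y') (b j) = poly (root_prod N y) (b j)" if "j \<in> {1..degree q}" for j
    using that by (simp add: assms)
  thus ?thesis unfolding * by (intro arg_cong[of _ _ "\<lambda>u. l ^ N * u"] prod.cong refl) simp
qed simp

text \<open>At a root of P - T Q the Wronskian identity says that the derivative times
  \<open>Q\<close> equals R^2. Multiplying over all roots expresses the squared Vandermonde product
  through values of \<open>Q\<close> and \<open>R\<close>.\<close>

lemma mestre_discriminant:
  fixes \<iota> :: "'k::field \<Rightarrow> 'a::field"
  assumes \<iota>: "field_hom \<iota>" and W: "pderiv P * Q - P * pderiv Q = R ^ 2"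
    and y: "map_poly \<iota> P - smult T (map_poly \<iota> Q) = root_prod N y"
  shows "vdm N y ^ 2 * (\<Prod>i\<in>{1..N}. poly (map_poly \<iota> Q) (y i)) =
    (- 1) ^ (N * (N - 1) div 2) * (\<Prod>i\<in>{1..N}. poly (map_poly \<iota> R) (y i)) ^ 2"
proof -
  interpret field_hom \<iota> by fact
  interpret mp: map_poly_idom_hom \<iota> ..
  have "map_poly \<iota> (pderiv P * Q - P * pderiv Q) = map_poly \<iota> (R ^ 2)" by (simp only: W)
  hence W': "pderiv (map_poly \<iota> P) * map_poly \<iota> Q - map_poly \<iota> P * pderiv (map_poly \<iota> Q) = map_poly \<iota> R ^ 2"
    by (simp add: hom_distribs)
  have "poly (pderiv (root_prod N y)) (y i) * poly (map_poly \<iota> Q) (y i) = poly (map_poly \<iota> R) (y i) ^ 2"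
    if i: "i \<in> {1..N}" for i
  proof -
    have "poly (root_prod N y) (y i) = 0" unfolding root_prod_root_iff using i by blast
    from this[folded y] arg_cong[OF W', of "\<lambda>p. poly p (y i)"] show ?thesis unfolding y[symmetric]
      by (simp add: pderiv_diff pderiv_smult algebra_simps)
  qed
  thus ?thesis unfolding vdm_square by (simp add: mult.assoc prod.distrib[symmetric] prod_power_distrib)
qed

text \<open>The discriminant formula is used for P - T Q and for \<open>P\<close> itself. The
  product of \<open>Q\<close> over the roots is the same in both cases, so the two discriminants
  differ by a square and the Vandermonde product of \<open>y\<close> is, up to sign, \<delta> B'/B.
  Here B' is symmetric in the roots and B is a resultant over k, so \<sigma> fixes the
  quotient.\<close>

lemma mestre_even:
  fixes \<iota> :: "'k::field_char_0 \<Rightarrow> 'a::{alg_closed_field,field_char_0}"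
  assumes \<iota>: "field_hom \<iota>" and W: "pderiv P * Q - P * pderiv Q = R ^ 2"
    and y: "map_poly \<iota> P - smult T (map_poly \<iota> Q) = root_prod N y" "inj_on y {1..N}"
    and \<alpha>: "map_poly to_ac P = root_prod N \<alpha>" "inj_on \<alpha> {1..N}" "vdm N \<alpha> = to_ac \<delta>"
      "\<And>i. i \<in> {1..N} \<Longrightarrow> poly (map_poly to_ac R) (\<alpha> i) \<noteq> 0"
    and \<sigma>: "field_hom \<sigma>" "\<forall>c. \<sigma> (\<iota> c) = \<iota> c" "p permutes {1..N}" "\<forall>i\<in>{1..N}. \<sigma> (y i) = y (p i)"
  shows "evenperm p"
proof -
  interpret \<iota>: field_hom \<iota> by fact
  interpret \<sigma>: field_hom \<sigma> by fact
  obtain \<epsilon> where \<epsilon>: "field_hom \<epsilon>" "\<And>c. \<epsilon> (to_ac c) = \<iota> c" using extend_to_alg_closure[OF \<iota>] by blast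
  interpret \<epsilon>: field_hom \<epsilon> by fact
  define w where "w i = \<epsilon> (\<alpha> i)" for i
  have \<epsilon>map: "map_poly \<iota> u = map_poly \<epsilon> (map_poly to_ac u)" for u by (rule poly_eqI) (simp add: \<epsilon>(2))
  have w: "map_poly \<iota> P = root_prod N w" unfolding \<epsilon>map \<alpha>(1) w_def root_prod_def by (rule map_root_prod[OF \<epsilon>(1)])
  have eval: "poly (map_poly \<iota> u) (w i) = \<epsilon> (poly (map_poly to_ac u) (\<alpha> i))" for u i
    unfolding w_def \<epsilon>map by simp
  define A where "A = (\<Prod>i\<in>{1..N}. poly (map_poly \<iota> Q) (w i))"
  define B where "B = (\<Prod>i\<in>{1..N}. poly (map_poly \<iota> R) (w i))"
  define B' where "B' = (\<Prod>i\<in>{1..N}. poly (map_poly \<iota> R) (y i))"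
  have A: "(\<Prod>i\<in>{1..N}. poly (map_poly \<iota> Q) (y i)) = A" unfolding A_def
    by (rule prod_poly_roots_shift[of N y w "- T"]) (simp flip: y(1) w)
  have vw: "vdm N w = \<iota> \<delta>" unfolding \<epsilon>(2)[symmetric] \<alpha>(3)[symmetric] map_vdm[OF \<epsilon>(1)] w_def ..
  let ?s = "(- 1) ^ (N * (N - 1) div 2) :: 'a"
  have y2: "vdm N y ^ 2 * A = ?s * B' ^ 2" using mestre_discriminant[OF \<iota> W y(1)] unfolding A B'_def .
  have w2: "\<iota> \<delta> ^ 2 * A = ?s * B ^ 2"
    \<comment> \<open>The case T = 0, whose roots are those of \<open>P\<close>.\<close>
    using mestre_discriminant[OF \<iota> W, of 0 N w] unfolding vw A_def[symmetric] B_def[symmetric] by (simp add: w)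
  have B0: "B \<noteq> 0" unfolding B_def eval using \<alpha>(4) by simp
  have A0: "A \<noteq> 0" using w2 B0 by auto
  have "(vdm N y * B) ^ 2 * A = (\<iota> \<delta> * B') ^ 2 * A"
  proof -
    have "(vdm N y * B) ^ 2 * A = (vdm N y ^ 2 * A) * B ^ 2" by (simp add: power_mult_distrib)
    also have "\<dots> = (?s * B ^ 2) * B' ^ 2" unfolding y2 by simp
    also have "\<dots> = (\<iota> \<delta> * B') ^ 2 * A" unfolding w2[symmetric] by (simp add: power_mult_distrib)
    finally show ?thesis .
  qed
  hence "(vdm N y * B) ^ 2 = (\<iota> \<delta> * B') ^ 2" using A0 by simp
  hence pm: "vdm N y * B = \<iota> \<delta> * B' \<or> vdm N y * B = - (\<iota> \<delta> * B')" by (simp add: power2_eq_iff)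
  have \<sigma>map: "map_poly \<sigma> (map_poly \<iota> u) = map_poly \<iota> u" for u by (rule poly_eqI) (simp add: \<sigma>(2))
  have \<sigma>B': "\<sigma> B' = B'"
  proof -
    have "\<sigma> B' = (\<Prod>i\<in>{1..N}. \<sigma> (poly (map_poly \<iota> R) (y i)))" unfolding B'_def by (rule \<sigma>.hom_prod)
    also have "\<dots> = (\<Prod>i\<in>{1..N}. poly (map_poly \<iota> R) (y (p i)))"
      by (rule prod.cong[OF refl]) (simp only: poly_field_hom[OF \<sigma>(1)] \<sigma>map bspec[OF \<sigma>(4)])
    also have "\<dots> = B'" unfolding B'_def
      using prod.permute[OF \<sigma>(3), of "\<lambda>i. poly (map_poly \<iota> R) (y i)"] by (simp only: o_def)
    finally show ?thesis .
  qed
  have "B = \<iota> (resultant P R)"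
  proof -
    have injw: "inj_on w {1..degree (root_prod N w)}"
      unfolding degree_root_prod
      using comp_inj_on[OF \<alpha>(2) inj_on_subset[OF field_hom_inj[OF \<epsilon>(1)] subset_UNIV]] by (simp add: w_def[abs_def] o_def)
    have "resultant (map_poly \<iota> P) (map_poly \<iota> R) =
      lead_coeff (root_prod N w) ^ degree (map_poly \<iota> R) * (\<Prod>k\<in>{1..degree (root_prod N w)}. poly (map_poly \<iota> R) (w k))"
      unfolding w
    proof (rule resultant_roots[OF injw])
      fix k assume "k \<in> {1..degree (root_prod N w)}"
      thus "poly (root_prod N w) (w k) = 0" unfolding root_prod_root_iff degree_root_prod by blast
    qed
    hence "resultant (map_poly \<iota> P) (map_poly \<iota> R) = B"
      unfolding monic_root_prod unfolding degree_root_prod B_def by simp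
    thus ?thesis by (simp add: \<iota>.resultant_hom)
  qed
  hence \<sigma>B: "\<sigma> B = B" using \<sigma>(2) by simp
  have "\<sigma> (vdm N y) * B = \<sigma> (vdm N y * B)" by (simp add: \<sigma>B field_homD[OF \<sigma>(1)])
  also have "\<sigma> (vdm N y * B) = vdm N y * B" using pm
  proof
    assume e: "vdm N y * B = \<iota> \<delta> * B'"
    show ?thesis unfolding e by (simp add: \<sigma>B' \<sigma>(2) field_homD[OF \<sigma>(1)])
  next
    assume e: "vdm N y * B = - (\<iota> \<delta> * B')"
    show ?thesis unfolding e by (simp add: \<sigma>B' \<sigma>(2) field_homD[OF \<sigma>(1)])
  qed
  finally have fx: "\<sigma> (vdm N y) = vdm N y" using B0 by simp
  have "\<sigma> (vdm N y) = vdm N (y \<circ> p)" unfolding map_vdm[OF \<sigma>(1)]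
    by (rule vdm_cong) (simp only: bspec[OF \<sigma>(4)] o_apply)
  hence "of_int (sign p) * vdm N y = vdm N y" unfolding fx vdm_permute[OF \<sigma>(3)] by simp
  hence "of_int (sign p) = (1 :: 'a)" using vdm_nonzero[OF y(2)] by simp
  thus ?thesis by (auto simp: sign_def split: if_splits)
qed

text \<open>A nonconstant element is transcendental over the closed field of constants, so the
  indeterminate can be sent to it; the map then extends to the algebraic closure.\<close>

lemma exists_specialization_hom:
  fixes \<tau> :: "'k::field alg_closure poly fract alg_closure"
  assumes "\<forall>c. \<tau> \<noteq> const_ac c"
  obtains \<Psi> :: "'k poly fract alg_closure \<Rightarrow> 'k alg_closure poly fract alg_closure"
  where "field_hom \<Psi>" "\<And>c. \<Psi> (const_ac c) = const_ac (to_ac c)" "\<Psi> var_ac = \<tau>"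
proof -
  define \<kappa> where "\<kappa> c = const_ac (to_ac c)" for c :: 'k
  have \<kappa>: "field_hom \<kappa>" unfolding \<kappa>_def[abs_def] by (rule field_hom_comp[OF field_hom_const_ac to_ac_hom.field_hom_axioms])
  interpret \<kappa>: field_hom \<kappa> by (rule \<kappa>)
  interpret kb: field_hom "const_ac :: 'k alg_closure \<Rightarrow> _" by (rule field_hom_const_ac)
  have tr: "p = 0" if "poly (map_poly \<kappa> p) \<tau> = 0" for p
  proof -
    have "map_poly \<kappa> p = map_poly const_ac (map_poly to_ac p)" by (rule poly_eqI) (simp add: \<kappa>_def)
    hence "map_poly to_ac p = 0" using transcendental_of_nonconst[OF field_hom_const_ac assms] that by simp
    thus ?thesis by simp
  qed
  have fe: "field_hom (fract_eval \<kappa> \<tau>)" "\<And>a. fract_eval \<kappa> \<tau> (to_fract a) = poly (map_poly \<kappa> a) \<tau>"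
    by (rule fract_eval[OF \<kappa>], rule tr, assumption)+
  obtain \<Psi> where \<Psi>: "field_hom \<Psi>" "\<And>q. \<Psi> (to_ac q) = fract_eval \<kappa> \<tau> q"
    using extend_to_alg_closure[OF fe(1)] by blast
  show ?thesis
  proof
    show "field_hom \<Psi>" by (rule \<Psi>(1))
    show "\<Psi> (const_ac c) = const_ac (to_ac c)" for c
      unfolding const_ac_def[of c] \<Psi>(2) fe(2) by (simp add: hom_distribs) (simp add: \<kappa>_def)
    show "\<Psi> var_ac = \<tau>" unfolding var_ac_def \<Psi>(2) fe(2) by (simp add: hom_distribs)
  qed
qed

lemma map_specialization_hom:
  assumes "field_hom \<Psi>" "\<And>c. \<Psi> (const_ac c) = const_ac (to_ac c)"
  shows "map_poly \<Psi> (map_poly const_ac u) = map_poly const_ac (map_poly to_ac u)"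
  by (rule poly_eqI)
    (simp add: coeff_map_poly assms(2) field_homD(1)[OF assms(1)] field_homD(1)[OF field_hom_const_ac])

context mestre_cover
begin

lemma \<kappa>_const_ac: "\<kappa> = const_ac" and x_var_ac: "x = var_ac"
  by (simp_all add: fun_eq_iff \<kappa>_def const_ac_def x_def var_ac_def)

end

text \<open>\<open>T\<close> may be any element above the geometric parameter P(x)/Q(x): the
  indeterminate itself for odd degree, a rational function of it for even degree. The monodromy
  theorem is transported along \<Psi>.\<close>

lemma mestre_realization:
  fixes P Q R :: "'k::field_char_0 poly"
  assumes cover: "mestre_cover N (map_poly to_ac P) (map_poly to_ac Q) (map_poly to_ac R)"
    and dQ: "Suc (degree Q) = N"
    and \<Psi>: "field_hom \<Psi>" "\<And>c. \<Psi> (const_ac c) = const_ac (to_ac c)"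
      "\<Psi> T = mestre_cover.t (map_poly to_ac P) (map_poly to_ac Q)"
  obtains y where "map_poly const_ac P - smult T (map_poly const_ac Q) = root_prod N y" "inj_on y {1..N}"
    "\<Psi> (y N) = var_ac"
    "\<And>p. p permutes {1..N} \<Longrightarrow> evenperm p \<Longrightarrow> \<exists>\<sigma>. field_hom \<sigma> \<and> (\<forall>c. \<sigma> (const_ac c) = const_ac c) \<and>
      \<sigma> (\<Psi> T) = \<Psi> T \<and> (\<forall>i\<in>{1..N}. \<sigma> (\<Psi> (y i)) = \<Psi> (y (p i)))"
proof -
  interpret M: mestre_cover N "map_poly to_ac P" "map_poly to_ac Q" "map_poly to_ac R" by (rule cover)
  interpret \<Psi>: field_hom \<Psi> by (rule \<Psi>(1))
  interpret mp: map_poly_idom_hom \<Psi> ..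
  define F where "F = map_poly const_ac P - smult T (map_poly const_ac Q)"
  have F: "map_poly \<Psi> F = M.f"
    unfolding F_def M.f_def M.\<kappa>_const_ac \<Psi>(3)[symmetric]
    by (simp only: mp.hom_minus \<Psi>.map_poly_hom_smult map_specialization_hom[OF \<Psi>(1,2)])
  have dF: "degree F = N" using M.degree_f unfolding F[symmetric] by simp
  have "\<Psi> (lead_coeff F) = 1" using M.monic_f unfolding F[symmetric] by simp
  hence "lead_coeff F = 1" by simp
  then obtain y0 where y0: "F = root_prod N y0" using dF by (rule monic_splits)
  have "M.f = root_prod N (\<lambda>i. \<Psi> (y0 i))" unfolding F[symmetric] y0 root_prod_def by (rule map_root_prod[OF \<Psi>(1)])
  moreover have "poly M.f M.x = 0" unfolding M.f_def M.t_def using M.Qx_nonzero by simp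
  ultimately obtain j where j: "j \<in> {1..N}" "M.x = \<Psi> (y0 j)" using root_prod_root_iff by metis
  \<comment> \<open>Renumbers the roots so that the last one lies over \<open>x\<close>.\<close>
  define y where "y i = y0 (transpose j N i)" for i
  have tr: "transpose j N permutes {1..N}" using j(1) M.N by (intro permutes_swap_id) simp_all
  have y: "F = root_prod N y" unfolding y0 y_def root_prod_permute[OF tr] ..
  interpret M: mestre_roots N "map_poly to_ac P" "map_poly to_ac Q" "map_poly to_ac R" "\<lambda>i. \<Psi> (y i)"
  proof
    show "M.f = root_prod N (\<lambda>i. \<Psi> (y i))" unfolding F[symmetric] y root_prod_def by (rule map_root_prod[OF \<Psi>(1)])
    show "\<Psi> (y N) = M.x" using j(2) by (simp add: y_def)
  qed
  show ?thesis
  proof (rule that)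
    show "map_poly const_ac P - smult T (map_poly const_ac Q) = root_prod N y" using y unfolding F_def .
    show "inj_on y {1..N}"
    proof (rule inj_onI)
      fix i k assume "i \<in> {1..N}" "k \<in> {1..N}" "y i = y k"
      thus "i = k" using inj_onD[OF M.inj_xs, of i k] by simp
    qed
    show "\<Psi> (y N) = var_ac" using M.xs_N unfolding M.x_var_ac .
    fix p assume p: "p permutes {1..N}" "evenperm p"
    have "Suc (degree (map_poly to_ac Q)) = N" using dQ by simp
    then obtain \<sigma> where \<sigma>: "field_hom \<sigma>" "\<And>c. \<sigma> (M.\<kappa> c) = M.\<kappa> c" "\<sigma> M.t = M.t"
      "\<And>i. i \<in> {1..N} \<Longrightarrow> \<sigma> (\<Psi> (y i)) = \<Psi> (y (p i))" using M.alternating_monodromy[OF _ p] by blast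
    show "\<exists>\<sigma>. field_hom \<sigma> \<and> (\<forall>c. \<sigma> (const_ac c) = const_ac c) \<and>
      \<sigma> (\<Psi> T) = \<Psi> T \<and> (\<forall>i\<in>{1..N}. \<sigma> (\<Psi> (y i)) = \<Psi> (y (p i)))"
      using \<sigma>(1,2,3,4) unfolding M.\<kappa>_const_ac \<Psi>(3) by blast
  qed
qed

section \<open>From the polynomial g to the family and its specialization\<close>

text \<open>With leading coefficient l the resultant formula gives discriminant (l^(n-1)
  \<open>vdm n \<gamma>\<close>)^2, so the Vandermonde product itself is rational; an odd
  permutation would change its sign.\<close>

lemma square_discriminant_even:
  fixes g :: "'k::field_char_0 poly"
  assumes sep: "separable_poly g" and deg: "degree g = n" "n \<ge> 1" and disc: "discriminant g = d ^ 2"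
  obtains \<gamma> where "inj_on \<gamma> {1..n}" "\<And>z. poly (map_poly to_ac g) z = 0 \<longleftrightarrow> z \<in> \<gamma> ` {1..n}"
    "even_galois_action n \<gamma>"
proof -
  define h where "h = map_poly to_ac g"
  define l where "l = lead_coeff h"
  have g0: "g \<noteq> 0" using deg by auto
  hence l: "l \<noteq> 0" by (simp add: l_def h_def)
  have dh: "degree h = n" using deg by (simp add: h_def)
  have "lead_coeff (smult (inverse l) h) = 1" using l by (simp add: l_def)
  moreover have "degree (smult (inverse l) h) = n" using l dh by simp
  ultimately obtain \<gamma> where \<gamma>: "smult (inverse l) h = root_prod n \<gamma>" by (rule monic_splits)
  have "h = smult l (smult (inverse l) h)" using l by simp
  hence h: "h = smult l (root_prod n \<gamma>)" unfolding \<gamma> .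
  have roots: "poly h z = 0 \<longleftrightarrow> z \<in> \<gamma> ` {1..n}" for z
    using l root_prod_root_iff[of n \<gamma> z] by (simp add: h image_iff)
  have inj: "inj_on \<gamma> {1..n}"
  proof (rule root_prod_inj)
    fix z assume "poly (root_prod n \<gamma>) z = 0"
    hence "poly h z = 0" by (simp add: h)
    hence "poly (pderiv h) z \<noteq> 0" using sep unfolding separable_poly_def h_def[symmetric] rsquarefree_roots by blast
    thus "poly (pderiv (root_prod n \<gamma>)) z \<noteq> 0" by (simp add: h pderiv_smult)
  qed
  have res: "resultant h (pderiv h) = l ^ (n - 1) * (l ^ n * (\<Prod>k\<in>{1..n}. poly (pderiv (root_prod n \<gamma>)) (\<gamma> k)))"
  proof -
    have "resultant h (pderiv h) = l ^ degree (pderiv h) * (\<Prod>k\<in>{1..degree h}. poly (pderiv h) (\<gamma> k))"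
      unfolding l_def by (rule resultant_roots) (use inj roots dh in auto)
    also have "(\<Prod>k\<in>{1..degree h}. poly (pderiv h) (\<gamma> k)) = l ^ n * (\<Prod>k\<in>{1..n}. poly (pderiv (root_prod n \<gamma>)) (\<gamma> k))"
      unfolding dh by (simp add: h pderiv_smult prod.distrib)
    finally show ?thesis by (simp add: degree_pderiv dh)
  qed
  have "to_ac d ^ 2 = to_ac (discriminant g)" by (simp add: disc)
  also have "\<dots> = (- 1) ^ (n * (n - 1) div 2) * resultant h (pderiv h) / l"
  proof -
    have "resultant h (pderiv h) = to_ac (resultant g (pderiv g))"
      unfolding h_def to_ac_hom.map_poly_pderiv[symmetric] to_ac_hom.resultant_hom ..
    thus ?thesis by (simp add: discriminant_def deg to_ac_divide l_def h_def)
  qed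
  also have "\<dots> = (l ^ (n - 1) * vdm n \<gamma>) ^ 2"
  proof -
    have "l ^ n = l * l ^ (n - 1)" using deg(2) by (simp add: power_eq_if)
    thus ?thesis unfolding res power_mult_distrib vdm_square using l by (simp add: power2_eq_square)
  qed
  finally have "l ^ (n - 1) * vdm n \<gamma> = to_ac d \<or> l ^ (n - 1) * vdm n \<gamma> = - to_ac d"
    by (simp only: power2_eq_iff) auto
  then obtain d' where d': "l ^ (n - 1) * vdm n \<gamma> = to_ac d'" by (metis to_ac_hom.hom_uminus)
  show ?thesis
  proof (rule that[OF inj])
    show "poly (map_poly to_ac g) z = 0 \<longleftrightarrow> z \<in> \<gamma> ` {1..n}" for z using roots unfolding h_def .
    show "even_galois_action n \<gamma>" unfolding even_galois_action_def
    proof (intro allI impI)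
      fix \<sigma> :: "'k alg_closure \<Rightarrow> 'k alg_closure"
      assume "field_hom \<sigma>" "\<forall>a. \<sigma> (to_ac a) = to_ac a"
      hence \<sigma>: "field_hom \<sigma>" "\<And>a. \<sigma> (to_ac a) = to_ac a" by simp_all
      interpret \<sigma>: field_hom \<sigma> by (rule \<sigma>(1))
      have \<sigma>h: "map_poly \<sigma> h = h" by (rule poly_eqI) (simp add: h_def \<sigma>(2))
      have "\<sigma> (\<gamma> i) \<in> \<gamma> ` {1..n}" if "i \<in> {1..n}" for i
      proof -
        have "poly h (\<gamma> i) = 0" unfolding roots using that by blast
        hence "poly h (\<sigma> (\<gamma> i)) = 0" using poly_field_hom[OF \<sigma>(1), of h "\<gamma> i"] unfolding \<sigma>h by simp
        thus ?thesis unfolding roots .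
      qed
      then obtain p where p: "p permutes {1..n}" "\<And>i. i \<in> {1..n} \<Longrightarrow> \<sigma> (\<gamma> i) = \<gamma> (p i)"
        using hom_permutes_roots[OF inj field_hom_inj[OF \<sigma>(1)]] by blast
      have \<sigma>l: "\<sigma> l = l" by (simp add: l_def h_def \<sigma>(2))
      have "l ^ (n - 1) * \<sigma> (vdm n \<gamma>) = \<sigma> (l ^ (n - 1) * vdm n \<gamma>)" by (simp add: hom_distribs \<sigma>l)
      also have "\<dots> = l ^ (n - 1) * vdm n \<gamma>" unfolding d' by (rule \<sigma>(2))
      finally have fx: "\<sigma> (vdm n \<gamma>) = vdm n \<gamma>" using l by simp
      have "\<sigma> (vdm n \<gamma>) = vdm n (\<gamma> \<circ> p)" unfolding map_vdm[OF \<sigma>(1)]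
        by (rule vdm_cong) (simp only: p(2) o_apply)
      hence "of_int (sign p) * vdm n \<gamma> = vdm n \<gamma>" unfolding fx vdm_permute[OF p(1)] by simp
      hence "of_int (sign p) = (1 :: 'k alg_closure)" using vdm_nonzero[OF inj] by simp
      hence "evenperm p" by (auto simp: sign_def split: if_splits)
      thus "\<exists>p. p permutes {1..n} \<and> evenperm p \<and> (\<forall>i\<in>{1..n}. \<sigma> (\<gamma> i) = \<gamma> (p i))" using p by blast
    qed
  qed
qed

lemma alternating_specialization:
  fixes g :: "'k::field_char_0 poly" and F :: "'k poly poly"
  assumes geo: "geometric_alt n (map_poly to_fract F) y \<Psi>"
    and inj: "inj_on \<alpha> {1..n}" and \<alpha>: "\<And>i. i \<in> {1..n} \<Longrightarrow> \<alpha> i = poly (map_poly to_ac q) (\<gamma> i)"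
    and g: "\<And>z. poly (map_poly to_ac g) z = 0 \<longleftrightarrow> z \<in> \<gamma> ` {1..n}"
    and F0: "\<And>z. poly (map_poly to_ac (map_poly (\<lambda>c. poly c 0) F)) z = 0 \<longleftrightarrow> z \<in> \<alpha> ` {1..n}"
  shows "\<exists>f :: 'k poly fract poly.
    f \<noteq> 0 \<and>
    regular_galois_extension (splitting_field f) \<and>
    galois_group (splitting_field f) (range to_ac) \<cong> alt_group n \<and>
    (\<forall>i. defined_at_0 (coeff f i)) \<and>
    specialize_at_0 f \<noteq> 0 \<and>
    splitting_field g = splitting_field (specialize_at_0 f)"
proof (intro exI conjI allI)
  interpret geometric_alt n "map_poly to_fract F" y \<Psi> by (rule geo)
  have fract1: "to_fract c = Fract c 1" for c :: "'k poly" by (simp add: to_fract_def)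
  have val0: "value_at_0 (to_fract c) = poly c 0" for c :: "'k poly"
    unfolding fract1 by (subst value_at_0_Fract) simp_all
  have v0: "value_at_0 (0 :: 'k poly fract) = 0" using val0[of 0] by simp
  have spec: "specialize_at_0 (map_poly to_fract F) = map_poly (\<lambda>c. poly c 0) F"
    unfolding specialize_at_0_def by (rule poly_eqI) (simp add: coeff_map_poly v0 val0)
  \<comment> \<open>Used against the zero polynomial, which would make every element of an infinite
    field one of finitely many roots.\<close>
  have fin: False if "\<And>z. z \<in> w ` {1..n}" for w :: "nat \<Rightarrow> 'b::field_char_0"
    using that infinite_UNIV_char_0[where 'a='b] by (metis UNIV_eq_I finite_atLeastAtMost finite_imageI)
  show "map_poly to_fract F \<noteq> 0"
  proof
    assume "map_poly to_fract F = 0"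
    hence "z \<in> y ` {1..n}" for z using roots[of z] by simp
    thus False by (rule fin)
  qed
  show "regular_galois_extension (splitting_field (map_poly to_fract F))" by (rule regular_galois)
  show "Gal \<cong> alt_group n" by (rule galois_group_iso)
  show "defined_at_0 (coeff (map_poly to_fract F) i)" for i
    unfolding defined_at_0_def by (rule exI[of _ "coeff F i"], rule exI[of _ 1]) (simp add: fract1)
  show "specialize_at_0 (map_poly to_fract F) \<noteq> 0"
  proof
    assume "specialize_at_0 (map_poly to_fract F) = 0"
    hence "z \<in> \<alpha> ` {1..n}" for z using F0[of z] by (simp add: spec)
    thus False by (rule fin)
  qed
  show "splitting_field g = splitting_field (specialize_at_0 (map_poly to_fract F))" unfolding spec
    by (rule splitting_field_eqI[OF inj \<alpha> g F0])
qed

lemma to_ac_to_fract_hom: "inj_comm_ring_hom (\<lambda>c :: 'k::field poly. to_ac (to_fract c))"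
  by unfold_locales simp_all

lemma const_poly_hom: "comm_ring_hom (\<lambda>c :: 'k::field. [:c:])"
  by unfold_locales (simp_all flip: one_pCons)

lemma eval_at_0_hom: "comm_ring_hom (\<lambda>c :: 'k::field poly. poly c 0)"
  by unfold_locales simp_all

lemma map_poly_const_ac:
  fixes p :: "'k::field poly"
  shows "map_poly (\<lambda>c. to_ac (to_fract c)) (map_poly (\<lambda>c. [:c:]) p) = map_poly const_ac p"
proof -
  interpret c: comm_ring_hom "\<lambda>c :: 'k. [:c:]" by (rule const_poly_hom)
  interpret k: field_hom "const_ac :: 'k \<Rightarrow> _" by (rule field_hom_const_ac)
  show ?thesis by (rule poly_eqI) (simp add: coeff_map_poly const_ac_def)
qed

lemma map_poly_const_at_0: "map_poly (\<lambda>c. poly c 0) (map_poly (\<lambda>c. [:c:]) p) = p"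
  by (rule poly_eqI) (simp add: coeff_map_poly)

lemma map_poly_at_0_smult: "map_poly (\<lambda>c. poly c 0) (smult a p) = smult (poly a 0) (map_poly (\<lambda>c. poly c 0) p)"
  by (rule poly_eqI) (simp add: coeff_map_poly)

lemma map_poly_to_ac_to_fract: "map_poly to_ac (map_poly to_fract p) = map_poly (\<lambda>c. to_ac (to_fract c)) p"
  by (rule poly_eqI) (simp add: coeff_map_poly)

lemma cover_identity:
  assumes "mestre_cover N (map_poly to_ac P) (map_poly to_ac Q) (map_poly to_ac R)"
  shows "pderiv P * Q - P * pderiv Q = R ^ 2"
proof -
  interpret mestre_cover N "map_poly to_ac P" "map_poly to_ac Q" "map_poly to_ac R" by fact
  interpret mp: map_poly_inj_idom_hom to_ac ..
  have "map_poly to_ac (pderiv P * Q - P * pderiv Q) = map_poly to_ac (R ^ 2)"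
    using W by (simp add: hom_distribs)
  thus ?thesis by (simp only: mp.eq_iff)
qed

lemma root_prod_Suc: "root_prod (Suc n) y = [:- y (Suc n), 1:] * root_prod n y"
  unfolding root_prod_def by (simp add: atLeastAtMostSuc_conv mult.commute)

text \<open>The family is P - t Q, which becomes \<open>P\<close> at t = 0; \<Psi> sends
  \<open>t\<close> to P(x)/Q(x).\<close>

lemma alternating_odd:
  fixes g :: "'k::field_char_0 poly"
  assumes n: "odd n" "n \<ge> 3" and \<gamma>: "inj_on \<gamma> {1..n}"
    and g: "\<And>z. poly (map_poly to_ac g) z = 0 \<longleftrightarrow> z \<in> \<gamma> ` {1..n}"
    and gal: "even_galois_action n \<gamma>"
  obtains F y \<Psi> \<alpha> q where "geometric_alt n (map_poly to_fract F) y \<Psi>" "inj_on \<alpha> {1..n}"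
    "\<And>i. i \<in> {1..n} \<Longrightarrow> \<alpha> i = poly (map_poly to_ac (q :: 'k poly)) (\<gamma> i)"
    "\<And>z. poly (map_poly to_ac (map_poly (\<lambda>c. poly c 0) F)) z = 0 \<longleftrightarrow> z \<in> \<alpha> ` {1..n}"
proof -
  obtain q P Q R :: "'k poly" and \<alpha> \<delta> where \<alpha>: "\<And>i. \<alpha> i = poly (map_poly to_ac q) (\<gamma> i)" "inj_on \<alpha> {1..n}"
    and P: "map_poly to_ac P = root_prod n \<alpha>"
    and cover: "mestre_cover n (map_poly to_ac P) (map_poly to_ac Q) (map_poly to_ac R)" and dQ: "Suc (degree Q) = n"
    and \<delta>: "vdm n \<alpha> = to_ac \<delta>" and R: "\<And>i. i \<in> {1..n} \<Longrightarrow> poly (map_poly to_ac R) (\<alpha> i) \<noteq> 0"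
  proof -
    show thesis by (rule mestre_descent[OF n \<gamma> gal]) (fact that)
  qed
  interpret M: mestre_cover n "map_poly to_ac P" "map_poly to_ac Q" "map_poly to_ac R" by (rule cover)
  have nc: "\<forall>c. M.t \<noteq> const_ac c" using M.t_not_const unfolding M.\<kappa>_const_ac by (rule allI)
  obtain \<Psi> :: "'k poly fract alg_closure \<Rightarrow> 'k alg_closure poly fract alg_closure"
    where \<Psi>: "field_hom \<Psi>" "\<And>c. \<Psi> (const_ac c) = const_ac (to_ac c)" "\<Psi> var_ac = M.t"
  proof -
    show thesis by (rule exists_specialization_hom[OF nc]) (fact that)
  qed
  obtain y where y: "map_poly const_ac P - smult var_ac (map_poly const_ac Q) = root_prod n y" "inj_on y {1..n}"
    and yN: "\<Psi> (y n) = var_ac"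
    and alt: "\<And>p. p permutes {1..n} \<Longrightarrow> evenperm p \<Longrightarrow> \<exists>\<sigma>. field_hom \<sigma> \<and> (\<forall>c. \<sigma> (const_ac c) = const_ac c) \<and>
      \<sigma> (\<Psi> var_ac) = \<Psi> var_ac \<and> (\<forall>i\<in>{1..n}. \<sigma> (\<Psi> (y i)) = \<Psi> (y (p i)))"
  proof -
    show thesis by (rule mestre_realization[OF cover dQ \<Psi>]) (fact that)
  qed
  define F where "F = map_poly (\<lambda>c. [:c:]) P - smult [:0, 1:] (map_poly (\<lambda>c. [:c:]) Q)"
  interpret h: inj_comm_ring_hom "\<lambda>c :: 'k poly. to_ac (to_fract c)" by (rule to_ac_to_fract_hom)
  interpret hm: map_poly_comm_ring_hom "\<lambda>c :: 'k poly. to_ac (to_fract c)" ..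
  interpret e: comm_ring_hom "\<lambda>c :: 'k poly. poly c 0" by (rule eval_at_0_hom)
  interpret em: map_poly_comm_ring_hom "\<lambda>c :: 'k poly. poly c 0" ..
  have F: "map_poly to_ac (map_poly to_fract F) = root_prod n y"
    unfolding map_poly_to_ac_to_fract y(1)[symmetric] F_def var_ac_def
    by (simp only: hm.hom_minus h.map_poly_hom_smult map_poly_const_ac)
  have F0: "map_poly (\<lambda>c. poly c 0) F = P"
    unfolding F_def em.hom_minus map_poly_at_0_smult map_poly_const_at_0 by simp
  have geo: "geometric_alt n (map_poly to_fract F) y \<Psi>"
  proof (rule geometric_alt.intro)
    show "poly (map_poly to_ac (map_poly to_fract F)) z = 0 \<longleftrightarrow> z \<in> y ` {1..n}" for z
      unfolding F root_prod_root_iff by blast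
    show "evenperm p" if "field_hom \<sigma>" "\<forall>a. \<sigma> (to_ac a) = to_ac a" "p permutes {1..n}" "\<forall>i\<in>{1..n}. \<sigma> (y i) = y (p i)" for \<sigma> p
      by (rule mestre_even[OF field_hom_const_ac cover_identity[OF cover] y P \<alpha>(2) \<delta> R that(1) _ that(3,4)])
        (simp_all add: const_ac_def that(2))
    show "\<Psi> var_ac \<noteq> const_ac b" for b using M.t_not_const[of b] unfolding \<Psi>(3) M.\<kappa>_const_ac .
  qed (fact y(2) \<Psi>(1,2) alt)+
  show ?thesis
  proof (rule that[OF geo \<alpha>(2)])
    show "\<alpha> i = poly (map_poly to_ac q) (\<gamma> i)" for i by (rule \<alpha>(1))
    show "poly (map_poly to_ac (map_poly (\<lambda>c. poly c 0) F)) z = 0 \<longleftrightarrow> z \<in> \<alpha> ` {1..n}" for z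
      unfolding F0 P root_prod_root_iff by blast
  qed
qed

text \<open>The cover has odd degree N = n + 1. Pulling it back along t to P(a+t)/Q(a+t), with
  \<open>a\<close> a rational root of \<open>P\<close>, makes a + t a root of the fibre polynomial;
  the remaining n roots carry the stabiliser of that root in the alternating group, which is
  alternating of degree n. At t = 0 the parameter P(a)/Q(a) is 0, so \<open>P\<close> without its
  root \<open>a\<close> reappears up to a constant.\<close>

lemma alternating_even:
  fixes g :: "'k::field_char_0 poly"
  assumes n: "even n" "n \<ge> 3" and \<gamma>: "inj_on \<gamma> {1..n}" and g0: "g \<noteq> 0"
    and g: "\<And>z. poly (map_poly to_ac g) z = 0 \<longleftrightarrow> z \<in> \<gamma> ` {1..n}"
    and gal: "even_galois_action n \<gamma>"
  obtains F y \<Psi> \<alpha> q where "geometric_alt n (map_poly to_fract F) y \<Psi>" "inj_on \<alpha> {1..n}"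
    "\<And>i. i \<in> {1..n} \<Longrightarrow> \<alpha> i = poly (map_poly to_ac (q :: 'k poly)) (\<gamma> i)"
    "\<And>z. poly (map_poly to_ac (map_poly (\<lambda>c. poly c 0) F)) z = 0 \<longleftrightarrow> z \<in> \<alpha> ` {1..n}"
proof -
  define N where "N = Suc n"
  have N: "odd N" "N \<ge> 3" using n by (simp_all add: N_def)
  have sub: "{1..n} \<subseteq> {1..N}" and Nn: "{1..N} = insert N {1..n}" and Nin: "N \<in> {1..N}" "N \<notin> {1..n}" by (auto simp: N_def)
  have pN: "p permutes {1..N} \<and> p N = N" if "p permutes {1..n}" for p
    using permutes_subset[OF that sub] permutes_not_in[OF that Nin(2)] by blast
  \<comment> \<open>The added root must differ from the roots of \<open>g\<close>.\<close>
  obtain c :: 'k where c: "poly g c \<noteq> 0"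
    using poly_roots_finite[OF g0] infinite_UNIV_char_0[where 'a='k] by (metis (mono_tags, lifting) UNIV_eq_I mem_Collect_eq)
  define \<gamma>' where "\<gamma>' i = (if i = N then to_ac c else \<gamma> i)" for i
  have \<gamma>'n: "\<gamma>' i = \<gamma> i" if "i \<in> {1..n}" for i using that Nin(2) by (auto simp: \<gamma>'_def)
  have "to_ac c \<notin> \<gamma> ` {1..n}" using g[of "to_ac c"] c by simp
  moreover have "\<gamma>' ` {1..n} = \<gamma> ` {1..n}" by (rule image_cong[OF refl]) (rule \<gamma>'n)
  moreover have "inj_on \<gamma>' {1..n}" using \<gamma> by (subst inj_on_cong[of _ _ \<gamma>]) (rule \<gamma>'n)
  moreover have "{1..n} - {N} = {1..n}" "\<gamma>' N = to_ac c" using Nin(2) by (simp_all add: \<gamma>'_def)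
  ultimately have inj': "inj_on \<gamma>' {1..N}" unfolding Nn inj_on_insert by simp
  have gal': "even_galois_action N \<gamma>'" unfolding even_galois_action_def
  proof (intro allI impI)
    fix \<sigma> :: "'k alg_closure \<Rightarrow> 'k alg_closure"
    assume "field_hom \<sigma>" "\<forall>a. \<sigma> (to_ac a) = to_ac a"
    hence \<sigma>: "field_hom \<sigma>" "\<And>a. \<sigma> (to_ac a) = to_ac a" by simp_all
    obtain p where p: "p permutes {1..n}" "evenperm p" "\<forall>i\<in>{1..n}. \<sigma> (\<gamma> i) = \<gamma> (p i)" using even_galois_actionD[OF gal \<sigma>] by blast
    have "\<sigma> (\<gamma>' i) = \<gamma>' (p i)" if "i \<in> {1..N}" for i
    proof (cases "i = N")
      case True
      thus ?thesis using pN[OF p(1)] by (simp add: \<gamma>'_def \<sigma>(2))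
    next
      case False
      hence i: "i \<in> {1..n}" using that unfolding Nn by blast
      hence "p i \<in> {1..n}" using permutes_in_image[OF p(1)] by blast
      thus ?thesis using i bspec[OF p(3) i] by (simp only: \<gamma>'n)
    qed
    thus "\<exists>p. p permutes {1..N} \<and> evenperm p \<and> (\<forall>i\<in>{1..N}. \<sigma> (\<gamma>' i) = \<gamma>' (p i))"
      using p(2) pN[OF p(1)] by blast
  qed
  obtain q P Q R :: "'k poly" and \<alpha> \<delta> where \<alpha>: "\<And>i. \<alpha> i = poly (map_poly to_ac q) (\<gamma>' i)" "inj_on \<alpha> {1..N}"
    and P: "map_poly to_ac P = root_prod N \<alpha>"
    and cover: "mestre_cover N (map_poly to_ac P) (map_poly to_ac Q) (map_poly to_ac R)" and dQ: "Suc (degree Q) = N"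
    and \<delta>: "vdm N \<alpha> = to_ac \<delta>" and R: "\<And>i. i \<in> {1..N} \<Longrightarrow> poly (map_poly to_ac R) (\<alpha> i) \<noteq> 0"
  proof -
    show thesis by (rule mestre_descent[OF N inj' gal']) (fact that)
  qed
  interpret M: mestre_cover N "map_poly to_ac P" "map_poly to_ac Q" "map_poly to_ac R" by (rule cover)
  define a where "a = poly q c"
  have \<alpha>N: "\<alpha> N = to_ac a" by (simp add: \<alpha>(1) \<gamma>'_def a_def)
  have "poly (map_poly to_ac P) (to_ac a) = 0" unfolding P root_prod_root_iff
    using \<alpha>N[symmetric] Nin(1) by (rule bexI)
  hence Pa: "poly P a = 0" by simp
  have "to_ac (poly Q a) \<noteq> 0" using M.coprime_PQ[of "to_ac a"] Pa by simp
  hence Qa: "poly Q a \<noteq> 0" by simp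
  have ncx: "var_ac \<noteq> const_ac (b :: 'k alg_closure)" for b by (simp add: var_ac_def const_ac_def)
  have nc: "\<forall>b. var_ac - const_ac (to_ac a) \<noteq> const_ac b"
  proof (intro allI notI)
    fix b assume "var_ac - const_ac (to_ac a) = const_ac b"
    hence "var_ac = const_ac (b + to_ac a)" by (simp add: field_homD(3)[OF field_hom_const_ac] algebra_simps)
    thus False using ncx by blast
  qed
  obtain \<Psi> :: "'k poly fract alg_closure \<Rightarrow> 'k alg_closure poly fract alg_closure"
    where \<Psi>: "field_hom \<Psi>" "\<And>c. \<Psi> (const_ac c) = const_ac (to_ac c)" "\<Psi> var_ac = var_ac - const_ac (to_ac a)"
  proof -
    show thesis by (rule exists_specialization_hom[OF nc]) (fact that)
  qed
  interpret \<Psi>: field_hom \<Psi> by (rule \<Psi>(1))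
  \<comment> \<open>The root a + t, which \<Psi> sends to the generic point
    \<open>x\<close>.\<close>
  define s where "s = const_ac a + var_ac"
  define T where "T = poly (map_poly const_ac P) s / poly (map_poly const_ac Q) s"
  have \<Psi>s: "\<Psi> s = var_ac" by (simp add: s_def \<Psi>(2,3) hom_distribs)
  have \<Psi>e: "\<Psi> (poly (map_poly const_ac u) s) = poly (map_poly const_ac (map_poly to_ac u)) var_ac" for u
    unfolding poly_field_hom[OF \<Psi>(1)] \<Psi>s map_specialization_hom[OF \<Psi>(1,2)] ..
  have \<Psi>T: "\<Psi> T = M.t" unfolding T_def M.t_def M.\<kappa>_const_ac M.x_var_ac by (simp add: hom_distribs \<Psi>e)
  have Qs: "poly (map_poly const_ac Q) s \<noteq> 0"
    using \<Psi>e[of Q] M.Qx_nonzero unfolding M.\<kappa>_const_ac M.x_var_ac by auto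
  obtain y where y: "map_poly const_ac P - smult T (map_poly const_ac Q) = root_prod N y" "inj_on y {1..N}"
    and yN: "\<Psi> (y N) = var_ac"
    and alt: "\<And>p. p permutes {1..N} \<Longrightarrow> evenperm p \<Longrightarrow> \<exists>\<sigma>. field_hom \<sigma> \<and> (\<forall>c. \<sigma> (const_ac c) = const_ac c) \<and>
      \<sigma> (\<Psi> T) = \<Psi> T \<and> (\<forall>i\<in>{1..N}. \<sigma> (\<Psi> (y i)) = \<Psi> (y (p i)))"
  proof -
    show thesis by (rule mestre_realization[OF cover dQ \<Psi>(1,2) \<Psi>T]) (fact that)
  qed
  have ys: "y N = s" by (rule injD[OF field_hom_inj[OF \<Psi>(1)]]) (simp only: yN \<Psi>s)
  let ?C = "map_poly (\<lambda>c :: 'k. [:c:])"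
  \<comment> \<open>The pulled-back fibre polynomial with its denominator Q(a+t) cleared, so that
    its coefficients are polynomials in \<open>t\<close> and can be specialized.\<close>
  define G where "G = smult (poly (?C Q) [:a, 1:]) (?C P) - smult (poly (?C P) [:a, 1:]) (?C Q)"
  have "poly G [:a, 1:] = 0" by (simp add: G_def mult.commute)
  then obtain F where F: "G = [:- [:a, 1:], 1:] * F" unfolding poly_eq_0_iff_dvd by (rule dvdE)
  interpret h: inj_comm_ring_hom "\<lambda>c :: 'k poly. to_ac (to_fract c)" by (rule to_ac_to_fract_hom)
  interpret hm: map_poly_comm_ring_hom "\<lambda>c :: 'k poly. to_ac (to_fract c)" ..
  interpret e: comm_ring_hom "\<lambda>c :: 'k poly. poly c 0" by (rule eval_at_0_hom)
  interpret em: map_poly_comm_ring_hom "\<lambda>c :: 'k poly. poly c 0" ..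
  have hs: "to_ac (to_fract [:a, 1:]) = s"
  proof -
    have "[:a, 1:] = [:a:] + [:0, 1:]" by simp
    thus ?thesis by (simp only: s_def const_ac_def var_ac_def to_fract_add to_ac_add)
  qed
  have he: "to_ac (to_fract (poly (?C u) [:a, 1:])) = poly (map_poly const_ac u) s" for u
    using h.poly_map_poly[of "?C u" "[:a, 1:]"] by (simp only: hs map_poly_const_ac)
  let ?H = "map_poly (\<lambda>c. to_ac (to_fract c))"
  have "?H [:- [:a, 1:], 1:] = [:to_ac (to_fract (- [:a, 1:])), 1:]"
    by (rule poly_eqI) (simp add: coeff_map_poly coeff_pCons split: nat.split)
  also have "\<dots> = [:- s, 1:]" unfolding h.hom_uminus hs ..
  finally have "[:- s, 1:] * ?H F = ?H G" unfolding F hm.hom_mult by simp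
  also have "\<dots> = smult (poly (map_poly const_ac Q) s) (map_poly const_ac P) - smult (poly (map_poly const_ac P) s) (map_poly const_ac Q)"
    unfolding G_def hm.hom_minus h.map_poly_hom_smult map_poly_const_ac he ..
  also have "\<dots> = smult (poly (map_poly const_ac Q) s) (map_poly const_ac P - smult T (map_poly const_ac Q))"
    using Qs by (simp add: T_def smult_diff_right)
  also have "\<dots> = [:- s, 1:] * smult (poly (map_poly const_ac Q) s) (root_prod n y)"
    unfolding y(1) N_def root_prod_Suc ys[unfolded N_def] by (simp only: mult_smult_right)
  finally have HF: "?H F = smult (poly (map_poly const_ac Q) s) (root_prod n y)" by (rule mult_left_cancel[THEN iffD1, rotated]) simp
  let ?Z = "map_poly (\<lambda>c :: 'k poly. poly c 0)"
  have e0: "poly (poly (?C u) [:a, 1:]) 0 = poly u a" for u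
    unfolding pcompose_altdef[symmetric] poly_pcompose by simp
  have "[:- a, 1:] * ?Z F = ?Z G" unfolding F em.hom_mult by simp
  also have "\<dots> = smult (poly Q a) P" unfolding G_def em.hom_minus map_poly_at_0_smult map_poly_const_at_0 e0 Pa by simp
  finally have eq: "[:- a, 1:] * ?Z F = smult (poly Q a) P" .
  interpret tm: map_poly_inj_idom_hom "to_ac :: 'k \<Rightarrow> _" ..
  have lin: "map_poly to_ac [:- a, 1:] = [:- to_ac a, 1:]" by (simp add: hom_distribs)
  from eq have "map_poly to_ac ([:- a, 1:] * ?Z F) = map_poly to_ac (smult (poly Q a) P)" by (rule arg_cong)
  hence "[:- to_ac a, 1:] * map_poly to_ac (?Z F) = smult (to_ac (poly Q a)) (root_prod N \<alpha>)"
    unfolding tm.hom_mult lin to_ac_hom.map_poly_hom_smult P .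
  also have "\<dots> = [:- to_ac a, 1:] * smult (to_ac (poly Q a)) (root_prod n \<alpha>)"
    unfolding N_def root_prod_Suc \<alpha>N[unfolded N_def] by (simp only: mult_smult_right)
  finally have ZF: "map_poly to_ac (?Z F) = smult (to_ac (poly Q a)) (root_prod n \<alpha>)"
    by (rule mult_left_cancel[THEN iffD1, rotated]) simp
  have geo: "geometric_alt n (map_poly to_fract F) y \<Psi>"
  proof (rule geometric_alt.intro)
    show "inj_on y {1..n}" by (rule inj_on_subset[OF y(2) sub])
    show "poly (map_poly to_ac (map_poly to_fract F)) z = 0 \<longleftrightarrow> z \<in> y ` {1..n}" for z
      unfolding map_poly_to_ac_to_fract HF using Qs root_prod_root_iff[of n y z] by (simp add: image_iff)
    show "evenperm p" if \<sigma>: "field_hom \<sigma>" "\<forall>a. \<sigma> (to_ac a) = to_ac a" and p: "p permutes {1..n}" "\<forall>i\<in>{1..n}. \<sigma> (y i) = y (p i)" for \<sigma> p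
    proof (rule mestre_even[OF field_hom_const_ac cover_identity[OF cover] y P \<alpha>(2) \<delta> R \<sigma>(1)])
      show "\<forall>c. \<sigma> (const_ac c) = const_ac c" by (simp add: const_ac_def \<sigma>(2))
      show "p permutes {1..N}" using pN[OF p(1)] by blast
      have "\<sigma> s = s" unfolding hs[symmetric] by (rule \<sigma>(2)[rule_format])
      hence eqN: "\<sigma> (y N) = y (p N)" using pN[OF p(1)] ys by simp
      show "\<forall>i\<in>{1..N}. \<sigma> (y i) = y (p i)"
      proof
        fix i assume "i \<in> {1..N}"
        hence "i = N \<or> i \<in> {1..n}" unfolding Nn by (simp only: insert_iff)
        thus "\<sigma> (y i) = y (p i)"
        proof
          assume "i = N"
          thus ?thesis using eqN by (simp only:)
        qed (rule bspec[OF p(2)])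
      qed
    qed
    show "\<Psi> var_ac \<noteq> const_ac b" for b unfolding \<Psi>(3) by (rule spec[OF nc])
    show "\<exists>\<sigma>. field_hom \<sigma> \<and> (\<forall>c. \<sigma> (const_ac c) = const_ac c) \<and> \<sigma> (\<Psi> var_ac) = \<Psi> var_ac \<and>
        (\<forall>i\<in>{1..n}. \<sigma> (\<Psi> (y i)) = \<Psi> (y (p i)))" if p: "p permutes {1..n}" "evenperm p" for p
    proof -
      obtain \<sigma> where \<sigma>: "field_hom \<sigma>" "\<forall>c. \<sigma> (const_ac c) = const_ac c" "\<forall>i\<in>{1..N}. \<sigma> (\<Psi> (y i)) = \<Psi> (y (p i))"
        using alt[OF conjunct1[OF pN[OF p(1)]] p(2)] by (elim exE conjE)
      interpret \<sigma>: field_hom \<sigma> by (rule \<sigma>(1))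
      \<comment> \<open>The permutation fixes the index \<open>N\<close>, hence the endomorphism
        fixes x = \<Psi>(y_N), and with it the image x - a of the indeterminate.\<close>
      have "\<sigma> var_ac = var_ac" using bspec[OF \<sigma>(3) Nin(1)] pN[OF p(1)] yN by simp
      hence "\<sigma> (\<Psi> var_ac) = \<Psi> var_ac" unfolding \<Psi>(3) by (simp add: hom_distribs \<sigma>(2))
      moreover have "\<forall>i\<in>{1..n}. \<sigma> (\<Psi> (y i)) = \<Psi> (y (p i))"
      proof
        fix i assume "i \<in> {1..n}"
        hence "i \<in> {1..N}" by (rule subsetD[OF sub])
        thus "\<sigma> (\<Psi> (y i)) = \<Psi> (y (p i))" by (rule bspec[OF \<sigma>(3)])
      qed
      ultimately show ?thesis using \<sigma>(1,2) by (intro exI[of _ \<sigma>] conjI)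
    qed
  qed (fact \<Psi>(1,2))+
  show ?thesis
  proof (rule that[OF geo inj_on_subset[OF \<alpha>(2) sub]])
    show "\<alpha> i = poly (map_poly to_ac q) (\<gamma> i)" if "i \<in> {1..n}" for i unfolding \<alpha>(1) \<gamma>'n[OF that] ..
    show "poly (map_poly to_ac (?Z F)) z = 0 \<longleftrightarrow> z \<in> \<alpha> ` {1..n}" for z
      unfolding ZF using Qa root_prod_root_iff[of n \<alpha> z] by (simp add: image_iff)
  qed
qed

theorem theorem3:
  fixes g :: "'k::field_char_0 poly" and n :: nat
  assumes "n \<ge> 3"
    and "separable_poly g"
    and "Polynomial.degree g = n"
    and "\<exists>d. discriminant g = d ^ 2"
  shows "\<exists>f :: 'k poly fract poly.
    f \<noteq> 0 \<and>
    regular_galois_extension (splitting_field f) \<and>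
    galois_group (splitting_field f) (range to_ac) \<cong> alt_group n \<and>
    (\<forall>i. defined_at_0 (Polynomial.coeff f i)) \<and>
    specialize_at_0 f \<noteq> 0 \<and>
    splitting_field g = splitting_field (specialize_at_0 f)"
proof -
  obtain d where d: "discriminant g = d ^ 2" using assms(4) by blast
  have n1: "n \<ge> 1" using assms(1) by simp
  have g0: "g \<noteq> 0" using assms(1,3) by auto
  obtain \<gamma> where \<gamma>: "inj_on \<gamma> {1..n}" "\<And>z. poly (map_poly to_ac g) z = 0 \<longleftrightarrow> z \<in> \<gamma> ` {1..n}"
    "even_galois_action n \<gamma>"
  proof -
    show thesis by (rule square_discriminant_even[OF assms(2,3) n1 d]) (fact that)
  qed
  show ?thesis
  proof (cases "odd n")
    case True
    show ?thesis
    proof (rule alternating_odd[OF True assms(1) \<gamma>])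
      fix F :: "'k poly poly" and y \<Psi> \<alpha> and q :: "'k poly"
      assume F: "geometric_alt n (map_poly to_fract F) y \<Psi>" "inj_on \<alpha> {1..n}"
        "\<And>i. i \<in> {1..n} \<Longrightarrow> \<alpha> i = poly (map_poly to_ac q) (\<gamma> i)"
        "\<And>z. poly (map_poly to_ac (map_poly (\<lambda>c. poly c 0) F)) z = 0 \<longleftrightarrow> z \<in> \<alpha> ` {1..n}"
      show ?thesis
        by ((rule alternating_specialization[OF F(1,2,3) \<gamma>(2) F(4)], assumption) |
          (rule alternating_specialization[OF F(1,2,3) \<gamma>(2) F(4)]; fail) |
          (rule alternating_specialization[OF F(1,2)], (fact F(3) \<gamma>(2) F(4))+))
    qed
  next
    case False
    hence "even n" by simp
    show ?thesis
    proof (rule alternating_even[OF \<open>even n\<close> assms(1) \<gamma>(1) g0 \<gamma>(2,3)])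
      fix F :: "'k poly poly" and y \<Psi> \<alpha> and q :: "'k poly"
      assume F: "geometric_alt n (map_poly to_fract F) y \<Psi>" "inj_on \<alpha> {1..n}"
        "\<And>i. i \<in> {1..n} \<Longrightarrow> \<alpha> i = poly (map_poly to_ac q) (\<gamma> i)"
        "\<And>z. poly (map_poly to_ac (map_poly (\<lambda>c. poly c 0) F)) z = 0 \<longleftrightarrow> z \<in> \<alpha> ` {1..n}"
      show ?thesis
        by ((rule alternating_specialization[OF F(1,2,3) \<gamma>(2) F(4)], assumption) |
          (rule alternating_specialization[OF F(1,2,3) \<gamma>(2) F(4)]; fail) |
          (rule alternating_specialization[OF F(1,2)], (fact F(3) \<gamma>(2) F(4))+))
    qed
  qed
qed

end
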